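(* Let $A:=\frac{\sqrt{6}}{\pi}$ and let $\gamma$ be the Euler--Mascheroni constant. (1) For every $v \in \mathbb{R}$, $$ \lim_{n \to \infty} \mathbf{P}^*_{n}\left(\frac{{\rm PK}-A\sqrt{n}\log\left(2A\sqrt{n}\right)}{A\sqrt{n}} \leq v \right)=e^{-e^{-v}}, $$ and, writing $\mathbf{E}^*_n$ for expectation under $\mathbf{P}^*_n$, $\mathbf{E}^*_n({\rm PK}) = A\sqrt{n}\log\left(2A\sqrt{n}\right)+A\gamma \sqrt{n}(1+o(1))$. (2) Let $(t_n)$ be a sequence of positive integers with $t_n=o(n^{1/4})$, and for each $n$ let $v_0\in\mathbb{R}$ and $\{v_t^{[j]}\}_{1 \leq t \leq t_n,\, j \in \{L,R\}} \subset \mathbb{R}$. Then, as $n\to\infty$, the difference \begin{multline*} \mathbf{P}^*_{n}\left(\frac{{\rm PK}-A\sqrt{n}\log\left(2A\sqrt{n}\right)}{A\sqrt{n}} \leq v_0, \ \frac{Y_{t}^{[j]}-A\sqrt{n}\log\left(2A\sqrt{n}\right)}{A\sqrt{n}} \leq v_{t}^{[j]} \ \text{ for } j \in \{L,R\},\ 1 \leq t \leq t_n\right) \\ - \int_{-\infty}^{v_0} \int_{-\infty}^{v_{1}^{[L]}} \int_{-\infty}^{v_{1}^{[R]}} \cdots \int_{-\infty}^{v_{t_n}^{[L]}} \int_{-\infty}^{v_{t_n}^{[R]}} F\left(u_0,u_{1}^{[L]},u_{1}^{[R]}, \dots, u_{t_n}^{[L]},u_{t_n}^{[R]}\right) du_{t_n}^{[R]}\,du_{t_n}^{[L]}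 \cdots du_0 \end{multline*} tends to $0$, where $$ F\left(u_0,u_{1}^{[L]},u_{1}^{[R]}, \dots, u_{t_n}^{[L]},u_{t_n}^{[R]}\right) := \begin{cases}\frac{1}{2^{2t_n}}e^{-u_0-\sum_{1 \leq t \leq t_n} \left(u_t^{[L]}+u_t^{[R]}\right) - \frac{e^{-u_{t_n}^{[L]}}}{2} - \frac{e^{-u_{t_n}^{[R]}}}{2}} & \text{if } u_0 \geq u_1^{[j]} \geq \dots \geq u_{t_n}^{[j]} \text{ for } j \in \{L,R\}, \\ 0 & \text{otherwise.} \end{cases} $$
   Context: A strongly unimodal sequence $\lambda$ of size $n$ is a finite sequence of positive integers $\lambda_{1}^{[L]} < \dots < \lambda_{r}^{[L]} < \lambda_{\mathrm{PK}} > \lambda_{s}^{[R]} > \dots > \lambda_{1}^{[R]}$ ($r,s\ge 0$) with distinguished entry $\lambda_{\mathrm{PK}}$ (the peak), such that $\lambda_{\mathrm{PK}}+\sum_{k=1}^r\lambda_k^{[L]}+\sum_{k=1}^s\lambda_k^{[R]}=n$. Let $\mathcal{U}^*_n$ be the set of strongly unimodal sequences of size $n$ and $\mathbf{P}^*_n$ the uniform probability measure on $\mathcal{U}^*_n$. ${\rm PK}(\lambda):=\lambda_{\mathrm{PK}}$, and $Y_t^{[L]}(\lambda)$ (resp. $Y_t^{[R]}(\lambda)$) denotes the $t$-th largest part of $\lambda$ to the left (resp. right) of the peak. *)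

theory Defs
  imports "HOL-Probability.Probability" "HOL-Library.Landau_Symbols"
begin

datatype side = L | R

text \<open>Both lists are written as they appear in the sequence, read from left to right:
  the left parts in increasing order, the right parts in decreasing order.\<close>

datatype useq = USeq (left_parts: "nat list") (PK: nat) (right_parts: "nat list")

definition strongly_unimodal :: "useq \<Rightarrow> bool" where
  "strongly_unimodal s \<longleftrightarrow>
     sorted_wrt (<) (left_parts s @ [PK s]) \<and>
     sorted_wrt (>) (PK s # right_parts s) \<and>
     (\<forall>x \<in> set (left_parts s @ PK s # right_parts s). 0 < x)"

definition seq_size :: "useq \<Rightarrow> nat" where
  "seq_size s = PK s + sum_list (left_parts s) + sum_list (right_parts s)"

definition ustar :: "nat \<Rightarrow> useq set" where
  "ustar n = {s. strongly_unimodal s \<and> seq_size s = n}"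

fun side_parts :: "side \<Rightarrow> useq \<Rightarrow> nat list" where
  "side_parts L s = left_parts s"
| "side_parts R s = right_parts s"

text \<open>The \<open>t\<close>-th largest part, counted from \<open>t = 1\<close>; it is \<open>0\<close> if there are fewer than
  \<open>t\<close> parts on that side.\<close>

definition Y :: "side \<Rightarrow> nat \<Rightarrow> useq \<Rightarrow> nat" where
  "Y j t s = (if 1 \<le> t \<and> t \<le> length (side_parts j s)
              then rev (sort (side_parts j s)) ! (t - 1) else 0)"

text \<open>There is no sequence of size \<open>0\<close>, so this is meaningful for \<open>n \<ge> 1\<close> only; see the two
  lemmas below.\<close>

definition Pstar :: "nat \<Rightarrow> useq pmf" where
  "Pstar n = pmf_of_set (ustar n)"

lemma ustar_nonempty:
  assumes "1 \<le> n"
  shows "ustar n \<noteq> {}"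
proof -
  have "USeq [] n [] \<in> ustar n"
    using assms by (simp add: ustar_def strongly_unimodal_def seq_size_def)
  then show ?thesis by blast
qed

lemma length_le_sum_list:
  fixes xs :: "nat list"
  assumes "\<forall>x \<in> set xs. 0 < x"
  shows "length xs \<le> sum_list xs"
  using assms by (induction xs) auto

lemma finite_ustar: "finite (ustar n)"
proof -
  let ?S = "{xs. set xs \<subseteq> {..n} \<and> length xs \<le> n}"
  have fin: "finite ?S"
    by (rule finite_lists_length_le) simp
  have "ustar n \<subseteq> (\<lambda>(xs, p, ys). USeq xs p ys) ` (?S \<times> {..n} \<times> ?S)"
  proof
    fix s assume s: "s \<in> ustar n"
    obtain xs p ys where [simp]: "s = USeq xs p ys" by (cases s)
    have sz: "p + sum_list xs + sum_list ys = n"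
      and pos: "\<forall>x \<in> set xs. 0 < x" "\<forall>x \<in> set ys. 0 < x"
      using s by (auto simp: ustar_def strongly_unimodal_def seq_size_def)
    have bound: "zs \<in> ?S" if "sum_list zs \<le> n" "\<forall>x \<in> set zs. 0 < x" for zs :: "nat list"
    proof -
      have "length zs \<le> n"
        using length_le_sum_list[OF that(2)] that(1) by simp
      moreover have "x \<le> n" if "x \<in> set zs" for x
        using member_le_sum_list[OF that] \<open>sum_list zs \<le> n\<close> by simp
      ultimately show ?thesis by auto
    qed
    have "xs \<in> ?S" "ys \<in> ?S"
      using bound[OF _ pos(1)] bound[OF _ pos(2)] sz by simp_all
    moreover have "p \<in> {..n}"
      using sz by simp
    ultimately have "(xs, p, ys) \<in> ?S \<times> {..n} \<times> ?S"
      by blast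
    then show "s \<in> (\<lambda>(xs, p, ys). USeq xs p ys) ` (?S \<times> {..n} \<times> ?S)"
      by (rule rev_image_eqI) simp
  qed
  then show ?thesis
    by (rule finite_subset) (use fin in auto)
qed

definition A :: real where
  "A = sqrt 6 / pi"

definition scaled :: "nat \<Rightarrow> real \<Rightarrow> real" where
  "scaled n x = (x - A * sqrt (real n) * ln (2 * A * sqrt (real n))) / (A * sqrt (real n))"

text \<open>Names of the integration variables: \<open>Peak\<close> for \<open>u\<^sub>0\<close>, and \<open>Part j t\<close> for the variable
  belonging to the \<open>t\<close>-th largest part on side \<open>j\<close>.\<close>

datatype coord = Peak | Part side nat

definition coords :: "nat \<Rightarrow> coord set" where
  "coords T = insert Peak {Part j t | j t. j \<in> {L, R} \<and> t \<in> {1..T}}"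

definition F :: "nat \<Rightarrow> (coord \<Rightarrow> real) \<Rightarrow> real" where
  "F T u =
    (if \<forall>j \<in> {L, R}. u (Part j 1) \<le> u Peak \<and> (\<forall>t \<in> {1..<T}. u (Part j (t + 1)) \<le> u (Part j t))
     then 1 / 2 ^ (2 * T) *
       exp (- u Peak - (\<Sum>t = 1..T. u (Part L t) + u (Part R t))
            - exp (- u (Part L T)) / 2 - exp (- u (Part R T)) / 2)
     else 0)"

definition orthant :: "nat \<Rightarrow> real \<Rightarrow> (side \<Rightarrow> nat \<Rightarrow> real) \<Rightarrow> (coord \<Rightarrow> real) set" where
  "orthant T v0 v =
    {u \<in> space (Pi\<^sub>M (coords T) (\<lambda>_. lborel)).
       u Peak \<le> v0 \<and> (\<forall>j \<in> {L, R}. \<forall>t \<in> {1..T}. u (Part j t) \<le> v j t)}"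

end

theory Submission
  imports Defs "HOL-Real_Asymp.Real_Asymp"
begin

text \<open>
  Put \<open>h = A * sqrt n\<close> and give a part \<open>k\<close> the Boltzmann weight \<open>q\<^sup>k\<close>, where \<open>q = exp (- 1 / h)\<close>. A sequence
  with peak \<open>m\<close> is a pair of sets of parts below \<open>m\<close>, so the number of sequences with given peak is a
  normalising product times the point probability of a sum of independent Bernoulli variables. This
  probability is controlled by a local limit theorem, proved by Fourier inversion, and the sum over all
  peaks telescopes, because \<open>2 q\<^sup>m P\<^sub>m\<^sup>2 \<le> P\<^bsub>m+1\<^esub>\<^sup>2 - P\<^sub>m\<^sup>2\<close> for \<open>P\<^sub>m = \<Prod>\<^bsub>1\<le>k<m\<^esub> (1 + q\<^sup>k)\<close>.

  Prescribing the largest parts truncates the two products, which yields a pointwise lower bound for the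
  joint law by the density \<open>F\<close>, uniformly over a typical set. As both laws have total mass one, this lower
  bound, applied to an event and to its complement, already gives the convergence. The points of the scaled
  lattice are obtained from real ones by rounding up and shifting by the index, which makes weakly
  decreasing chains strictly decreasing; a suitable constant shift puts the result inside or outside the
  event.

  The expectation follows from the limit law by dominated convergence of the tails; the constant is
  identified through the mean \<open>harm N\<close> of the maximum of \<open>N\<close> exponential variables.
\<close>

section \<open>The limit density\<close>

text \<open>The obstacle is that prescribing the \<open>T\<close> largest parts of each side must
  not push the truncated model off centre: its mean has to match the remaining size up to a small
  multiple of the standard deviation, which is of order \<open>h * sqrt h\<close>. It does, because
  the expected number of parts cut off a side is about \<open>wgt\<close> of its \<open>T\<close>-th
  prescribed part, which is T + O(sqrt T) on the typical set, and both these parts and the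
  prescribed ones exceed the cut by only O(h) on average. So the mean mass removed and the sum
  prescribed differ by O(T h) and smaller terms, which asks for T = o(sqrt h), that is T =
  o(n^(1/4)). Rounding gives the same threshold: each of the \<open>2 * T + 1\<close> parts moves by
  at most \<open>2 * T\<close>, which changes the Boltzmann weight by a factor exp (O(T^2 / h)). The
  cut \<open>h * ln h / 2\<close> recurs because it is low enough to lie below all typical
  prescribed parts (about sqrt h parts of a side are expected above it) and high enough to leave the
  variance asymptotically unchanged.\<close>

instantiation side :: finite
begin
instance by standard (rule finite_subset[of _ "{L,R}"], auto intro: side.exhaust)
end

lemma UNIV_side: "(UNIV :: side set) = {L, R}"
  by (auto intro: side.exhaust)

text \<open>In the variables \<open>w = exp (- u) / 2\<close> the density \<open>F\<close> becomes \<open>2 * exp (- w\<^sub>L - w\<^sub>R)\<close> on increasing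
  chains, where \<open>w\<^sub>L\<close> and \<open>w\<^sub>R\<close> are the last variables on either side. So the variables can be integrated
  out one by one, also when the two chains have different lengths.\<close>

definition wgt :: "real \<Rightarrow> real" where "wgt x = exp (- x) / 2"

text \<open>Counting the peak as part number 0 of both sides makes the chain condition, and every
  induction along a side, uniform.\<close>

definition side_coord :: "side \<Rightarrow> nat \<Rightarrow> coord" where
  "side_coord j t = (if t = 0 then Peak else Part j t)"

definition coords_upto :: "(side \<Rightarrow> nat) \<Rightarrow> coord set" where
  "coords_upto len = insert Peak {Part j t | j t. t \<in> {1..len j}}"

definition desc_chain :: "(side \<Rightarrow> nat) \<Rightarrow> (coord \<Rightarrow> real) \<Rightarrow> bool" where
  "desc_chain len u \<longleftrightarrow> (\<forall>j. \<forall>t\<in>{..<len j}. u (side_coord j (Suc t)) \<le> u (side_coord j t))"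

definition chain_density :: "(side \<Rightarrow> nat) \<Rightarrow> (coord \<Rightarrow> real) \<Rightarrow> real" where
  "chain_density len u = (if desc_chain len u then
     2 * (\<Prod>c\<in>coords_upto len. wgt (u c)) * (\<Prod>j\<in>UNIV. exp (- wgt (u (side_coord j (len j))))) else 0)"

lemma wgt_pos: "0 < wgt x" by (simp add: wgt_def)

lemma wgt_measurable[measurable]: "wgt \<in> borel_measurable borel"
  unfolding wgt_def[abs_def] by measurable

lemma finite_coords_upto[simp]: "finite (coords_upto len)"
proof -
  have "coords_upto len = insert Peak (\<Union>j\<in>UNIV. Part j ` {1..len j})"
    unfolding coords_upto_def by blast
  then show ?thesis by simp
qed

lemma side_coord_in_coords_upto: "t \<le> len j \<Longrightarrow> side_coord j t \<in> coords_upto len"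
  by (auto simp: side_coord_def coords_upto_def)

lemma chain_density_nonneg: "0 \<le> chain_density len u"
  unfolding chain_density_def by (auto intro!: mult_nonneg_nonneg prod_nonneg simp: wgt_pos less_imp_le)

lemma chain_density_measurable[measurable]:
  "chain_density len \<in> borel_measurable (Pi\<^sub>M (coords_upto len) (\<lambda>_. lborel))"
proof -
  have cm[measurable]: "(\<lambda>u. u c) \<in> borel_measurable (Pi\<^sub>M (coords_upto len) (\<lambda>_. lborel))"
    if "c \<in> coords_upto len" for c
    using measurable_component_singleton[OF that, of "\<lambda>_. lborel"] by simp
  have [measurable]: "(\<lambda>u. u (side_coord j t)) \<in> borel_measurable (Pi\<^sub>M (coords_upto len) (\<lambda>_. lborel))"
    if "t \<le> len j" for j t
    using that by (intro cm side_coord_in_coords_upto)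
  have [measurable]: "Measurable.pred (Pi\<^sub>M (coords_upto len) (\<lambda>_. lborel)) (desc_chain len)"
  proof -
    have "desc_chain len = (\<lambda>u. \<forall>j\<in>UNIV. \<forall>t\<in>{..<len j}. u (side_coord j (Suc t)) \<le> u (side_coord j t))"
      by (auto simp: desc_chain_def fun_eq_iff)
    then show ?thesis
      by (simp only:) (intro pred_intros_finite finite finite_lessThan borel_measurable_le[folded pred_def]
        cm side_coord_in_coords_upto, auto)
  qed
  show ?thesis
    unfolding chain_density_def[abs_def]
    by (intro measurable_If borel_measurable_times borel_measurable_prod borel_measurable_const
      measurable_compose[OF _ borel_measurable_exp] borel_measurable_uminus measurable_compose[OF _
        wgt_measurable] cm side_coord_in_coords_upto) auto
qed

definition lengthen :: "side \<Rightarrow> (side \<Rightarrow> nat) \<Rightarrow> side \<Rightarrow> nat" where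
  "lengthen s len = len(s := Suc (len s))"

lemma coords_upto_lengthen: "coords_upto (lengthen s len) = insert (Part s (Suc (len s))) (coords_upto len)"
proof -
  have "{1..lengthen s len j} = (if j = s then insert (Suc (len s)) {1..len j} else {1..len j})" for j
    by (auto simp: lengthen_def)
  then show ?thesis unfolding coords_upto_def by (auto split: if_splits)
qed

lemma new_notin: "Part s (Suc (len s)) \<notin> coords_upto len"
  by (auto simp: coords_upto_def)

lemma side_coord_upd: "t \<le> len j \<Longrightarrow> (x(Part s (Suc (len s)) := y)) (side_coord j t) = x (side_coord j t)"
  by (auto simp: side_coord_def)

lemma ball_lengthen:
  "(\<forall>j. \<forall>t\<in>{..<lengthen s len j}. P j t) \<longleftrightarrow> (\<forall>j. \<forall>t\<in>{..<len j}. P j t) \<and> P s (len s)"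
proof -
  have "(\<forall>t\<in>{..<lengthen s len j}. P j t) \<longleftrightarrow> (\<forall>t\<in>{..<len j}. P j t) \<and> (j = s \<longrightarrow> P s (len s))" for j
    by (simp add: lengthen_def lessThan_Suc) blast
  then show ?thesis by (simp only: all_conj_distrib) simp
qed

lemma desc_chain_lengthen: "desc_chain (lengthen s len) (x(Part s (Suc (len s)) := y)) \<longleftrightarrow>
   desc_chain len x \<and> y \<le> x (side_coord s (len s))" (is "?A \<longleftrightarrow> ?B")
proof -
  let ?x = "x(Part s (Suc (len s)) := y)"
  have "?A \<longleftrightarrow> (\<forall>j. \<forall>t\<in>{..<len j}. ?x (side_coord j (Suc t)) \<le> ?x (side_coord j t)) \<and>
      ?x (side_coord s (Suc (len s))) \<le> ?x (side_coord s (len s))"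
    unfolding desc_chain_def by (rule ball_lengthen)
  also have "(\<forall>j. \<forall>t\<in>{..<len j}. ?x (side_coord j (Suc t)) \<le> ?x (side_coord j t)) \<longleftrightarrow> desc_chain len x"
  proof -
    have "?x (side_coord j (Suc t)) = x (side_coord j (Suc t))" "?x (side_coord j t) = x (side_coord j t)"
      if "t \<in> {..<len j}" for j t
      using that by (intro side_coord_upd; simp)+
    then show ?thesis unfolding desc_chain_def by (simp del: fun_upd_apply)
  qed
  also have "?x (side_coord s (Suc (len s))) = y" by (simp add: side_coord_def)
  also have "?x (side_coord s (len s)) = x (side_coord s (len s))" by (rule side_coord_upd) simp
  finally show ?thesis .
qed

text \<open>Moving the end of a chain from z down to y trades the factor exp (- wgt z) for exp (-
  wgt y). In the variable w = \<open>wgt\<close> the new factor is the density of a unit exponential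
  increment, so under the limit law the values of \<open>wgt\<close> along a side are partial sums
  of independent exponentials.\<close>

lemma chain_density_lengthen: "chain_density (lengthen s len) (x(Part s (Suc (len s)) := y)) =
   chain_density len x * (indicator {..x (side_coord s (len s))} y * (wgt y * exp (wgt (x (side_coord s (len
     s))) - wgt y)))"
proof (cases "desc_chain len x \<and> y \<le> x (side_coord s (len s))")
  case False
  then show ?thesis unfolding chain_density_def desc_chain_lengthen by (auto simp: indicator_def)
next
  case True
  let ?c = "Part s (Suc (len s))"
  let ?x = "x(?c := y)"
  have p: "(\<Prod>c\<in>coords_upto (lengthen s len). wgt (?x c)) = wgt y * (\<Prod>c\<in>coords_upto len. wgt (x c))"
  proof -
    have "(\<Prod>c\<in>coords_upto len. wgt (?x c)) = (\<Prod>c\<in>coords_upto len. wgt (x c))"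
      by (rule prod.cong) (use new_notin in auto)
    then show ?thesis unfolding coords_upto_lengthen by (subst prod.insert) (auto simp: new_notin)
  qed
  have a: "exp (- wgt (?x (side_coord s (Suc (len s))))) = exp (- wgt y)" by (simp add: side_coord_def)
  have b: "exp (- wgt (?x (side_coord j (len j)))) = exp (- wgt (x (side_coord j (len j))))" for j
    by (subst side_coord_upd) auto
  have q: "(\<Prod>j\<in>UNIV. exp (- wgt (?x (side_coord j (lengthen s len j))))) =
     (\<Prod>j\<in>UNIV. exp (- wgt (x (side_coord j (len j))))) * exp (wgt (x (side_coord s (len s))) - wgt y)"
    using a b unfolding UNIV_side lengthen_def
    by (cases s) (simp_all add: exp_add[symmetric] del: fun_upd_apply, simp_all add: fun_upd_def)
  have "chain_density (lengthen s len) ?x = 2 * (wgt y * (\<Prod>c\<in>coords_upto len. wgt (x c))) * ((\<Prod>j\<in>UNIV. exp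
    (- wgt (x (side_coord j (len j))))) * exp (wgt (x (side_coord s (len s))) - wgt y))"
    unfolding chain_density_def desc_chain_lengthen p q using True by simp
  also have "\<dots> = (2 * (\<Prod>c\<in>coords_upto len. wgt (x c)) * (\<Prod>j\<in>UNIV. exp (- wgt (x (side_coord j (len j)))))) *
    (wgt y * exp (wgt (x (side_coord s (len s))) - wgt y))"
    by (simp only: mult_ac)
  finally show ?thesis using True by (simp add: chain_density_def)
qed

section \<open>Integrating out the chain variables\<close>

definition chain_expect :: "(side \<Rightarrow> nat) \<Rightarrow> ((coord \<Rightarrow> real) \<Rightarrow> ennreal) \<Rightarrow> ennreal" where
  "chain_expect len g = (\<integral>\<^sup>+u. ennreal (chain_density len u) * g u \<partial>Pi\<^sub>M (coords_upto len) (\<lambda>_. lborel))"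

interpretation lborel_prod: product_sigma_finite "\<lambda>_::coord. lborel :: real measure"
  by (rule product_sigma_finite.intro) (rule sigma_finite_lborel)

text \<open>One step of the integration: a function \<open>f\<close> of the newest part is replaced
  by its kernel average \<open>k\<close>, a function of the part above it. All statements about
  single coordinates come from iterating this.\<close>

lemma chain_expect_lengthen:
  assumes g[measurable]: "g \<in> borel_measurable (Pi\<^sub>M (coords_upto len) (\<lambda>_. lborel))"
    and g': "g \<in> borel_measurable (Pi\<^sub>M (coords_upto (lengthen s len)) (\<lambda>_. lborel))"
    and gi: "\<And>x y. g (x(Part s (Suc (len s)) := y)) = g x"
    and f[measurable]: "f \<in> borel_measurable borel"
    and K: "\<And>z. (\<integral>\<^sup>+y. ennreal (indicator {..z} y * (wgt y * exp (wgt z - wgt y))) * f y \<partial>lborel) = k z"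
  shows "chain_expect (lengthen s len) (\<lambda>u. g u * f (u (Part s (Suc (len s))))) = chain_expect len (\<lambda>u. g u
    * k (u (side_coord s (len s))))"
proof -
  let ?c = "Part s (Suc (len s))"
  let ?G = "\<lambda>u. ennreal (chain_density (lengthen s len) u) * (g u * f (u ?c))"
  have c: "?c \<in> coords_upto (lengthen s len)" by (simp add: coords_upto_lengthen)
  have [measurable]: "(\<lambda>u. u ?c) \<in> borel_measurable (Pi\<^sub>M (coords_upto (lengthen s len)) (\<lambda>_. lborel))"
    using measurable_component_singleton[OF c, of "\<lambda>_. lborel"] by simp
  note g'[measurable]
  have m: "?G \<in> borel_measurable (Pi\<^sub>M (coords_upto (lengthen s len)) (\<lambda>_. lborel))"
    by measurable
  have "chain_expect (lengthen s len) (\<lambda>u. g u * f (u ?c)) =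
     (\<integral>\<^sup>+x. (\<integral>\<^sup>+y. ?G (x(?c := y)) \<partial>lborel) \<partial>Pi\<^sub>M (coords_upto len) (\<lambda>_. lborel))"
    unfolding chain_expect_def coords_upto_lengthen
    by (rule lborel_prod.product_nn_integral_insert) (use m new_notin in \<open>auto simp: coords_upto_lengthen\<close>)
  also have "\<dots> = chain_expect len (\<lambda>u. g u * k (u (side_coord s (len s))))"
    unfolding chain_expect_def
  proof (rule nn_integral_cong)
    fix x :: "coord \<Rightarrow> real"
    let ?z = "x (side_coord s (len s))"
    have "(\<integral>\<^sup>+y. ?G (x(?c := y)) \<partial>lborel) =
       (\<integral>\<^sup>+y. (ennreal (chain_density len x) * g x) * (ennreal (indicator {..?z} y * (wgt y * exp (wgt ?z -
         wgt y))) * f y) \<partial>lborel)"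
      by (rule nn_integral_cong)
         (auto simp: chain_density_lengthen gi ennreal_mult chain_density_nonneg wgt_pos less_imp_le mult_ac)
    also have "\<dots> = (ennreal (chain_density len x) * g x) * k ?z"
      by (subst nn_integral_cmult) (auto simp: K)
    finally show "(\<integral>\<^sup>+y. ?G (x(?c := y)) \<partial>lborel) = ennreal (chain_density len x) * (g x * k ?z)"
      by (simp add: mult_ac)
  qed
  finally show ?thesis .
qed

lemma nn_integral_FTC_atMost:
  fixes f :: "real \<Rightarrow> real"
  assumes f_borel[measurable]: "f \<in> borel_measurable borel"
  assumes f: "\<And>x. DERIV g x :> f x"
  assumes nonneg: "\<And>x. 0 \<le> f x"
  assumes lim: "(g \<longlongrightarrow> T) at_bot"
  shows "(\<integral>\<^sup>+x. ennreal (f x) * indicator {..a} x \<partial>lborel) = g a - T"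
proof -
  have "(\<integral>\<^sup>+x. ennreal (f x) * indicator {..a} x \<partial>lborel) =
      (\<integral>\<^sup>+x. ennreal (f (- x)) * indicator {- a..} x \<partial>lborel)"
    by (subst nn_integral_real_affine[where c = "-1" and t = 0])
       (auto intro!: nn_integral_cong simp: indicator_def)
  also have "\<dots> = - T - (- g (- (- a)))"
  proof (rule nn_integral_FTC_atLeast[where F = "\<lambda>x. - g (- x)"])
    show "((\<lambda>x. - g (- x)) \<longlongrightarrow> - T) at_top"
      by (rule tendsto_minus, rule filterlim_compose[OF lim], rule filterlim_uminus_at_bot_at_top)
    fix x show "((\<lambda>x. - g (- x)) has_real_derivative f (- x)) (at x)"
      using DERIV_minus[OF iffD1[OF DERIV_mirror f[of "- x"]]] by simp
  qed (auto simp: nonneg)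
  finally show ?thesis by simp
qed

lemma wgt_deriv[derivative_intros]: "(g has_real_derivative g') (at x) \<Longrightarrow>
  ((\<lambda>x. wgt (g x)) has_real_derivative (- wgt (g x) * g')) (at x)"
  unfolding wgt_def by (auto intro!: derivative_eq_intros)

text \<open>The kernel is exp (wgt z) times a function of y alone, so one antiderivative
  \<open>G\<close> serves every z. It has to vanish at minus infinity, where \<open>wgt\<close>
  tends to infinity.\<close>

lemma kernel_FTC:
  assumes f[measurable]: "f \<in> borel_measurable borel" and f0: "\<And>y. 0 \<le> f y"
    and d: "\<And>y. (G has_real_derivative wgt y * exp (- wgt y) * f y) (at y)"
    and l: "(G \<longlongrightarrow> 0) at_bot"
  shows "(\<integral>\<^sup>+y. ennreal (indicator {..z} y * (wgt y * exp (wgt z - wgt y))) * ennreal (f y) \<partial>lborel) =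
     ennreal (exp (wgt z) * G z)"
proof -
  have "(\<integral>\<^sup>+y. ennreal (indicator {..z} y * (wgt y * exp (wgt z - wgt y))) * ennreal (f y) \<partial>lborel)
     = (\<integral>\<^sup>+y. ennreal (exp (wgt z) * (wgt y * exp (- wgt y) * f y)) * indicator {..z} y \<partial>lborel)"
    by (rule nn_integral_cong)
       (auto simp: indicator_def exp_diff exp_minus field_simps ennreal_mult'[symmetric] f0 wgt_pos less_imp_le)
  also have "\<dots> = exp (wgt z) * G z - 0"
  proof (rule nn_integral_FTC_atMost[where g = "\<lambda>a. exp (wgt z) * G a"])
    show "((\<lambda>a. exp (wgt z) * G a) \<longlongrightarrow> 0) at_bot" using tendsto_mult_left[OF l, of "exp (wgt z)"] by simp
  qed (auto intro!: DERIV_cmult d simp: f0 wgt_pos less_imp_le)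
  finally show ?thesis by simp
qed

lemma wgt_at_bot: "filterlim wgt at_top at_bot"
  unfolding wgt_def by real_asymp

lemma exp_decay: "((\<lambda>w::real. 1 / c * exp (- c * w)) \<longlongrightarrow> 0) at_top" if "0 < c" for c :: real
  using that by real_asymp

text \<open>A unit exponential increment has Laplace transform 1 / (1 + lam).\<close>

lemma kernel_exp:
  assumes "0 \<le> lam"
  shows "(\<integral>\<^sup>+y. ennreal (indicator {..z} y * (wgt y * exp (wgt z - wgt y))) * ennreal (exp (- lam *
    wgt y)) \<partial>lborel) =
     ennreal (1 / (1 + lam)) * ennreal (exp (- lam * wgt z))"
proof -
  have "(\<integral>\<^sup>+y. ennreal (indicator {..z} y * (wgt y * exp (wgt z - wgt y))) * ennreal (exp (- lam *
    wgt y)) \<partial>lborel) =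
    ennreal (exp (wgt z) * (1 / (1 + lam) * exp (- (1 + lam) * wgt z)))"
  proof (rule kernel_FTC)
    fix y show "((\<lambda>z. 1 / (1 + lam) * exp (- (1 + lam) * wgt z)) has_real_derivative wgt y * exp (- wgt y) *
      exp (- lam * wgt y)) (at y)"
    proof -
      have *: "wgt y * exp (- wgt y) * exp (- lam * wgt y) = wgt y * exp (- (1 + lam) * wgt y)"
        by (simp add: exp_add[symmetric] algebra_simps)
      have "((\<lambda>z. exp (- (1 + lam) * wgt z)) has_real_derivative
          exp (- (1 + lam) * wgt y) * (- (1 + lam) * (- wgt y * 1))) (at y)"
        by (intro DERIV_fun_exp DERIV_cmult wgt_deriv DERIV_ident)
      from DERIV_cmult[OF this, of "1 / (1 + lam)"]
      have "((\<lambda>z. 1 / (1 + lam) * exp (- (1 + lam) * wgt z)) has_real_derivative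
          1 / (1 + lam) * (exp (- (1 + lam) * wgt y) * (- (1 + lam) * (- wgt y * 1)))) (at y)" .
      also have "1 / (1 + lam) * (exp (- (1 + lam) * wgt y) * (- (1 + lam) * (- wgt y * 1))) = wgt y *
        exp (- (1 + lam) * wgt y)"
        using assms by (simp add: field_simps)
      finally show ?thesis unfolding * .
    qed
    have "((\<lambda>w. 1 / (1 + lam) * exp (- (1 + lam) * w)) \<longlongrightarrow> 0) at_top"
      by (rule exp_decay) (use assms in simp)
    from filterlim_compose[OF this wgt_at_bot]
    show "((\<lambda>a. 1 / (1 + lam) * exp (- (1 + lam) * wgt a)) \<longlongrightarrow> 0) at_bot" .
  qed auto
  also have "exp (wgt z) * (1 / (1 + lam) * exp (- (1 + lam) * wgt z)) = 1 / (1 + lam) * exp (- lam * wgt z)"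
    by (simp add: exp_add[symmetric] algebra_simps)
  also have "ennreal \<dots> = ennreal (1 / (1 + lam)) * ennreal (exp (- lam * wgt z))"
    using assms by (intro ennreal_mult) auto
  finally show ?thesis .
qed

lemma kernel_one:
  "(\<integral>\<^sup>+y. ennreal (indicator {..z} y * (wgt y * exp (wgt z - wgt y))) * 1 \<partial>lborel) = 1"
  using kernel_exp[of 0 z] by simp

text \<open>A unit exponential has mean 1 and variance 1: moving the centre from m to m + 1 along
  with the increment adds exactly 1 to the mean square.\<close>

lemma kernel_sq:
  "(\<integral>\<^sup>+y. ennreal (indicator {..z} y * (wgt y * exp (wgt z - wgt y))) * ennreal ((wgt y - (m + 1))\<^sup>2) \<partial>lborel) =
     ennreal ((wgt z - m)\<^sup>2 + 1)"
proof -
  let ?g = "\<lambda>w. exp (- w) * ((w - m)\<^sup>2 + 1)"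
  have "(\<integral>\<^sup>+y. ennreal (indicator {..z} y * (wgt y * exp (wgt z - wgt y))) * ennreal ((wgt y - (m +
    1))\<^sup>2) \<partial>lborel) =
    ennreal (exp (wgt z) * ?g (wgt z))"
  proof (rule kernel_FTC)
    fix y show "((\<lambda>z. ?g (wgt z)) has_real_derivative wgt y * exp (- wgt y) * (wgt y - (m + 1))\<^sup>2) (at y)"
      by (auto intro!: derivative_eq_intros simp: power2_eq_square algebra_simps)
    have "(?g \<longlongrightarrow> 0) at_top" by real_asymp
    from filterlim_compose[OF this wgt_at_bot]
    show "((\<lambda>a. ?g (wgt a)) \<longlongrightarrow> 0) at_bot" .
  qed auto
  also have "exp (wgt z) * ?g (wgt z) = (wgt z - m)\<^sup>2 + 1"
    by (simp add: exp_minus)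
  finally show ?thesis .
qed

lemma nn_integral_FTC_UNIV:
  fixes f :: "real \<Rightarrow> real"
  assumes f_borel[measurable]: "f \<in> borel_measurable borel"
  assumes f: "\<And>x. DERIV g x :> f x"
  assumes nonneg: "\<And>x. 0 \<le> f x"
  assumes lim: "(g \<longlongrightarrow> S) at_bot" "(g \<longlongrightarrow> T) at_top"
  shows "(\<integral>\<^sup>+x. ennreal (f x) \<partial>lborel) = ennreal (T - S)"
proof -
  have mono: "g x \<le> g y" if "x \<le> y" for x y
    by (rule DERIV_nonneg_imp_nondecreasing[OF that]) (use f nonneg in blast)
  have "g 0 \<le> T"
    by (rule tendsto_lowerbound[OF lim(2)]) (auto intro!: eventually_at_top_linorderI[of 0] mono)
  moreover have "S \<le> g 0"
    by (rule tendsto_upperbound[OF lim(1)]) (auto intro!: eventually_at_bot_linorderI[of 0] mono)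
  moreover have "(\<integral>\<^sup>+x. ennreal (f x) \<partial>lborel) =
      (\<integral>\<^sup>+x. ennreal (f x) * indicator {..0} x + ennreal (f x) * indicator {0..} x \<partial>lborel)"
    by (rule nn_integral_cong_AE) (use AE_lborel_singleton[of 0] in eventually_elim, auto simp: indicator_def)
  moreover have "\<dots> = ennreal (g 0 - S) + ennreal (T - g 0)"
    by (subst nn_integral_add) (auto simp: nn_integral_FTC_atMost[OF f_borel f nonneg lim(1)]
      nn_integral_FTC_atLeast[OF f_borel f nonneg lim(2)])
  ultimately show ?thesis by (simp add: ennreal_plus[symmetric] del: ennreal_plus)
qed

text \<open>Without parts both end factors sit at the peak, so \<open>wgt\<close> of the peak is
  exponential with rate 2. This is the Gumbel law for the peak itself.\<close>

lemma chain_expect_zero: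
  assumes f[measurable]: "f \<in> borel_measurable borel"
  shows "chain_expect (\<lambda>_. 0) (\<lambda>u. f (u Peak)) = (\<integral>\<^sup>+x. ennreal (2 * wgt x * exp (- (2 * wgt x))) *
    f x \<partial>lborel)"
proof -
  have c: "coords_upto (\<lambda>_. 0) = {Peak}" by (auto simp: coords_upto_def)
  have d: "chain_density (\<lambda>_. 0) u = 2 * wgt (u Peak) * exp (- (2 * wgt (u Peak)))" for u
  proof -
    have "chain_density (\<lambda>_. 0) u = 2 * wgt (u Peak) * (exp (- wgt (u Peak)) * exp (- wgt (u Peak)))"
      by (simp add: chain_density_def desc_chain_def c side_coord_def UNIV_side)
    also have "exp (- wgt (u Peak)) * exp (- wgt (u Peak)) = exp (- (2 * wgt (u Peak)))"
      by (simp add: exp_add[symmetric])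
    finally show ?thesis .
  qed
  show ?thesis unfolding chain_expect_def d c
    using lborel_prod.product_nn_integral_singleton[of "\<lambda>x. ennreal (2 * wgt x * exp (- (2 * wgt x))) *
      f x" Peak] by simp
qed

lemma chain_expect_marginal:
  assumes g: "g \<in> borel_measurable (Pi\<^sub>M (coords_upto len) (\<lambda>_. lborel))"
    and loc: "\<And>x y. (\<And>c. c \<in> coords_upto len \<Longrightarrow> x c = y c) \<Longrightarrow> g x = g y"
    and le: "\<And>j. len j \<le> len' j"
  shows "chain_expect len' g = chain_expect len g"
  using le
proof (induction "\<Sum>j\<in>UNIV. len' j - len j" arbitrary: len')
  case 0
  then have "len' = len" by (simp add: fun_eq_iff le_antisym)
  then show ?case by simp
next
  case (Suc k)
  have "\<exists>s. len s < len' s"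
  proof (rule ccontr)
    assume "\<not> ?thesis"
    then have "(\<Sum>j\<in>UNIV. len' j - len j) = 0" by (simp add: not_less)
    with Suc show False by simp
  qed
  then obtain s where s: "len s < len' s" by blast
  define l where "l = len'(s := len' s - 1)"
  have len': "len' = lengthen s l" using s by (auto simp: lengthen_def l_def)
  have le: "len j \<le> l j" for j using s Suc.prems[of j] by (auto simp: l_def)
  have "(\<Sum>j\<in>UNIV. len' j - len j) = Suc (\<Sum>j\<in>UNIV. l j - len j)"
    using s unfolding UNIV_side l_def by (cases s) auto
  with Suc.hyps(2) have k: "k = (\<Sum>j\<in>UNIV. l j - len j)" by simp
  have sub: "coords_upto len \<subseteq> coords_upto m" if "\<And>j. len j \<le> m j" for m
    using that by (force simp: coords_upto_def intro: order_trans)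
  have gm: "g \<in> borel_measurable (Pi\<^sub>M (coords_upto m) (\<lambda>_. lborel))" if "\<And>j. len j \<le> m j" for m
  proof -
    have "(\<lambda>x. g (restrict x (coords_upto len))) \<in> borel_measurable (Pi\<^sub>M (coords_upto m) (\<lambda>_. lborel))"
      by (rule measurable_compose[OF measurable_restrict_subset[OF sub[OF that]] g])
    moreover have "g (restrict x (coords_upto len)) = g x" for x by (rule loc) simp
    ultimately show ?thesis by simp
  qed
  have nin: "Part s (Suc (l s)) \<notin> coords_upto len"
    using le[of s] by (auto simp: coords_upto_def)
  have "chain_expect (lengthen s l) (\<lambda>u. g u * 1) = chain_expect l (\<lambda>u. g u * 1)"
  proof (rule chain_expect_lengthen[where f = "\<lambda>_. 1" and k = "\<lambda>_. 1"])
    show "g (x(Part s (Suc (l s)) := y)) = g x" for x y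
      by (rule loc) (use nin in auto)
    show "g \<in> borel_measurable (Pi\<^sub>M (coords_upto (lengthen s l)) (\<lambda>_. lborel))"
      using gm[of len'] Suc.prems by (simp add: len')
  qed (use gm[OF le] kernel_one in auto)
  also have "chain_expect l (\<lambda>u. g u * 1) = chain_expect len g" using Suc.hyps(1)[OF k le] by simp
  finally show ?case by (simp add: len')
qed

text \<open>The shortest chain that contains the \<open>t\<close>-th part of side \<open>s\<close>;
  the other side is cut down to the shared peak.\<close>

definition one_sided :: "side \<Rightarrow> nat \<Rightarrow> side \<Rightarrow> nat" where
  "one_sided s t = (\<lambda>j. if j = s then t else 0)"

lemma chain_expect_pos:
  assumes f: "f \<in> borel_measurable borel" and t: "t \<le> len s"
  shows "chain_expect len (\<lambda>u. f (u (side_coord s t))) = chain_expect (one_sided s t) (\<lambda>u. f (u (side_coord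
    s t)))"
proof (rule chain_expect_marginal)
  have p: "side_coord s t \<in> coords_upto (one_sided s t)" by (rule side_coord_in_coords_upto) (simp add:
    one_sided_def)
  show "(\<lambda>u. f (u (side_coord s t))) \<in> borel_measurable (Pi\<^sub>M (coords_upto (one_sided s t)) (\<lambda>_. lborel))"
    using measurable_component_singleton[OF p, of "\<lambda>_. lborel"]
    by (intro measurable_compose[OF _ f]) simp
  show "f (x (side_coord s t)) = f (y (side_coord s t))" if "\<And>c. c \<in> coords_upto (one_sided s t) \<Longrightarrow> x c =
    y c" for x y
    using that[OF p] by simp
  show "one_sided s t j \<le> len j" for j using t by (simp add: one_sided_def)
qed

lemma chain_expect_one_sided_Suc:
  assumes f: "f \<in> borel_measurable borel"
    and K: "\<And>z. (\<integral>\<^sup>+y. ennreal (indicator {..z} y * (wgt y * exp (wgt z - wgt y))) * f y \<partial>lborel) = k z"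
  shows "chain_expect (one_sided s (Suc t)) (\<lambda>u. f (u (side_coord s (Suc t)))) = chain_expect (one_sided s
    t) (\<lambda>u. k (u (side_coord s t)))"
proof -
  have "one_sided s (Suc t) = lengthen s (one_sided s t)" by (auto simp: one_sided_def lengthen_def)
  moreover have "chain_expect (lengthen s (one_sided s t)) (\<lambda>u. 1 * f (u (Part s (Suc (one_sided s t s))))) =
      chain_expect (one_sided s t) (\<lambda>u. 1 * k (u (side_coord s (one_sided s t s))))"
    by (rule chain_expect_lengthen[OF _ _ _ f K]) auto
  moreover have "one_sided s t s = t" by (simp add: one_sided_def)
  ultimately show ?thesis by (simp add: side_coord_def)
qed

lemma one_sided_zero: "one_sided s 0 = (\<lambda>_. 0)" by (simp add: one_sided_def fun_eq_iff)

lemma wgt_at_top: "(wgt \<longlongrightarrow> 0) at_top"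
  unfolding wgt_def by real_asymp

lemma chain_expect_Peak_le: "chain_expect len (\<lambda>u. indicator {..v} (u Peak)) = ennreal (exp (- exp (- v)))"
proof -
  have "chain_expect len (\<lambda>u. indicator {..v} (u Peak)) = chain_expect (\<lambda>_. 0) (\<lambda>u. indicator {..v} (u Peak))"
    using chain_expect_pos[of "indicator {..v}" 0 len L] by (simp add: side_coord_def one_sided_zero)
  also have "\<dots> = (\<integral>\<^sup>+x. ennreal (2 * wgt x * exp (- (2 * wgt x))) * indicator {..v} x \<partial>lborel)"
    by (rule chain_expect_zero) simp
  also have "\<dots> = ennreal (exp (- (2 * wgt v)) - 0)"
  proof (rule nn_integral_FTC_atMost[where g = "\<lambda>x. exp (- (2 * wgt x))"])
    show "((\<lambda>x. exp (- (2 * wgt x))) has_real_derivative 2 * wgt x * exp (- (2 * wgt x))) (at x)" for x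
      by (auto intro!: derivative_eq_intros)
    have "((\<lambda>w::real. exp (- (2 * w))) \<longlongrightarrow> 0) at_top" by real_asymp
    from filterlim_compose[OF this wgt_at_bot]
    show "((\<lambda>x. exp (- (2 * wgt x))) \<longlongrightarrow> 0) at_bot" .
  qed (auto simp: wgt_pos less_imp_le)
  finally show ?thesis by (simp add: wgt_def)
qed

lemma chain_expect_one: "chain_expect len (\<lambda>_. 1) = 1"
proof -
  have "chain_expect len (\<lambda>_. 1) = chain_expect (\<lambda>_. 0) (\<lambda>_. 1)"
    by (rule chain_expect_marginal) auto
  also have "\<dots> = (\<integral>\<^sup>+x. ennreal (2 * wgt x * exp (- (2 * wgt x))) \<partial>lborel)"
    using chain_expect_zero[of "\<lambda>_. 1"] by simp
  also have "\<dots> = ennreal (1 - 0)"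
  proof (rule nn_integral_FTC_UNIV[where g = "\<lambda>x. exp (- (2 * wgt x))"])
    show "((\<lambda>x. exp (- (2 * wgt x))) has_real_derivative 2 * wgt x * exp (- (2 * wgt x))) (at x)" for x
      by (auto intro!: derivative_eq_intros)
    have "((\<lambda>w::real. exp (- (2 * w))) \<longlongrightarrow> 0) at_top" by real_asymp
    from filterlim_compose[OF this wgt_at_bot]
    show "((\<lambda>x. exp (- (2 * wgt x))) \<longlongrightarrow> 0) at_bot" .
    show "((\<lambda>x. exp (- (2 * wgt x))) \<longlongrightarrow> 1) at_top"
      using tendsto_exp[OF tendsto_minus[OF tendsto_mult_left[OF wgt_at_top, of 2]]] by simp
  qed (auto simp: wgt_pos less_imp_le)
  finally show ?thesis by simp
qed

lemma chain_expect_cmult: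
  assumes "g \<in> borel_measurable (Pi\<^sub>M (coords_upto len) (\<lambda>_. lborel))"
  shows "chain_expect len (\<lambda>u. c * g u) = c * chain_expect len g"
proof -
  have "chain_expect len (\<lambda>u. c * g u) = (\<integral>\<^sup>+u. c * (ennreal (chain_density len u) * g u) \<partial>Pi\<^sub>M (coords_upto
    len) (\<lambda>_. lborel))"
    unfolding chain_expect_def by (simp add: mult_ac)
  then show ?thesis unfolding chain_expect_def using assms by (simp add: nn_integral_cmult)
qed

lemma side_coord_measurable:
  assumes "f \<in> borel_measurable borel" "t \<le> len s"
  shows "(\<lambda>u. f (u (side_coord s t))) \<in> borel_measurable (Pi\<^sub>M (coords_upto len) (\<lambda>_. lborel))"
proof -
  have "side_coord s t \<in> coords_upto len" by (rule side_coord_in_coords_upto) fact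
  from measurable_component_singleton[OF this, of "\<lambda>_. lborel"] show ?thesis
    by (intro measurable_compose[OF _ assms(1)]) simp
qed

lemma chain_expect_zero_exp:
  assumes "0 \<le> lam"
  shows "chain_expect (\<lambda>_. 0) (\<lambda>u. ennreal (exp (- lam * wgt (u Peak)))) = ennreal (2 / (2 + lam))"
proof -
  have "chain_expect (\<lambda>_. 0) (\<lambda>u. ennreal (exp (- lam * wgt (u Peak)))) =
     (\<integral>\<^sup>+x. ennreal (2 * wgt x * exp (- (2 + lam) * wgt x)) \<partial>lborel)"
    by (subst chain_expect_zero[of "\<lambda>x. ennreal (exp (- lam * wgt x))"])
       (auto intro!: nn_integral_cong simp: ennreal_mult'[symmetric] exp_add[symmetric] algebra_simps)
  also have "\<dots> = ennreal (2 * (1 / (2 + lam)) - 0)"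
  proof (rule nn_integral_FTC_UNIV[where g = "\<lambda>x. 2 * (1 / (2 + lam) * exp (- (2 + lam) * wgt x))"])
    fix x
    have "((\<lambda>z. exp (- (2 + lam) * wgt z)) has_real_derivative
          exp (- (2 + lam) * wgt x) * (- (2 + lam) * (- wgt x * 1))) (at x)"
      by (intro DERIV_fun_exp DERIV_cmult wgt_deriv DERIV_ident)
    from DERIV_cmult[OF DERIV_cmult[OF this, of "1 / (2 + lam)"], of 2]
    show "((\<lambda>x. 2 * (1 / (2 + lam) * exp (- (2 + lam) * wgt x))) has_real_derivative 2 * wgt x * exp (- (2 +
      lam) * wgt x)) (at x)"
      by (rule DERIV_cong) (use assms in \<open>simp add: field_simps\<close>)
  next
    have "((\<lambda>w. 1 / (2 + lam) * exp (- (2 + lam) * w)) \<longlongrightarrow> 0) at_top"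
      by (rule exp_decay) (use assms in simp)
    from tendsto_mult_left[OF filterlim_compose[OF this wgt_at_bot], of 2]
    show "((\<lambda>x. 2 * (1 / (2 + lam) * exp (- (2 + lam) * wgt x))) \<longlongrightarrow> 0) at_bot" by simp
    have "((\<lambda>x. 2 * (1 / (2 + lam) * exp (- (2 + lam) * wgt x))) \<longlongrightarrow> 2 * (1 / (2 + lam) * exp (- (2 + lam) *
      0))) at_top"
      by (intro tendsto_intros wgt_at_top)
    then show "((\<lambda>x. 2 * (1 / (2 + lam) * exp (- (2 + lam) * wgt x))) \<longlongrightarrow> 2 * (1 / (2 + lam))) at_top" by simp
  qed (auto simp: wgt_pos less_imp_le)
  finally show ?thesis by simp
qed

text \<open>The bound is the Laplace transform of t unit exponentials plus one of rate 2. It serves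
  for the lower tail of \<open>wgt\<close> in \<open>limit_law_small\<close>.\<close>

lemma chain_expect_exp_le:
  assumes lam: "0 \<le> lam" and t: "t \<le> len s"
  shows "chain_expect len (\<lambda>u. ennreal (exp (- lam * wgt (u (side_coord s t))))) \<le> ennreal ((1 / (1 +
    lam)) ^ t * (2 / (2 + lam)))"
proof -
  let ?f = "\<lambda>x. ennreal (exp (- lam * wgt x))"
  have "chain_expect (one_sided s t) (\<lambda>u. ?f (u (side_coord s t))) = ennreal ((1 / (1 + lam)) ^ t *
    (2 / (2 + lam)))"
  proof (induction t)
    case 0
    show ?case using chain_expect_zero_exp[OF lam] by (simp add: one_sided_zero side_coord_def)
  next
    case (Suc t)
    have "chain_expect (one_sided s (Suc t)) (\<lambda>u. ?f (u (side_coord s (Suc t)))) =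
       chain_expect (one_sided s t) (\<lambda>u. ennreal (1 / (1 + lam)) * ?f (u (side_coord s t)))"
      by (rule chain_expect_one_sided_Suc[where f = ?f]) (use kernel_exp[OF lam] in auto)
    also have "\<dots> = ennreal (1 / (1 + lam)) * chain_expect (one_sided s t) (\<lambda>u. ?f (u (side_coord s t)))"
      by (rule chain_expect_cmult, rule side_coord_measurable[of ?f]) (auto simp: one_sided_def)
    finally show ?case using Suc lam by (simp add: ennreal_mult'[symmetric] mult_ac)
  qed
  then show ?thesis using chain_expect_pos[of ?f t len s] t by simp
qed

text \<open>The rate 2 exponential at the peak has second moment 1/2, and each of the t steps adds
  1. Centring at t rather than at the true mean t + 1/2 is harmless and keeps the recursion
  simple.\<close>

lemma chain_expect_sq_le:
  assumes t: "t \<le> len s"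
  shows "chain_expect len (\<lambda>u. ennreal ((wgt (u (side_coord s t)) - real t)\<^sup>2)) \<le> ennreal (real t + 1)"
proof -
  have base: "chain_expect (\<lambda>_. 0) (\<lambda>u. ennreal ((wgt (u Peak))\<^sup>2)) \<le> 1"
  proof -
    have "chain_expect (\<lambda>_. 0) (\<lambda>u. ennreal ((wgt (u Peak))\<^sup>2)) =
     (\<integral>\<^sup>+x. ennreal (2 * wgt x * exp (- (2 * wgt x)) * (wgt x)\<^sup>2) \<partial>lborel)"
      by (subst chain_expect_zero[of "\<lambda>x. ennreal ((wgt x)\<^sup>2)"])
       (auto intro!: nn_integral_cong simp: ennreal_mult''[symmetric])
    also have "\<dots> = ennreal (1 / 2 - 0)"
    proof (rule nn_integral_FTC_UNIV[where g = "\<lambda>x. exp (- (2 * wgt x)) * ((wgt x)\<^sup>2 + wgt x + 1/2)"])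
      show "((\<lambda>x. exp (- (2 * wgt x)) * ((wgt x)\<^sup>2 + wgt x + 1/2)) has_real_derivative 2 * wgt x *
        exp (- (2 * wgt x)) * (wgt x)\<^sup>2) (at x)" for x
        by (auto intro!: derivative_eq_intros simp: power2_eq_square algebra_simps)
      have "((\<lambda>w::real. exp (- (2 * w)) * (w\<^sup>2 + w + 1/2)) \<longlongrightarrow> 0) at_top" by real_asymp
      from filterlim_compose[OF this wgt_at_bot]
      show "((\<lambda>x. exp (- (2 * wgt x)) * ((wgt x)\<^sup>2 + wgt x + 1/2)) \<longlongrightarrow> 0) at_bot" .
      have "((\<lambda>x. exp (- (2 * wgt x)) * ((wgt x)\<^sup>2 + wgt x + 1/2)) \<longlongrightarrow> exp (- (2 * 0)) * (0\<^sup>2 + 0 + 1/2)) at_top"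
        by (intro tendsto_intros wgt_at_top)
      then show "((\<lambda>x. exp (- (2 * wgt x)) * ((wgt x)\<^sup>2 + wgt x + 1/2)) \<longlongrightarrow> 1 / 2) at_top" by simp
    qed (auto simp: wgt_pos less_imp_le)
    also have "\<dots> \<le> ennreal 1" by (rule ennreal_leI) simp
    finally show ?thesis by simp
  qed
  let ?f = "\<lambda>t x. ennreal ((wgt x - real t)\<^sup>2)"
  have "chain_expect (one_sided s t) (\<lambda>u. ?f t (u (side_coord s t))) \<le> ennreal (real t + 1)"
  proof (induction t)
    case 0
    show ?case using base by (simp add: one_sided_zero side_coord_def)
  next
    case (Suc t)
    have "chain_expect (one_sided s (Suc t)) (\<lambda>u. ?f (Suc t) (u (side_coord s (Suc t)))) =
       chain_expect (one_sided s t) (\<lambda>u. ennreal ((wgt (u (side_coord s t)) - real t)\<^sup>2 + 1))"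
    proof (rule chain_expect_one_sided_Suc[where f = "?f (Suc t)" and k = "\<lambda>z. ennreal ((wgt z - real t)\<^sup>2 +
      1)"])
      show "(\<integral>\<^sup>+y. ennreal (indicator {..z} y * (wgt y * exp (wgt z - wgt y))) * ?f (Suc t) y \<partial>lborel) =
        ennreal ((wgt z - real t)\<^sup>2 + 1)" for z
        using kernel_sq[of z "real t"] unfolding of_nat_Suc add.commute[of 1 "real t"] .
    qed measurable
    also have "\<dots> = chain_expect (one_sided s t) (\<lambda>u. ?f t (u (side_coord s t)) + 1)"
      by simp
    also have "\<dots> = chain_expect (one_sided s t) (\<lambda>u. ?f t (u (side_coord s t))) + chain_expect (one_sided s
      t) (\<lambda>_. 1)"
    proof -
      have [measurable]: "(\<lambda>u. ?f t (u (side_coord s t))) \<in> borel_measurable (Pi\<^sub>M (coords_upto (one_sided s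
        t)) (\<lambda>_. lborel))"
        by (rule side_coord_measurable[of "?f t"]) (auto simp: one_sided_def)
      show ?thesis unfolding chain_expect_def distrib_left by (intro nn_integral_add) measurable
    qed
    also have "\<dots> \<le> ennreal (real t + 1) + 1" using Suc chain_expect_one by (simp add: add_mono)
    also have "\<dots> = ennreal (real (Suc t) + 1)"
      using ennreal_plus[of "real t + 1" 1] by (simp add: add.commute del: ennreal_plus)
    finally show ?case .
  qed
  then show ?thesis using chain_expect_pos[of "?f t" t len s] t by simp
qed

section \<open>Typical points of the limit law\<close>

definition limit_law :: "nat \<Rightarrow> (coord \<Rightarrow> real) measure" where
  "limit_law T = density (Pi\<^sub>M (coords T) (\<lambda>_. lborel)) (\<lambda>u. ennreal (chain_density (\<lambda>_. T) u))"

lemma coords_eq: "coords T = coords_upto (\<lambda>_. T)"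
proof -
  have "j \<in> {L, R}" for j by (cases j) auto
  then show ?thesis by (auto simp: coords_def coords_upto_def)
qed

lemma finite_coords: "finite (coords T)"
  by (simp add: coords_eq)

text \<open>The leading 2 of \<open>chain_density\<close> cancels the 1/2 in \<open>wgt\<close> of
  the peak, which leaves a factor 1/2 for each of the 2 T parts.\<close>

lemma F_eq_chain_density:
  assumes "1 \<le> T" shows "F T u = chain_density (\<lambda>_. T) u"
proof -
  have ch: "(\<forall>j\<in>{L, R}. u (Part j 1) \<le> u Peak \<and> (\<forall>t\<in>{1..<T}. u (Part j (t + 1)) \<le> u (Part j t))) \<longleftrightarrow>
     desc_chain (\<lambda>_. T) u" (is "?A \<longleftrightarrow> ?B")
  proof -
    have "(\<forall>t\<in>{..<T}. u (side_coord j (Suc t)) \<le> u (side_coord j t)) \<longleftrightarrow>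
       u (Part j 1) \<le> u Peak \<and> (\<forall>t\<in>{1..<T}. u (Part j (t + 1)) \<le> u (Part j t))" for j
    proof -
      have "{..<T} = insert 0 {1..<T}" using assms by auto
      then show ?thesis by (auto simp: side_coord_def)
    qed
    then have "?B \<longleftrightarrow> (\<forall>j\<in>UNIV. u (Part j 1) \<le> u Peak \<and> (\<forall>t\<in>{1..<T}. u (Part j (t + 1)) \<le> u (Part j t)))"
      unfolding desc_chain_def by simp
    then show ?thesis unfolding UNIV_side by simp
  qed
  have "coords_upto (\<lambda>_. T) = insert Peak (Part L ` {1..T} \<union> Part R ` {1..T})"
    unfolding coords_eq[symmetric] by (auto simp: coords_def)
  then have p: "(\<Prod>c\<in>coords_upto (\<lambda>_. T). wgt (u c)) =
      wgt (u Peak) * ((\<Prod>t=1..T. wgt (u (Part L t))) * (\<Prod>t=1..T. wgt (u (Part R t))))"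
  proof -
    have "(\<Prod>c\<in>Part j ` {1..T}. wgt (u c)) = (\<Prod>t=1..T. wgt (u (Part j t)))" for j
      by (subst prod.reindex) (auto simp: inj_on_def)
    moreover have "(\<Prod>c\<in>Part L ` {1..T} \<union> Part R ` {1..T}. wgt (u c)) =
        (\<Prod>c\<in>Part L ` {1..T}. wgt (u c)) * (\<Prod>c\<in>Part R ` {1..T}. wgt (u c))"
      by (rule prod.union_disjoint) auto
    moreover have "(\<Prod>c\<in>insert Peak (Part L ` {1..T} \<union> Part R ` {1..T}). wgt (u c)) =
        wgt (u Peak) * (\<Prod>c\<in>Part L ` {1..T} \<union> Part R ` {1..T}. wgt (u c))"
      by (rule prod.insert) auto
    ultimately show ?thesis by (simp only: \<open>coords_upto (\<lambda>_. T) = _\<close>)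
  qed
  have e: "(\<Prod>t=1..T. wgt (u (Part j t))) = 1 / 2 ^ T * exp (- (\<Sum>t=1..T. u (Part j t)))" for j
    by (simp add: wgt_def exp_sum prod_dividef sum_negf[symmetric])
  have "2 * (\<Prod>c\<in>coords_upto (\<lambda>_. T). wgt (u c)) * (\<Prod>j\<in>UNIV. exp (- wgt (u (side_coord j T)))) =
      1 / 2 ^ (2 * T) *
       exp (- u Peak - (\<Sum>t = 1..T. u (Part L t) + u (Part R t))
            - exp (- u (Part L T)) / 2 - exp (- u (Part R T)) / 2)"
    unfolding p e using assms
    by (simp add: UNIV_side side_coord_def wgt_def power_mult power2_eq_square sum.distrib exp_diff exp_add
      exp_minus power_mult_distrib)
      (simp add: field_simps flip: power_mult_distrib)
  then show ?thesis
    unfolding F_def chain_density_def ch by simp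
qed

lemma emeasure_limit_law:
  assumes "S \<in> sets (Pi\<^sub>M (coords T) (\<lambda>_. lborel))"
  shows "emeasure (limit_law T) S = chain_expect (\<lambda>_. T) (indicator S)"
  unfolding limit_law_def chain_expect_def using assms
  by (subst emeasure_density) (auto simp: coords_eq)

lemma sets_limit_law[simp, measurable_cong]: "sets (limit_law T) = sets (Pi\<^sub>M (coords T) (\<lambda>_. lborel))"
  by (simp add: limit_law_def)

lemma space_limit_law: "space (limit_law T) = space (Pi\<^sub>M (coords T) (\<lambda>_. lborel))"
  by (simp add: limit_law_def)

lemma prob_space_limit_law: "prob_space (limit_law T)"
proof
  have "chain_expect (\<lambda>_. T) (indicator (space (Pi\<^sub>M (coords T) (\<lambda>_. lborel)))) = chain_expect (\<lambda>_. T) (\<lambda>_. 1)"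
    unfolding chain_expect_def by (rule nn_integral_cong) (simp add: coords_eq)
  then show "emeasure (limit_law T) (space (limit_law T)) = 1"
    using chain_expect_one by (simp add: emeasure_limit_law space_limit_law)
qed

lemma nn_integral_limit_law:
  assumes "g \<in> borel_measurable (Pi\<^sub>M (coords T) (\<lambda>_. lborel))"
  shows "(\<integral>\<^sup>+u. g u \<partial>limit_law T) = chain_expect (\<lambda>_. T) g"
  unfolding limit_law_def chain_expect_def using assms by (subst nn_integral_density) (auto simp: coords_eq)

lemma coord_measurable:
  assumes "f \<in> borel_measurable borel" "t \<le> T"
  shows "(\<lambda>u. f (u (side_coord j t))) \<in> borel_measurable (Pi\<^sub>M (coords T) (\<lambda>_. lborel))"
  using side_coord_measurable[of f t "\<lambda>_. T" j] assms by (simp add: coords_eq)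

lemma coord_measurable2[measurable]:
  assumes "c \<in> coords T"
  shows "(\<lambda>u. u c) \<in> borel_measurable (Pi\<^sub>M (coords T) (\<lambda>_. lborel))"
  using measurable_component_singleton[OF assms, of "\<lambda>_. lborel"] by simp

text \<open>The lower bounds on \<open>wgt\<close> cap the parts: the one at the peak limits every
  part to h ln (h / c), and the linear one keeps the sum of a side within O(T h) of T times its last
  part. The concentration of the last \<open>wgt\<close> around \<open>T\<close> is what balances
  the mean of the truncated model.\<close>

definition typical :: "real \<Rightarrow> real \<Rightarrow> nat \<Rightarrow> (coord \<Rightarrow> real) set" where
  "typical c C T = {u \<in> space (limit_law T). desc_chain (\<lambda>_. T) u \<and> c \<le> wgt (u Peak) \<and>
     (\<forall>j. \<forall>t\<in>{1..T}. c * real t \<le> wgt (u (Part j t))) \<and>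
     (\<forall>j. \<bar>wgt (u (Part j T)) - real T\<bar> \<le> C * sqrt (real T))}"

lemma limit_law_markov:
  assumes g[measurable]: "g \<in> borel_measurable borel" and t: "t \<le> T"
    and bd: "chain_expect (\<lambda>_. T) (\<lambda>u. ennreal (g (u (side_coord j t)))) \<le> ennreal B" and B: "0 \<le> B" and a:
      "0 < a"
  shows "{u \<in> space (limit_law T). a \<le> g (u (side_coord j t))} \<in> sets (limit_law T)"
    and "measure (limit_law T) {u \<in> space (limit_law T). a \<le> g (u (side_coord j t))} \<le> B / a"
proof -
  have m[measurable]: "(\<lambda>u. g (u (side_coord j t))) \<in> borel_measurable (limit_law T)"
    using coord_measurable[OF g t, of j] by (simp cong: measurable_cong_sets)
  show s: "{u \<in> space (limit_law T). a \<le> g (u (side_coord j t))} \<in> sets (limit_law T)" by measurable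
  have "ennreal a * emeasure (limit_law T) {u \<in> space (limit_law T). a \<le> g (u (side_coord j t))} =
     (\<integral>\<^sup>+u. ennreal a * indicator {u \<in> space (limit_law T). a \<le> g (u (side_coord j t))} u \<partial>limit_law T)"
    using s by (simp add: nn_integral_cmult_indicator)
  also have "\<dots> \<le> (\<integral>\<^sup>+u. ennreal (g (u (side_coord j t))) \<partial>limit_law T)"
    by (rule nn_integral_mono) (auto simp: indicator_def intro: ennreal_leI)
  also have "\<dots> = chain_expect (\<lambda>_. T) (\<lambda>u. ennreal (g (u (side_coord j t))))"
    by (rule nn_integral_limit_law) (use coord_measurable[of "\<lambda>x. ennreal (g x)", OF _ t] in simp)
  finally have "ennreal a * emeasure (limit_law T) {u \<in> space (limit_law T). a \<le> g (u (side_coord j t))} \<le>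
    ennreal B"
    using bd by simp
  then have "ennreal (a * measure (limit_law T) {u \<in> space (limit_law T). a \<le> g (u (side_coord j t))}) \<le>
    ennreal B"
    using a by (simp add: ennreal_mult' finite_measure.emeasure_eq_measure[OF prob_space.finite_measure[OF
      prob_space_limit_law]])
  then have "a * measure (limit_law T) {u \<in> space (limit_law T). a \<le> g (u (side_coord j t))} \<le> B"
    using B by (simp add: ennreal_le_iff)
  then show "measure (limit_law T) {u \<in> space (limit_law T). a \<le> g (u (side_coord j t))} \<le> B / a"
    using a by (simp add: field_simps)
qed

text \<open>Chernoff bound: small \<open>wgt\<close> means large exp (- wgt / c). The threshold
  index \<open>t'\<close> is separate from \<open>t\<close> so that t = 0 with t' = 1 covers the
  peak.\<close>

lemma limit_law_small:
  assumes c: "0 < c" and t: "t \<le> T"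
  shows "{u \<in> space (limit_law T). wgt (u (side_coord j t)) \<le> c * real t'} \<in> sets (limit_law T)" (is ?A)
    and "measure (limit_law T) {u \<in> space (limit_law T). wgt (u (side_coord j t)) \<le> c * real t'} \<le> c ^ t *
      exp (real t') * (2 * c / (2 * c + 1))" (is ?B)
proof -
  have *: "{u \<in> space (limit_law T). wgt (u (side_coord j t)) \<le> c * real t'} =
     {u \<in> space (limit_law T). exp (- real t') \<le> exp (- (1 / c) * wgt (u (side_coord j t)))}"
    using c by (auto simp: field_simps)
  have bd: "chain_expect (\<lambda>_. T) (\<lambda>u. ennreal (exp (- (1 / c) * wgt (u (side_coord j t))))) \<le> ennreal (c ^ t
    * (2 * c / (2 * c + 1)))"
  proof -
    have "chain_expect (\<lambda>_. T) (\<lambda>u. ennreal (exp (- (1 / c) * wgt (u (side_coord j t))))) \<le> ennreal ((1 / (1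
      + 1 / c)) ^ t * (2 / (2 + 1 / c)))"
      by (rule chain_expect_exp_le) (use c t in auto)
    also have "\<dots> \<le> ennreal (c ^ t * (2 * c / (2 * c + 1)))"
    proof (rule ennreal_leI, rule mult_mono)
      show "(1 / (1 + 1 / c)) ^ t \<le> c ^ t" by (rule power_mono) (use c in \<open>auto simp: field_simps\<close>)
    qed (use c in \<open>auto simp: field_simps\<close>)
    finally show ?thesis .
  qed
  have m: "(\<lambda>x. exp (- (1 / c) * wgt x)) \<in> borel_measurable borel" by measurable
  note mk = limit_law_markov[OF m t bd, of "exp (- real t')"]
  show ?A unfolding * by (rule mk) (use c in auto)
  have "measure (limit_law T) {u \<in> space (limit_law T). wgt (u (side_coord j t)) \<le> c * real t'} \<le> c ^ t *
    (2 * c / (2 * c + 1)) / exp (- real t')"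
    unfolding * by (rule mk) (use c in auto)
  then show ?B by (simp add: exp_minus field_simps)
qed

lemma typical_sets: "typical c C T \<in> sets (limit_law T)" if "1 \<le> T"
proof -
  have pe: "Part j t = side_coord j t" if "1 \<le> t" for j t using that by (simp add: side_coord_def)
  have [measurable]: "Measurable.pred (Pi\<^sub>M (coords T) (\<lambda>_. lborel)) (desc_chain (\<lambda>_. T))"
  proof -
    have "desc_chain (\<lambda>_. T) = (\<lambda>u. \<forall>j\<in>UNIV. \<forall>t\<in>{..<T}. u (side_coord j (Suc t)) \<le> u (side_coord j t))"
      by (auto simp: desc_chain_def fun_eq_iff)
    then show ?thesis
      by (simp only:) (intro pred_intros_finite finite finite_lessThan borel_measurable_le[folded pred_def]
        coord_measurable[of "\<lambda>x. x"], auto)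
  qed
  have [measurable]: "(\<lambda>u. u Peak) \<in> borel_measurable (Pi\<^sub>M (coords T) (\<lambda>_. lborel))"
    by (rule coord_measurable2) (simp add: coords_def)
  have cp[measurable]: "(\<lambda>u. u (Part j t)) \<in> borel_measurable (Pi\<^sub>M (coords T) (\<lambda>_. lborel))"
    if "t \<in> {1..T}" for j t
    by (rule coord_measurable2) (use that in \<open>cases j; auto simp: coords_def\<close>)
  have eq: "typical c C T = {u \<in> space (limit_law T). desc_chain (\<lambda>_. T) u \<and> c \<le> wgt (u Peak) \<and>
     (\<forall>j\<in>UNIV. \<forall>t\<in>{1..T}. c * real t \<le> wgt (u (Part j t))) \<and>
     (\<forall>j\<in>UNIV. \<bar>wgt (u (Part j T)) - real T\<bar> \<le> C * sqrt (real T))}"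
    by (simp add: typical_def)
  have T: "T \<in> {1..T}" using that by simp
  have 1: "Measurable.pred (limit_law T) (\<lambda>u. \<forall>j\<in>UNIV. \<forall>t\<in>{1..T}. c * real t \<le> wgt (u (Part j t)))"
    by (intro pred_intros_finite finite finite_atLeastAtMost borel_measurable_le[folded pred_def]
      measurable_compose[OF _ wgt_measurable])
       (auto simp: limit_law_def intro: cp)
  have 2: "Measurable.pred (limit_law T) (\<lambda>u. \<forall>j\<in>UNIV. \<bar>wgt (u (Part j T)) - real T\<bar> \<le> C * sqrt (real T))"
    by (intro pred_intros_finite finite borel_measurable_le[folded pred_def] borel_measurable_abs
      borel_measurable_diff measurable_compose[OF _ wgt_measurable])
       (auto simp: limit_law_def intro: cp[OF T])
  show ?thesis unfolding eq using 1 2 by measurable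
qed

lemma AE_chain: "AE u in limit_law T. desc_chain (\<lambda>_. T) u"
  unfolding limit_law_def coords_eq by (subst AE_density) (measurable, auto simp: chain_density_def)

lemma geometric_sum_le: "(\<Sum>t=1..n. x ^ t) \<le> 2 * x" if x: "0 \<le> x" "x \<le> 1/2" for x :: real
proof -
  have "(\<Sum>t=1..n. x ^ t) \<le> 2 * x - 2 * x ^ Suc n"
  proof (induction n)
    case 0
    then show ?case using x by simp
  next
    case (Suc n)
    have "x ^ Suc n * (2 * x) \<le> x ^ Suc n * 1" by (intro mult_left_mono) (use x in auto)
    then have "2 * x ^ Suc (Suc n) \<le> x ^ Suc n" by (simp add: mult_ac)
    moreover have "(\<Sum>t=1..Suc n. x ^ t) = (\<Sum>t=1..n. x ^ t) + x ^ Suc n" by simp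
    ultimately show ?case using Suc by linarith
  qed
  moreover have "0 \<le> x ^ Suc n" using x by simp
  ultimately show ?thesis by linarith
qed

text \<open>A union bound over all parts works uniformly in \<open>T\<close>, because the t-th lower
  bound fails with probability at most (e c)^t. The last condition is Chebyshev's inequality with
  the second moment T + 1, at most 2 T.\<close>

lemma typical_prob:
  assumes e: "0 < (e::real)"
  shows "\<exists>c C. 0 < c \<and> c < 1 \<and> 0 < C \<and> (\<forall>T\<ge>1. measure (limit_law T) (typical c C T) \<ge> 1 - e)"
proof -
  \<comment> \<open>The first bound makes e c at most 1/2 for the geometric series; the second pays
    for 6 e c: two from the peak and two from the series on each side. \<open>C\<close> gives each
    side a Chebyshev bound of 2 / C^2, one quarter of the allowance.\<close>
  define c where "c = min (1 / (2 * exp 1)) (e / (12 * exp 1))"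
  define C where "C = sqrt (8 / e)"
  have c: "0 < c" and C: "0 < C" using e by (auto simp: c_def C_def)
  have ec: "exp 1 * c \<le> 1 / 2" and ec2: "6 * (exp 1 * c) \<le> e / 2"
  proof -
    have "exp 1 * c \<le> exp 1 * (1 / (2 * exp 1))" "exp 1 * c \<le> exp 1 * (e / (12 * exp 1))"
      unfolding c_def by (intro mult_left_mono; simp)+
    then show "exp 1 * c \<le> 1 / 2" "6 * (exp 1 * c) \<le> e / 2" by auto
  qed
  show ?thesis
  proof (intro exI conjI allI impI)
    show "0 < c" by (fact c)
    show "0 < C" by (fact C)
    have "1 < 2 * exp (1::real)" using exp_ge_add_one_self[of "1::real"] by linarith
    then show "c < 1" unfolding c_def by (intro min.strict_coboundedI1) simp
    fix T :: nat assume T: "1 \<le> T"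
    interpret N: prob_space "limit_law T" by (rule prob_space_limit_law)
    let ?S = "\<lambda>j t. {u \<in> space (limit_law T). wgt (u (side_coord j t)) \<le> c * real t}"
    let ?P = "{u \<in> space (limit_law T). wgt (u (side_coord L 0)) \<le> c * real 1}"
    let ?D = "\<lambda>j. {u \<in> space (limit_law T). C\<^sup>2 * real T \<le> (wgt (u (side_coord j T)) - real T)\<^sup>2}"
    let ?bad = "?P \<union> ((\<Union>j\<in>UNIV. \<Union>t\<in>{1..T}. ?S j t) \<union> (\<Union>j\<in>UNIV. ?D j))"
    have Dm: "?D j \<in> sets (limit_law T)" "measure (limit_law T) (?D j) \<le> e / 4" for j
    proof -
      have m: "(\<lambda>x. (wgt x - real T)\<^sup>2) \<in> borel_measurable borel" by measurable
      have B: "chain_expect (\<lambda>_. T) (\<lambda>u. ennreal ((wgt (u (side_coord j T)) - real T)\<^sup>2)) \<le> ennreal (real T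
        + 1)"
        by (rule chain_expect_sq_le) simp
      note mk = limit_law_markov[OF m order_refl B, of "C\<^sup>2 * real T"]
      show "?D j \<in> sets (limit_law T)" by (rule mk) (use C T in auto)
      have "measure (limit_law T) (?D j) \<le> (real T + 1) / (C\<^sup>2 * real T)" by (rule mk) (use C T in auto)
      also have "\<dots> \<le> (2 * real T) / (C\<^sup>2 * real T)" by (intro divide_right_mono) (use T in auto)
      also have "\<dots> = e / 4" using e T by (simp add: C_def)
      finally show "measure (limit_law T) (?D j) \<le> e / 4" .
    qed
    have Sm: "?S j t \<in> sets (limit_law T)" "measure (limit_law T) (?S j t) \<le> (exp 1 * c) ^ t"
      if "t \<in> {1..T}" for j t
    proof -
      show "?S j t \<in> sets (limit_law T)" by (rule limit_law_small) (use c that in auto)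
      have "measure (limit_law T) (?S j t) \<le> c ^ t * exp (real t) * (2 * c / (2 * c + 1))"
        by (rule limit_law_small) (use c that in auto)
      also have "\<dots> \<le> c ^ t * exp (real t) * 1"
        by (intro mult_left_mono) (use c in auto)
      also have "\<dots> = (exp 1 * c) ^ t" by (simp add: power_mult_distrib exp_of_nat_mult[symmetric])
      finally show "measure (limit_law T) (?S j t) \<le> (exp 1 * c) ^ t" .
    qed
    have Pm: "?P \<in> sets (limit_law T)" "measure (limit_law T) ?P \<le> 2 * (exp 1 * c)"
    proof -
      show "?P \<in> sets (limit_law T)" by (rule limit_law_small) (use c in auto)
      have "measure (limit_law T) ?P \<le> c ^ 0 * exp (real 1) * (2 * c / (2 * c + 1))"
        by (rule limit_law_small) (use c in auto)
      also have "\<dots> \<le> exp 1 * (2 * c)" using c by (auto simp: field_simps)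
      finally show "measure (limit_law T) ?P \<le> 2 * (exp 1 * c)" by simp
    qed
    have geo: "(\<Sum>t=1..T. (exp 1 * c) ^ t) \<le> 2 * (exp 1 * c)"
    proof -
      let ?x = "exp 1 * c"
      have x: "0 \<le> ?x" "?x \<le> 1/2" using c ec by auto
      show ?thesis by (rule geometric_sum_le[OF x])
    qed
    have tail_sets: "(\<Union>t\<in>{1..T}. ?S j t) \<in> sets (limit_law T)" for j
      by (intro sets.finite_UN finite_atLeastAtMost Sm(1))
    have "measure (limit_law T) ?bad \<le> measure (limit_law T) ?P + (measure (limit_law T) (\<Union>j\<in>UNIV.
      \<Union>t\<in>{1..T}. ?S j t) + measure (limit_law T) (\<Union>j\<in>UNIV. ?D j))"
      by (intro order_trans[OF measure_Un_le] add_mono order_refl sets.Un sets.finite_UN Pm tail_sets Dm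
        finite)
    also have "\<dots> \<le> 2 * (exp 1 * c) + (4 * (exp 1 * c) + e / 2)"
    proof (intro add_mono)
      have "measure (limit_law T) (\<Union>j\<in>UNIV. \<Union>t\<in>{1..T}. ?S j t) \<le> (\<Sum>j\<in>UNIV. measure (limit_law T) (\<Union>t\<in>{1..T}.
        ?S j t))"
        by (intro measure_UNION_le finite tail_sets)
      also have "\<dots> \<le> (\<Sum>j\<in>(UNIV::side set). 2 * (exp 1 * c))"
      proof (rule sum_mono)
        fix j
        have "measure (limit_law T) (\<Union>t\<in>{1..T}. ?S j t) \<le> (\<Sum>t\<in>{1..T}. measure (limit_law T) (?S j t))"
          by (intro measure_UNION_le finite_atLeastAtMost Sm)
        also have "\<dots> \<le> (\<Sum>t=1..T. (exp 1 * c) ^ t)" by (intro sum_mono Sm)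
        finally show "measure (limit_law T) (\<Union>t\<in>{1..T}. ?S j t) \<le> 2 * (exp 1 * c)" using geo by simp
      qed
      also have "\<dots> = 4 * (exp 1 * c)" by (simp add: UNIV_side)
      finally show "measure (limit_law T) (\<Union>j\<in>UNIV. \<Union>t\<in>{1..T}. ?S j t) \<le> 4 * (exp 1 * c)" .
      have "measure (limit_law T) (\<Union>j\<in>UNIV. ?D j) \<le> (\<Sum>j\<in>UNIV. measure (limit_law T) (?D j))"
        by (intro measure_UNION_le finite Dm)
      also have "\<dots> \<le> (\<Sum>j\<in>(UNIV::side set). e / 4)" by (intro sum_mono Dm)
      also have "\<dots> = e / 2" by (simp add: UNIV_side)
      finally show "measure (limit_law T) (\<Union>j\<in>UNIV. ?D j) \<le> e / 2" .
    qed (rule Pm)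
    also have "\<dots> \<le> e" using ec2 by linarith
    finally have bad: "measure (limit_law T) ?bad \<le> e" .
    have badm: "?bad \<in> sets (limit_law T)"
      by (intro sets.Un sets.finite_UN Pm tail_sets Dm finite)
    have "1 - e \<le> measure (limit_law T) (space (limit_law T) - ?bad)"
      using bad N.prob_compl[OF badm] by simp
    also have "\<dots> \<le> measure (limit_law T) (typical c C T)"
    proof (rule N.finite_measure_mono_AE)
      show "AE u in limit_law T. u \<in> space (limit_law T) - ?bad \<longrightarrow> u \<in> typical c C T"
        using AE_chain
      proof eventually_elim
        case (elim u)
        show ?case
        proof
          assume u: "u \<in> space (limit_law T) - ?bad"
          have "\<not> C\<^sup>2 * real T \<le> (wgt (u (side_coord j T)) - real T)\<^sup>2" for j using u by blast
          then have "(wgt (u (side_coord j T)) - real T)\<^sup>2 \<le> (C * sqrt (real T))\<^sup>2" for j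
            by (simp add: power_mult_distrib not_le less_imp_le)
          then have "\<bar>wgt (u (side_coord j T)) - real T\<bar> \<le> \<bar>C * sqrt (real T)\<bar>" for j
            by (simp only: abs_le_square_iff)
          moreover have "\<bar>C * sqrt (real T)\<bar> = C * sqrt (real T)" using C by simp
          moreover have "side_coord j T = Part j T" for j using T by (simp add: side_coord_def)
          moreover have "c * real t \<le> wgt (u (Part j t))" if t: "t \<in> {1..T}" for j t
          proof -
            have "\<not> wgt (u (side_coord j t)) \<le> c * real t" using u t by blast
            moreover have "side_coord j t = Part j t" using t by (simp add: side_coord_def)
            ultimately show ?thesis by simp
          qed
          moreover have "c \<le> wgt (u Peak)"
          proof -
            have "\<not> wgt (u (side_coord L 0)) \<le> c * real 1" using u by blast
            then show ?thesis by (simp add: side_coord_def)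
          qed
          ultimately show "u \<in> typical c C T" using elim u unfolding typical_def by auto
        qed
      qed
    qed (rule typical_sets[OF T])
    finally show "1 - e \<le> measure (limit_law T) (typical c C T)" .
  qed
qed

section \<open>Sums of independent weighted Bernoulli variables\<close>

lemma has_bochner_integral_le:
  fixes f g :: "'b \<Rightarrow> real"
  assumes "has_bochner_integral M f x" "has_bochner_integral M g y" "\<And>z. f z \<le> g z"
  shows "x \<le> y"
  using assms by (metis has_bochner_integral_iff integral_mono)

text \<open>Indices are kept apart from their weights because in the application every part size
  occurs twice, once on each side of the peak.\<close>

locale bernoulli_sum =
  fixes I :: "'a set" and w :: "'a \<Rightarrow> nat" and p :: "'a \<Rightarrow> real"
  assumes fin: "finite I" and p: "\<And>i. i \<in> I \<Longrightarrow> 0 \<le> p i \<and> p i \<le> 1"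
begin

definition wt :: "'a set \<Rightarrow> real" where
  "wt J = (\<Prod>i\<in>J. p i) * (\<Prod>i\<in>I - J. 1 - p i)"

definition pr :: "int \<Rightarrow> real" where
  "pr N = (\<Sum>J | J \<subseteq> I \<and> int (\<Sum>i\<in>J. w i) = N. wt J)"

definition cf :: "real \<Rightarrow> complex" where
  "cf \<theta> = (\<Prod>i\<in>I. of_real (1 - p i) + of_real (p i) * cis (real (w i) * \<theta>))"

definition mom :: "nat \<Rightarrow> real" where
  "mom m = (\<Sum>i\<in>I. real (w i) ^ m * (p i * (1 - p i)))"

definition mean :: real where
  "mean = (\<Sum>i\<in>I. real (w i) * p i)"

lemma cf_expand: "cf \<theta> = (\<Sum>J\<in>Pow I. of_real (wt J) * cis (real (\<Sum>i\<in>J. w i) * \<theta>))"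
proof -
  have "cf \<theta> = (\<Prod>i\<in>I. of_real (p i) * cis (real (w i) * \<theta>) + of_real (1 - p i))"
    unfolding cf_def by (simp add: add.commute)
  also have "\<dots> = (\<Sum>J\<in>Pow I. (\<Prod>i\<in>J. of_real (p i) * cis (real (w i) * \<theta>)) * (\<Prod>i\<in>I-J. of_real (1 - p i)))"
    by (rule prod_add[OF fin])
  also have "\<dots> = (\<Sum>J\<in>Pow I. of_real (wt J) * cis (real (\<Sum>i\<in>J. w i) * \<theta>))"
  proof (rule sum.cong[OF refl])
    fix J assume "J \<in> Pow I"
    then have fJ: "finite J" using fin by (auto intro: finite_subset)
    have "(\<Prod>i\<in>J. cis (real (w i) * \<theta>)) = cis (real (\<Sum>i\<in>J. w i) * \<theta>)"
      using fJ by (induction J) (auto simp: cis_mult algebra_simps)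
    then show "(\<Prod>i\<in>J. of_real (p i) * cis (real (w i) * \<theta>)) * (\<Prod>i\<in>I-J. of_real (1 - p i)) =
        (of_real (wt J) * cis (real (\<Sum>i\<in>J. w i) * \<theta>) :: complex)"
      by (simp only: prod.distrib wt_def of_real_mult of_real_prod mult_ac)
  qed
  finally show ?thesis .
qed

lemma Re_cf: "Re (cf \<theta> * cis (- (real_of_int N * \<theta>))) =
   (\<Sum>J\<in>Pow I. wt J * cos (real_of_int (int (\<Sum>i\<in>J. w i) - N) * \<theta>))"
proof -
  have "cf \<theta> * cis (- (real_of_int N * \<theta>)) =
     (\<Sum>J\<in>Pow I. of_real (wt J) * cis (real_of_int (int (\<Sum>i\<in>J. w i) - N) * \<theta>))"
    unfolding cf_expand sum_distrib_right
    by (intro sum.cong refl) (simp only: mult.assoc cis_mult, simp add: algebra_simps)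
  then show ?thesis by simp
qed

lemma fourier_cos:
  fixes m :: int
  shows "has_bochner_integral lborel (\<lambda>x. cos (real_of_int m * x) * indicator {-pi..pi} x) (if m = 0 then 2
    * pi else 0)"
proof (cases "m = 0")
  case True
  have "has_bochner_integral lborel (\<lambda>x. 1 * indicator {-pi..pi} x) (pi - (- pi))"
    by (rule has_bochner_integral_FTC_Icc_real) (auto intro!: derivative_eq_intros)
  then show ?thesis using True by simp
next
  case False
  have "has_bochner_integral lborel (\<lambda>x. cos (real_of_int m * x) * indicator {-pi..pi} x)
     (sin (real_of_int m * pi) / real_of_int m - sin (real_of_int m * (- pi)) / real_of_int m)"
    by (rule has_bochner_integral_FTC_Icc_real) (use False in \<open>auto intro!: derivative_eq_intros
      continuous_intros\<close>)
  moreover have "sin (real_of_int m * pi) = 0" by (simp add: sin_zero_iff_int2)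
  ultimately show ?thesis using False by simp
qed

text \<open>Fourier inversion over one period. Taking real parts loses nothing, since the
  probabilities are real, and reduces everything to the orthogonality of cosines.\<close>

lemma pr_integral:
  "has_bochner_integral lborel (\<lambda>x. Re (cf x * cis (- (real_of_int N * x))) * indicator {-pi..pi} x) (2 *
    pi * pr N)"
proof -
  have "has_bochner_integral lborel
    (\<lambda>x. \<Sum>J\<in>Pow I. wt J * (cos (real_of_int (int (\<Sum>i\<in>J. w i) - N) * x) * indicator {-pi..pi} x))
    (\<Sum>J\<in>Pow I. wt J * (if int (\<Sum>i\<in>J. w i) - N = 0 then 2 * pi else 0))"
    by (intro has_bochner_integral_sum has_bochner_integral_mult_right fourier_cos)
  moreover have "(\<Sum>J\<in>Pow I. wt J * (if int (\<Sum>i\<in>J. w i) - N = 0 then 2 * pi else 0)) = 2 * pi * pr N"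
  proof -
    have "(\<Sum>J\<in>Pow I. wt J * (if int (\<Sum>i\<in>J. w i) - N = 0 then 2 * pi else 0)) =
       (\<Sum>J\<in>{J \<in> Pow I. int (\<Sum>i\<in>J. w i) = N}. wt J * (2 * pi))"
      by (subst sum.inter_filter) (auto intro!: sum.cong simp: fin)
    also have "\<dots> = 2 * pi * pr N"
      unfolding pr_def by (simp add: sum_distrib_right[symmetric] sum_distrib_left mult_ac)
    finally show ?thesis .
  qed
  moreover have "(\<lambda>x. Re (cf x * cis (- (real_of_int N * x))) * indicator {-pi..pi} x) =
    (\<lambda>x. \<Sum>J\<in>Pow I. wt J * (cos (real_of_int (int (\<Sum>i\<in>J. w i) - N) * x) * indicator {-pi..pi} x))"
    by (simp only: Re_cf sum_distrib_right mult.assoc)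
  ultimately show ?thesis by (simp only:)
qed

lemma factor_norm_sq: "(cmod (of_real (1 - q) + of_real q * cis x))\<^sup>2 = 1 - 2 * (q * (1 - q)) * (1 - cos x)"
  for q :: real
proof -
  have "(cmod (of_real (1 - q) + of_real q * cis x))\<^sup>2 = (1 - q + q * cos x)\<^sup>2 + (q * sin x)\<^sup>2"
    by (simp add: cmod_power2)
  also have "\<dots> = (1 - q + q * cos x)\<^sup>2 + q\<^sup>2 * (1 - (cos x)\<^sup>2)"
    by (simp add: power_mult_distrib sin_squared_eq)
  also have "\<dots> = 1 - 2 * (q * (1 - q)) * (1 - cos x)"
    by (simp add: power2_eq_square algebra_simps)
  finally show ?thesis .
qed

lemma norm_cf_le: "cmod (cf x) \<le> exp (- (\<Sum>i\<in>I. (p i * (1 - p i)) * (1 - cos (real (w i) * x))))"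
proof -
  have "cmod (cf x) = (\<Prod>i\<in>I. cmod (of_real (1 - p i) + of_real (p i) * cis (real (w i) * x)))"
    unfolding cf_def by (rule prod_norm[symmetric])
  also have "\<dots> \<le> (\<Prod>i\<in>I. exp (- ((p i * (1 - p i)) * (1 - cos (real (w i) * x)))))"
  proof (rule prod_mono, intro conjI norm_ge_zero)
    fix i assume "i \<in> I"
    let ?t = "(p i * (1 - p i)) * (1 - cos (real (w i) * x))"
    have "(cmod (of_real (1 - p i) + of_real (p i) * cis (real (w i) * x)))\<^sup>2 = 1 + (- 2 * ?t)"
      by (subst factor_norm_sq) simp
    also have "\<dots> \<le> exp (- 2 * ?t)" by (rule exp_ge_add_one_self)
    also have "\<dots> = (exp (- ?t))\<^sup>2" by (simp add: power2_eq_square exp_add[symmetric])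
    finally show "cmod (of_real (1 - p i) + of_real (p i) * cis (real (w i) * x)) \<le> exp (- ?t)"
      by (rule power2_le_imp_le) simp
  qed
  also have "\<dots> = exp (- (\<Sum>i\<in>I. (p i * (1 - p i)) * (1 - cos (real (w i) * x))))"
    by (simp add: exp_sum[OF fin] sum_negf[symmetric])
  finally show ?thesis .
qed

text \<open>Expand both values of the centred variable to second order: the linear terms cancel and
  the quadratic ones give the variance. The error must keep the factor q (1 - q), since only then do
  the errors add up to moments weighted by the variances of the summands.\<close>

lemma factor_approx:
  assumes q: "0 \<le> q" "q \<le> (1::real)"
  shows "cmod ((of_real (1 - q) + of_real q * cis x) * cis (- (q * x)) - of_real (exp (- (q * (1 - q) *
    x\<^sup>2 / 2))))
    \<le> q * (1 - q) * \<bar>x\<bar> ^ 3 / 6 + q * (1 - q) * x ^ 4 / 8"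
proof -
  have iexp: "cmod (cis y - (1 + \<i> * of_real y - of_real (y\<^sup>2 / 2))) \<le> \<bar>y\<bar> ^ 3 / 6" for y :: real
    using iexp_approx1[of y 2]
    by (simp add: cis_conv_exp numeral_2_eq_2 atMost_Suc power_mult_distrib fact_numeral algebra_simps
      eval_nat_numeral)
  have a: "(of_real (1 - q) + of_real q * cis x) * cis (- (q * x)) = of_real (1 - q) * cis (- q * x) +
    of_real q * cis ((1 - q) * x)"
    by (simp add: distrib_right mult.assoc cis_mult algebra_simps)
  define E1 where "E1 = cis (- q * x) - (1 + \<i> * of_real (- q * x) - of_real ((- q * x)\<^sup>2 / 2))"
  define E2 where "E2 = cis ((1 - q) * x) - (1 + \<i> * of_real ((1 - q) * x) - of_real (((1 - q) * x)\<^sup>2 / 2))"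
  define y where "y = q * (1 - q) * x\<^sup>2 / 2"
  have y0: "0 \<le> y" using q by (simp add: y_def)
  have b: "of_real (1 - q) * cis (- q * x) + of_real q * cis ((1 - q) * x) =
     of_real (1 - q) * E1 + of_real q * E2 + of_real (1 - y)"
    unfolding E1_def E2_def y_def by (simp add: complex_eq_iff power2_eq_square algebra_simps) (simp add:
      field_simps)
  have e: "\<bar>exp (- y) - (1 - y)\<bar> \<le> y\<^sup>2 / 2"
  proof -
    have "1 - y \<le> exp (- y)" using exp_ge_add_one_self[of "- y"] by simp
    moreover have "exp (- y) \<le> 1 - y + y\<^sup>2 / 2"
    proof -
      have "1 + y + y\<^sup>2 / 2 \<le> exp y" using exp_lower_Taylor_quadratic[OF y0] by simp
      \<comment> \<open>The product of the two quadratics is 1 + y^4 / 4.\<close>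
      have "1 \<le> (1 - y + y\<^sup>2 / 2) * (1 + y + y\<^sup>2 / 2)"
      proof -
        have "(1 - y + y\<^sup>2 / 2) * (1 + y + y\<^sup>2 / 2) = 1 + (y\<^sup>2)\<^sup>2 / 4" by (simp add: power2_eq_square
          field_simps)
        then show ?thesis by simp
      qed
      also have "\<dots> \<le> (1 - y + y\<^sup>2 / 2) * exp y"
      proof (rule mult_left_mono)
        have "1 - y + y\<^sup>2 / 2 = ((1 - y)\<^sup>2 + 1) / 2" by (simp add: power2_eq_square field_simps)
        also have "0 \<le> \<dots>" by (intro divide_nonneg_nonneg add_nonneg_nonneg) auto
        finally show "0 \<le> 1 - y + y\<^sup>2 / 2" .
      qed fact
      finally show ?thesis by (simp add: exp_minus field_simps)
    qed
    ultimately show ?thesis by simp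
  qed
  have "cmod ((of_real (1 - q) + of_real q * cis x) * cis (- (q * x)) - of_real (exp (- y))) =
     cmod (of_real (1 - q) * E1 + of_real q * E2 - of_real (exp (- y) - (1 - y)))"
    unfolding a b by (simp add: algebra_simps)
  also have "\<dots> \<le> cmod (of_real (1 - q) * E1) + cmod (of_real q * E2) + cmod (of_real (exp (- y) - (1 - y)))"
    by (intro order_trans[OF norm_triangle_ineq4] add_mono norm_triangle_ineq order_refl)
  also have "\<dots> \<le> (1 - q) * (\<bar>- q * x\<bar> ^ 3 / 6) + q * (\<bar>(1 - q) * x\<bar> ^ 3 / 6) + y\<^sup>2 / 2"
  proof (intro add_mono)
    show "cmod (of_real (1 - q) * E1) \<le> (1 - q) * (\<bar>- q * x\<bar> ^ 3 / 6)"
      unfolding norm_mult norm_of_real E1_def using q by (intro mult_mono iexp) auto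
    show "cmod (of_real q * E2) \<le> q * (\<bar>(1 - q) * x\<bar> ^ 3 / 6)"
      unfolding norm_mult norm_of_real E2_def using q by (intro mult_mono iexp) auto
    show "cmod (of_real (exp (- y) - (1 - y))) \<le> y\<^sup>2 / 2" using e unfolding norm_of_real .
  qed
  also have "\<dots> = q * (1 - q) * \<bar>x\<bar> ^ 3 / 6 * (q\<^sup>2 + (1 - q)\<^sup>2) + q * (1 - q) * x ^ 4 / 8 * (q * (1 - q))"
  proof -
    have a1: "\<bar>- q * x\<bar> = q * \<bar>x\<bar>" "\<bar>(1 - q) * x\<bar> = (1 - q) * \<bar>x\<bar>" using q by (simp_all add: abs_mult)
    show ?thesis unfolding a1 y_def by (simp add: power_mult_distrib power2_eq_square power3_eq_cube
      power4_eq_xxxx field_simps)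
  qed
  also have "\<dots> \<le> q * (1 - q) * \<bar>x\<bar> ^ 3 / 6 * 1 + q * (1 - q) * x ^ 4 / 8 * 1"
  proof (intro add_mono mult_left_mono)
    have "q * (1 - q) \<ge> 0" using q by simp
    moreover have "q\<^sup>2 + (1 - q)\<^sup>2 = 1 - 2 * (q * (1 - q))" by (simp add: power2_eq_square algebra_simps)
    ultimately show "q\<^sup>2 + (1 - q)\<^sup>2 \<le> 1" by simp
    have "q * (1 - q) \<le> 1 * 1" using q by (intro mult_mono) auto
    then show "q * (1 - q) \<le> 1" by simp
  qed (use q in auto)
  finally show ?thesis by (simp add: y_def)
qed

text \<open>All factors on both sides have modulus at most 1, so the difference of the products is
  at most the sum of the differences of the factors.\<close>

lemma cf_approx:
  "cmod (cf x * cis (- (mean * x)) - of_real (exp (- (mom 2 * x\<^sup>2 / 2)))) \<le> mom 3 * \<bar>x\<bar> ^ 3 / 6 + mom 4 *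
    x ^ 4 / 8"
proof -
  let ?z = "\<lambda>i. (of_real (1 - p i) + of_real (p i) * cis (real (w i) * x)) * cis (- (p i * (real (w i) * x)))"
  let ?e = "\<lambda>i. (of_real (exp (- (p i * (1 - p i) * (real (w i) * x)\<^sup>2 / 2))) :: complex)"
  have "cis (- (mean * x)) = (\<Prod>i\<in>I. cis (- (p i * (real (w i) * x))))"
  proof -
    have "(\<Prod>i\<in>J. cis (- (p i * (real (w i) * x)))) = cis (- (\<Sum>i\<in>J. p i * (real (w i) * x)))" if "finite J" for J
      using that by (induction J) (auto simp: cis_mult algebra_simps)
    from this[OF fin] show ?thesis by (simp add: mean_def sum_distrib_left mult_ac)
  qed
  then have 1: "cf x * cis (- (mean * x)) = (\<Prod>i\<in>I. ?z i)"
    unfolding cf_def by (simp add: prod.distrib)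
  have 2: "of_real (exp (- (mom 2 * x\<^sup>2 / 2))) = (\<Prod>i\<in>I. ?e i)"
  proof -
    have "- (mom 2 * x\<^sup>2 / 2) = mom 2 * (- (x\<^sup>2 / 2))" by simp
    also have "\<dots> = (\<Sum>i\<in>I. - (p i * (1 - p i) * (real (w i) * x)\<^sup>2 / 2))"
      unfolding mom_def sum_distrib_right by (intro sum.cong refl) (simp add: power_mult_distrib)
    finally show ?thesis by (simp only: of_real_prod[symmetric] exp_sum[OF fin])
  qed
  have "cmod ((\<Prod>i\<in>I. ?z i) - (\<Prod>i\<in>I. ?e i)) \<le> (\<Sum>i\<in>I. cmod (?z i - ?e i))"
  proof (rule norm_prod_diff)
    fix i assume i: "i \<in> I"
    have "(cmod (of_real (1 - p i) + of_real (p i) * cis (real (w i) * x)))\<^sup>2 \<le> 1\<^sup>2"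
      unfolding factor_norm_sq using p[OF i] by simp
    then have "cmod (of_real (1 - p i) + of_real (p i) * cis (real (w i) * x)) \<le> 1"
      by (rule power2_le_imp_le) simp
    then show "cmod (?z i) \<le> 1" by (simp add: norm_mult)
    show "cmod (?e i) \<le> 1" using p[OF i] by simp
  qed
  also have "\<dots> \<le> (\<Sum>i\<in>I. p i * (1 - p i) * \<bar>real (w i) * x\<bar> ^ 3 / 6 + p i * (1 - p i) * (real (w i) *
    x) ^ 4 / 8)"
    by (intro sum_mono factor_approx) (use p in auto)
  also have "\<dots> = mom 3 * \<bar>x\<bar> ^ 3 / 6 + mom 4 * x ^ 4 / 8"
  proof -
    have "mom k * y / z = (\<Sum>i\<in>I. p i * (1 - p i) * (real (w i) ^ k * y) / z)" for k y z
      unfolding mom_def sum_distrib_right sum_divide_distrib by (intro sum.cong refl) (simp add: mult_ac)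
    then show ?thesis by (simp add: sum.distrib power_mult_distrib abs_mult)
  qed
  finally show ?thesis unfolding 1 2 .
qed

end

section \<open>From the characteristic function to point probabilities\<close>

lemma gauss_integral:
  assumes "0 < (a::real)"
  shows "has_bochner_integral lborel (\<lambda>x. exp (- (a * x\<^sup>2 / 2))) (sqrt (2 * pi / a))"
proof -
  define s where "s = 1 / sqrt a"
  have s: "0 < s" using assms by (simp add: s_def)
  have s2: "s\<^sup>2 = 1 / a" using assms by (simp add: s_def power_divide)
  interpret prob_space "density lborel (normal_density 0 s)" by (rule prob_space_normal_density[OF s])
  have "has_bochner_integral lborel (normal_density 0 s) 1"
    using integrable_normal_density[OF s] integral_normal_density[OF s] by (simp add: has_bochner_integral_iff)
  then have "has_bochner_integral lborel (\<lambda>x. sqrt (2 * pi / a) * normal_density 0 s x) (sqrt (2 * pi / a) * 1)"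
    by (rule has_bochner_integral_mult_right)
  also have "(\<lambda>x. sqrt (2 * pi / a) * normal_density 0 s x) = (\<lambda>x. exp (- (a * x\<^sup>2 / 2)))"
    using assms by (simp add: normal_density_def s2 fun_eq_iff field_simps)
  finally show ?thesis by simp
qed

text \<open>Gaussian tails are dominated by multiples of 1 / (x^2 + r^2) through exp (- x) at most 1
  / x, so that only integrals over the whole line occur and no incomplete Gaussian integral has to
  be estimated.\<close>

lemma cauchy_integral:
  assumes r: "0 < (r::real)"
  shows "has_bochner_integral lborel (\<lambda>x. 1 / (x\<^sup>2 + r\<^sup>2)) (pi / r)"
proof -
  have sq_pos: "0 < x\<^sup>2 + r\<^sup>2" for x using r by (simp add: add_nonneg_pos)
  have "(\<integral>\<^sup>+x. ennreal (1 / (x\<^sup>2 + r\<^sup>2)) \<partial>lborel) = ennreal (pi / 2 / r - (- (pi / 2) / r))"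
  proof (rule nn_integral_FTC_UNIV[where g = "\<lambda>x. arctan (x / r) / r"])
    show "((\<lambda>x. arctan (x / r) / r) has_real_derivative 1 / (x\<^sup>2 + r\<^sup>2)) (at x)" for x
    proof -
      have eq: "1 + (x / r)\<^sup>2 = (x\<^sup>2 + r\<^sup>2) / r\<^sup>2" using r by (simp add: power_divide add_divide_distrib)
      have "((\<lambda>x. arctan (x / r) / r) has_real_derivative inverse (1 + (x / r)\<^sup>2) * (1 / r) / r) (at x)"
        by (intro DERIV_cdivide DERIV_chain2[OF DERIV_arctan] DERIV_ident)
      then show ?thesis by (rule DERIV_cong) (unfold eq, use r in \<open>simp add: power2_eq_square\<close>)
    qed
    have "filterlim (\<lambda>x. x / r) at_bot at_bot" "filterlim (\<lambda>x. x / r) at_top at_top"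
      using r by real_asymp+
    then show "((\<lambda>x. arctan (x / r) / r) \<longlongrightarrow> - (pi / 2) / r) at_bot" "((\<lambda>x. arctan (x / r) / r) \<longlongrightarrow> pi / 2 / r)
      at_top"
      by (intro tendsto_divide tendsto_const filterlim_compose[OF tendsto_arctan_at_bot]
        filterlim_compose[OF tendsto_arctan_at_top]; use r in simp)+
  qed (use sq_pos in \<open>auto intro: less_imp_le\<close>)
  also have "pi / 2 / r - (- (pi / 2) / r) = pi / r" by (simp add: field_simps)
  finally show ?thesis
    by (intro has_bochner_integral_nn_integral) (use sq_pos r in \<open>auto intro: less_imp_le\<close>)
qed

lemma exp_neg_le_inverse: "exp (- x) \<le> 1 / x" if "0 < x" for x :: real
proof -
  have "x \<le> exp x" using exp_ge_add_one_self[of x] by linarith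
  then show ?thesis using that by (simp add: exp_minus field_simps)
qed

context bernoulli_sum
begin

lemma pr_upper:
  assumes a: "0 < a" and b: "0 \<le> b"
    and bd: "\<And>x. \<bar>x\<bar> \<le> pi \<Longrightarrow> cmod (cf x) \<le> exp (- (a * x\<^sup>2 / 2)) + b"
  shows "2 * pi * pr N \<le> sqrt (2 * pi / a) + 2 * pi * b"
proof -
  have ib: "has_bochner_integral lborel (\<lambda>x. 1 * indicator {-pi..pi} x) (pi - (- pi))"
    by (rule has_bochner_integral_FTC_Icc_real) (auto intro!: derivative_eq_intros)
  have i2: "has_bochner_integral lborel (\<lambda>x. exp (- (a * x\<^sup>2 / 2)) + b * (1 * indicator {-pi..pi} x)) (sqrt
    (2 * pi / a) + b * (pi - (- pi)))"
    by (intro has_bochner_integral_add gauss_integral[OF a] has_bochner_integral_mult_right ib)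
  have "2 * pi * pr N \<le> sqrt (2 * pi / a) + b * (pi - (- pi))"
  proof (rule has_bochner_integral_le[OF pr_integral i2])
    fix x :: real
    have "Re (cf x * cis (- (real_of_int N * x))) \<le> exp (- (a * x\<^sup>2 / 2)) + b" if "\<bar>x\<bar> \<le> pi"
    proof -
      have "Re (cf x * cis (- (real_of_int N * x))) \<le> cmod (cf x * cis (- (real_of_int N * x)))"
        by (rule complex_Re_le_cmod)
      also have "\<dots> = cmod (cf x)" by (simp add: norm_mult)
      finally show ?thesis using bd[OF that] by simp
    qed
    then show "Re (cf x * cis (- (real_of_int N * x))) * indicator {-pi..pi} x \<le> exp (- (a * x\<^sup>2 / 2)) + b *
      (1 * indicator {-pi..pi} x)"
      by (auto simp: indicator_def)
  qed
  then show ?thesis by (simp add: mult_ac)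
qed

text \<open>Three zones: for |x| at most r the characteristic function is compared with a Gaussian,
  between r and pi it is only bounded in modulus, and beyond pi the Gaussian has to be
  removed.\<close>

lemma pr_lower:
  assumes V: "0 < V" "V = mom 2" and b: "0 \<le> b" and r: "0 < r"
    and bd: "\<And>x. \<bar>x\<bar> \<le> pi \<Longrightarrow> cmod (cf x) \<le> exp (- (V * x\<^sup>2 / 4)) + b"
    and e: "mom 3 * r ^ 3 / 6 + mom 4 * r ^ 4 / 8 + \<bar>mean - real_of_int N\<bar> * r \<le> e"
  shows "2 * pi * pr N \<ge> sqrt (2 * pi / V) - 4 / V - 2 * r * e - 12 * pi / (V * r) - 2 * pi * b"
proof -
  have m0: "0 \<le> mom k" for k unfolding mom_def using p by (intro sum_nonneg) auto
  have e0: "0 \<le> e" using m0[of 3] m0[of 4] r by (intro order_trans[OF _ e] add_nonneg_nonneg) auto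
  have ind: "has_bochner_integral lborel (\<lambda>x. 1 * indicator {-c..c} x) (c - (- c))" if "0 \<le> c" for c :: real
    by (rule has_bochner_integral_FTC_Icc_real) (use that in \<open>auto intro!: derivative_eq_intros\<close>)
  \<comment> \<open>A minorant of the integrand on the whole line. The first Cauchy term pays for
    the Gaussian outside the period. The second pays, for |x| beyond r, for the Gaussian and for the
    modulus bound together: 4 / (V x^2) + 2 / (V x^2) = (12 / V) / (2 x^2).\<close>
  let ?f = "\<lambda>x. exp (- (V * x\<^sup>2 / 2)) - 4 / V * (1 / (x\<^sup>2 + pi\<^sup>2)) - e * (1 * indicator {-r..r} x) - 12 / V
    * (1 / (x\<^sup>2 + r\<^sup>2)) - b * (1 * indicator {-pi..pi} x)"
  have i: "has_bochner_integral lborel ?f (sqrt (2 * pi / V) - 4 / V * (pi / pi) - e * (r - (- r)) - 12 / V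
    * (pi / r) - b * (pi - (- pi)))"
    by (intro has_bochner_integral_diff gauss_integral has_bochner_integral_mult_right ind cauchy_integral)
      (use V r in auto)
  have "sqrt (2 * pi / V) - 4 / V * (pi / pi) - e * (r - (- r)) - 12 / V * (pi / r) - b * (pi - (- pi)) \<le>
    2 * pi * pr N"
  proof (rule has_bochner_integral_le[OF i pr_integral])
    fix x :: real
    let ?R = "Re (cf x * cis (- (real_of_int N * x)))"
    have sq_pos: "0 < x\<^sup>2 + r\<^sup>2" "0 < x\<^sup>2 + pi\<^sup>2" using r by (simp_all add: add_nonneg_pos)
    have pos2: "0 \<le> 12 / V * (1 / (x\<^sup>2 + r\<^sup>2))" "0 \<le> 4 / V * (1 / (x\<^sup>2 + pi\<^sup>2))" using V sq_pos by auto
    show "?f x \<le> ?R * indicator {-pi..pi} x"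
    proof (cases "\<bar>x\<bar> \<le> pi")
      case False
      then have px: "pi\<^sup>2 \<le> x\<^sup>2" by (metis abs_le_square_iff abs_of_nonneg linear pi_ge_zero)
      have x2: "0 < x\<^sup>2" using False pi_gt_zero by auto
      have "exp (- (V * x\<^sup>2 / 2)) \<le> 1 / (V * x\<^sup>2 / 2)" by (rule exp_neg_le_inverse) (use V x2 in simp)
      also have "\<dots> = 4 / V * (1 / (x\<^sup>2 + x\<^sup>2))" by simp
      also have "\<dots> \<le> 4 / V * (1 / (x\<^sup>2 + pi\<^sup>2))" using V sq_pos x2 px
        by (intro mult_left_mono divide_left_mono) auto
      finally have "exp (- (V * x\<^sup>2 / 2)) \<le> 4 / V * (1 / (x\<^sup>2 + pi\<^sup>2))" .
      moreover have "indicator {-pi..pi} x = (0::real)" using False by (auto simp: indicator_def)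
      moreover have "0 \<le> e * (1 * indicator {-r..r} x)" using e0 by simp
      ultimately show ?thesis using pos2 by (simp only: mult_zero_right mult_1)
    next
      case True
      then have ix: "indicator {-pi..pi} x = (1::real)" by (auto simp: indicator_def)
      have "exp (- (V * x\<^sup>2 / 2)) - e * indicator {-r..r} x - 12 / V * (1 / (x\<^sup>2 + r\<^sup>2)) - b \<le> ?R"
      proof (cases "\<bar>x\<bar> \<le> r")
        case xr: True
        let ?d = "mean - real_of_int N"
        have eq: "cf x * cis (- (real_of_int N * x)) = (cf x * cis (- (mean * x))) * cis (?d * x)"
          by (simp add: mult.assoc cis_mult algebra_simps)
        have c1: "cmod (cis (?d * x) - 1) \<le> \<bar>?d * x\<bar>"
          using iexp_approx1[of "?d * x" 0] by (simp add: cis_conv_exp mult_ac)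
        have c2: "cmod (cf x * cis (- (mean * x)) - of_real (exp (- (V * x\<^sup>2 / 2)))) \<le> mom 3 * r ^ 3 / 6 +
          mom 4 * r ^ 4 / 8"
        proof -
          have "x ^ 4 = \<bar>x\<bar> ^ 4" by simp
          also have "\<dots> \<le> r ^ 4" by (rule power_mono[OF xr]) simp
          finally have "x ^ 4 \<le> r ^ 4" .
          moreover have "\<bar>x\<bar> ^ 3 \<le> r ^ 3" by (rule power_mono[OF xr]) simp
          ultimately have "mom 3 * \<bar>x\<bar> ^ 3 / 6 + mom 4 * x ^ 4 / 8 \<le> mom 3 * r ^ 3 / 6 + mom 4 * r ^ 4 / 8"
            by (intro add_mono divide_right_mono mult_left_mono m0) auto
          then show ?thesis using cf_approx[of x] V(2) by simp
        qed
        have "cmod (cf x * cis (- (real_of_int N * x)) - of_real (exp (- (V * x\<^sup>2 / 2)))) =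
          cmod ((cf x * cis (- (mean * x)) - of_real (exp (- (V * x\<^sup>2 / 2)))) * cis (?d * x) + of_real (exp
            (- (V * x\<^sup>2 / 2))) * (cis (?d * x) - 1))"
          unfolding eq by (simp add: algebra_simps)
        also have "\<dots> \<le> cmod (cf x * cis (- (mean * x)) - of_real (exp (- (V * x\<^sup>2 / 2)))) * 1 + exp (- (V *
          x\<^sup>2 / 2)) * cmod (cis (?d * x) - 1)"
          by (rule order_trans[OF norm_triangle_ineq]) (simp add: norm_mult)
        also have "\<dots> \<le> (mom 3 * r ^ 3 / 6 + mom 4 * r ^ 4 / 8) * 1 + 1 * (\<bar>?d\<bar> * r)"
        proof (intro add_mono mult_mono c2)
          show "cmod (cis (?d * x) - 1) \<le> \<bar>?d\<bar> * r"
            by (rule order_trans[OF c1]) (simp add: abs_mult mult_left_mono xr)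
        qed (use V in auto, use order_trans[OF norm_ge_zero c2] in simp)
        also have "\<dots> \<le> e" using e by simp
        finally have "cmod (cf x * cis (- (real_of_int N * x)) - of_real (exp (- (V * x\<^sup>2 / 2)))) \<le> e" .
        then have "\<bar>Re (cf x * cis (- (real_of_int N * x)) - of_real (exp (- (V * x\<^sup>2 / 2))))\<bar> \<le> e"
          using abs_Re_le_cmod order_trans by blast
        then have "exp (- (V * x\<^sup>2 / 2)) - e \<le> ?R" by simp
        moreover have "indicator {-r..r} x = (1::real)" using xr by (auto simp: indicator_def)
        ultimately show ?thesis using pos2 b by (simp only: mult_1_right)
      next
        case xr: False
        then have r2: "r\<^sup>2 \<le> x\<^sup>2" using r by (metis abs_le_square_iff abs_of_pos linear)
        have x2: "0 < x\<^sup>2" using xr r by auto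
        have "- ?R \<le> cmod (cf x)"
          using abs_Re_le_cmod[of "cf x * cis (- (real_of_int N * x))"] by (simp add: norm_mult)
        then have "- ?R \<le> exp (- (V * x\<^sup>2 / 4)) + b" using bd[OF True] by simp
        moreover have "exp (- (V * x\<^sup>2 / 4)) + exp (- (V * x\<^sup>2 / 2)) \<le> 12 / V * (1 / (x\<^sup>2 + r\<^sup>2))"
        proof -
          have "exp (- (V * x\<^sup>2 / 4)) + exp (- (V * x\<^sup>2 / 2)) \<le> 1 / (V * x\<^sup>2 / 4) + 1 / (V * x\<^sup>2 / 2)"
            by (intro add_mono exp_neg_le_inverse) (use V x2 in auto)
          also have "\<dots> = 12 / V * (1 / (x\<^sup>2 + x\<^sup>2))" by (simp add: field_simps)
          also have "\<dots> \<le> 12 / V * (1 / (x\<^sup>2 + r\<^sup>2))" using V sq_pos x2 r2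
            by (intro mult_left_mono divide_left_mono) auto
          finally show ?thesis .
        qed
        moreover have "indicator {-r..r} x = (0::real)" using xr by (auto simp: indicator_def)
        ultimately show ?thesis by (simp only: mult_zero_right)
      qed
      then show ?thesis using pos2 by (simp only: ix mult_1 mult_1_right)
    qed
  qed
  moreover have "4 / V * (pi / pi) = 4 / V" "e * (r - (- r)) = 2 * r * e" "12 / V * (pi / r) = 12 *
    pi / (V * r)" "b * (pi - (- pi)) = 2 * pi * b"
    by simp_all
  ultimately show ?thesis by linarith
qed

end

section \<open>The Boltzmann model for a pair of distinct partitions\<close>

definition part_prob :: "real \<Rightarrow> nat \<Rightarrow> real" where
  "part_prob h k = exp (- (real k / h)) / (1 + exp (- (real k / h)))"

definition moment_sum :: "real \<Rightarrow> nat \<Rightarrow> nat \<Rightarrow> real" where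
  "moment_sum h m a = (\<Sum>k=1..<a. real k ^ m * (part_prob h k * (1 - part_prob h k)))"

lemma part_prob_bounds: "0 \<le> part_prob h k" "part_prob h k \<le> 1" "part_prob h k \<le> exp (- (real k / h))"
proof -
  have p: "0 < 1 + exp (- (real k / h))" by (simp add: add_pos_pos)
  show "0 \<le> part_prob h k" unfolding part_prob_def using p by (intro divide_nonneg_nonneg) auto
  show "part_prob h k \<le> 1" unfolding part_prob_def using p by (simp add: field_simps)
  show "part_prob h k \<le> exp (- (real k / h))"
    unfolding part_prob_def by (subst divide_le_eq) (use p in \<open>auto simp: algebra_simps intro:
      mult_nonneg_nonneg\<close>)
qed

lemma pq_bounds: "0 \<le> part_prob h k * (1 - part_prob h k)" "part_prob h k * (1 - part_prob h k) \<le>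
  exp (- (real k / h))"
  "0 < h \<Longrightarrow> exp (- (real k / h)) / 4 \<le> part_prob h k * (1 - part_prob h k)"
proof -
  let ?x = "exp (- (real k / h))"
  show "0 \<le> part_prob h k * (1 - part_prob h k)" using part_prob_bounds[of h k] by simp
  have "part_prob h k * (1 - part_prob h k) \<le> ?x * 1" by (rule mult_mono) (use part_prob_bounds[of h k] in auto)
  then show "part_prob h k * (1 - part_prob h k) \<le> ?x" by simp
  assume "0 < h"
  then have x1: "?x \<le> 1" by simp
  have p: "0 < 1 + ?x" by (simp add: add_pos_pos)
  then have "1 - part_prob h k = 1 / (1 + ?x)" unfolding part_prob_def by (simp add: field_simps)
  then have "part_prob h k * (1 - part_prob h k) = ?x / (1 + ?x)\<^sup>2" by (simp add: part_prob_def
    power2_eq_square)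
  moreover have "(1 + ?x)\<^sup>2 \<le> 2\<^sup>2" by (rule power_mono) (use x1 in auto)
  then have "?x / 4 \<le> ?x / (1 + ?x)\<^sup>2" using p by (intro divide_left_mono) auto
  ultimately show "?x / 4 \<le> part_prob h k * (1 - part_prob h k)" by simp
qed

lemma sum_gp_ivl: "(1 - x) * (\<Sum>k=a..<b. x ^ k) = x ^ a - x ^ b" if "a \<le> b" for x :: real
  using that
proof (induction b rule: dec_induct)
  case (step n)
  have "(1 - x) * (\<Sum>k=a..<Suc n. x ^ k) = (1 - x) * (\<Sum>k=a..<n. x ^ k) + (1 - x) * x ^ n"
    using step(1) by (simp add: distrib_left)
  then show ?case unfolding step.IH by (simp add: algebra_simps)
qed simp

lemma geom_exp_bound: "(\<Sum>k=a..<b. exp (- (real k / h))) \<le> exp (- (real a / h)) * (1 + h)" if "0 < h"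
proof (cases "a \<le> b")
  case False then show ?thesis using that by simp
next
  case True
  let ?q = "exp (- (1 / h))"
  have q: "?q < 1" "0 < ?q" using that by auto
  have pw: "exp (- (real k / h)) = ?q ^ k" for k
    by (simp add: exp_of_nat_mult[symmetric])
  have "1 + 1 / h \<le> exp (1 / h)" by (rule exp_ge_add_one_self)
  then have "?q \<le> 1 / (1 + 1 / h)" using that by (simp add: exp_minus field_simps)
  then have "1 / (1 + h) \<le> 1 - ?q" using that by (simp add: field_simps)
  then have i: "1 / (1 - ?q) \<le> 1 + h" using q that by (simp add: field_simps)
  have "(1 - ?q) * (\<Sum>k=a..<b. ?q ^ k) = ?q ^ a - ?q ^ b"
    by (rule sum_gp_ivl[OF True])
  then have gp: "(\<Sum>k=a..<b. ?q ^ k) = (?q ^ a - ?q ^ b) / (1 - ?q)"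
    using q by (simp add: nonzero_eq_divide_eq mult.commute)
  have "(\<Sum>k=a..<b. exp (- (real k / h))) = (\<Sum>k=a..<b. ?q ^ k)" by (simp only: pw)
  also have "\<dots> = (?q ^ a - ?q ^ b) / (1 - ?q)" by (rule gp)
  also have "\<dots> \<le> ?q ^ a / (1 - ?q)" using q by (intro divide_right_mono) auto
  also have "\<dots> = ?q ^ a * (1 / (1 - ?q))" by simp
  also have "\<dots> \<le> ?q ^ a * (1 + h)" using i q by (intro mult_left_mono) auto
  finally show ?thesis by (simp only: pw)
qed

lemma power_le_fact_exp: "x ^ m \<le> fact m * exp x" if "0 \<le> x" for x :: real
proof -
  have "x ^ m / fact m = (\<Sum>k\<in>{m}. inverse (fact k) * x ^ k)" by (simp add: field_simps)
  also have "\<dots> \<le> (\<Sum>k. inverse (fact k) * x ^ k)"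
    by (rule sum_le_suminf[OF summable_exp]) (use that in auto)
  also have "\<dots> = exp x" by (simp add: exp_def divide_inverse mult.commute)
  finally show ?thesis by (simp add: field_simps)
qed

text \<open>Half of the exponential weight absorbs the power, the other half keeps the decay.\<close>

lemma power_exp_sum_bound:
  assumes h: "0 < h"
  shows "(\<Sum>k=a..<b. real k ^ m * exp (- (real k / h))) \<le>
     fact m * (2 * h) ^ m * (exp (- (real a / (2 * h))) * (1 + 2 * h))"
proof -
  have "(\<Sum>k=a..<b. real k ^ m * exp (- (real k / h))) \<le>
      (\<Sum>k=a..<b. fact m * (2 * h) ^ m * exp (- (real k / (2 * h))))"
  proof (rule sum_mono)
    fix k
    have "real k ^ m = (2 * h) ^ m * (real k / (2 * h)) ^ m" using h by (simp add: power_divide)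
    also have "\<dots> \<le> (2 * h) ^ m * (fact m * exp (real k / (2 * h)))"
      by (intro mult_left_mono power_le_fact_exp) (use h in auto)
    finally have "real k ^ m * exp (- (real k / h)) \<le> (2 * h) ^ m * (fact m * exp (real k / (2 * h))) *
      exp (- (real k / h))"
      by (rule mult_right_mono) simp
    also have "\<dots> = fact m * (2 * h) ^ m * (exp (real k / (2 * h)) * exp (- (real k / h)))" by (simp only:
      mult_ac)
    also have "exp (real k / (2 * h)) * exp (- (real k / h)) = exp (- (real k / (2 * h)))"
      unfolding exp_add[symmetric] by (rule arg_cong[of _ _ exp]) (use h in \<open>simp add: field_simps\<close>)
    finally show "real k ^ m * exp (- (real k / h)) \<le> fact m * (2 * h) ^ m * exp (- (real k / (2 * h)))" .
  qed
  also have "\<dots> = fact m * (2 * h) ^ m * (\<Sum>k=a..<b. exp (- (real k / (2 * h))))"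
    by (simp add: sum_distrib_left)
  also have "\<dots> \<le> fact m * (2 * h) ^ m * (exp (- (real a / (2 * h))) * (1 + 2 * h))"
    by (intro mult_left_mono geom_exp_bound) (use h in auto)
  finally show ?thesis .
qed

lemma moment_sum_le:
  assumes h: "1 \<le> h"
  shows "moment_sum h m a \<le> fact m * 2 ^ (m + 2) * h ^ (m + 1)"
proof -
  have "moment_sum h m a \<le> (\<Sum>k=1..<a. real k ^ m * exp (- (real k / h)))"
    unfolding moment_sum_def by (intro sum_mono mult_left_mono pq_bounds) auto
  also have "\<dots> \<le> fact m * (2 * h) ^ m * (exp (- (real 1 / (2 * h))) * (1 + 2 * h))"
    by (rule power_exp_sum_bound) (use h in simp)
  also have "\<dots> \<le> fact m * (2 * h) ^ m * (1 * (4 * h))"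
    by (intro mult_left_mono mult_mono) (use h in auto)
  also have "\<dots> = fact m * 2 ^ (m + 2) * h ^ (m + 1)" by (simp add: power_mult_distrib)
  finally show ?thesis .
qed

lemma moment_sum_mono: "a \<le> b \<Longrightarrow> moment_sum h m a \<le> moment_sum h m b"
  unfolding moment_sum_def by (intro sum_mono2 mult_nonneg_nonneg pq_bounds) auto

lemma moment_sum_nonneg: "0 \<le> moment_sum h m a"
  unfolding moment_sum_def by (intro sum_nonneg mult_nonneg_nonneg pq_bounds) auto

lemma moment_sum_tail:
  assumes h: "1 \<le> h" and ab: "1 \<le> a"
  shows "moment_sum h m b - moment_sum h m a \<le> fact m * 2 ^ (m + 2) * h ^ (m + 1) * exp (- (real a / (2 * h)))"
proof (cases "a \<le> b")
  case False
  then have "moment_sum h m b - moment_sum h m a \<le> 0" using moment_sum_mono[of b a h m] by simp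
  also have "0 \<le> fact m * 2 ^ (m + 2) * h ^ (m + 1) * exp (- (real a / (2 * h)))" using h by simp
  finally show ?thesis .
next
  case True
  have "moment_sum h m b - moment_sum h m a = (\<Sum>k=a..<b. real k ^ m * (part_prob h k * (1 - part_prob h k)))"
    unfolding moment_sum_def using sum.atLeastLessThan_concat[OF ab True, of "\<lambda>k. real k ^ m * (part_prob h
      k * (1 - part_prob h k))"] by simp
  also have "\<dots> \<le> (\<Sum>k=a..<b. real k ^ m * exp (- (real k / h)))"
    by (intro sum_mono mult_left_mono pq_bounds) auto
  also have "\<dots> \<le> fact m * (2 * h) ^ m * (exp (- (real a / (2 * h))) * (1 + 2 * h))"
    by (rule power_exp_sum_bound) (use h in simp)
  also have "\<dots> \<le> fact m * (2 * h) ^ m * (exp (- (real a / (2 * h))) * (4 * h))"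
    by (intro mult_left_mono) (use h in auto)
  also have "\<dots> = fact m * 2 ^ (m + 2) * h ^ (m + 1) * exp (- (real a / (2 * h)))" by (simp add:
    power_mult_distrib)
  finally show ?thesis .
qed

lemma pq_lower_h: "1 / 12 \<le> part_prob h k * (1 - part_prob h k)" if "0 < h" "real k \<le> h"
proof -
  have "exp (- 1) \<le> exp (- (real k / h))" using that by simp
  moreover have "1 / 3 \<le> exp (- (1::real))" using exp_le by (simp add: exp_minus field_simps)
  ultimately show ?thesis using pq_bounds(3)[OF that(1), of k] by linarith
qed

lemma sum_squares_lower: "real K ^ 3 / 3 \<le> (\<Sum>k=1..K. real k ^ 2)"
proof (induction K)
  case (Suc K)
  have "real (Suc K) ^ 3 / 3 = real K ^ 3 / 3 + real K ^ 2 + real K + 1 / 3"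
    by (simp add: power3_eq_cube power2_eq_square field_simps)
  also have "\<dots> \<le> real K ^ 3 / 3 + real (Suc K) ^ 2" by (simp add: power2_eq_square field_simps)
  finally show ?case using Suc by simp
qed simp

text \<open>The parts up to \<open>h\<close> alone give the order h^3, as each has variance factor
  at least 1/12. Rounding \<open>h\<close> down loses at most a factor 2, whence 288 = 8 *
  36.\<close>

lemma moment_sum_2_lower:
  assumes h: "1 \<le> h" and a: "h + 1 \<le> real a"
  shows "h ^ 3 / 288 \<le> moment_sum h 2 a"
proof -
  define K where "K = nat \<lfloor>h\<rfloor>"
  have K: "real K \<le> h" "h < real K + 1" using h unfolding K_def by linarith+
  have K2: "h / 2 \<le> real K"
  proof -
    have "1 \<le> K" using h unfolding K_def by (simp add: le_nat_floor)
    then show ?thesis using K by linarith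
  qed
  have sub: "{1..K} \<subseteq> {1..<a}" using K a by auto
  have "(h / 2) ^ 3 / 36 \<le> real K ^ 3 / 36" by (intro divide_right_mono power_mono K2) (use h in auto)
  also have "\<dots> \<le> (\<Sum>k=1..K. real k ^ 2 * (1 / 12))" using sum_squares_lower[of K] by (simp add:
    sum_divide_distrib[symmetric])
  also have "\<dots> \<le> (\<Sum>k=1..K. real k ^ 2 * (part_prob h k * (1 - part_prob h k)))"
    by (intro sum_mono mult_left_mono pq_lower_h) (use K h in auto)
  also have "\<dots> \<le> moment_sum h 2 a"
    unfolding moment_sum_def by (intro sum_mono2 sub mult_nonneg_nonneg pq_bounds) auto
  finally show ?thesis by (simp add: power_divide)
qed

section \<open>Decay of the characteristic function away from zero\<close>

lemma cos_bound4: "\<bar>1 - cos x - (x::real)\<^sup>2 / 2\<bar> \<le> x ^ 4 / 24"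
proof -
  have "cmod (iexp x - (\<Sum>k \<le> 3. (\<i> * x)^k / fact k)) \<le> \<bar>x\<bar>^(Suc 3) / fact (Suc 3)" by (rule iexp_approx1)
  then have "\<bar>Re (iexp x - (\<Sum>k \<le> 3. (\<i> * x)^k / fact k))\<bar> \<le> \<bar>x\<bar>^(Suc 3) / fact (Suc 3)"
    using abs_Re_le_cmod order_trans by blast
  moreover have "Re (iexp x - (\<Sum>k \<le> 3. (\<i> * x)^k / fact k)) = cos x - (1 - x\<^sup>2 / 2)"
    by (simp add: numeral_3_eq_3 atMost_Suc cis_conv_exp[symmetric] power2_eq_square)
  moreover have "\<bar>x\<bar>^(Suc 3) / fact (Suc 3) = x ^ 4 / 24" by (simp add: fact_numeral eval_nat_numeral)
  ultimately show ?thesis by linarith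
qed

lemma sin_bound3: "\<bar>sin x - (x::real)\<bar> \<le> \<bar>x\<bar> ^ 3 / 6"
proof -
  have "cmod (iexp x - (\<Sum>k \<le> 2. (\<i> * x)^k / fact k)) \<le> \<bar>x\<bar>^(Suc 2) / fact (Suc 2)" by (rule iexp_approx1)
  then have "\<bar>Im (iexp x - (\<Sum>k \<le> 2. (\<i> * x)^k / fact k))\<bar> \<le> \<bar>x\<bar>^(Suc 2) / fact (Suc 2)"
    using abs_Im_le_cmod order_trans by blast
  moreover have "Im (iexp x - (\<Sum>k \<le> 2. (\<i> * x)^k / fact k)) = sin x - x"
    by (simp add: numeral_2_eq_2 atMost_Suc cis_conv_exp[symmetric] power2_eq_square)
  moreover have "\<bar>x\<bar>^(Suc 2) / fact (Suc 2) = \<bar>x\<bar> ^ 3 / 6" by (simp add: fact_numeral eval_nat_numeral)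
  ultimately show ?thesis by linarith
qed

text \<open>Since pi^2 is at most 10, x^2 / 2 - x^4 / 24 is at least (1/2 - 10/24) x^2.\<close>

lemma one_minus_cos_lower: "(x::real)\<^sup>2 / 12 \<le> 1 - cos x" if "\<bar>x\<bar> \<le> pi"
proof -
  have "pi\<^sup>2 \<le> (3.16)\<^sup>2" by (rule power_mono) (use pi_less_4 pi_approx in \<open>auto\<close>)
  moreover have "x\<^sup>2 \<le> pi\<^sup>2" using that by (simp add: abs_le_square_iff[symmetric])
  ultimately have x: "x\<^sup>2 \<le> 10" by (simp add: power2_eq_square)
  have "x ^ 4 = x\<^sup>2 * x\<^sup>2" by (simp add: power2_eq_square power4_eq_xxxx)
  also have "\<dots> \<le> x\<^sup>2 * 10" by (rule mult_left_mono[OF x]) simp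
  finally have "x ^ 4 \<le> x\<^sup>2 * 10" .
  then show ?thesis using cos_bound4[of x] by linarith
qed

lemma dirichlet: "2 * sin (x / 2) * (\<Sum>k=1..n. cos (real k * x)) = sin ((real n + 1 / 2) * x) - sin (x / 2)"
proof (induction n)
  case (Suc n)
  have "2 * sin (x / 2) * cos (real (Suc n) * x) = sin ((real (Suc n) + 1 / 2) * x) - sin ((real n +
    1 / 2) * x)"
  proof -
    have "(real (Suc n) + 1 / 2) * x = real (Suc n) * x + x / 2" "(real n + 1 / 2) * x = real (Suc n) *
      x - x / 2"
      by (simp_all add: field_simps)
    then show ?thesis by (simp only: sin_add sin_diff) simp
  qed
  then show ?case using Suc by (simp add: distrib_left)
qed simp

text \<open>The Dirichlet kernel bounds the cosine sum by 1 / |sin (x / 2)|, at most 4 / |x|, so at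
  least half of the K ones survive.\<close>

lemma cos_sum_lower_big:
  assumes x: "8 / real K \<le> \<bar>x\<bar>" "\<bar>x\<bar> \<le> pi" and K: "0 < K"
  shows "real K / 2 \<le> (\<Sum>k=1..K. 1 - cos (real k * x))"
proof -
  have x0: "0 < \<bar>x\<bar>" using x K by (smt (verit) divide_pos_pos of_nat_0_less_iff)
  define y where "y = \<bar>x\<bar> / 2"
  have y: "0 < y" "y \<le> 1.6" using x0 x pi_approx unfolding y_def by auto
  have "y\<^sup>2 \<le> 1.6\<^sup>2" by (rule power_mono) (use y in auto)
  then have y2: "y\<^sup>2 \<le> 2.56" by (simp add: power2_eq_square)
  have "y ^ 3 = y * y\<^sup>2" by (simp add: power2_eq_square power3_eq_cube)
  also have "\<dots> \<le> y * 2.56" by (rule mult_left_mono[OF y2]) (use y in simp)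
  finally have "\<bar>y\<bar> ^ 3 / 6 \<le> y / 2" using y by simp
  then have "y / 2 \<le> sin y" using sin_bound3[of y] y by linarith
  then have s: "\<bar>x\<bar> / 4 \<le> \<bar>sin (x / 2)\<bar>"
    unfolding y_def by (cases "0 \<le> x") auto
  have "\<bar>2 * sin (x / 2) * (\<Sum>k=1..K. cos (real k * x))\<bar> \<le> 2"
    unfolding dirichlet using abs_sin_le_one[of "(real K + 1 / 2) * x"] abs_sin_le_one[of "x / 2"] by linarith
  then have "\<bar>sin (x / 2)\<bar> * \<bar>\<Sum>k=1..K. cos (real k * x)\<bar> \<le> 1" by (simp add: abs_mult)
  moreover have "\<bar>x\<bar> / 4 * \<bar>\<Sum>k=1..K. cos (real k * x)\<bar> \<le> \<bar>sin (x / 2)\<bar> * \<bar>\<Sum>k=1..K. cos (real k * x)\<bar>"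
    by (rule mult_right_mono[OF s]) simp
  moreover have "(8 / real K) / 4 * \<bar>\<Sum>k=1..K. cos (real k * x)\<bar> \<le> \<bar>x\<bar> / 4 * \<bar>\<Sum>k=1..K. cos (real k * x)\<bar>"
    by (intro mult_right_mono divide_right_mono x) auto
  ultimately have "(8 / real K) / 4 * \<bar>\<Sum>k=1..K. cos (real k * x)\<bar> \<le> 1" by linarith
  then have "\<bar>\<Sum>k=1..K. cos (real k * x)\<bar> \<le> real K / 2" using K by (simp add: field_simps)
  then show ?thesis by (simp add: sum_subtractf)
qed

text \<open>A bound of order \<open>h\<close> is needed for all |x| from \<open>\<eta> / h\<close>
  up to pi. Large x are handled by cancellation of the cosines. Small x are handled termwise by the
  quadratic bound, and the constant is 2304 = 36 * 64.\<close>

lemma cos_sum_lower: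
  assumes h: "12 \<le> h" and eta: "0 < \<eta>" "\<eta> \<le> 1" and x: "\<eta> / h \<le> \<bar>x\<bar>" "\<bar>x\<bar> \<le> pi"
  shows "\<eta>\<^sup>2 * h / 2304 \<le> (\<Sum>k=1..nat \<lfloor>h\<rfloor>. 1 - cos (real k * x))"
proof -
  define K where "K = nat \<lfloor>h\<rfloor>"
  have K: "real K \<le> h" "h < real K + 1" "0 < K" using h unfolding K_def by linarith+
  have e2: "\<eta>\<^sup>2 \<le> 1" using eta by (simp add: power_le_one)
  show ?thesis
  proof (cases "8 / real K \<le> \<bar>x\<bar>")
    case True
    have "\<eta>\<^sup>2 * h / 2304 \<le> 1 * h / 2304" by (intro divide_right_mono mult_right_mono e2) (use h in auto)
    also have "\<dots> \<le> real K / 2" using K h by simp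
    also have "\<dots> \<le> (\<Sum>k=1..K. 1 - cos (real k * x))" by (rule cos_sum_lower_big[OF True x(2) K(3)])
    finally show ?thesis by (simp add: K_def)
  next
    case False
    \<comment> \<open>Here |x| is below 8 / K, so for k up to K / 3 the argument k x stays below
      8/3, hence within the range of the quadratic bound.\<close>
    define J where "J = K div 3"
    have J: "real J \<le> real K / 3" "h / 4 \<le> real J" "J \<le> K" using K h unfolding J_def by linarith+
    have "\<eta>\<^sup>2 * h / 2304 = (\<eta> / h)\<^sup>2 * ((h / 4) ^ 3 / 36)" using h by (simp add: power2_eq_square
      power3_eq_cube field_simps)
    also have "\<dots> \<le> \<bar>x\<bar>\<^sup>2 * (real J ^ 3 / 36)"
      by (intro mult_mono power_mono divide_right_mono x J) (use eta h in auto)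
    also have "\<dots> \<le> \<bar>x\<bar>\<^sup>2 * ((\<Sum>k=1..J. real k ^ 2) / 12)"
      using sum_squares_lower[of J] by (intro mult_left_mono) auto
    also have "\<dots> = (\<Sum>k=1..J. (real k * x)\<^sup>2 / 12)"
      by (simp add: sum_divide_distrib sum_distrib_left power_mult_distrib mult_ac)
    also have "\<dots> \<le> (\<Sum>k=1..J. 1 - cos (real k * x))"
    proof (intro sum_mono one_minus_cos_lower)
      fix k assume "k \<in> {1..J}"
      then have "\<bar>real k * x\<bar> \<le> real K / 3 * (8 / real K)"
        unfolding abs_mult using False J by (intro mult_mono) auto
      also have "\<dots> \<le> pi" using pi_gt3 K by simp
      finally show "\<bar>real k * x\<bar> \<le> pi" .
    qed
    also have "\<dots> \<le> (\<Sum>k=1..K. 1 - cos (real k * x))" by (intro sum_mono2) (use J in auto)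
    finally show ?thesis by (simp add: K_def)
  qed
qed

text \<open>One copy of the part sizes for each side; the cuts \<open>a\<close> and \<open>b\<close>
  may differ because the last prescribed parts of the two sides do.\<close>

definition part_idx :: "nat \<Rightarrow> nat \<Rightarrow> (nat + nat) set" where
  "part_idx a b = {1..<a} <+> {1..<b}"

definition mean_sum :: "real \<Rightarrow> nat \<Rightarrow> real" where
  "mean_sum h a = (\<Sum>k=1..<a. real k * part_prob h k)"

interpretation bs: bernoulli_sum "part_idx a b" "case_sum (\<lambda>k. k) (\<lambda>k. k)" "case_sum (part_prob h)
  (part_prob h)" for a b h
  by unfold_locales (auto simp: part_idx_def part_prob_bounds)

lemma bs_mom: "bs.mom a b h m = moment_sum h m a + moment_sum h m b"
  unfolding bs.mom_def moment_sum_def by (simp add: part_idx_def sum.Plus)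

lemma bs_mean: "bs.mean a b h = mean_sum h a + mean_sum h b"
  unfolding bs.mean_def mean_sum_def by (simp add: part_idx_def sum.Plus)

text \<open>Above \<open>\<eta> / h\<close> the cosine sum makes everything exponentially small.
  Below it the quartic term is at most a fraction of order \<open>\<eta>\<^sup>2\<close> of the
  quadratic one, so the Gaussian keeps nearly the full variance; this is what yields a sharp upper
  bound later. The constants are 27648 = 12 * 2304 and 36864 = 2 * 128 * 144, the latter from
  comparing h^3 with the variance.\<close>

lemma cf_bound:
  assumes h: "12 \<le> h" and a: "h + 1 \<le> real a" and b: "h + 1 \<le> real b"
    and eta: "0 < \<eta>" "\<eta> \<le> 1" and x: "\<bar>x\<bar> \<le> pi"
  shows "cmod (bs.cf a b h x) \<le> exp (- ((1 - 36864 * \<eta>\<^sup>2) * bs.mom a b h 2 * x\<^sup>2 / 2)) + exp (- (\<eta>\<^sup>2 *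
    h / 27648))"
proof -
  define Q where "Q c = (\<Sum>k=1..<c. part_prob h k * (1 - part_prob h k) * (1 - cos (real k * x)))" for c
  have Q0: "0 \<le> Q c" for c unfolding Q_def by (intro sum_nonneg mult_nonneg_nonneg pq_bounds) auto
  have cf: "cmod (bs.cf a b h x) \<le> exp (- (Q a + Q b))"
    using bs.norm_cf_le[of a b h x] unfolding Q_def part_idx_def by (subst (asm) sum.Plus) auto
  show ?thesis
  proof (cases "\<eta> / h \<le> \<bar>x\<bar>")
    case True
    let ?K = "nat \<lfloor>h\<rfloor>"
    have "\<eta>\<^sup>2 * h / 27648 = \<eta>\<^sup>2 * h / 2304 / 12" by simp
    also have "\<dots> \<le> (\<Sum>k=1..?K. 1 - cos (real k * x)) / 12"
      by (intro divide_right_mono cos_sum_lower h eta True x) auto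
    also have "\<dots> = (\<Sum>k=1..?K. 1 / 12 * (1 - cos (real k * x)))" by (simp add: sum_divide_distrib)
    also have "\<dots> \<le> (\<Sum>k=1..?K. part_prob h k * (1 - part_prob h k) * (1 - cos (real k * x)))"
    proof (intro sum_mono mult_right_mono pq_lower_h)
      fix k assume "k \<in> {1..?K}"
      then show "real k \<le> h" using h by (simp add: le_nat_iff le_floor_iff)
    qed (use h in auto)
    also have "\<dots> \<le> Q a"
      unfolding Q_def
    proof (rule sum_mono2)
      show "{1..?K} \<subseteq> {1..<a}" using a h by auto linarith
    qed (auto intro!: mult_nonneg_nonneg pq_bounds)
    finally have "\<eta>\<^sup>2 * h / 27648 \<le> Q a + Q b" using Q0[of b] by simp
    then have "exp (- (Q a + Q b)) \<le> exp (- (\<eta>\<^sup>2 * h / 27648))" by simp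
    then show ?thesis using cf by (smt (verit) exp_gt_zero)
  next
    case False
    have low: "moment_sum h 2 c * x\<^sup>2 / 2 - 64 * h ^ 3 * \<eta>\<^sup>2 * x\<^sup>2 \<le> Q c" for c
    proof -
      have xh: "x\<^sup>2 \<le> (\<eta> / h)\<^sup>2" using False eta h by (simp add: abs_le_square_iff[symmetric])
      have "moment_sum h 4 c * x ^ 4 / 24 \<le> (fact 4 * 2 ^ (4 + 2) * h ^ (4 + 1)) * (x\<^sup>2 * (\<eta> / h)\<^sup>2) / 24"
      proof (intro divide_right_mono mult_mono moment_sum_le)
        show "x ^ 4 \<le> x\<^sup>2 * (\<eta> / h)\<^sup>2" using mult_left_mono[OF xh, of "x\<^sup>2"] by (simp add: power2_eq_square
          power4_eq_xxxx)
      qed (use h in auto)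
      also have "\<dots> = 64 * h ^ 3 * \<eta>\<^sup>2 * x\<^sup>2" using h
        by (simp add: fact_numeral power_divide field_simps eval_nat_numeral)
      finally have 1: "moment_sum h 4 c * x ^ 4 / 24 \<le> 64 * h ^ 3 * \<eta>\<^sup>2 * x\<^sup>2" .
      have "moment_sum h 2 c * x\<^sup>2 / 2 - moment_sum h 4 c * x ^ 4 / 24 =
         (\<Sum>k=1..<c. part_prob h k * (1 - part_prob h k) * ((real k * x)\<^sup>2 / 2 - (real k * x) ^ 4 / 24))"
        unfolding moment_sum_def sum_distrib_right sum_divide_distrib sum_subtractf[symmetric]
        by (intro sum.cong refl) (simp add: power_mult_distrib algebra_simps)
      also have "\<dots> \<le> Q c"
        unfolding Q_def
      proof (intro sum_mono mult_left_mono pq_bounds)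
        fix k show "(real k * x)\<^sup>2 / 2 - (real k * x) ^ 4 / 24 \<le> 1 - cos (real k * x)"
          using cos_bound4[of "real k * x"] by linarith
      qed
      finally show ?thesis using 1 by linarith
    qed
    let ?V = "bs.mom a b h 2"
    have "h ^ 3 / 144 \<le> ?V" unfolding bs_mom using moment_sum_2_lower[OF _ a] moment_sum_2_lower[OF _ b] h
      by simp
    then have "128 * h ^ 3 \<le> 18432 * ?V" by simp
    then have "128 * h ^ 3 * (\<eta>\<^sup>2 * x\<^sup>2) \<le> 18432 * ?V * (\<eta>\<^sup>2 * x\<^sup>2)" by (rule mult_right_mono) simp
    then have "(1 - 36864 * \<eta>\<^sup>2) * ?V * x\<^sup>2 / 2 \<le> ?V * x\<^sup>2 / 2 - 128 * h ^ 3 * (\<eta>\<^sup>2 * x\<^sup>2)"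
    proof -
      have "(1 - 36864 * \<eta>\<^sup>2) * ?V * x\<^sup>2 / 2 = ?V * x\<^sup>2 / 2 - 18432 * ?V * (\<eta>\<^sup>2 * x\<^sup>2)"
        by (simp add: algebra_simps diff_divide_distrib)
      then show ?thesis using \<open>128 * h ^ 3 * (\<eta>\<^sup>2 * x\<^sup>2) \<le> _\<close> by linarith
    qed
    also have "\<dots> \<le> Q a + Q b" using low[of a] low[of b] unfolding bs_mom by (simp add: algebra_simps)
    finally have "exp (- (Q a + Q b)) \<le> exp (- ((1 - 36864 * \<eta>\<^sup>2) * ?V * x\<^sup>2 / 2))" by simp
    then show ?thesis using cf by (smt (verit) exp_gt_zero)
  qed
qed

section \<open>Local limit theorem for the pair model\<close>

lemma mom_le: "1 \<le> h \<Longrightarrow> bs.mom a b h m \<le> fact m * 2 ^ (m + 3) * h ^ (m + 1)"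
proof -
  assume "1 \<le> h"
  moreover have "fact m * 2 ^ (m + 3) * h ^ (m + 1) = 2 * (fact m * 2 ^ (m + 2) * h ^ (m + 1))"
    by (simp add: power_add)
  ultimately show ?thesis unfolding bs_mom using moment_sum_le[of h m a] moment_sum_le[of h m b] by linarith
qed

lemma mom_2_lower: "h ^ 3 / 144 \<le> bs.mom a b h 2" if "1 \<le> h" "h + 1 \<le> real a" "h + 1 \<le> real b"
  unfolding bs_mom using moment_sum_2_lower[of h a] moment_sum_2_lower[of h b] that by simp

text \<open>Uniform in N: the modulus of the characteristic function does not see the point N, so
  the bound by the central value of the Gaussian density holds everywhere. \<open>\<delta>\<close>
  is the tolerated loss of variance, chosen so that 1 / sqrt (1 - \<open>\<delta>\<close>) is 1 +
  \<open>\<epsilon> / 2\<close>.\<close>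

lemma LLT_upper:
  assumes e: "0 < (\<epsilon>::real)"
  shows "\<forall>\<^sub>F h in at_top. \<forall>a b N. h + 1 \<le> real a \<longrightarrow> h + 1 \<le> real b \<longrightarrow>
     bs.pr a b h N * sqrt (2 * pi * bs.mom a b h 2) \<le> 1 + \<epsilon>"
proof -
  define \<delta> where "\<delta> = 1 - 1 / (1 + \<epsilon> / 2)\<^sup>2"
  have "1 < (1 + \<epsilon> / 2)\<^sup>2" using e by (intro one_less_power) auto
  then have d: "0 < \<delta>" "\<delta> < 1" by (auto simp: \<delta>_def divide_less_eq)
  define \<eta> where "\<eta> = sqrt (\<delta> / 36864)"
  have eta: "0 < \<eta>" "\<eta> \<le> 1" "36864 * \<eta>\<^sup>2 = \<delta>" using d by (auto simp: \<eta>_def)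
  have "((\<lambda>h. sqrt (2 * pi * (64 * h ^ 3)) * exp (- (\<eta>\<^sup>2 * h / 27648))) \<longlongrightarrow> 0) at_top"
    using eta(1) by real_asymp
  then have ev: "\<forall>\<^sub>F h in at_top. sqrt (2 * pi * (64 * h ^ 3)) * exp (- (\<eta>\<^sup>2 * h / 27648)) < \<epsilon> / 2"
    by (rule order_tendstoD) (use e in simp)
  show ?thesis
    using ev eventually_ge_at_top[of 12]
  proof eventually_elim
    case (elim h)
    show ?case
    proof (intro allI impI)
      fix a b :: nat and N :: int assume ab: "h + 1 \<le> real a" "h + 1 \<le> real b"
      let ?V = "bs.mom a b h 2" and ?b = "exp (- (\<eta>\<^sup>2 * h / 27648))"
      have V: "h ^ 3 / 144 \<le> ?V" by (rule mom_2_lower) (use ab elim in auto)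
      have "0 < h ^ 3 / 144" using elim by simp
      then have V0: "0 < ?V" using V by linarith
      have V1: "?V \<le> 64 * h ^ 3" using mom_le[of h a b 2] elim by (simp add: eval_nat_numeral)
      let ?c = "1 - \<delta>"
      have c0: "0 < ?c * ?V" using d V0 by simp
      have "2 * pi * bs.pr a b h N \<le> sqrt (2 * pi / (?c * ?V)) + 2 * pi * ?b"
      proof (rule bs.pr_upper)
        fix x :: real assume "\<bar>x\<bar> \<le> pi"
        from cf_bound[OF elim(2) ab eta(1,2) this]
        show "cmod (bs.cf a b h x) \<le> exp (- (?c * ?V * x\<^sup>2 / 2)) + ?b" by (simp add: eta(3))
      qed (use c0 in auto)
      then have "bs.pr a b h N * (2 * pi) * sqrt (2 * pi * ?V) \<le> (sqrt (2 * pi / (?c * ?V)) + 2 * pi * ?b) *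
        sqrt (2 * pi * ?V)"
        by (intro mult_right_mono) (use V0 in \<open>auto simp: mult_ac\<close>)
      also have "\<dots> = 2 * pi * (1 / sqrt ?c + ?b * sqrt (2 * pi * ?V))"
      proof -
        have "sqrt (2 * pi / (?c * ?V)) * sqrt (2 * pi * ?V) = sqrt ((2 * pi)\<^sup>2 / ?c)"
          unfolding real_sqrt_mult[symmetric] using V0 d by (simp add: power2_eq_square)
        also have "\<dots> = 2 * pi / sqrt ?c" unfolding real_sqrt_divide by (subst real_sqrt_abs) simp
        finally show ?thesis by (simp add: algebra_simps)
      qed
      finally have "bs.pr a b h N * sqrt (2 * pi * ?V) \<le> 1 / sqrt ?c + ?b * sqrt (2 * pi * ?V)"
        using pi_gt_zero by (simp add: mult_ac)
      moreover have "?b * sqrt (2 * pi * ?V) \<le> ?b * sqrt (2 * pi * (64 * h ^ 3))" using V1 by simp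
      moreover have "1 / sqrt ?c = 1 + \<epsilon> / 2" using e by (simp add: \<delta>_def real_sqrt_divide)
      moreover have "?b * sqrt (2 * pi * (64 * h ^ 3)) < \<epsilon> / 2" using elim(1) by (subst mult.commute)
      ultimately show "bs.pr a b h N * sqrt (2 * pi * ?V) \<le> 1 + \<epsilon>" by linarith
    qed
  qed
qed

text \<open>The standard deviation has order \<open>h * sqrt h\<close>, so N within a small multiple
  of that from the mean sees almost the central density.\<close>

lemma LLT_lower:
  assumes e: "0 < (\<epsilon>::real)"
  shows "\<exists>\<delta>>0. \<forall>\<^sub>F h in at_top. \<forall>a b N. h + 1 \<le> real a \<longrightarrow> h + 1 \<le> real b \<longrightarrow>
     \<bar>bs.mean a b h - real_of_int N\<bar> \<le> \<delta> * (h * sqrt h) \<longrightarrow>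
     1 - \<epsilon> \<le> bs.pr a b h N * sqrt (2 * pi * bs.mom a b h 2)"
proof -
  \<comment> \<open>The inner zone is |x| at most \<open>\<rho> / s\<close>, with \<open>s\<close>
    the standard deviation. A large \<open>\<rho>\<close> makes the outer zones cost
    \<open>\<epsilon> / 8\<close>; \<open>\<delta>\<close> then makes the error from the off-centre
    N, 24 times \<open>\<delta>\<close> times the square of \<open>\<rho>\<close>, equal to
    \<open>\<epsilon> / 4\<close>. The value of \<open>\<eta>\<close> gives up half the variance,
    which is enough outside the inner zone.\<close>
  define \<rho> where "\<rho> = 96 * pi / \<epsilon>"
  have r: "0 < \<rho>" using e by (simp add: \<rho>_def)
  define \<delta> where "\<delta> = \<epsilon> / (96 * \<rho>\<^sup>2)"
  have d: "0 < \<delta>" using e r by (simp add: \<delta>_def)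
  define \<eta> where "\<eta> = sqrt (1 / 73728)"
  have eta: "0 < \<eta>" "\<eta> \<le> 1" "36864 * \<eta>\<^sup>2 = 1 / 2" by (auto simp: \<eta>_def)
  let ?b = "\<lambda>h. exp (- (\<eta>\<^sup>2 * h / 27648))"
  define C3 where "C3 = (fact 3 * 2 ^ 6 * 12 ^ 3 / 6 :: real)"
  define C4 where "C4 = (fact 4 * 2 ^ 7 * 12 ^ 4 / 8 :: real)"
  let ?err = "\<lambda>h. 48 / (h * sqrt h) + 2 * \<rho> * (C3 * \<rho> ^ 3 * (h ^ 4 / (h * sqrt h) ^ 3) + C4 * \<rho> ^ 4 *
    (h ^ 5 / (h * sqrt h) ^ 4)) + 2 * pi * ?b h * sqrt (64 * h ^ 3)"
  have C: "0 < C3" "0 < C4" by (auto simp: C3_def C4_def)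
  have "(?err \<longlongrightarrow> 0) at_top"
    using eta(1) by real_asymp
  then have ev: "\<forall>\<^sub>F h in at_top. ?err h < \<epsilon> / 4"
    by (rule order_tendstoD) (use e in simp)
  show ?thesis
  proof (intro exI[of _ \<delta>] conjI d)
    show "\<forall>\<^sub>F h in at_top. \<forall>a b N. h + 1 \<le> real a \<longrightarrow> h + 1 \<le> real b \<longrightarrow>
     \<bar>bs.mean a b h - real_of_int N\<bar> \<le> \<delta> * (h * sqrt h) \<longrightarrow>
     1 - \<epsilon> \<le> bs.pr a b h N * sqrt (2 * pi * bs.mom a b h 2)"
      using ev eventually_ge_at_top[of 12]
    proof eventually_elim
      case (elim h)
      show ?case
      proof (intro allI impI)
        fix a b :: nat and N :: int assume ab: "h + 1 \<le> real a" "h + 1 \<le> real b"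
          and N: "\<bar>bs.mean a b h - real_of_int N\<bar> \<le> \<delta> * (h * sqrt h)"
        define V where "V = bs.mom a b h 2"
        define s where "s = sqrt V"
        define g where "g = h * sqrt h"
        have g0: "0 < g" using elim by (simp add: g_def)
        have V: "h ^ 3 / 144 \<le> V" unfolding V_def by (rule mom_2_lower) (use ab elim in auto)
        have "0 < h ^ 3 / 144" using elim by simp
        then have V0: "0 < V" using V by linarith
        have V1: "V \<le> 64 * h ^ 3" using mom_le[of h a b 2] elim by (simp add: V_def eval_nat_numeral)
        have g2: "g\<^sup>2 = h ^ 3" using elim by (simp add: g_def power_mult_distrib power2_eq_square
          power3_eq_cube)
        have s0: "0 < s" and ss: "s\<^sup>2 = V" using V0 by (auto simp: s_def)
        have sg: "g / 12 \<le> s"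
        proof (rule power2_le_imp_le)
          show "(g / 12)\<^sup>2 \<le> s\<^sup>2" using V by (simp add: power_divide g2 ss)
        qed (use s0 in simp)
        have s1: "s \<le> sqrt (64 * h ^ 3)" using V1 by (simp add: s_def)
        let ?r = "\<rho> / s"
        let ?e = "bs.mom a b h 3 * ?r ^ 3 / 6 + bs.mom a b h 4 * ?r ^ 4 / 8 + \<bar>bs.mean a b h - real_of_int
          N\<bar> * ?r"
        have low: "2 * pi * bs.pr a b h N \<ge> sqrt (2 * pi / V) - 4 / V - 2 * ?r * ?e - 12 * pi / (V *
          ?r) - 2 * pi * ?b h"
        proof (rule bs.pr_lower[OF V0 _ _ _ _ order_refl])
          fix x :: real assume "\<bar>x\<bar> \<le> pi"
          from cf_bound[OF elim(2) ab eta(1,2) this]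
          show "cmod (bs.cf a b h x) \<le> exp (- (V * x\<^sup>2 / 4)) + ?b h"
            unfolding eta(3) by (simp add: V_def)
        qed (use r s0 in \<open>auto simp: V_def\<close>)
        have rg: "?r \<le> 12 * \<rho> / g" using sg g0 s0 r by (simp add: field_simps)
        have e3: "bs.mom a b h 3 * ?r ^ 3 / 6 \<le> C3 * \<rho> ^ 3 * (h ^ 4 / g ^ 3)"
        proof -
          have "bs.mom a b h 3 * ?r ^ 3 / 6 \<le> (fact 3 * 2 ^ (3 + 3) * h ^ (3 + 1)) * (12 * \<rho> / g) ^ 3 / 6"
            by (intro divide_right_mono mult_mono mom_le power_mono rg) (use elim r s0 g0 in auto)
          also have "\<dots> = C3 * \<rho> ^ 3 * (h ^ 4 / g ^ 3)" by (simp add: C3_def power_mult_distrib power_divide)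
          finally show ?thesis .
        qed
        have e4: "bs.mom a b h 4 * ?r ^ 4 / 8 \<le> C4 * \<rho> ^ 4 * (h ^ 5 / g ^ 4)"
        proof -
          have "bs.mom a b h 4 * ?r ^ 4 / 8 \<le> (fact 4 * 2 ^ (4 + 3) * h ^ (4 + 1)) * (12 * \<rho> / g) ^ 4 / 8"
            by (intro divide_right_mono mult_mono mom_le power_mono rg) (use elim r s0 g0 in auto)
          also have "\<dots> = C4 * \<rho> ^ 4 * (h ^ 5 / g ^ 4)" by (simp add: C4_def power_mult_distrib power_divide)
          finally show ?thesis .
        qed
        have e1: "\<bar>bs.mean a b h - real_of_int N\<bar> * ?r \<le> 12 * \<delta> * \<rho>"
        proof -
          have "\<bar>bs.mean a b h - real_of_int N\<bar> * ?r \<le> (\<delta> * g) * (12 * \<rho> / g)"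
            by (intro mult_mono rg) (use N g0 d r s0 in \<open>auto simp: g_def\<close>)
          then show ?thesis using g0 by simp
        qed
        have "2 * \<rho> * ?e \<le> 2 * \<rho> * (C3 * \<rho> ^ 3 * (h ^ 4 / g ^ 3) + C4 * \<rho> ^ 4 * (h ^ 5 / g ^ 4) + 12 * \<delta> * \<rho>)"
          by (intro mult_left_mono add_mono e3 e4 e1) (use r in auto)
        also have "\<dots> = 2 * \<rho> * (C3 * \<rho> ^ 3 * (h ^ 4 / g ^ 3) + C4 * \<rho> ^ 4 * (h ^ 5 / g ^ 4)) + \<epsilon> / 4"
          using r by (simp add: \<delta>_def power2_eq_square field_simps)
        finally have T1: "2 * \<rho> * ?e \<le> 2 * \<rho> * (C3 * \<rho> ^ 3 * (h ^ 4 / g ^ 3) + C4 * \<rho> ^ 4 * (h ^ 5 / g ^ 4))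
          + \<epsilon> / 4" .
        have T2: "4 / s \<le> 48 / g" using sg g0 s0 by (simp add: field_simps)
        have T3: "12 * pi / \<rho> \<le> \<epsilon> / 4" using e by (simp add: \<rho>_def)
        have T4: "2 * pi * ?b h * s \<le> 2 * pi * ?b h * sqrt (64 * h ^ 3)" by (intro mult_left_mono s1) auto
        have "4 / s + 2 * \<rho> * ?e + 12 * pi / \<rho> + 2 * pi * ?b h * s \<le> ?err h + \<epsilon> / 4 + \<epsilon> / 4"
          using T1 T2 T3 T4 unfolding g_def by linarith
        then have bd: "4 / s + 2 * \<rho> * ?e + 12 * pi / \<rho> + 2 * pi * ?b h * s \<le> \<epsilon>" using elim(1) e by linarith
        have "s * (sqrt (2 * pi / V) - 4 / V - 2 * ?r * ?e - 12 * pi / (V * ?r) - 2 * pi * ?b h) \<le> s * (2 *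
          pi * bs.pr a b h N)"
          by (intro mult_left_mono low) (use s0 in simp)
        moreover have "s * (sqrt (2 * pi / V) - 4 / V - 2 * ?r * ?e - 12 * pi / (V * ?r) - 2 * pi * ?b h) =
           sqrt (2 * pi) - (4 / s + 2 * \<rho> * ?e + 12 * pi / \<rho> + 2 * pi * ?b h * s)"
        proof -
          have "s * sqrt (2 * pi / V) = sqrt (2 * pi)" using s0 by (simp add: real_sqrt_divide s_def[symmetric])
          moreover have "s * (4 / V) = 4 / s" using s0 by (simp add: ss[symmetric] power2_eq_square)
          moreover have "s * (2 * ?r * ?e) = 2 * \<rho> * ?e" using s0 by simp
          moreover have "s * (12 * pi / (V * ?r)) = 12 * pi / \<rho>" using s0 r by (simp add: ss[symmetric]
            power2_eq_square)
          moreover have "s * (2 * pi * ?b h) = 2 * pi * ?b h * s" by simp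
          ultimately show ?thesis by (simp only: right_diff_distrib)
        qed
        ultimately have 1: "sqrt (2 * pi) - \<epsilon> \<le> s * (2 * pi * bs.pr a b h N)" using bd by linarith
        have q1: "1 \<le> sqrt (2 * pi)" using pi_gt3 by simp
        have "sqrt (2 * pi) * (1 - \<epsilon>) \<le> sqrt (2 * pi) - \<epsilon>" using q1 e by (simp add: algebra_simps
          mult_le_cancel_left1)
        also have "\<dots> \<le> s * (2 * pi * bs.pr a b h N)" by (rule 1)
        also have "\<dots> = sqrt (2 * pi) * (bs.pr a b h N * sqrt (2 * pi * V))"
        proof -
          have a: "sqrt (2 * pi * V) = sqrt (2 * pi) * s" unfolding s_def by (rule real_sqrt_mult)
          have b: "sqrt (2 * pi) * sqrt (2 * pi) = 2 * pi" by (rule real_sqrt_mult_self[THEN trans]) simp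
          have "sqrt (2 * pi) * (bs.pr a b h N * sqrt (2 * pi * V)) = (sqrt (2 * pi) * sqrt (2 * pi)) * (s *
            bs.pr a b h N)"
            unfolding a by (simp only: mult_ac)
          then show ?thesis unfolding b by (simp only: mult_ac)
        qed
        finally show "1 - \<epsilon> \<le> bs.pr a b h N * sqrt (2 * pi * bs.mom a b h 2)"
          using q1 unfolding V_def by (subst (asm) mult_le_cancel_left_pos) auto
      qed
    qed
  qed
qed

section \<open>The expected size\<close>

definition exp_series :: "real \<Rightarrow> real" where
  "exp_series s = exp (- s) / (1 - exp (- s))\<^sup>2"

lemma exp_series_sums: "(\<lambda>k. real (Suc k) * exp (- (real (Suc k) * s))) sums exp_series s" if "0 < s"
proof -
  have "norm (exp (- s)) < 1" using that by simp
  from sums_mult[OF geometric_deriv_sums[OF this], of "exp (- s)"]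
  have "(\<lambda>k. exp (- s) * (real (Suc k) * exp (- s) ^ k)) sums (exp (- s) * (1 / (1 - exp (- s))\<^sup>2))" by simp
  moreover have "exp (- s) * (real (Suc k) * exp (- s) ^ k) = real (Suc k) * exp (- (real (Suc k) * s))" for k
  proof -
    have "exp (- (real (Suc k) * s)) = exp (- s) * exp (real k * (- s))" by (simp add: exp_add[symmetric]
      algebra_simps)
    also have "\<dots> = exp (- s) * exp (- s) ^ k" by (simp only: exp_of_nat_mult)
    finally show ?thesis by simp
  qed
  ultimately show ?thesis unfolding exp_series_def by (simp only: times_divide_eq_right mult_1_right)
qed

lemma exp_series_alt: "exp_series s = 1 / (exp (s / 2) - exp (- (s / 2)))\<^sup>2" if "0 < s"
proof -
  have e: "exp (s / 2) * exp (- (s / 2)) = 1" by (simp add: exp_add[symmetric])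
  have "exp (- s) = (exp (- (s / 2)))\<^sup>2" by (simp add: power2_eq_square exp_add[symmetric])
  moreover have "1 - exp (- s) = exp (- (s / 2)) * (exp (s / 2) - exp (- (s / 2)))"
    by (simp add: algebra_simps exp_add[symmetric])
  ultimately show ?thesis using that by (simp add: exp_series_def power_mult_distrib)
qed

text \<open>The series is 1 / (2 sinh (s / 2))^2. Its distance from 1 / s^2 is at most 1 / s for
  small s and 1 / s^2 for large s. Any exponent between lies above both; 5/4 is summable over s = j
  / h and leaves an error h^(5/4), below the standard deviation scale h^(3/2).\<close>

lemma exp_series_bounds: assumes s: "0 < s" shows "0 \<le> exp_series s" "exp_series s \<le> 1 / s\<^sup>2" "\<bar>1 / s\<^sup>2 -
  exp_series s\<bar> \<le> s powr (- 5 / 4)"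
proof -
  define w where "w = exp (s / 2) - exp (- (s / 2))"
  have w: "s \<le> w"
  proof -
    have d: "((\<lambda>x. exp (x / 2) - exp (- (x / 2)) - x) has_real_derivative (exp (x / 2) / 2 + exp (- (x / 2))
      / 2 - 1)) (at x)" for x :: real
      by (auto intro!: derivative_eq_intros)
    have nn: "0 \<le> exp (x / 2) / 2 + exp (- (x / 2)) / 2 - 1" for x :: real
    proof -
      have "0 \<le> (exp (x / 4) - exp (- (x / 4)))\<^sup>2" by simp
      also have "\<dots> = exp (x / 2) + exp (- (x / 2)) - 2" by (simp add: power2_eq_square algebra_simps
        exp_add[symmetric])
      finally show ?thesis by simp
    qed
    have "exp (0 / 2) - exp (- (0 / 2)) - 0 \<le> exp (s / 2) - exp (- (s / 2)) - s"
    proof (rule DERIV_nonneg_imp_nondecreasing[of 0 s "\<lambda>x. exp (x / 2) - exp (- (x / 2)) - x"])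
      fix x show "\<exists>y. ((\<lambda>x. exp (x / 2) - exp (- (x / 2)) - x) has_real_derivative y) (at x) \<and> 0 \<le> y"
        using d[of x] nn[of x] by blast
    qed (use s in simp)
    then show ?thesis by (simp add: w_def)
  qed
  have S: "exp_series s = 1 / w\<^sup>2" using exp_series_alt[OF s] by (simp add: w_def)
  show 1: "0 \<le> exp_series s" by (simp add: S)
  have "s\<^sup>2 \<le> w\<^sup>2" using w s by (intro power_mono) auto
  then show 2: "exp_series s \<le> 1 / s\<^sup>2" unfolding S using s by (intro divide_left_mono) (auto intro!:
    mult_pos_pos)
  show "\<bar>1 / s\<^sup>2 - exp_series s\<bar> \<le> s powr (- 5 / 4)"
  proof (cases "s \<le> 1")
    case False
    have "\<bar>1 / s\<^sup>2 - exp_series s\<bar> \<le> 1 / s\<^sup>2" using 1 2 by simp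
    also have "\<dots> = s powr (- 2)" using s by (simp add: powr_minus powr_numeral divide_inverse)
    also have "\<dots> \<le> s powr (- 5 / 4)" using False by (intro powr_mono) auto
    finally show ?thesis .
  next
    case True
    have "exp (s / 2) \<le> 1 + s / 2 + (s / 2)\<^sup>2" by (rule exp_bound) (use s True in auto)
    moreover have "1 - s / 2 \<le> exp (- (s / 2))" using exp_ge_add_one_self[of "- (s / 2)"] by simp
    ultimately have w2: "w - s \<le> s\<^sup>2 / 4" unfolding w_def by (simp add: power2_eq_square)
    have "1 / s\<^sup>2 - exp_series s = (w - s) * (w + s) / (s\<^sup>2 * w\<^sup>2)"
      unfolding S using s w by (simp add: field_simps power2_eq_square)
    also have "\<dots> \<le> (s\<^sup>2 / 4) * (2 * w) / (s\<^sup>2 * w\<^sup>2)"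
      by (intro divide_right_mono mult_mono w2) (use w s in auto)
    also have "\<dots> = 1 / (2 * w)" using w s by (simp add: field_simps power2_eq_square)
    also have "\<dots> \<le> 1 / s" using w s by (intro divide_left_mono) auto
    also have "\<dots> = s powr (- 1)" using s by (simp add: powr_minus divide_inverse)
    also have "\<dots> \<le> s powr (- 5 / 4)" using powr_mono'[of "- 5 / 4" "- 1" s] s True by simp
    finally show ?thesis using 2 by simp
  qed
qed

text \<open>Subtracting the even terms twice from the full sum removes half of the sum up to m, so
  the limit is half of pi^2 / 6.\<close>

lemma alternating_squares: "(\<lambda>m. \<Sum>j=1..2*m. (- 1) ^ (j + 1) / real j ^ 2) \<longlonglongrightarrow> pi\<^sup>2 / 12"
proof -
  define H where "H m = (\<Sum>j=1..m. 1 / real j ^ 2)" for m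
  have "H \<longlonglongrightarrow> pi\<^sup>2 / 6"
  proof -
    have "(\<lambda>m. \<Sum>j<m. 1 / (real j + 1)\<^sup>2) \<longlonglongrightarrow> pi\<^sup>2 / 6"
      using inverse_squares_sums by (simp add: sums_def add.commute)
    moreover have "(\<Sum>j<m. 1 / (real j + 1)\<^sup>2) = H m" for m
      unfolding H_def by (induction m) (auto simp: add.commute)
    ultimately show ?thesis by simp
  qed
  moreover have "filterlim (\<lambda>m::nat. 2 * m) at_top at_top" by (rule filterlim_subseq) (simp add:
    strict_mono_def)
  ultimately have "(\<lambda>m. H (2 * m) - H m / 2) \<longlonglongrightarrow> pi\<^sup>2 / 6 - pi\<^sup>2 / 6 / 2"
    by (intro tendsto_intros) (auto intro: filterlim_compose)
  moreover have "(\<Sum>j=1..2*m. (- 1) ^ (j + 1) / real j ^ 2) = H (2 * m) - H m / 2" for m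
  proof (induction m)
    case (Suc m)
    have "2 * Suc m = Suc (Suc (2 * m))" by simp
    then have "(\<Sum>j=1..2*Suc m. (- 1) ^ (j + 1) / real j ^ 2) =
       (\<Sum>j=1..2*m. (- 1) ^ (j + 1) / real j ^ 2) + 1 / real (2 * m + 1) ^ 2 - 1 / real (2 * m + 2) ^ 2"
      by simp
    moreover have "H (2 * Suc m) = H (2 * m) + 1 / real (2 * m + 1) ^ 2 + 1 / real (2 * m + 2) ^ 2"
      using \<open>2 * Suc m = _\<close> by (simp add: H_def)
    moreover have "H (Suc m) = H m + 1 / real (m + 1) ^ 2" by (simp add: H_def)
    moreover have "1 / real (m + 1) ^ 2 / 2 = 2 * (1 / real (2 * m + 2) ^ 2)"
    proof -
      have "real (2 * m + 2) = 2 * real (m + 1)" by simp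
      then show ?thesis by (simp only: power_mult_distrib) simp
    qed
    ultimately show ?case using Suc by (simp only: add_divide_distrib)
  qed (simp add: H_def)
  ultimately show ?thesis by simp
qed

lemma geometric_alt: "\<bar>y / (1 + y) - (\<Sum>j=1..J. (- 1) ^ (j + 1) * y ^ j)\<bar> \<le> y ^ (J + 1)" if "0 \<le> y" for y :: real
proof -
  have "y / (1 + y) - (\<Sum>j=1..J. (- 1) ^ (j + 1) * y ^ j) = (- 1) ^ J * (y ^ (J + 1) / (1 + y))"
  proof (induction J)
    case (Suc J)
    then have "y / (1 + y) - (\<Sum>j=1..Suc J. (- 1) ^ (j + 1) * y ^ j) = (- 1) ^ J * (y ^ (J + 1) / (1 +
      y)) - (- 1) ^ J * y ^ (J + 1)"
      by simp
    also have "\<dots> = (- 1) ^ J * (y ^ (J + 1) / (1 + y) - y ^ (J + 1))" by (simp only: right_diff_distrib)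
    also have "y ^ (J + 1) / (1 + y) - y ^ (J + 1) = - (y ^ (Suc J + 1) / (1 + y))"
      using that by (simp add: field_simps)
    finally show ?case by simp
  qed simp
  then have "\<bar>y / (1 + y) - (\<Sum>j=1..J. (- 1) ^ (j + 1) * y ^ j)\<bar> = y ^ (J + 1) / (1 + y)"
    using that by (simp add: abs_mult power_abs)
  also have "\<dots> \<le> y ^ (J + 1) / 1" using that by (intro divide_left_mono) auto
  finally show ?thesis by simp
qed

definition mean_limit :: "real \<Rightarrow> real" where
  "mean_limit h = (\<Sum>k. real (Suc k) * part_prob h (Suc k))"

lemma mean_limit_summable: "summable (\<lambda>k. real (Suc k) * part_prob h (Suc k))" if "0 < h"
proof (rule summable_comparison_test)
  show "summable (\<lambda>k. real (Suc k) * exp (- (real (Suc k) * (1 / h))))"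
    using exp_series_sums[of "1 / h"] that by (auto simp: summable_def)
  show "\<exists>N. \<forall>n\<ge>N. norm (real (Suc n) * part_prob h (Suc n)) \<le> real (Suc n) * exp (- (real (Suc n) * (1 / h)))"
  proof (intro exI[of _ 0] allI impI)
    fix n
    have "norm (real (Suc n) * part_prob h (Suc n)) = real (Suc n) * part_prob h (Suc n)"
      using part_prob_bounds(1)[of h "Suc n"] by (simp add: abs_mult)
    also have "\<dots> \<le> real (Suc n) * exp (- (real (Suc n) / h))" by (intro mult_left_mono part_prob_bounds) auto
    finally show "norm (real (Suc n) * part_prob h (Suc n)) \<le> real (Suc n) * exp (- (real (Suc n) *
      (1 / h)))" by simp
  qed
qed

text \<open>Expanding 1 / (1 + y) only to J terms means exchanging an infinite sum with a finite
  one. The remainder of the alternating expansion is bounded by its next term, which sums to another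
  \<open>exp_series\<close>.\<close>

lemma mean_limit_approx_J:
  assumes h: "0 < h"
  shows "\<bar>mean_limit h - (\<Sum>j=1..J. (- 1) ^ (j + 1) * exp_series (real j / h))\<bar> \<le> exp_series (real (J + 1) / h)"
proof -
  let ?e = "\<lambda>j k. real (Suc k) * exp (- (real (Suc k) * (real j / h)))"
  let ?f = "\<lambda>k. real (Suc k) * part_prob h (Suc k)"
  have e: "(\<lambda>k. ?e j k) sums exp_series (real j / h)" if "1 \<le> j" for j
    using exp_series_sums[of "real j / h"] that h by simp
  have s1: "(\<lambda>k. \<Sum>j=1..J. (- 1) ^ (j + 1) * ?e j k) sums (\<Sum>j=1..J. (- 1) ^ (j + 1) * exp_series (real j / h))"
    by (intro sums_sum sums_mult e) auto
  have s2: "(\<lambda>k. ?f k - (\<Sum>j=1..J. (- 1) ^ (j + 1) * ?e j k)) sums (mean_limit h - (\<Sum>j=1..J. (- 1) ^ (j +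
    1) * exp_series (real j / h)))"
    unfolding mean_limit_def by (intro sums_diff s1 summable_sums mean_limit_summable h)
  have bd: "\<bar>?f k - (\<Sum>j=1..J. (- 1) ^ (j + 1) * ?e j k)\<bar> \<le> ?e (J + 1) k" for k
  proof -
    let ?y = "exp (- (real (Suc k) / h))"
    have y: "exp (- (real (Suc k) * (real j / h))) = ?y ^ j" for j
      by (simp add: exp_of_nat_mult[symmetric] mult_ac)
    have "?f k - (\<Sum>j=1..J. (- 1) ^ (j + 1) * ?e j k) = real (Suc k) * (?y / (1 + ?y) - (\<Sum>j=1..J. (- 1) ^ (j
      + 1) * ?y ^ j))"
      unfolding y part_prob_def right_diff_distrib sum_distrib_left by (simp only: mult_ac)
    then have "\<bar>?f k - (\<Sum>j=1..J. (- 1) ^ (j + 1) * ?e j k)\<bar> = real (Suc k) * \<bar>?y / (1 + ?y) - (\<Sum>j=1..J.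
      (- 1) ^ (j + 1) * ?y ^ j)\<bar>"
      by (simp only: abs_mult abs_of_nat)
    also have "\<dots> \<le> real (Suc k) * ?y ^ (J + 1)" by (intro mult_left_mono geometric_alt) auto
    finally show ?thesis unfolding y .
  qed
  have le: "mean_limit h - (\<Sum>j=1..J. (- 1) ^ (j + 1) * exp_series (real j / h)) \<le> exp_series (real (J + 1) / h)"
    by (rule sums_le[OF _ s2 e]) (use bd in \<open>auto simp: abs_le_iff\<close>)
  have "- (mean_limit h - (\<Sum>j=1..J. (- 1) ^ (j + 1) * exp_series (real j / h))) \<le> exp_series (real (J + 1) / h)"
    by (rule sums_le[OF _ sums_minus[OF s2] e]) (use bd in \<open>auto simp: abs_le_iff\<close>)
  with le show ?thesis by linarith
qed

text \<open>Each \<open>exp_series\<close> at j / h is replaced by h^2 / j^2 with an error summable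
  in j. Letting the number of terms grow at fixed \<open>h\<close> turns the alternating sum into
  pi^2 / 12.\<close>

lemma mean_limit_approx: "\<exists>C\<ge>0. \<forall>h>0. \<bar>mean_limit h - h\<^sup>2 * (pi\<^sup>2 / 12)\<bar> \<le> C * h powr (5 / 4)"
proof -
  have sp: "summable (\<lambda>j. real j powr (- 5 / 4))" by (subst summable_real_powr_iff) simp
  define C where "C = (\<Sum>j. real j powr (- 5 / 4))"
  have C0: "0 \<le> C" unfolding C_def by (intro suminf_nonneg sp) auto
  show ?thesis
  proof (intro exI[of _ C] conjI C0 allI impI)
    fix h :: real assume h: "0 < h"
    have bd: "\<bar>mean_limit h - h\<^sup>2 * (\<Sum>j=1..J. (- 1) ^ (j + 1) / real j ^ 2)\<bar> \<le> h\<^sup>2 / real (J + 1) ^ 2 + C *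
      h powr (5 / 4)" for J
    proof -
      have "\<bar>(\<Sum>j=1..J. (- 1) ^ (j + 1) * exp_series (real j / h)) - h\<^sup>2 * (\<Sum>j=1..J. (- 1) ^ (j + 1) / real j
        ^ 2)\<bar>
         = \<bar>\<Sum>j=1..J. (- 1) ^ (j + 1) * (exp_series (real j / h) - 1 / (real j / h)\<^sup>2)\<bar>"
        unfolding sum_distrib_left sum_subtractf[symmetric]
        by (rule arg_cong[of _ _ abs], intro sum.cong refl) (simp add: power_divide algebra_simps)
      also have "\<dots> \<le> (\<Sum>j=1..J. \<bar>(- 1) ^ (j + 1) * (exp_series (real j / h) - 1 / (real j / h)\<^sup>2)\<bar>)"
        by (rule sum_abs)
      also have "\<dots> \<le> (\<Sum>j=1..J. real j powr (- 5 / 4) * h powr (5 / 4))"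
      proof (rule sum_mono)
        fix j assume j: "j \<in> {1..J}"
        have "\<bar>(- 1) ^ (j + 1) * (exp_series (real j / h) - 1 / (real j / h)\<^sup>2)\<bar> = \<bar>1 / (real j / h)\<^sup>2 -
          exp_series (real j / h)\<bar>"
          by (simp add: abs_mult power_abs abs_minus_commute)
        also have "\<dots> \<le> (real j / h) powr (- 5 / 4)" by (rule exp_series_bounds) (use j h in auto)
        also have "\<dots> = real j powr (- 5 / 4) * h powr (5 / 4)"
        proof -
          have "h powr (- 5 / 4) * h powr (5 / 4) = 1" unfolding powr_add[symmetric] using h by simp
          then have "h powr (5 / 4) = 1 / h powr (- 5 / 4)" using h by (simp add: nonzero_eq_divide_eq
            mult.commute)
          moreover have "(real j / h) powr (- 5 / 4) = real j powr (- 5 / 4) / h powr (- 5 / 4)"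
            by (rule powr_divide)
          ultimately show ?thesis by (simp only: times_divide_eq_right mult_1_right)
        qed
        finally show "\<bar>(- 1) ^ (j + 1) * (exp_series (real j / h) - 1 / (real j / h)\<^sup>2)\<bar> \<le> real j powr (- 5
          / 4) * h powr (5 / 4)" .
      qed
      also have "\<dots> \<le> C * h powr (5 / 4)"
        unfolding sum_distrib_right[symmetric] C_def by (intro mult_right_mono sum_le_suminf sp) auto
      finally have 1: "\<bar>(\<Sum>j=1..J. (- 1) ^ (j + 1) * exp_series (real j / h)) - h\<^sup>2 * (\<Sum>j=1..J. (- 1) ^ (j +
        1) / real j ^ 2)\<bar> \<le> C * h powr (5 / 4)" .
      have "exp_series (real (J + 1) / h) \<le> 1 / (real (J + 1) / h)\<^sup>2" by (rule exp_series_bounds) (use h in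
        auto)
      also have "\<dots> = h\<^sup>2 / real (J + 1) ^ 2" by (simp add: power_divide)
      finally show ?thesis using 1 mean_limit_approx_J[OF h, of J] by linarith
    qed
    have l1: "(\<lambda>m. \<bar>mean_limit h - h\<^sup>2 * (\<Sum>j=1..2*m. (- 1) ^ (j + 1) / real j ^ 2)\<bar>) \<longlonglongrightarrow> \<bar>mean_limit h - h\<^sup>2 *
      (pi\<^sup>2 / 12)\<bar>"
      by (intro tendsto_intros alternating_squares)
    have "(\<lambda>m. h\<^sup>2 / real (2 * m + 1) ^ 2 + C * h powr (5 / 4)) \<longlonglongrightarrow> 0 + C * h powr (5 / 4)"
      by (intro tendsto_add tendsto_const) real_asymp
    from tendsto_le[OF _ this l1] show "\<bar>mean_limit h - h\<^sup>2 * (pi\<^sup>2 / 12)\<bar> \<le> C * h powr (5 / 4)"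
      using bd[of "2 * m" for m] by simp
  qed
qed

lemma mean_sum_near_limit: "\<bar>mean_limit h - mean_sum h a\<bar> \<le> 8 * h\<^sup>2 * exp (- (real a / (2 * h)))"
  if h: "1 \<le> h" and a: "1 \<le> a"
proof -
  have s: "(\<lambda>k. real (Suc k) * part_prob h (Suc k)) sums mean_limit h"
    unfolding mean_limit_def by (intro summable_sums mean_limit_summable) (use h in simp)
  have eq: "(\<Sum>k<b. real (Suc k) * part_prob h (Suc k)) = mean_sum h (Suc b)" for b
    unfolding mean_sum_def by (induction b) auto
  have lim: "(\<lambda>b. mean_sum h (Suc b) - mean_sum h a) \<longlonglongrightarrow> mean_limit h - mean_sum h a"
    using s unfolding sums_def eq by (intro tendsto_intros)
  have diff: "mean_sum h b - mean_sum h a = (\<Sum>k=a..<b. real k * part_prob h k)" if "a \<le> b" for b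
    unfolding mean_sum_def using sum.atLeastLessThan_concat[OF a that, of "\<lambda>k. real k * part_prob h k"] by simp
  have up: "mean_sum h b - mean_sum h a \<le> 8 * h\<^sup>2 * exp (- (real a / (2 * h)))" if "a \<le> b" for b
  proof -
    have "mean_sum h b - mean_sum h a \<le> (\<Sum>k=a..<b. real k ^ 1 * exp (- (real k / h)))"
      unfolding diff[OF that] by (simp, intro sum_mono mult_left_mono part_prob_bounds) auto
    also have "\<dots> \<le> fact 1 * (2 * h) ^ 1 * (exp (- (real a / (2 * h))) * (1 + 2 * h))"
      by (rule power_exp_sum_bound) (use h in simp)
    also have "\<dots> \<le> fact 1 * (2 * h) ^ 1 * (exp (- (real a / (2 * h))) * (4 * h))"
      by (intro mult_left_mono) (use h in auto)
    finally show ?thesis by (simp add: power2_eq_square mult_ac)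
  qed
  have lo: "0 \<le> mean_sum h b - mean_sum h a" if "a \<le> b" for b
    unfolding diff[OF that] by (intro sum_nonneg mult_nonneg_nonneg part_prob_bounds) auto
  have "mean_limit h - mean_sum h a \<le> 8 * h\<^sup>2 * exp (- (real a / (2 * h)))"
    by (rule tendsto_upperbound[OF lim]) (auto intro!: eventually_sequentiallyI[of a] up)
  moreover have "0 \<le> mean_limit h - mean_sum h a"
    by (rule tendsto_lowerbound[OF lim]) (rule eventually_sequentiallyI[of a], rule lo, simp_all)
  ultimately show ?thesis by simp
qed

section \<open>The scale as a function of the size\<close>

definition hscale :: "nat \<Rightarrow> real" where "hscale n = A * sqrt (real n)"

lemma A_pos: "0 < A" by (simp add: A_def)

lemma A_bounds: "3 / 5 \<le> A" "A \<le> 1"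
proof -
  have "12/5 \<le> sqrt 6" by (rule real_le_rsqrt) (simp add: power2_eq_square)
  moreover have "sqrt 6 \<le> 3" by (rule real_le_lsqrt) auto
  ultimately show "3 / 5 \<le> A" "A \<le> 1" using pi_gt3 pi_less_4 unfolding A_def by (auto simp: field_simps)
qed

text \<open>This is the origin of \<open>A\<close>: the two sides have mean size about h^2 pi^2 / 12
  each, and together they must make n.\<close>

lemma hscale_sq: "(hscale n)\<^sup>2 * pi\<^sup>2 = 6 * real n"
  by (simp add: hscale_def A_def power_mult_distrib power_divide)

lemma hscale_filterlim: "filterlim hscale at_top sequentially"
proof -
  have "filterlim (\<lambda>n. a * sqrt (real n)) at_top sequentially" if "0 < a" for a using that by real_asymp
  from this[OF A_pos] show ?thesis by (simp add: hscale_def[abs_def])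
qed

text \<open>It lets the cut n + 1 stand for infinity: the Boltzmann weight beyond n is at most exp
  (- h).\<close>

lemma hscale_sq_le: "(hscale n)\<^sup>2 \<le> real n"
proof -
  have "(hscale n)\<^sup>2 = A\<^sup>2 * real n" by (simp add: hscale_def power_mult_distrib)
  also have "\<dots> \<le> 1 * real n" using A_bounds by (intro mult_right_mono) (auto simp: power_le_one)
  finally show ?thesis by simp
qed

text \<open>The untruncated model is centred at n on the scale required by
  \<open>LLT_lower\<close>.\<close>

lemma mean_total: "(\<lambda>n. \<bar>2 * mean_sum (hscale n) (n + 1) - real n\<bar> / (hscale n * sqrt (hscale n))) \<longlonglongrightarrow> 0"
proof -
  obtain C where C: "0 \<le> C" "\<And>h. 0 < h \<Longrightarrow> \<bar>mean_limit h - h\<^sup>2 * (pi\<^sup>2 / 12)\<bar> \<le> C * h powr (5 / 4)"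
    using mean_limit_approx by blast
  have lim: "((\<lambda>h. (2 * C * h powr (5 / 4) + 16 * h\<^sup>2 * exp (- (h / 2))) / (h * sqrt h)) \<longlongrightarrow> 0) at_top"
  proof -
    have "((\<lambda>h::real. 2 * C * (h powr (5 / 4) / (h * sqrt h)) + 16 * h\<^sup>2 * exp (- (h / 2)) / (h *
      sqrt h)) \<longlongrightarrow> 2 * C * 0 + 0) at_top"
      by (intro tendsto_add tendsto_mult tendsto_const) real_asymp+
    then show ?thesis by (simp add: add_divide_distrib)
  qed
  have bd: "\<forall>\<^sub>F n in sequentially. \<bar>2 * mean_sum (hscale n) (n + 1) - real n\<bar> / (hscale n * sqrt (hscale n)) \<le>
      (2 * C * hscale n powr (5 / 4) + 16 * (hscale n)\<^sup>2 * exp (- (hscale n / 2))) / (hscale n *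
        sqrt (hscale n))"
  proof -
    have "\<forall>\<^sub>F n in sequentially. 1 \<le> hscale n" using hscale_filterlim by (simp add: filterlim_at_top)
    then show ?thesis
    proof eventually_elim
      case (elim n)
      have n: "real n = 2 * ((hscale n)\<^sup>2 * (pi\<^sup>2 / 12))" using hscale_sq[of n] by simp
      have "exp (- (real (n + 1) / (2 * hscale n))) \<le> exp (- (hscale n / 2))"
      proof -
        have "hscale n * hscale n \<le> real (n + 1)" using hscale_sq_le[of n] by (simp add: power2_eq_square)
        then show ?thesis using elim by (simp add: field_simps)
      qed
      then have "8 * (hscale n)\<^sup>2 * exp (- (real (n + 1) / (2 * hscale n))) \<le> 8 * (hscale n)\<^sup>2 *
        exp (- (hscale n / 2))" by (intro mult_left_mono) auto
      then have "\<bar>mean_limit (hscale n) - mean_sum (hscale n) (n + 1)\<bar> \<le> 8 * (hscale n)\<^sup>2 * exp (- (hscale n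
        / 2))"
        using mean_sum_near_limit[OF elim, of "n + 1"] by simp
      moreover have "\<bar>mean_limit (hscale n) - (hscale n)\<^sup>2 * (pi\<^sup>2 / 12)\<bar> \<le> C * hscale n powr (5 / 4)"
        by (rule C) (use elim in simp)
      ultimately have "\<bar>2 * mean_sum (hscale n) (n + 1) - real n\<bar> \<le> 2 * C * hscale n powr (5 / 4) + 16 *
        (hscale n)\<^sup>2 * exp (- (hscale n / 2))"
        unfolding n by linarith
      then show ?case by (intro divide_right_mono) (use elim in auto)
    qed
  qed
  show ?thesis
  proof (rule tendsto_sandwich[OF _ bd tendsto_const])
    show "\<forall>\<^sub>F n in sequentially. 0 \<le> \<bar>2 * mean_sum (hscale n) (n + 1) - real n\<bar> / (hscale n * sqrt (hscale n))"
      by (intro always_eventually allI divide_nonneg_nonneg) (use A_pos in \<open>auto simp: hscale_def\<close>)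
    show "(\<lambda>n. (2 * C * hscale n powr (5 / 4) + 16 * (hscale n)\<^sup>2 * exp (- (hscale n / 2))) / (hscale n *
      sqrt (hscale n))) \<longlonglongrightarrow> 0"
      by (rule filterlim_compose[OF lim hscale_filterlim])
  qed
qed

section \<open>Counting strongly unimodal sequences\<close>

definition part_prod :: "real \<Rightarrow> nat \<Rightarrow> real" where
  "part_prod h a = (\<Prod>k=1..<a. 1 + exp (- (real k / h)))"

lemma part_prod_pos: "0 < part_prod h a"
  unfolding part_prod_def by (intro prod_pos) (auto intro: add_pos_pos)

lemma part_prod_Suc: "1 \<le> a \<Longrightarrow> part_prod h (Suc a) = part_prod h a * (1 + exp (- (real a / h)))"
  unfolding part_prod_def by simp

lemma part_prod_telescope: "(\<Sum>m=1..<M. 2 * exp (- (real m / h)) * (part_prod h m)\<^sup>2) \<le> (part_prod h M)\<^sup>2"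
proof (induction M)
  case (Suc M)
  show ?case
  proof (cases "1 \<le> M")
    case True
    have "(\<Sum>m=1..<Suc M. 2 * exp (- (real m / h)) * (part_prod h m)\<^sup>2) \<le> (part_prod h M)\<^sup>2 + 2 *
      exp (- (real M / h)) * (part_prod h M)\<^sup>2"
      using Suc True by simp
    also have "\<dots> \<le> (part_prod h M)\<^sup>2 * (1 + exp (- (real M / h)))\<^sup>2"
    proof -
      have "(part_prod h M)\<^sup>2 * (1 + exp (- (real M / h)))\<^sup>2 =
          (part_prod h M)\<^sup>2 + 2 * exp (- (real M / h)) * (part_prod h M)\<^sup>2 + (part_prod h M * exp (- (real M
            / h)))\<^sup>2"
        by (simp add: power2_eq_square algebra_simps)
      then show ?thesis by simp
    qed
    also have "\<dots> = (part_prod h (Suc M))\<^sup>2" by (simp add: part_prod_Suc[OF True] power_mult_distrib)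
    finally show ?thesis .
  qed (simp add: part_prod_def)
qed simp

lemma part_prod_concat: "part_prod h b = part_prod h a * (\<Prod>k=a..<b. 1 + exp (- (real k / h)))"
  if "1 \<le> a" "a \<le> b"
  unfolding part_prod_def by (rule prod.atLeastLessThan_concat[symmetric]) (use that in auto)

lemma part_prod_ratio_upper:
  assumes "0 < h" "1 \<le> a" "a \<le> b"
  shows "part_prod h b \<le> part_prod h a * exp (exp (- (real a / h)) * (1 + h))"
proof -
  have "(\<Prod>k=a..<b. 1 + exp (- (real k / h))) \<le> (\<Prod>k=a..<b. exp (exp (- (real k / h))))"
    by (intro prod_mono conjI exp_ge_add_one_self) (auto intro: add_nonneg_nonneg)
  also have "\<dots> = exp (\<Sum>k=a..<b. exp (- (real k / h)))" by (simp add: exp_sum)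
  also have "\<dots> \<le> exp (exp (- (real a / h)) * (1 + h))" using geom_exp_bound[OF assms(1), of a b] by simp
  finally show ?thesis unfolding part_prod_concat[OF assms(2,3)] using part_prod_pos[of h a] by simp
qed

lemma geom_exp_lower: "h * (exp (- (real a / h)) - exp (- (real b / h))) \<le> (\<Sum>k=a..<b. exp (- (real k / h)))"
  if "0 < h" "a \<le> b"
proof -
  let ?q = "exp (- (1 / h))"
  have pw: "exp (- (real k / h)) = ?q ^ k" for k by (simp add: exp_of_nat_mult[symmetric])
  have q: "1 - ?q \<le> 1 / h" using exp_ge_add_one_self[of "- (1 / h)"] by simp
  have "?q ^ a - ?q ^ b = (1 - ?q) * (\<Sum>k=a..<b. ?q ^ k)" by (simp add: sum_gp_ivl[OF that(2)])
  also have "\<dots> \<le> 1 / h * (\<Sum>k=a..<b. ?q ^ k)" by (intro mult_right_mono q sum_nonneg) auto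
  finally show ?thesis unfolding pw using that by (simp add: field_simps)
qed

text \<open>Each factor satisfies 1 + x at least exp (x / 2) for x in [0, 1], and the exponents form
  a geometric sum.\<close>

lemma part_prod_ratio_lower:
  assumes "0 < h" "1 \<le> a" "a \<le> b"
  shows "part_prod h a * exp (h * (exp (- (real a / h)) - exp (- (real b / h))) / 2) \<le> part_prod h b"
proof -
  have "exp (h * (exp (- (real a / h)) - exp (- (real b / h))) / 2) \<le> exp (\<Sum>k=a..<b. exp (- (real k / h)) / 2)"
    using geom_exp_lower[OF assms(1,3)] by (simp add: sum_divide_distrib[symmetric])
  also have "\<dots> = (\<Prod>k=a..<b. exp (exp (- (real k / h)) / 2))" by (simp add: exp_sum)
  also have "\<dots> \<le> (\<Prod>k=a..<b. 1 + exp (- (real k / h)))"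
  proof (intro prod_mono conjI)
    fix k
    have x: "0 \<le> exp (- (real k / h)) / 2" "exp (- (real k / h)) / 2 \<le> 1 / 2" using assms by auto
    have "exp y \<le> 1 + 2 * y" if "0 \<le> y" "y \<le> 1 / 2" for y :: real
    proof -
      have "exp y \<le> 1 + y + y\<^sup>2" by (rule exp_bound) (use that in auto)
      also have "y\<^sup>2 \<le> y" using that by (simp add: power2_eq_square mult_left_le)
      finally show ?thesis by simp
    qed
    from this[OF x] show "exp (exp (- (real k / h)) / 2) \<le> 1 + exp (- (real k / h))" by simp
  qed auto
  finally show ?thesis unfolding part_prod_concat[OF assms(2,3)] using part_prod_pos[of h a] by simp
qed

text \<open>The leading term a h exp (- a / h) must have constant 1, because it will be balanced
  against the prescribed parts; \<open>power_exp_sum_bound\<close> would lose a factor. The function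
  \<open>g\<close> decreases by at least the k-th summand from k to k + 1, so the sum
  telescopes.\<close>

lemma mean_sum_tail_upper:
  assumes h: "0 < h" and ab: "1 \<le> a" "a \<le> b"
  shows "mean_sum h b - mean_sum h a \<le> exp (- (real a / h)) * (real a * (1 + h) + (1 + h)\<^sup>2)"
proof -
  define g where "g k = exp (- (real k / h)) * (real k * (1 + h) + (1 + h)\<^sup>2)" for k :: nat
  have step: "real k * exp (- (real k / h)) \<le> g k - g (Suc k)" for k
  proof -
    let ?q = "exp (- (1 / h))"
    have "1 + 1 / h \<le> exp (1 / h)" by (rule exp_ge_add_one_self)
    then have q: "?q * (1 + h) \<le> h" using h by (simp add: exp_minus field_simps)
    have "?q * ((real k + 1) * (1 + h) + (1 + h)\<^sup>2) = (?q * (1 + h)) * (real k + 1 + (1 + h))"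
      by (simp add: power2_eq_square algebra_simps)
    also have "\<dots> \<le> h * (real k + 1 + (1 + h))" by (intro mult_right_mono q) (use h in auto)
    finally have "real k \<le> (real k * (1 + h) + (1 + h)\<^sup>2) - ?q * ((real k + 1) * (1 + h) + (1 + h)\<^sup>2)"
      by (simp add: power2_eq_square algebra_simps)
    then have "exp (- (real k / h)) * real k \<le> exp (- (real k / h)) * ((real k * (1 + h) + (1 + h)\<^sup>2) - ?q *
      ((real k + 1) * (1 + h) + (1 + h)\<^sup>2))"
      by (intro mult_left_mono) auto
    also have "exp (- (real k / h)) * ?q = exp (- (real (Suc k) / h))"
      unfolding exp_add[symmetric] by (rule arg_cong[of _ _ exp]) (simp add: add_divide_distrib)
    then have "exp (- (real k / h)) * ((real k * (1 + h) + (1 + h)\<^sup>2) - ?q * ((real k + 1) * (1 + h) + (1 +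
      h)\<^sup>2)) = g k - g (Suc k)"
      unfolding g_def right_diff_distrib mult.assoc[symmetric] by (simp add: add.commute)
    finally show ?thesis by (simp add: mult.commute)
  qed
  have "mean_sum h b - mean_sum h a = (\<Sum>k=a..<b. real k * part_prob h k)"
    unfolding mean_sum_def using sum.atLeastLessThan_concat[OF ab, of "\<lambda>k. real k * part_prob h k"] by simp
  also have "\<dots> \<le> (\<Sum>k=a..<b. real k * exp (- (real k / h)))"
    by (intro sum_mono mult_left_mono part_prob_bounds) auto
  also have "\<dots> \<le> (\<Sum>k=a..<b. g k - g (Suc k))" by (intro sum_mono step)
  also have "\<dots> = g a - g b" using ab(2) by (induction b rule: dec_induct) auto
  also have "\<dots> \<le> g a" using h by (simp add: g_def)
  finally show ?thesis by (simp add: g_def)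
qed

text \<open>Beyond a the denominator in \<open>part_prob\<close> is so close to 1 that the Boltzmann
  weight loses only the factor 1 - q: for x at most q, (1 - q) (1 + x) is at most 1 - q^2. Then k is
  replaced by its least value a.\<close>

lemma mean_sum_tail_lower:
  assumes h: "0 < h" and ab: "1 \<le> a" "a \<le> b"
  shows "(1 - exp (- (real a / h))) * (real a * (h * (exp (- (real a / h)) - exp (- (real b / h))))) \<le>
    mean_sum h b - mean_sum h a"
proof -
  let ?q = "exp (- (real a / h))"
  have q: "?q \<le> 1" using h by simp
  have "(1 - ?q) * (real a * (h * (?q - exp (- (real b / h))))) \<le> (1 - ?q) * (real a * (\<Sum>k=a..<b. exp (-
    (real k / h))))"
    by (intro mult_left_mono geom_exp_lower h ab) (use q in auto)
  also have "\<dots> = (\<Sum>k=a..<b. real a * ((1 - ?q) * exp (- (real k / h))))"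
    by (simp add: sum_distrib_left mult_ac)
  also have "\<dots> \<le> (\<Sum>k=a..<b. real k * part_prob h k)"
  proof (intro sum_mono mult_mono)
    fix k assume k: "k \<in> {a..<b}"
    let ?x = "exp (- (real k / h))"
    have xq: "?x \<le> ?q" using k h by (simp add: divide_right_mono)
    have "(1 - ?q) * (1 + ?x) \<le> (1 - ?q) * (1 + ?q)" by (intro mult_left_mono) (use q xq in auto)
    also have "\<dots> \<le> 1" by (simp add: algebra_simps)
    finally have "(1 - ?q) * (1 + ?x) * ?x \<le> 1 * ?x" by (intro mult_right_mono) auto
    moreover have "0 < 1 + ?x" by (simp add: add_pos_pos)
    ultimately show "(1 - ?q) * ?x \<le> part_prob h k" unfolding part_prob_def by (simp add: pos_le_divide_eq
      mult_ac)
  qed (use q in auto)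
  also have "\<dots> = mean_sum h b - mean_sum h a"
    unfolding mean_sum_def using sum.atLeastLessThan_concat[OF ab, of "\<lambda>k. real k * part_prob h k"] by simp
  finally show ?thesis .
qed

section \<open>From pairs of sets to sequences\<close>

definition pair_count :: "nat \<Rightarrow> nat \<Rightarrow> nat \<Rightarrow> nat" where
  "pair_count a b N = card {(X, Z). X \<subseteq> {1..<a} \<and> Z \<subseteq> {1..<b} \<and> \<Sum>X + \<Sum>Z = N}"

lemma pair_count_finite: "finite {(X, Z). X \<subseteq> {1..<a::nat} \<and> Z \<subseteq> {1..<b::nat} \<and> \<Sum>X + \<Sum>Z = N}"
  by (rule finite_subset[of _ "Pow {1..<a} \<times> Pow {1..<b}"]) auto

text \<open>All configurations of total size N have the same Boltzmann weight exp (- N / h),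
  whatever \<open>h\<close> is, so multiplying the point probability by the normalising product
  counts them.\<close>

lemma pr_pair_count: "bs.pr a b h (int N) * (part_prod h a * part_prod h b) = real (pair_count a b N) *
  exp (- (real N / h))"
proof -
  let ?w = "case_sum (\<lambda>k::nat. k) (\<lambda>k. k)"
  let ?q = "\<lambda>i. exp (- (real (?w i) / h))"
  let ?S = "{J. J \<subseteq> part_idx a b \<and> int (\<Sum>i\<in>J. ?w i) = int N}"
  have fin: "finite (part_idx a b)" by (simp add: part_idx_def)
  have PPI: "(\<Prod>i\<in>part_idx a b. 1 + ?q i) = part_prod h a * part_prod h b"
    unfolding part_prod_def part_idx_def by (subst prod.Plus) auto
  have q0: "1 + ?q i \<noteq> 0" for i using add_pos_pos[of 1 "?q i"] by (smt (verit) exp_gt_zero)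
  have pw: "case_sum (part_prob h) (part_prob h) i = ?q i / (1 + ?q i)" for i by (cases i) (auto simp:
    part_prob_def)
  have wt: "bs.wt a b h J * (part_prod h a * part_prod h b) = exp (- (real N / h))" if J: "J \<in> ?S" for J
  proof -
    have sub: "J \<subseteq> part_idx a b" using J by blast
    have "int (\<Sum>i\<in>J. ?w i) = int N" using J by blast
    then have sums: "(\<Sum>i\<in>J. ?w i) = N" by (simp only: of_nat_eq_iff)
    have fJ: "finite J" using sub fin finite_subset by blast
    have "part_prod h a * part_prod h b = (\<Prod>i\<in>J. 1 + ?q i) * (\<Prod>i\<in>part_idx a b - J. 1 + ?q i)"
      unfolding PPI[symmetric] by (rule prod.subset_diff[OF sub fin, THEN trans]) (rule mult.commute)
    moreover have "bs.wt a b h J = (\<Prod>i\<in>J. ?q i / (1 + ?q i)) * (\<Prod>i\<in>part_idx a b - J. 1 / (1 + ?q i))"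
      unfolding bs.wt_def pw using q0 by (intro arg_cong2[of _ _ _ _ "(*)"] prod.cong refl) (simp add:
        field_simps)
    ultimately have "bs.wt a b h J * (part_prod h a * part_prod h b) =
      ((\<Prod>i\<in>J. ?q i / (1 + ?q i)) * (\<Prod>i\<in>J. 1 + ?q i)) * ((\<Prod>i\<in>part_idx a b - J. 1 / (1 + ?q i)) * (\<Prod>i\<in>part_idx
        a b - J. 1 + ?q i))"
      by (simp only: mult_ac)
    also have "\<dots> = (\<Prod>i\<in>J. ?q i)"
      unfolding prod.distrib[symmetric] using q0 by simp
    also have "\<dots> = exp (- (real (\<Sum>i\<in>J. ?w i) / h))"
      using fJ by (simp add: exp_sum[symmetric] sum_negf sum_divide_distrib)
    finally show ?thesis by (simp add: sums)
  qed
  have "card ?S = pair_count a b N"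
  proof -
    have "bij_betw (\<lambda>(X, Z). X <+> Z) {(X, Z). X \<subseteq> {1..<a} \<and> Z \<subseteq> {1..<b} \<and> \<Sum>X + \<Sum>Z = N} ?S"
    proof (rule bij_betw_imageI)
      show "inj_on (\<lambda>(X, Z). X <+> Z) {(X, Z). X \<subseteq> {1..<a} \<and> Z \<subseteq> {1..<b} \<and> \<Sum>X + \<Sum>Z = N}"
        by (auto simp: inj_on_def Plus_def)
      have sumP: "(\<Sum>i\<in>X <+> Z. ?w i) = \<Sum>X + \<Sum>Z" if "X \<subseteq> {1..<a}" "Z \<subseteq> {1..<b}" for X Z
        using that by (subst sum.Plus) (auto intro: finite_subset)
      show "(\<lambda>(X, Z). X <+> Z) ` {(X, Z). X \<subseteq> {1..<a} \<and> Z \<subseteq> {1..<b} \<and> \<Sum>X + \<Sum>Z = N} = ?S" (is "?f ` ?A = _")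
      proof (intro equalityI subsetI)
        fix J assume "J \<in> ?f ` ?A"
        then obtain X Z where XZ: "X \<subseteq> {1..<a}" "Z \<subseteq> {1..<b}" "\<Sum>X + \<Sum>Z = N" "J = X <+> Z" by auto
        have "(\<Sum>i\<in>J. ?w i) = N" using sumP[OF XZ(1,2)] XZ(3,4) by simp
        moreover have "J \<subseteq> part_idx a b" using XZ by (auto simp: part_idx_def)
        ultimately show "J \<in> ?S" by (simp only: mem_Collect_eq simp_thms)
      next
        fix J assume J: "J \<in> ?S"
        define X Z where "X = Inl -` J" and "Z = Inr -` J"
        have JX: "J = X <+> Z" unfolding X_def Z_def Plus_def using sum.exhaust by (auto simp:
          image_iff) (metis sum.exhaust)
        have XZ: "X \<subseteq> {1..<a}" "Z \<subseteq> {1..<b}" using J unfolding X_def Z_def part_idx_def by auto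
        have "int (\<Sum>i\<in>J. ?w i) = int N" using J by blast
        then have "(\<Sum>i\<in>J. ?w i) = N" by (simp only: of_nat_eq_iff)
        then have "\<Sum>X + \<Sum>Z = N" using sumP[OF XZ] unfolding JX by simp
        then show "J \<in> ?f ` ?A" using XZ JX by (intro image_eqI[of _ _ "(X, Z)"]) auto
      qed
    qed
    then show ?thesis unfolding pair_count_def by (rule bij_betw_same_card[symmetric])
  qed
  moreover have "bs.pr a b h (int N) * (part_prod h a * part_prod h b) = (\<Sum>J\<in>?S. exp (- (real N / h)))"
    unfolding bs.pr_def sum_distrib_right by (intro sum.cong refl wt)
  ultimately show ?thesis by simp
qed

lemma strict_sorted_set_eq:
  assumes "sorted_wrt (<) xs" "sorted_wrt (<) ys" "set xs = set (ys :: nat list)"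
  shows "xs = ys"
  using assms strict_sorted_equal by blast

lemma sum_list_strict: "sorted_wrt (<) (xs :: nat list) \<Longrightarrow> sum_list xs = \<Sum>(set xs)"
  by (simp add: sum_list_distinct_conv_sum_set[of xs "\<lambda>x. x", simplified] strict_sorted_iff)

text \<open>A strictly sorted list is determined by its set of entries, so a sequence is determined
  by its peak and the sets of parts on both sides.\<close>

lemma card_peak_le: "card {s \<in> ustar n. PK s \<in> W} \<le> (\<Sum>m\<in>{1..n} \<inter> W. pair_count m m (n - m))"
proof -
  let ?f = "\<lambda>s. (PK s, set (left_parts s), set (right_parts s))"
  let ?B = "\<lambda>m. {(X, Z). X \<subseteq> {1..<m} \<and> Z \<subseteq> {1..<m} \<and> \<Sum>X + \<Sum>Z = n - m}"
  have U: "sorted_wrt (<) (left_parts s)" "sorted_wrt (<) (rev (right_parts s))"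
    "set (left_parts s) \<subseteq> {1..<PK s}" "set (right_parts s) \<subseteq> {1..<PK s}" "1 \<le> PK s"
    "PK s + \<Sum>(set (left_parts s)) + \<Sum>(set (right_parts s)) = n" if "s \<in> ustar n" for s
  proof -
    have s: "sorted_wrt (<) (left_parts s @ [PK s])" "sorted_wrt (>) (PK s # right_parts s)"
      "\<forall>x \<in> set (left_parts s @ PK s # right_parts s). 0 < x" "seq_size s = n"
      using that by (auto simp: ustar_def strongly_unimodal_def)
    show 1: "sorted_wrt (<) (left_parts s)" "sorted_wrt (<) (rev (right_parts s))"
      using s by (auto simp: sorted_wrt_append sorted_wrt_rev)
    show "set (left_parts s) \<subseteq> {1..<PK s}" "set (right_parts s) \<subseteq> {1..<PK s}" "1 \<le> PK s"
      using s by (auto simp: sorted_wrt_append Suc_le_eq)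
    show "PK s + \<Sum>(set (left_parts s)) + \<Sum>(set (right_parts s)) = n"
      using s(4) sum_list_strict[OF 1(1)] sum_list_strict[OF 1(2)] by (simp add: seq_size_def)
  qed
  let ?U = "{s \<in> ustar n. PK s \<in> W}"
  have inj: "inj_on ?f ?U"
  proof (rule inj_onI)
    fix s s' assume "s \<in> ?U" "s' \<in> ?U" and eq: "?f s = ?f s'"
    then have a: "s \<in> ustar n" "s' \<in> ustar n" "?f s = ?f s'" by auto
    have "left_parts s = left_parts s'" by (rule strict_sorted_set_eq[OF U(1)[OF a(1)] U(1)[OF a(2)]]) (use
      a(3) in simp)
    moreover have "rev (right_parts s) = rev (right_parts s')"
      by (rule strict_sorted_set_eq[OF U(2)[OF a(1)] U(2)[OF a(2)]]) (use a(3) in simp)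
    ultimately show "s = s'" using a(3) by (cases s, cases s') simp
  qed
  have sub: "?f ` ?U \<subseteq> (SIGMA m:{1..n} \<inter> W. ?B m)"
  proof
    fix x assume "x \<in> ?f ` ?U"
    then obtain s where s: "s \<in> ustar n" "x = ?f s" "PK s \<in> W" by blast
    show "x \<in> (SIGMA m:{1..n} \<inter> W. ?B m)" using U(3-6)[OF s(1)] s(2,3) by auto
  qed
  have "card ?U = card (?f ` ?U)" by (rule card_image[OF inj, symmetric])
  also have "\<dots> \<le> card (SIGMA m:{1..n} \<inter> W. ?B m)"
    by (rule card_mono[OF _ sub]) (intro finite_SigmaI pair_count_finite, simp)
  also have "\<dots> = (\<Sum>m\<in>{1..n} \<inter> W. pair_count m m (n - m))"
    unfolding pair_count_def by (rule card_SigmaI) (use pair_count_finite in auto)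
  finally show ?thesis .
qed

lemma card_ustar_le: "card (ustar n) \<le> (\<Sum>m=1..n. pair_count m m (n - m))"
  using card_peak_le[of n UNIV] by simp

text \<open>Only this bound from below is needed for the joint law of the largest parts; the matching upper bound
  comes for free from the total mass.\<close>

lemma card_top_ge:
  assumes T: "1 \<le> T" and dec: "\<And>j t. t < T \<Longrightarrow> z (side_coord j (Suc t)) < z (side_coord j t)"
    and p: "\<And>j. 1 \<le> z (Part j T)" and sz: "(\<Sum>c\<in>coords T. z c) \<le> n"
  shows "pair_count (z (Part L T)) (z (Part R T)) (n - (\<Sum>c\<in>coords T. z c)) \<le>
     card {s \<in> ustar n. PK s = z Peak \<and> (\<forall>j. \<forall>t\<in>{1..T}. Y j t s = z (Part j t))}"
proof -
  define zs where "zs j = map (\<lambda>t. z (Part j t)) [1..<Suc T]" for j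
  have lz: "length (zs j) = T" for j by (simp add: zs_def)
  have nz: "zs j ! i = z (Part j (Suc i))" if "i < T" for i j using that by (simp add: zs_def del: upt_Suc)
  have dec': "z (side_coord j t') < z (side_coord j t)" if "t < t'" "t' \<le> T" for j t t'
  proof -
    have "Suc t \<le> t'" using that by simp
    then show ?thesis using that(2)
    proof (induction t' rule: dec_induct)
      case base
      then show ?case using dec[of t j] by simp
    next
      case (step m)
      then show ?case using dec[of m j] by simp
    qed
  qed
  have zdec: "sorted_wrt (>) (zs j)" for j
    unfolding sorted_wrt_iff_nth_less
    using dec' by (auto simp: lz nz side_coord_def) (metis Suc_less_eq Suc_leI nat.simps(3) side_coord_def)
  have zset: "set (zs j) = (\<lambda>t. z (Part j t)) ` {1..T}" for j
    by (simp add: zs_def atLeastLessThanSuc_atLeastAtMost del: upt_Suc)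
  have zmem: "z (Part j T) \<le> x \<and> x < z Peak" if xz: "x \<in> set (zs j)" for j x
  proof -
    obtain t where t: "t \<in> {1..T}" "x = z (Part j t)" using xz unfolding zset by blast
    have "x < z Peak" using dec'[of 0 t j] t by (simp add: side_coord_def)
    moreover have "z (Part j T) \<le> x"
      using dec'[of t T j] t by (cases "t = T") (auto simp: side_coord_def split: if_splits)
    ultimately show ?thesis by simp
  qed
  let ?f = "\<lambda>(X, Z). USeq (sorted_list_of_set X @ rev (zs L)) (z Peak) (zs R @ rev (sorted_list_of_set Z))"
  let ?D = "{(X, Z). X \<subseteq> {1..<z (Part L T)} \<and> Z \<subseteq> {1..<z (Part R T)} \<and> \<Sum>X + \<Sum>Z = n - (\<Sum>c\<in>coords T. z c)}"
  let ?E = "{s \<in> ustar n. PK s = z Peak \<and> (\<forall>j. \<forall>t\<in>{1..T}. Y j t s = z (Part j t))}"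
  have inj: "inj_on ?f ?D"
  proof (rule inj_onI)
    fix x x' assume a: "x \<in> ?D" "x' \<in> ?D" and eq: "?f x = ?f x'"
    obtain X Z X' Z' where x: "x = (X, Z)" "x' = (X', Z')" by (cases x, cases x')
    have "finite X" "finite Z" "finite X'" "finite Z'" using a by (auto simp: x intro: finite_subset)
    moreover have "sorted_list_of_set X = sorted_list_of_set X'" "sorted_list_of_set Z = sorted_list_of_set Z'"
      using eq by (auto simp: x)
    ultimately show "x = x'" unfolding x by (metis sorted_list_of_set.set_sorted_key_list_of_set)
  qed
  have "?f ` ?D \<subseteq> ?E"
  proof
    fix s assume "s \<in> ?f ` ?D"
    then obtain X Z where X: "X \<subseteq> {1..<z (Part L T)}" and Z: "Z \<subseteq> {1..<z (Part R T)}"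
      and sizes: "\<Sum>X + \<Sum>Z = n - (\<Sum>c\<in>coords T. z c)" and s: "s = ?f (X, Z)" by blast
    define xs where "xs = sorted_list_of_set X"
    define ys where "ys = sorted_list_of_set Z"
    have fX: "finite X" "finite Z" using X Z by (auto intro: finite_subset)
    have xs: "sorted_wrt (<) xs" "set xs = X" "sum_list xs = \<Sum>X"
      using fX sum_list_strict[of xs] by (auto simp: xs_def)
    have ys: "sorted_wrt (<) ys" "set ys = Z" "sum_list ys = \<Sum>Z"
      using fX sum_list_strict[of ys] by (auto simp: ys_def)
    let ?s = "USeq (xs @ rev (zs L)) (z Peak) (zs R @ rev ys)"
    have zp: "z (Part j T) < z Peak" for j using zmem[of "z (Part j T)" j] T unfolding zset by force
    have L1: "sorted_wrt (<) (xs @ rev (zs L))"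
      using xs zdec[of L] zmem[of _ L] X by (fastforce simp: sorted_wrt_append sorted_wrt_rev)
    have R1: "sorted_wrt (<) (ys @ rev (zs R))"
      using ys zdec[of R] zmem[of _ R] Z by (fastforce simp: sorted_wrt_append sorted_wrt_rev)
    have R2: "sorted_wrt (>) (zs R @ rev ys)"
    proof -
      have "zs R @ rev ys = rev (ys @ rev (zs R))" by simp
      then show ?thesis using R1 by (simp only: sorted_wrt_rev)
    qed
    have bL: "\<forall>x\<in>set (xs @ rev (zs L)). x < z Peak \<and> 0 < x"
      using xs X zmem[of _ L] p[of L] zp[of L] by fastforce
    have bR: "\<forall>x\<in>set (zs R @ rev ys). x < z Peak \<and> 0 < x"
      using ys Z zmem[of _ R] p[of R] zp[of R] by fastforce
    have su: "strongly_unimodal ?s"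
      unfolding strongly_unimodal_def using L1 R2 bL bR zp[of L] by (auto simp: sorted_wrt_append)
    have "sum_list (zs j) = (\<Sum>t=1..T. z (Part j t))" for j
      unfolding zs_def by (simp only: sum_set_upt_conv_sum_list_nat[symmetric]) (simp add:
        atLeastLessThanSuc_atLeastAtMost del: upt_Suc)
    moreover have "(\<Sum>c\<in>coords T. z c) = z Peak + ((\<Sum>t=1..T. z (Part L t)) + (\<Sum>t=1..T. z (Part R t)))"
    proof -
      have "coords T = insert Peak (Part L ` {1..T} \<union> Part R ` {1..T})" by (auto simp: coords_def)
      moreover have "(\<Sum>c\<in>Part j ` {1..T}. z c) = (\<Sum>t=1..T. z (Part j t))" for j
        by (subst sum.reindex) (auto simp: inj_on_def)
      moreover have "(\<Sum>c\<in>Part L ` {1..T} \<union> Part R ` {1..T}. z c) = (\<Sum>c\<in>Part L ` {1..T}. z c) + (\<Sum>c\<in>Part R `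
        {1..T}. z c)"
        by (rule sum.union_disjoint) auto
      moreover have "(\<Sum>c\<in>insert Peak (Part L ` {1..T} \<union> Part R ` {1..T}). z c) = z Peak + (\<Sum>c\<in>Part L `
        {1..T} \<union> Part R ` {1..T}. z c)"
        by (rule sum.insert) auto
      ultimately show ?thesis by simp
    qed
    ultimately have "seq_size ?s = n"
      using sizes sz xs(3) ys(3) by (simp add: seq_size_def)
    with su have inU: "?s \<in> ustar n" by (simp add: ustar_def)
    have srt: "rev (sort (side_parts j ?s)) = zs j @ rev (case j of L \<Rightarrow> xs | R \<Rightarrow> ys)" for j
    proof (cases j)
      case L
      have "sort (xs @ rev (zs L)) = xs @ rev (zs L)" using L1 by (intro sorted_sort_id) (simp add:
        strict_sorted_imp_sorted)
      then show ?thesis using L by simp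
    next
      case R
      have "sort (zs R @ rev ys) = ys @ rev (zs R)"
        by (rule properties_for_sort) (use R1 in \<open>auto simp: strict_sorted_imp_sorted\<close>)
      then show ?thesis using R by simp
    qed
    have "Y j t ?s = z (Part j t)" if "t \<in> {1..T}" for j t
    proof -
      have len: "T \<le> length (side_parts j ?s)" by (cases j) (auto simp: lz)
      have "Y j t ?s = rev (sort (side_parts j ?s)) ! (t - 1)" unfolding Y_def using that len by simp
      also have "\<dots> = z (Part j t)"
      proof -
        have t1: "t - 1 < T" using that T by auto
        then show ?thesis unfolding srt using nz[OF t1, of j] that by (simp add: nth_append lz)
      qed
      finally show ?thesis .
    qed
    moreover have "s = ?s" by (simp add: s xs_def ys_def)
    ultimately show "s \<in> ?E" using inU by simp
  qed
  then have "card (?f ` ?D) \<le> card ?E" by (intro card_mono) (auto intro: finite_subset[OF _ finite_ustar])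
  then show ?thesis unfolding pair_count_def card_image[OF inj] .
qed

section \<open>An upper bound for the number of sequences\<close>

context bernoulli_sum
begin

lemma pr_le_1: "pr N \<le> 1"
proof -
  have wt0: "0 \<le> wt J" if "J \<in> Pow I" for J
    unfolding wt_def using that p by (intro mult_nonneg_nonneg prod_nonneg) (auto simp: subset_eq)
  have "pr N = (\<Sum>J\<in>{J \<in> Pow I. int (\<Sum>i\<in>J. w i) = N}. wt J)" unfolding pr_def by (simp add: Pow_def)
  also have "\<dots> \<le> (\<Sum>J\<in>Pow I. wt J)" by (intro sum_mono2) (use fin wt0 in auto)
  also have "\<dots> = (\<Prod>i\<in>I. p i + (1 - p i))" unfolding wt_def by (rule prod_add[OF fin, symmetric])
  also have "\<dots> = 1" by simp
  finally show ?thesis .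
qed

lemma pr_nonneg: "0 \<le> pr N"
  unfolding pr_def wt_def using p by (intro sum_nonneg mult_nonneg_nonneg prod_nonneg) auto

end

definition total_var :: "nat \<Rightarrow> real" where "total_var n = 2 * moment_sum (hscale n) 2 (n + 1)"

text \<open>The predicted number of sequences: inverse Boltzmann weight, half the squared full
  product from the telescoping sum over peaks, and the central density of a Gaussian with variance
  \<open>total_var n\<close>.\<close>

definition ustar_asymp :: "nat \<Rightarrow> real" where
  "ustar_asymp n = exp (real n / hscale n) * (part_prod (hscale n) (n + 1))\<^sup>2 / (2 * sqrt (2 * pi *
    total_var n))"

lemma pair_count_eq_pr: "real (pair_count a b N) = bs.pr a b h (int N) * (part_prod h a * part_prod h b) *
  exp (real N / h)"
proof -
  have "exp (- (real N / h)) * exp (real N / h) = 1" by (simp add: exp_add[symmetric])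
  then show ?thesis using pr_pair_count[of a b h N] by (simp add: mult.assoc)
qed

text \<open>Cutting at h ln h / 2 or above loses at most a relative h^(-1/4) of the second moment,
  up to the constant 9216 = 32 * 288. So every truncated model has asymptotically the variance of
  the full one.\<close>

lemma moment_sum_ratio:
  assumes e: "0 < (\<epsilon>::real)" "\<epsilon> < 1"
  shows "\<forall>\<^sub>F h in at_top. \<forall>a c. h * ln h / 2 \<le> real a \<longrightarrow> (1 - \<epsilon>) * moment_sum h 2 c \<le> moment_sum h 2 a"
proof -
  have "((\<lambda>h::real. 9216 * exp (- (ln h / 4))) \<longlongrightarrow> 0) at_top" by real_asymp
  then have "\<forall>\<^sub>F h in at_top. 9216 * exp (- (ln h / 4)) < \<epsilon>"
    by (rule order_tendstoD) (use e in simp)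
  moreover have "\<forall>\<^sub>F h::real in at_top. h + 1 \<le> h * ln h / 2" by real_asymp
  ultimately show ?thesis using eventually_ge_at_top[of 1]
  proof eventually_elim
    case (elim h)
    show ?case
    proof (intro allI impI)
      fix a c :: nat assume a: "h * ln h / 2 \<le> real a"
      have a1: "h + 1 \<le> real a" using a elim by linarith
      have low: "h ^ 3 / 288 \<le> moment_sum h 2 a" by (rule moment_sum_2_lower) (use elim a1 in auto)
      have "moment_sum h 2 c - moment_sum h 2 a \<le> fact 2 * 2 ^ (2 + 2) * h ^ (2 + 1) * exp (- (real a / (2 *
        h)))"
        by (rule moment_sum_tail) (use elim a1 in auto)
      also have "\<dots> = 32 * h ^ 3 * exp (- (real a / (2 * h)))" by (simp add: eval_nat_numeral)
      also have "\<dots> \<le> 32 * h ^ 3 * exp (- (ln h / 4))"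
      proof -
        have "ln h / 4 \<le> real a / (2 * h)" using a elim by (simp add: field_simps)
        then show ?thesis using elim by (intro mult_left_mono) auto
      qed
      also have "\<dots> = (h ^ 3 / 288) * (9216 * exp (- (ln h / 4)))" by simp
      also have "\<dots> \<le> moment_sum h 2 a * \<epsilon>"
        by (intro mult_mono low) (use elim moment_sum_nonneg in auto)
      finally have "moment_sum h 2 c \<le> moment_sum h 2 a * (1 + \<epsilon>)" by (simp add: algebra_simps)
      then have "(1 - \<epsilon>) * moment_sum h 2 c \<le> (1 - \<epsilon>) * (moment_sum h 2 a * (1 + \<epsilon>))"
        by (intro mult_left_mono) (use e in auto)
      also have "\<dots> = moment_sum h 2 a * (1 - \<epsilon>\<^sup>2)" by (simp add: power2_eq_square algebra_simps)
      also have "\<dots> \<le> moment_sum h 2 a * 1" by (intro mult_left_mono moment_sum_nonneg) auto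
      finally show "(1 - \<epsilon>) * moment_sum h 2 c \<le> moment_sum h 2 a" by simp
    qed
  qed
qed

lemma pr_upper_full:
  assumes e: "0 < (\<epsilon>::real)"
  shows "\<forall>\<^sub>F n in sequentially. \<forall>m N. hscale n * ln (hscale n) / 2 \<le> real m \<longrightarrow>
     bs.pr m m (hscale n) N * sqrt (2 * pi * total_var n) \<le> 1 + \<epsilon>"
proof -
  \<comment> \<open>One factor 1 + \<open>\<delta>\<close> comes from the local limit theorem and
    one from exchanging the variances; their product is at most 1 + 3 \<open>\<delta>\<close>. The
    number \<open>\<rho>\<close> is the loss of variance corresponding to the second factor.\<close>
  define \<delta> where "\<delta> = min 1 (\<epsilon> / 3)"
  have d: "0 < \<delta>" "\<delta> \<le> 1" "\<delta> \<le> \<epsilon> / 3" using e by (auto simp: \<delta>_def)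
  define \<rho> where "\<rho> = 1 - 1 / (1 + \<delta>)\<^sup>2"
  have "1 < (1 + \<delta>)\<^sup>2" using d by (intro one_less_power) auto
  then have r: "0 < \<rho>" "\<rho> < 1" by (auto simp: \<rho>_def divide_less_eq)
  have "\<forall>\<^sub>F h::real in at_top. h + 1 \<le> h * ln h / 2" by real_asymp
  with LLT_upper[OF d(1)] moment_sum_ratio[OF r]
  have "\<forall>\<^sub>F h in at_top. \<forall>m c N. h * ln h / 2 \<le> real m \<longrightarrow>
     bs.pr m m h N * sqrt (2 * pi * (2 * moment_sum h 2 c)) \<le> 1 + \<epsilon>"
  proof eventually_elim
    case (elim h)
    show ?case
    proof (intro allI impI)
      fix m c :: nat and N :: int assume m: "h * ln h / 2 \<le> real m"
      have "h + 1 \<le> real m" using m elim by linarith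
      then have 1: "bs.pr m m h N * sqrt (2 * pi * (2 * moment_sum h 2 m)) \<le> 1 + \<delta>"
      proof -
        have "bs.mom m m h 2 = 2 * moment_sum h 2 m" by (simp add: bs_mom)
        then show ?thesis using elim(1) \<open>h + 1 \<le> real m\<close> by metis
      qed
      have "(1 / (1 + \<delta>)\<^sup>2) * moment_sum h 2 c \<le> moment_sum h 2 m" using elim(2) m by (simp add: \<rho>_def)
      then have "moment_sum h 2 c \<le> (1 + \<delta>)\<^sup>2 * moment_sum h 2 m" using d by (simp add: field_simps)
      then have "sqrt (2 * pi * (2 * moment_sum h 2 c)) \<le> sqrt ((1 + \<delta>)\<^sup>2 * (2 * pi * (2 * moment_sum h 2
        m)))" by simp
      also have "\<dots> = (1 + \<delta>) * sqrt (2 * pi * (2 * moment_sum h 2 m))"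
        unfolding real_sqrt_mult[of "(1 + \<delta>)\<^sup>2"] using d by simp
      finally have "bs.pr m m h N * sqrt (2 * pi * (2 * moment_sum h 2 c)) \<le> bs.pr m m h N * ((1 + \<delta>) *
        sqrt (2 * pi * (2 * moment_sum h 2 m)))"
        by (intro mult_left_mono bs.pr_nonneg)
      also have "\<dots> = (1 + \<delta>) * (bs.pr m m h N * sqrt (2 * pi * (2 * moment_sum h 2 m)))" by simp
      also have "\<dots> \<le> (1 + \<delta>) * (1 + \<delta>)" by (intro mult_left_mono 1) (use d in auto)
      also have "\<dots> = 1 + 2 * \<delta> + \<delta> * \<delta>" by (simp add: algebra_simps)
      also have "\<dots> \<le> 1 + 2 * \<delta> + \<delta> * 1" using d by (intro add_mono mult_left_mono order_refl) auto
      also have "\<dots> \<le> 1 + \<epsilon>" using d by simp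
      finally show "bs.pr m m h N * sqrt (2 * pi * (2 * moment_sum h 2 c)) \<le> 1 + \<epsilon>" .
    qed
  qed
  from eventually_compose_filterlim[OF this hscale_filterlim] show ?thesis
    by eventually_elim (auto simp: total_var_def)
qed

text \<open>Peaks below \<open>h ln h / 2\<close> carry an exponentially small part of the mass.\<close>

definition small_peak_mass :: "real \<Rightarrow> real" where
  "small_peak_mass h = sqrt (2 * pi * (64 * h ^ 3)) * exp (h * exp (- h) - sqrt h / 2)"

lemma small_peak_mass_tendsto: "(small_peak_mass \<longlongrightarrow> 0) at_top"
  unfolding small_peak_mass_def by real_asymp

lemma total_var_bounds:
  assumes "2 \<le> hscale n"
  shows "(hscale n) ^ 3 / 144 \<le> total_var n" "total_var n \<le> 64 * (hscale n) ^ 3" "0 < total_var n"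
proof -
  have nh: "hscale n + 1 \<le> real (n + 1)"
  proof -
    have "hscale n * 1 \<le> hscale n * hscale n" using assms by (intro mult_left_mono) auto
    then show ?thesis using hscale_sq_le[of n] by (simp add: power2_eq_square)
  qed
  show 1: "(hscale n) ^ 3 / 144 \<le> total_var n" using moment_sum_2_lower[of "hscale n" "n + 1"] nh assms
    by (simp add: total_var_def)
  have "0 < (hscale n) ^ 3 / 144" using assms by simp
  with 1 show "0 < total_var n" by linarith
  show "total_var n \<le> 64 * (hscale n) ^ 3" using moment_sum_le[of "hscale n" 2 "n + 1"] assms by (simp add:
    total_var_def eval_nat_numeral)
qed

text \<open>The factors between M and n raise the squared product by exp (h (exp (- M / h) - exp (-
  n / h))) or more. For M near h ln h / 2 this exponent is about sqrt h / 2 or larger, which beats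
  the polynomial factor from the variance.\<close>

lemma part_prod_small:
  assumes h: "2 \<le> hscale n" and M: "1 \<le> M" "M \<le> n + 1" "real M \<le> hscale n * ln (hscale n) / 2 + 1"
  shows "(part_prod (hscale n) M)\<^sup>2 * sqrt (2 * pi * total_var n) \<le> (part_prod (hscale n) (n + 1))\<^sup>2 *
    small_peak_mass (hscale n)"
proof -
  let ?h = "hscale n"
  have ge: "1 / (2 * sqrt ?h) \<le> exp (- (real M / ?h))"
  proof -
    have "real M / ?h \<le> (?h * ln ?h / 2 + 1) / ?h" using M h by (intro divide_right_mono) auto
    also have "\<dots> = ln ?h / 2 + 1 / ?h" using h by (simp add: add_divide_distrib)
    also have "\<dots> \<le> ln ?h / 2 + 1 / 2" using h by simp
    finally have "exp (- (ln ?h / 2 + 1 / 2)) \<le> exp (- (real M / ?h))" by simp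
    moreover have "exp (- (ln ?h / 2 + 1 / 2)) = exp (- (1 / 2)) / sqrt ?h"
    proof -
      have "exp (ln ?h / 2) = sqrt ?h"
      proof -
        have "exp (ln ?h / 2) * exp (ln ?h / 2) = ?h" using h by (simp add: exp_add[symmetric])
        then show ?thesis by (metis abs_of_nonneg exp_ge_zero real_sqrt_mult_self real_sqrt_abs2)
      qed
      moreover have "exp (- (ln ?h / 2 + 1 / 2)) = exp (- (1 / 2)) * exp (- (ln ?h / 2))" by (simp add:
        exp_add[symmetric])
      moreover have "exp (- (ln ?h / 2)) = 1 / exp (ln ?h / 2)" by (simp only: exp_minus inverse_eq_divide)
      ultimately show ?thesis by (simp only: times_divide_eq_right mult_1_right)
    qed
    moreover have "1 / 2 \<le> exp (- (1 / 2 :: real))" using exp_ge_add_one_self[of "- (1 / 2)"] by simp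
    then have "(1 / 2) / sqrt ?h \<le> exp (- (1 / 2)) / sqrt ?h" using h by (intro divide_right_mono) auto
    moreover have "1 / (2 * sqrt ?h) = (1 / 2) / sqrt ?h" by simp
    ultimately show ?thesis by linarith
  qed
  have ge2: "exp (- (real (n + 1) / ?h)) \<le> exp (- ?h)"
  proof -
    have "?h * ?h \<le> real (n + 1)" using hscale_sq_le[of n] by (simp add: power2_eq_square)
    then show ?thesis using h by (simp add: field_simps)
  qed
  have "sqrt ?h / 2 - ?h * exp (- ?h) \<le> ?h * (exp (- (real M / ?h)) - exp (- (real (n + 1) / ?h)))"
  proof -
    have "?h * (1 / (2 * sqrt ?h) - exp (- ?h)) \<le> ?h * (exp (- (real M / ?h)) - exp (- (real (n + 1) / ?h)))"
      by (intro mult_left_mono diff_mono ge ge2) (use h in simp)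
    moreover have "?h * (1 / (2 * sqrt ?h)) = sqrt ?h / 2" using h by (simp add: real_div_sqrt)
    ultimately show ?thesis by (simp add: right_diff_distrib)
  qed
  then have E: "exp (sqrt ?h / 2 - ?h * exp (- ?h)) \<le> (exp (?h * (exp (- (real M / ?h)) - exp (- (real (n +
    1) / ?h))) / 2))\<^sup>2"
    by (simp add: power2_eq_square exp_add[symmetric])
  have "(part_prod ?h M)\<^sup>2 * exp (sqrt ?h / 2 - ?h * exp (- ?h)) \<le> (part_prod ?h M * exp (?h * (exp (- (real
    M / ?h)) - exp (- (real (n + 1) / ?h))) / 2))\<^sup>2"
    unfolding power_mult_distrib by (intro mult_left_mono E) auto
  also have "\<dots> \<le> (part_prod ?h (n + 1))\<^sup>2"
    by (intro power_mono part_prod_ratio_lower mult_nonneg_nonneg) (use h M part_prod_pos[of ?h M] in auto)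
  finally have "(part_prod ?h M)\<^sup>2 * exp (sqrt ?h / 2 - ?h * exp (- ?h)) * exp (?h * exp (- ?h) - sqrt ?h
    / 2) \<le> (part_prod ?h (n + 1))\<^sup>2 * exp (?h * exp (- ?h) - sqrt ?h / 2)"
    by (rule mult_right_mono) simp
  then have 1: "(part_prod ?h M)\<^sup>2 \<le> (part_prod ?h (n + 1))\<^sup>2 * exp (?h * exp (- ?h) - sqrt ?h / 2)"
    by (simp add: mult.assoc exp_add[symmetric])
  have "(part_prod ?h M)\<^sup>2 * sqrt (2 * pi * total_var n) \<le> ((part_prod ?h (n + 1))\<^sup>2 * exp (?h *
    exp (- ?h) - sqrt ?h / 2)) * sqrt (2 * pi * (64 * ?h ^ 3))"
    by (intro mult_mono 1) (use total_var_bounds[OF h] in auto)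
  then show ?thesis by (simp add: small_peak_mass_def mult_ac)
qed

lemma low_peak_le_n: "\<forall>\<^sub>F n in sequentially. hscale n * ln (hscale n) / 2 + 1 \<le> real n"
proof -
  have "\<forall>\<^sub>F h::real in at_top. h * ln h / 2 + 1 \<le> h\<^sup>2" by real_asymp
  from eventually_compose_filterlim[OF this hscale_filterlim] show ?thesis
    by eventually_elim (use hscale_sq_le order_trans in blast)
qed

text \<open>Peaks from \<open>M\<close> on obey the uniform upper bound of the local limit theorem,
  and the sum over them telescopes. For smaller peaks the trivial bound 1 on the point probability
  is enough, as their share of the telescoping sum is negligible.\<close>

lemma card_ustar_upper:
  assumes e: "0 < (\<epsilon>::real)"
  shows "\<forall>\<^sub>F n in sequentially. real (card (ustar n)) \<le> (1 + \<epsilon>) * ustar_asymp n"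
proof -
  have "\<forall>\<^sub>F h in at_top. small_peak_mass h < \<epsilon> / 2" by (rule order_tendstoD[OF small_peak_mass_tendsto])
    (use e in simp)
  from eventually_compose_filterlim[OF this hscale_filterlim]
  have t: "\<forall>\<^sub>F n in sequentially. small_peak_mass (hscale n) < \<epsilon> / 2" .
  have "\<forall>\<^sub>F n in sequentially. 2 \<le> hscale n" using hscale_filterlim by (simp add: filterlim_at_top)
  with t pr_upper_full[OF half_gt_zero[OF e]] low_peak_le_n show ?thesis
  proof eventually_elim
    case (elim n)
    let ?h = "hscale n" and ?s = "sqrt (2 * pi * total_var n)"
    define M where "M = nat \<lceil>?h * ln ?h / 2\<rceil>"
    have mlo: "0 < ?h * ln ?h / 2" using elim by simp
    have M: "1 \<le> M" "M \<le> n + 1" "real M \<le> ?h * ln ?h / 2 + 1" "?h * ln ?h / 2 \<le> real M"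
      using mlo elim(3) unfolding M_def by linarith+
    have s0: "0 < ?s" using total_var_bounds(3)[OF elim(4)] by simp
    let ?g = "\<lambda>m. exp (- (real m / ?h)) * (part_prod ?h m)\<^sup>2"
    have g0: "0 \<le> ?g m" for m by simp
    have ct: "real (pair_count m m (n - m)) = exp (real n / ?h) * (?g m * bs.pr m m ?h (int (n - m)))"
      if "m \<le> n" for m
    proof -
      have "exp (real (n - m) / ?h) = exp (real n / ?h) * exp (- (real m / ?h))"
        using that by (simp add: exp_add[symmetric] of_nat_diff diff_divide_distrib)
      then show ?thesis unfolding pair_count_eq_pr[of m m "n - m" ?h] by (simp add: power2_eq_square)
    qed
    have "(\<Sum>m=1..n. ?g m * bs.pr m m ?h (int (n - m))) * ?s \<le>
       (\<Sum>m=1..n. ?g m * (1 + \<epsilon> / 2) + (if m < M then ?g m * ?s else 0))"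
      unfolding sum_distrib_right
    proof (rule sum_mono)
      fix m assume "m \<in> {1..n}"
      show "?g m * bs.pr m m ?h (int (n - m)) * ?s \<le> ?g m * (1 + \<epsilon> / 2) + (if m < M then ?g m * ?s else 0)"
      proof (cases "m < M")
        case True
        have "?g m * bs.pr m m ?h (int (n - m)) * ?s \<le> ?g m * 1 * ?s"
          by (intro mult_right_mono mult_left_mono bs.pr_le_1 g0) (use s0 in auto)
        moreover have "0 \<le> ?g m * (1 + \<epsilon> / 2)" using e by (intro mult_nonneg_nonneg g0) auto
        ultimately show ?thesis using True by (simp only: mult_1_right if_True)
      next
        case False
        then have "?h * ln ?h / 2 \<le> real m" using M(4) by simp
        then have "bs.pr m m ?h (int (n - m)) * ?s \<le> 1 + \<epsilon> / 2" using elim(2) e by simp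
        then have "?g m * (bs.pr m m ?h (int (n - m)) * ?s) \<le> ?g m * (1 + \<epsilon> / 2)"
          by (rule mult_left_mono[OF _ g0])
        then show ?thesis using False by (simp add: mult.assoc)
      qed
    qed
    also have "\<dots> = (\<Sum>m=1..n. ?g m) * (1 + \<epsilon> / 2) + (\<Sum>m=1..<M. ?g m) * ?s"
    proof -
      have "(\<Sum>m=1..n. if m < M then ?g m * ?s else 0) = (\<Sum>m\<in>{m\<in>{1..n}. m < M}. ?g m * ?s)"
        by (rule sum.inter_filter[symmetric]) simp
      also have "{m\<in>{1..n}. m < M} = {1..<M}" using M by auto
      finally show ?thesis by (simp add: sum.distrib sum_distrib_right)
    qed
    also have "\<dots> \<le> (part_prod ?h (n + 1))\<^sup>2 / 2 * (1 + \<epsilon> / 2) + (part_prod ?h M)\<^sup>2 / 2 * ?s"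
    proof (intro add_mono mult_right_mono)
      have tl: "(\<Sum>m=1..<K. ?g m) \<le> (part_prod ?h K)\<^sup>2 / 2" for K
        using part_prod_telescope[of ?h K] by (simp add: sum_distrib_left[symmetric] mult.assoc)
      have "{1..n} = {1..<n + 1}" by auto
      then show "(\<Sum>m=1..n. ?g m) \<le> (part_prod ?h (n + 1))\<^sup>2 / 2" using tl[of "n + 1"] by simp
      show "(\<Sum>m=1..<M. ?g m) \<le> (part_prod ?h M)\<^sup>2 / 2" by (rule tl)
    qed (use e s0 in auto)
    also have "\<dots> \<le> (part_prod ?h (n + 1))\<^sup>2 / 2 * (1 + \<epsilon> / 2) + (part_prod ?h (n + 1))\<^sup>2 / 2 * (\<epsilon> / 2)"
    proof -
      have "(part_prod ?h M)\<^sup>2 * ?s \<le> (part_prod ?h (n + 1))\<^sup>2 * small_peak_mass ?h"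
        by (rule part_prod_small) (use elim M in auto)
      also have "\<dots> \<le> (part_prod ?h (n + 1))\<^sup>2 * (\<epsilon> / 2)" by (intro mult_left_mono) (use elim in auto)
      finally show ?thesis by simp
    qed
    also have "\<dots> = (part_prod ?h (n + 1))\<^sup>2 / 2 * (1 + \<epsilon>)" by (simp add: field_simps)
    finally have main: "(\<Sum>m=1..n. ?g m * bs.pr m m ?h (int (n - m))) \<le> (part_prod ?h (n + 1))\<^sup>2 / 2 * (1 +
      \<epsilon>) / ?s"
      using s0 by (simp add: pos_le_divide_eq)
    have "real (card (ustar n)) \<le> real (\<Sum>m=1..n. pair_count m m (n - m))" using card_ustar_le[of n]
      by (simp only: of_nat_le_iff)
    also have "\<dots> = exp (real n / ?h) * (\<Sum>m=1..n. ?g m * bs.pr m m ?h (int (n - m)))"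
      unfolding of_nat_sum sum_distrib_left by (intro sum.cong refl ct) simp
    also have "\<dots> \<le> exp (real n / ?h) * ((part_prod ?h (n + 1))\<^sup>2 / 2 * (1 + \<epsilon>) / ?s)"
      by (intro mult_left_mono main) auto
    also have "\<dots> = (1 + \<epsilon>) * ustar_asymp n" by (simp add: ustar_asymp_def)
    finally show ?case .
  qed
qed

section \<open>A pointwise lower bound for the joint law\<close>

primrec level :: "coord \<Rightarrow> nat" where
  "level Peak = 0"
| "level (Part j t) = t"

lemma level_side_coord: "level (side_coord j t) = t" by (simp add: side_coord_def)

lemma power_over_fact: "real T ^ T \<le> fact T * exp (real T)"
  by (rule power_le_fact_exp) simp

lemma coords_cases: "cc \<in> coords T \<longleftrightarrow> (\<exists>j. \<exists>t\<le>T. cc = side_coord j t)"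
proof
  assume "cc \<in> coords T"
  then consider "cc = Peak" | j t where "cc = Part j t" "t \<in> {1..T}" by (auto simp: coords_def)
  then show "\<exists>j. \<exists>t\<le>T. cc = side_coord j t"
  proof cases
    case 1
    then show ?thesis by (auto simp: side_coord_def)
  next
    case (2 j t)
    then have "cc = side_coord j t" "t \<le> T" by (auto simp: side_coord_def)
    then show ?thesis by blast
  qed
qed (auto simp: coords_eq intro: side_coord_in_coords_upto)

lemma sum_coords: "(\<Sum>c\<in>coords T. f c) = f Peak + ((\<Sum>t=1..T. f (Part L t)) + (\<Sum>t=1..T. f (Part R t)))"
  for f :: "coord \<Rightarrow> 'b::comm_monoid_add"
proof -
  have "coords T = insert Peak (Part L ` {1..T} \<union> Part R ` {1..T})" by (auto simp: coords_def)
  moreover have "(\<Sum>c\<in>Part j ` {1..T}. f c) = (\<Sum>t=1..T. f (Part j t))" for j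
    by (subst sum.reindex) (auto simp: inj_on_def)
  moreover have "(\<Sum>c\<in>Part L ` {1..T} \<union> Part R ` {1..T}. f c) = (\<Sum>c\<in>Part L ` {1..T}. f c) + (\<Sum>c\<in>Part R `
    {1..T}. f c)"
    by (rule sum.union_disjoint) auto
  moreover have "(\<Sum>c\<in>insert Peak (Part L ` {1..T} \<union> Part R ` {1..T}). f c) = f Peak + (\<Sum>c\<in>Part L ` {1..T} \<union>
    Part R ` {1..T}. f c)"
    by (rule sum.insert) auto
  ultimately show ?thesis by simp
qed

lemma card_coords: "card (coords T) = 2 * T + 1"
  using sum_coords[of "\<lambda>_. 1::nat" T] by simp

text \<open>Collects the errors of the mean that are o(h^(3/2)) once T is replaced by its bound sqrt
  h: terms of order h ln h, and one of order h^(5/4) ln h caused by the fluctuation sqrt T of the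
  last \<open>wgt\<close>.\<close>

definition mean_slack :: "real \<Rightarrow> real \<Rightarrow> real \<Rightarrow> real" where
  "mean_slack c C h = ln (h / c) * h * (1 + 24 * (1 + C)\<^sup>2 + 16 * (1 + C)) + (6 + 8 * (1 + C)) * h
     + 4 * h\<^sup>2 * ln (h / c) * exp (- h) + 2 * h * ln (h / c) * C * sqrt (sqrt h)"

lemma mean_slack_tendsto: assumes "0 < c" shows "((\<lambda>h. mean_slack c C h / (h * sqrt h)) \<longlongrightarrow> 0) at_top"
proof -
  have 1: "((\<lambda>h. ln (h / c) * h / (h * sqrt h)) \<longlongrightarrow> 0) at_top" using assms by real_asymp
  have 2: "((\<lambda>h::real. h / (h * sqrt h)) \<longlongrightarrow> 0) at_top" by real_asymp
  have 3: "((\<lambda>h. h\<^sup>2 * ln (h / c) * exp (- h) / (h * sqrt h)) \<longlongrightarrow> 0) at_top" using assms by real_asymp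
  have 4: "((\<lambda>h. h * ln (h / c) * sqrt (sqrt h) / (h * sqrt h)) \<longlongrightarrow> 0) at_top" using assms by real_asymp
  have "((\<lambda>h. (1 + 24 * (1 + C)\<^sup>2 + 16 * (1 + C)) * (ln (h / c) * h / (h * sqrt h)) + (6 + 8 * (1 + C)) *
    (h / (h * sqrt h))
     + 4 * (h\<^sup>2 * ln (h / c) * exp (- h) / (h * sqrt h)) + 2 * C * (h * ln (h / c) * sqrt (sqrt h) / (h *
       sqrt h)))
     \<longlongrightarrow> (1 + 24 * (1 + C)\<^sup>2 + 16 * (1 + C)) * 0 + (6 + 8 * (1 + C)) * 0 + 4 * 0 + 2 * C * 0) at_top"
    by (intro tendsto_intros 1 2 3 4)
  moreover have "mean_slack c C h / x = (1 + 24 * (1 + C)\<^sup>2 + 16 * (1 + C)) * (ln (h / c) * h / x) +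
    (6 + 8 * (1 + C)) * (h / x)
     + 4 * (h\<^sup>2 * ln (h / c) * exp (- h) / x) + 2 * C * (h * ln (h / c) * sqrt (sqrt h) / x)" for h x
    by (simp add: mean_slack_def add_divide_distrib) (simp add: algebra_simps add_divide_distrib)
  ultimately show ?thesis by (simp only: mult_zero_right add_0)
qed

text \<open>In its use \<open>s\<close> is the sum of the prescribed parts, \<open>m - t\<close> and
  \<open>m - t'\<close> are the mean masses cut off the two sides, and \<open>p\<close>,
  \<open>q\<close> are the common values T times the last part to which both are compared.\<close>

lemma abs_combine:
  fixes s p q m t t' k a b :: real
  assumes "\<bar>s - (p + q)\<bar> \<le> a" "\<bar>(m - t) - p\<bar> \<le> b" "\<bar>(m - t') - q\<bar> \<le> b"
  shows "\<bar>t + t' - (k - s)\<bar> \<le> \<bar>2 * m - k\<bar> + a + 2 * b"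
  using assms by linarith

text \<open>The shift \<open>D = -1\<close> moves every rounded value down, hence points of an orthant to points of the
  orthant; the shift \<open>D = T\<close> moves every value up, hence points outside to points outside.\<close>

locale top_parts =
  fixes n T :: nat and \<eta> c C :: real and u :: "coord \<Rightarrow> real" and D :: int
  assumes T1: "1 \<le> T" and h16: "16 \<le> hscale n" and Te: "real T \<le> \<eta> * sqrt (hscale n)"
    and eta: "0 < \<eta>" "\<eta> \<le> 1" "(1 + C) * \<eta> \<le> 1 / 3" and cC: "0 < c" "c < 1" "0 < C"
    and Lam: "6 * ln (hscale n / c) \<le> sqrt (hscale n)"
    and g: "u \<in> typical c C T" and D: "D = -1 \<or> D = int T"
begin

abbreviation "h \<equiv> hscale n"
abbreviation "\<Lambda> \<equiv> ln (h / c)"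

definition y :: "coord \<Rightarrow> real" where "y cc = h * (u cc + ln (2 * h))"
definition zz :: "coord \<Rightarrow> int" where "zz cc = \<lceil>y cc\<rceil> + D - int (level cc)"
definition z :: "coord \<Rightarrow> nat" where "z cc = nat (zz cc)"

lemma h0: "0 < h" using h16 by simp

text \<open>This gives \<open>wgt\<close> its meaning: h exp (- y / h) is approximately the expected
  number of parts of one side above y. Hence \<open>wgt\<close> of the T-th part should be near
  T.\<close>

lemma wgt_y: "wgt (u cc) = h * exp (- (y cc / h))"
proof -
  have "exp (- (y cc / h)) = exp (- u cc) * exp (- ln (2 * h))"
    using h0 by (simp add: y_def exp_add[symmetric])
  also have "exp (- ln (2 * h)) = 1 / (2 * h)" using h0 by (simp add: exp_minus inverse_eq_divide)
  finally show ?thesis using h0 by (simp add: wgt_def)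
qed

lemma y_wgt: "y cc = h * ln (h / wgt (u cc))"
proof -
  have "h / wgt (u cc) = exp (y cc / h)" using h0 by (simp add: wgt_y exp_minus inverse_eq_divide)
  then have "ln (h / wgt (u cc)) = y cc / h" by (simp only: ln_exp)
  then show ?thesis using h0 by simp
qed

lemma u_desc: "t < T \<Longrightarrow> u (side_coord j (Suc t)) \<le> u (side_coord j t)"
  using g by (auto simp: typical_def desc_chain_def)

text \<open>The second bound is where the growth condition on T enters: rounding errors will appear
  as exp (O(T^2 / h)).\<close>

lemma T_bounds: "real T \<le> sqrt h" "(real T)\<^sup>2 \<le> \<eta>\<^sup>2 * h" "(real T)\<^sup>2 \<le> h" "4 * real T \<le> h" "1 \<le> real T"
proof -
  have s: "4 \<le> sqrt h" using real_sqrt_le_mono[OF h16] by simp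
  have "\<eta> * sqrt h \<le> 1 * sqrt h" using eta s h0 by (intro mult_right_mono) auto
  then show 1: "real T \<le> sqrt h" using Te by simp
  have "(real T)\<^sup>2 \<le> (\<eta> * sqrt h)\<^sup>2" using Te by (intro power_mono) auto
  then show 2: "(real T)\<^sup>2 \<le> \<eta>\<^sup>2 * h" using h0 by (simp add: power_mult_distrib)
  have "\<eta>\<^sup>2 * h \<le> 1 * h" using eta h0 by (intro mult_right_mono) (auto simp: power_le_one)
  then show "(real T)\<^sup>2 \<le> h" using 2 by simp
  have "4 * real T \<le> sqrt h * sqrt h" using 1 s h0 by (intro mult_mono) auto
  then show "4 * real T \<le> h" using h0 by simp
  show "1 \<le> real T" using T1 by simp
qed

lemma wgt_last_bounds: "c * real T \<le> wgt (u (Part j T))" "wgt (u (Part j T)) \<le> (1 + C) * real T"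
  "\<bar>wgt (u (Part j T)) - real T\<bar> \<le> C * sqrt (real T)"
proof -
  show "c * real T \<le> wgt (u (Part j T))" using g T1 by (auto simp: typical_def)
  show d: "\<bar>wgt (u (Part j T)) - real T\<bar> \<le> C * sqrt (real T)" using g by (auto simp: typical_def)
  have "sqrt (real T) \<le> real T"
  proof -
    have "sqrt (real T) * 1 \<le> sqrt (real T) * sqrt (real T)" using T1 by (intro mult_left_mono) auto
    then show ?thesis by simp
  qed
  then have "C * sqrt (real T) \<le> C * real T" using cC by simp
  then show "wgt (u (Part j T)) \<le> (1 + C) * real T" using d by (simp add: algebra_simps)
qed

lemma pT: "side_coord j T = Part j T" using T1 by (simp add: side_coord_def)

text \<open>The assumption that (1 + C) \<open>\<eta>\<close> is at most 1/3 gives the last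
  \<open>wgt\<close> the bound sqrt h / 3, and ln 3 is at least 1. The extra summand
  \<open>h\<close> leaves room for the rounding, which moves a part by at most 2 T.\<close>

lemma yT_lower: "h * ln h / 2 + h \<le> y (Part j T)"
proof -
  have w0: "0 < wgt (u (Part j T))" by (rule wgt_pos)
  have s: "0 < sqrt h" "sqrt h * sqrt h = h" using h0 by auto
  have "wgt (u (Part j T)) \<le> (1 + C) * (\<eta> * sqrt h)"
    by (rule order_trans[OF wgt_last_bounds(2)]) (use Te cC in \<open>intro mult_left_mono; simp\<close>)
  also have "\<dots> = (1 + C) * \<eta> * sqrt h" by simp
  also have "\<dots> \<le> 1 / 3 * sqrt h" by (intro mult_right_mono eta) (use s in simp)
  finally have w: "wgt (u (Part j T)) \<le> sqrt h / 3" by simp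
  have "3 * sqrt h = h / (sqrt h / 3)" using s by (simp add: field_simps)
  also have "\<dots> \<le> h / wgt (u (Part j T))" using w w0 h0 s by (intro divide_left_mono) auto
  finally have "ln (3 * sqrt h) \<le> ln (h / wgt (u (Part j T)))" using s h0 w0
    by (intro iffD2[OF ln_le_cancel_iff]) auto
  moreover have "ln (3 * sqrt h) = ln 3 + ln h / 2" using h0 by (simp add: ln_mult ln_sqrt)
  moreover have "1 \<le> ln (3::real)"
    using exp_le by (subst ln_ge_iff) auto
  ultimately have "ln h / 2 + 1 \<le> ln (h / wgt (u (Part j T)))" by linarith
  then have "h * (ln h / 2 + 1) \<le> y (Part j T)" unfolding y_wgt using h0 by (intro mult_left_mono) auto
  then show ?thesis by (simp add: algebra_simps)
qed

lemma u_mono: "t \<le> t' \<Longrightarrow> t' \<le> T \<Longrightarrow> u (side_coord j t') \<le> u (side_coord j t)"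
proof (induction t' rule: dec_induct)
  case (step m)
  then show ?case using u_desc[of m j] by simp
qed simp

lemma y_mono: "t \<le> t' \<Longrightarrow> t' \<le> T \<Longrightarrow> y (side_coord j t') \<le> y (side_coord j t)"
  using u_mono[of t t' j] h0 unfolding y_def by (intro mult_left_mono add_right_mono) auto

lemma y_upper: "t \<le> T \<Longrightarrow> y (side_coord j t) \<le> h * \<Lambda>"
proof -
  assume "t \<le> T"
  then have "y (side_coord j t) \<le> y (side_coord j 0)" by (intro y_mono) auto
  also have "\<dots> = h * ln (h / wgt (u Peak))" by (simp add: side_coord_def y_wgt)
  also have "\<dots> \<le> h * \<Lambda>"
  proof -
    have "c \<le> wgt (u Peak)" using g by (auto simp: typical_def)
    then have "h / wgt (u Peak) \<le> h / c" using cC h0 by (intro divide_left_mono) (auto intro: mult_pos_pos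
      wgt_pos)
    then show ?thesis using h0 cC wgt_pos[of "u Peak"] by (intro mult_left_mono iffD2[OF ln_le_cancel_iff]) auto
  qed
  finally show ?thesis .
qed

lemma y_lower: "t \<le> T \<Longrightarrow> h * ln h / 2 + h \<le> y (side_coord j t)"
  using yT_lower[of j] y_mono[of t T j] by (simp add: pT)

lemma Lam_pos: "1 \<le> \<Lambda>"
proof -
  have "h * ln h / 2 + h \<le> h * \<Lambda>" using y_lower[of T L] y_upper[of T L] by simp
  moreover have "0 \<le> h * ln h / 2" using h16 by simp
  ultimately have "h * 1 \<le> h * \<Lambda>" by simp
  then show ?thesis using h0 by (simp only: mult_le_cancel_left_pos)
qed

lemma zz_near: "t \<le> T \<Longrightarrow> \<bar>real_of_int (zz (side_coord j t)) - y (side_coord j t)\<bar> \<le> 2 * real T"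
proof -
  assume t: "t \<le> T"
  have "real_of_int \<lceil>y (side_coord j t)\<rceil> < y (side_coord j t) + 1" "y (side_coord j t) \<le> real_of_int \<lceil>y
    (side_coord j t)\<rceil>" by linarith+
  moreover have "real_of_int (zz (side_coord j t)) = real_of_int \<lceil>y (side_coord j t)\<rceil> + real_of_int D - real t"
    by (simp add: zz_def level_side_coord)
  moreover have "real_of_int D = -1 \<or> real_of_int D = real T" using D by auto
  moreover have "1 \<le> real T" "0 \<le> real t" "real t \<le> real T" using T1 t by auto
  ultimately show ?thesis by linarith
qed

lemma zz_lower: "t \<le> T \<Longrightarrow> h * ln h / 2 + 1 \<le> real_of_int (zz (side_coord j t))"
proof -
  assume t: "t \<le> T"
  have "2 * real T \<le> h / 2" using T_bounds(4) by simp
  then show ?thesis using zz_near[OF t, of j] y_lower[OF t, of j] h16 by linarith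
qed

lemma z_real: "t \<le> T \<Longrightarrow> real (z (side_coord j t)) = real_of_int (zz (side_coord j t))"
proof -
  assume t: "t \<le> T"
  have "0 \<le> h * ln h / 2" using h16 by simp
  then have "0 \<le> zz (side_coord j t)" using zz_lower[OF t, of j] by linarith
  then show ?thesis by (simp add: z_def)
qed

lemma z_near: "t \<le> T \<Longrightarrow> \<bar>real (z (side_coord j t)) - y (side_coord j t)\<bar> \<le> 2 * real T"
  using zz_near z_real by simp

lemma z_lower: "t \<le> T \<Longrightarrow> h * ln h / 2 + 1 \<le> real (z (side_coord j t))"
  using zz_lower z_real by simp

lemma z_dec: "t < T \<Longrightarrow> z (side_coord j (Suc t)) < z (side_coord j t)"
proof -
  assume t: "t < T"
  have "y (side_coord j (Suc t)) \<le> y (side_coord j t)" by (rule y_mono) (use t in auto)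
  then have "\<lceil>y (side_coord j (Suc t))\<rceil> \<le> \<lceil>y (side_coord j t)\<rceil>" by (rule ceiling_mono)
  then have "zz (side_coord j (Suc t)) < zz (side_coord j t)" by (simp add: zz_def level_side_coord)
  moreover have "real_of_int (zz (side_coord j t)) > 0"
  proof -
    have "0 \<le> h * ln h / 2" using h16 by simp
    then show ?thesis using zz_lower[of t j] t by linarith
  qed
  ultimately show ?thesis unfolding z_def by simp
qed

definition S :: nat where "S = (\<Sum>cc\<in>coords T. z cc)"
definition Sy :: real where "Sy = (\<Sum>cc\<in>coords T. y cc)"

text \<open>There are 2 T + 1 coordinates, at most 3 T, and each is moved by at most 2 T. Dividing
  by h gives the factor exp (6 T^2 / h) of \<open>card_lower\<close>.\<close>

lemma S_Sy: "\<bar>real S - Sy\<bar> \<le> 6 * (real T)\<^sup>2"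
proof -
  have "\<bar>real S - Sy\<bar> = \<bar>\<Sum>cc\<in>coords T. real (z cc) - y cc\<bar>" by (simp add: S_def Sy_def sum_subtractf)
  also have "\<dots> \<le> (\<Sum>cc\<in>coords T. \<bar>real (z cc) - y cc\<bar>)" by (rule sum_abs)
  also have "\<dots> \<le> (\<Sum>cc\<in>coords T. 2 * real T)"
  proof (rule sum_mono)
    fix cc assume "cc \<in> coords T"
    then obtain j t where "t \<le> T" "cc = side_coord j t" unfolding coords_cases by blast
    then show "\<bar>real (z cc) - y cc\<bar> \<le> 2 * real T" using z_near by simp
  qed
  also have "\<dots> = (2 * real T + 1) * (2 * real T)" by (simp add: card_coords)
  also have "\<dots> \<le> (3 * real T) * (2 * real T)" using T1 by (intro mult_right_mono) auto
  also have "\<dots> = 6 * (real T)\<^sup>2" by (simp add: power2_eq_square)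
  finally show ?thesis .
qed

text \<open>A part exceeds the last one by h times the logarithm of the ratio of their
  \<open>wgt\<close> values, on the typical set at most h (ln ((1 + C) / c) + ln (T / t)). The
  logarithms ln (T / t) sum to ln (T^T / T!), at most T, so no factor ln T is lost.\<close>

lemma side_sum: "\<bar>(\<Sum>t=1..T. y (Part j t)) - real T * y (Part j T)\<bar> \<le> h * (real T * (ln ((1 + C) / c) + 1))"
proof -
  have "(\<Sum>t=1..T. y (Part j t)) - real T * y (Part j T) = (\<Sum>t=1..T. y (Part j t) - y (Part j T))"
    by (simp add: sum_subtractf)
  moreover have "0 \<le> (\<Sum>t=1..T. y (Part j t) - y (Part j T))"
  proof (rule sum_nonneg)
    fix t assume "t \<in> {1..T}"
    then show "0 \<le> y (Part j t) - y (Part j T)" using y_mono[of t T j] by (simp add: side_coord_def split: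
      if_splits)
  qed
  moreover have "(\<Sum>t=1..T. y (Part j t) - y (Part j T)) \<le> h * (real T * (ln ((1 + C) / c) + 1))"
  proof -
    have "(\<Sum>t=1..T. y (Part j t) - y (Part j T)) \<le> (\<Sum>t=1..T. h * (ln ((1 + C) / c) + ln (real T / real t)))"
    proof (rule sum_mono)
      fix t assume t: "t \<in> {1..T}"
      have wt: "c * real t \<le> wgt (u (Part j t))" using g t by (auto simp: typical_def)
      have p: "0 < c * real t" using cC t by simp
      have "y (Part j t) - y (Part j T) = h * (ln (wgt (u (Part j T))) - ln (wgt (u (Part j t))))"
        using h0 wgt_pos[of "u (Part j T)"] wgt_pos[of "u (Part j t)"] by (simp add: y_wgt ln_div algebra_simps)
      also have "\<dots> \<le> h * (ln ((1 + C) * real T) - ln (c * real t))"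
        by (intro mult_left_mono diff_mono) (use h0 wgt_last_bounds(2)[of j] wt p wgt_pos[of "u (Part j T)"]
          in auto)
      also have "ln ((1 + C) * real T) - ln (c * real t) = ln ((1 + C) / c) + ln (real T / real t)"
        using cC T1 t by (simp add: ln_mult ln_div)
      finally show "y (Part j t) - y (Part j T) \<le> h * (ln ((1 + C) / c) + ln (real T / real t))" .
    qed
    also have "\<dots> = h * (real T * ln ((1 + C) / c) + (\<Sum>t=1..T. ln (real T / real t)))"
      by (simp add: sum_distrib_left[symmetric] sum.distrib)
    also have "(\<Sum>t=1..T. ln (real T / real t)) = ln (real T ^ T / fact T)"
    proof -
      have "(\<Sum>t=1..T. ln (real T / real t)) = ln (\<Prod>t=1..T. real T / real t)"
        by (rule ln_prod[symmetric]) (use T1 in auto)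
      also have "(\<Prod>t=1..T. real T / real t) = real T ^ T / fact T"
        by (simp add: prod_dividef fact_prod)
      finally show ?thesis .
    qed
    also have "h * (real T * ln ((1 + C) / c) + ln (real T ^ T / fact T)) \<le> h * (real T * ln ((1 + C) / c) +
      ln (exp (real T)))"
    proof (intro mult_left_mono add_left_mono ln_mono)
      show "0 < real T ^ T / fact T" using T1 by simp
      show "real T ^ T / fact T \<le> exp (real T)" using power_over_fact[of T] by (simp add: field_simps)
    qed (use h0 in simp)
    finally show ?thesis using h0 by (simp add: algebra_simps)
  qed
  ultimately show ?thesis by simp
qed

abbreviation "a j \<equiv> z (Part j T)"

text \<open>The rounded counterpart of \<open>wgt\<close> at the last part: approximately the
  expected number of parts of side \<open>j\<close> from the cut \<open>a j\<close> on.\<close>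

definition G :: "side \<Rightarrow> real" where "G j = h * exp (- (real (a j) / h))"

lemma a_near: "\<bar>real (a j) - y (Part j T)\<bar> \<le> 2 * real T"
  using z_near[of T j] by (simp add: pT)

lemma a_lower: "h * ln h / 2 + 1 \<le> real (a j)"
  using z_lower[of T j] by (simp add: pT)

lemma a_upper: "real (a j) \<le> 2 * h * \<Lambda>"
proof -
  have "real (a j) \<le> y (Part j T) + 2 * real T" using a_near[of j] by simp
  also have "\<dots> \<le> h * \<Lambda> + h * 1" using y_upper[of T j] T_bounds(4) by (simp add: pT)
  also have "\<dots> \<le> h * \<Lambda> + h * \<Lambda>" using Lam_pos h0 by (intro add_left_mono mult_left_mono) auto
  finally show ?thesis by simp
qed

lemma G_near: "\<bar>G j - wgt (u (Part j T))\<bar> \<le> 4 * (1 + C) * ((real T)\<^sup>2 / h)"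
proof -
  let ?d = "(y (Part j T) - real (a j)) / h"
  have d: "\<bar>?d\<bar> \<le> 2 * real T / h" using a_near[of j] h0 by (simp add: abs_minus_commute divide_right_mono)
  have d1: "2 * real T / h \<le> 1 / 2" using T_bounds(4) h0 by (simp add: field_simps)
  have e: "\<bar>exp x - 1\<bar> \<le> 2 * \<bar>x\<bar>" if "\<bar>x\<bar> \<le> 1 / 2" for x :: real
  proof -
    have "1 + x \<le> exp x" by (rule exp_ge_add_one_self)
    moreover have "exp x \<le> 1 + 2 * \<bar>x\<bar>"
    proof (cases "0 \<le> x")
      case True
      have "exp x \<le> 1 + x + x\<^sup>2" by (rule exp_bound) (use that True in auto)
      also have "x\<^sup>2 \<le> x" using that True by (simp add: power2_eq_square mult_left_le)
      finally show ?thesis using True by simp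
    next
      case False
      then show ?thesis by (smt (verit) exp_le_one_iff)
    qed
    ultimately show ?thesis by linarith
  qed
  have "G j = wgt (u (Part j T)) * exp ?d"
  proof -
    have "exp (- (y (Part j T) / h)) * exp ?d = exp (- (real (a j) / h))"
      by (simp add: exp_add[symmetric] diff_divide_distrib)
    then show ?thesis by (simp add: G_def wgt_y)
  qed
  then have "G j - wgt (u (Part j T)) = wgt (u (Part j T)) * (exp ?d - 1)"
    by (simp add: right_diff_distrib)
  then have "\<bar>G j - wgt (u (Part j T))\<bar> = wgt (u (Part j T)) * \<bar>exp ?d - 1\<bar>"
    using wgt_pos[of "u (Part j T)"] by (simp add: abs_mult)
  also have "\<dots> \<le> ((1 + C) * real T) * (2 * (2 * real T / h))"
  proof (intro mult_mono wgt_last_bounds(2))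
    have "\<bar>exp ?d - 1\<bar> \<le> 2 * \<bar>?d\<bar>" by (rule e) (use d d1 in linarith)
    also have "\<dots> \<le> 2 * (2 * real T / h)" using d by simp
    finally show "\<bar>exp ?d - 1\<bar> \<le> 2 * (2 * real T / h)" .
  qed (use cC in auto)
  also have "\<dots> = 4 * (1 + C) * ((real T)\<^sup>2 / h)" by (simp add: power2_eq_square)
  finally show ?thesis .
qed

lemma G_bounds: "0 \<le> G j" "G j \<le> 2 * (1 + C) * real T"
proof -
  show "0 \<le> G j" using h0 by (simp add: G_def)
  have "4 * (real T)\<^sup>2 / h \<le> real T"
  proof -
    have "real T * (4 * real T) \<le> real T * h" using T_bounds(4) by (intro mult_left_mono) auto
    then show ?thesis using h0 by (simp add: power2_eq_square field_simps)
  qed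
  then have "(1 + C) * (4 * (real T)\<^sup>2 / h) \<le> (1 + C) * real T" using cC by (intro mult_left_mono) auto
  then show "G j \<le> 2 * (1 + C) * real T"
  proof -
    have "4 * (1 + C) * ((real T)\<^sup>2 / h) = (1 + C) * (4 * (real T)\<^sup>2 / h)" by simp
    then show ?thesis using G_near[of j] wgt_last_bounds(2)[of j] \<open>(1 + C) * (4 * (real T)\<^sup>2 / h) \<le> _\<close>
      by linarith
  qed
qed

lemma T2h: "(real T)\<^sup>2 / h \<le> \<eta>\<^sup>2" "(real T)\<^sup>2 / h \<le> 1"
  using T_bounds(2,3) h0 by (simp_all add: field_simps)

lemma GT: "\<bar>G j - real T\<bar> \<le> C * sqrt (sqrt h) + 4 * (1 + C)"
proof -
  have "4 * (1 + C) * ((real T)\<^sup>2 / h) \<le> 4 * (1 + C) * 1" by (intro mult_left_mono T2h) (use cC in auto)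
  moreover have "C * sqrt (real T) \<le> C * sqrt (sqrt h)" using T_bounds(1) cC by simp
  ultimately show ?thesis using G_near[of j] wgt_last_bounds(3)[of j] by linarith
qed

text \<open>The prescribed parts add up to at most 6 T h ln (h / c), which the assumption
  \<open>Lam\<close> bounds by h^2 and hence by n; so the remaining size is not truncated at
  0.\<close>

lemma sum_bound: "real S \<le> real n" "real (a j) \<le> real (n + 1)"
proof -
  have l: "1 \<le> \<Lambda>" by (rule Lam_pos)
  have Sy: "Sy \<le> (2 * real T + 1) * (h * \<Lambda>)"
  proof -
    have "Sy \<le> (\<Sum>cc\<in>coords T. h * \<Lambda>)"
      unfolding Sy_def
    proof (rule sum_mono)
      fix cc assume "cc \<in> coords T"
      then obtain j t where "t \<le> T" "cc = side_coord j t" unfolding coords_cases by blast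
      then show "y cc \<le> h * \<Lambda>" using y_upper by simp
    qed
    then show ?thesis by (simp add: card_coords add.commute)
  qed
  have "real S \<le> (2 * real T + 1) * (h * \<Lambda>) + 6 * (real T)\<^sup>2" using S_Sy Sy by linarith
  also have "\<dots> \<le> (3 * real T) * (h * \<Lambda>) + (3 * real T) * (h * \<Lambda>)"
  proof (intro add_mono mult_right_mono)
    have "6 * (real T)\<^sup>2 = (3 * real T) * (2 * real T)" by (simp add: power2_eq_square)
    also have "\<dots> \<le> (3 * real T) * (h * 1)" by (intro mult_left_mono) (use T_bounds(4) in auto)
    also have "\<dots> \<le> (3 * real T) * (h * \<Lambda>)" by (intro mult_left_mono l) (use h0 in auto)
    finally show "6 * (real T)\<^sup>2 \<le> (3 * real T) * (h * \<Lambda>)" .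
  qed (use T_bounds(5) h0 l in auto)
  also have "\<dots> = real T * h * (6 * \<Lambda>)" by simp
  also have "\<dots> \<le> sqrt h * h * sqrt h" by (intro mult_mono T_bounds Lam) (use h0 l in auto)
  also have "\<dots> = h\<^sup>2" using h0 by (simp add: power2_eq_square)
  also have "\<dots> \<le> real n" by (rule hscale_sq_le)
  finally show 1: "real S \<le> real n" .
  have "Part j T \<in> coords T" using T1 by (cases j) (auto simp: coords_def)
  then have "a j \<le> S" unfolding S_def by (intro member_le_sum) (auto simp: finite_coords)
  then show "real (a j) \<le> real (n + 1)" using 1 by simp
qed

text \<open>About \<open>G j\<close> parts are expected beyond the cut, each of size about
  \<open>a j\<close>, so the mean mass cut off is near their product, with an excess of at most
  about 4 h for each part. Replacing \<open>G j\<close> by \<open>T\<close> and \<open>a j\<close>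
  by the unrounded position gives the value to which the prescribed parts of the side were
  compared.\<close>

lemma tail_mean:
  "\<bar>(mean_sum h (n + 1) - mean_sum h (a j)) - real T * y (Part j T)\<bar> \<le>
     8 * (1 + C) * (real T * h) + h * \<Lambda> * (8 * (1 + C)\<^sup>2 + 8 * (1 + C)) + 4 * (1 + C) * h + 2 * h\<^sup>2 * \<Lambda> *
       exp (- h) + h * \<Lambda> * C * sqrt (sqrt h)"
proof -
  let ?q = "exp (- (real (a j) / h))"
  let ?tail = "mean_sum h (n + 1) - mean_sum h (a j)"
  have l: "1 \<le> \<Lambda>" by (rule Lam_pos)
  have lh: "0 \<le> h * ln h / 2" using h16 by simp
  have a1: "1 \<le> a j" using a_lower[of j] lh by linarith
  have an: "a j \<le> n + 1" using sum_bound(2)[of j] by linarith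
  have q: "?q = G j / h" using h0 by (simp add: G_def)
  have up: "?tail \<le> real (a j) * G j + (real (a j) * G j / h + 4 * G j * h)"
  proof -
    have "?tail \<le> ?q * (real (a j) * (1 + h) + (1 + h)\<^sup>2)" by (rule mean_sum_tail_upper[OF h0 a1 an])
    also have "\<dots> \<le> ?q * (real (a j) * (1 + h) + (2 * h)\<^sup>2)" by (intro mult_left_mono add_left_mono
      power_mono) (use h16 in auto)
    also have "\<dots> = real (a j) * G j + (real (a j) * G j / h + 4 * G j * h)"
      unfolding q using h0 by (simp add: power2_eq_square field_simps)
    finally show ?thesis .
  qed
  have lo: "real (a j) * G j - (real (a j) * (G j)\<^sup>2 / h + real (a j) * (h * exp (- h))) \<le> ?tail"
  proof -
    let ?r = "exp (- (real (n + 1) / h))"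
    have r: "?r \<le> exp (- h)"
    proof -
      have "h * h \<le> real (n + 1)" using hscale_sq_le[of n] by (simp add: power2_eq_square)
      then show ?thesis using h0 by (simp add: field_simps)
    qed
    have q1: "?q \<le> 1" using h0 by simp
    have "real (a j) * G j - (real (a j) * (G j)\<^sup>2 / h + real (a j) * (h * exp (- h))) \<le>
        real (a j) * G j - (real (a j) * (G j)\<^sup>2 / h + (1 - ?q) * (real (a j) * (h * ?r)))"
    proof -
      have "(1 - ?q) * (real (a j) * (h * ?r)) \<le> 1 * (real (a j) * (h * exp (- h)))"
        by (intro mult_mono r) (use q1 h0 in auto)
      then show ?thesis by simp
    qed
    also have "\<dots> = (1 - ?q) * (real (a j) * (h * (?q - ?r)))"
      unfolding q using h0 by (simp add: power2_eq_square field_simps)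
    also have "\<dots> \<le> ?tail" by (rule mean_sum_tail_lower[OF h0 a1 an])
    finally show ?thesis .
  qed
  have aG: "real (a j) * G j / h \<le> 4 * (1 + C) * (h * \<Lambda>)"
  proof -
    have "real (a j) * G j / h \<le> (2 * h * \<Lambda>) * (2 * (1 + C) * real T) / h"
      by (intro divide_right_mono mult_mono a_upper G_bounds) (use h0 l in auto)
    also have "\<dots> = 4 * (1 + C) * (real T * \<Lambda>)" using h0 by simp
    also have "\<dots> \<le> 4 * (1 + C) * (h * \<Lambda>)" by (intro mult_left_mono mult_right_mono) (use T_bounds cC l in auto)
    finally show ?thesis .
  qed
  have aG2: "real (a j) * (G j)\<^sup>2 / h \<le> 8 * (1 + C)\<^sup>2 * (h * \<Lambda>)"
  proof -
    have "real (a j) * (G j)\<^sup>2 / h \<le> (2 * h * \<Lambda>) * (2 * (1 + C) * real T)\<^sup>2 / h"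
      by (intro divide_right_mono mult_mono power_mono a_upper G_bounds) (use h0 l in auto)
    also have "\<dots> = 8 * (1 + C)\<^sup>2 * ((real T)\<^sup>2 * \<Lambda>)"
    proof -
      have "(2 * (1 + C) * real T)\<^sup>2 = 4 * ((1 + C)\<^sup>2 * (real T)\<^sup>2)"
        by (simp only: power_mult_distrib) simp
      then show ?thesis using h0 by simp
    qed
    also have "\<dots> \<le> 8 * (1 + C)\<^sup>2 * (h * \<Lambda>)" by (intro mult_left_mono mult_right_mono) (use T_bounds cC l in
      auto)
    finally show ?thesis .
  qed
  have ah: "real (a j) * (h * exp (- h)) \<le> 2 * h\<^sup>2 * \<Lambda> * exp (- h)"
  proof -
    have "real (a j) * (h * exp (- h)) \<le> (2 * h * \<Lambda>) * (h * exp (- h))" by (intro mult_right_mono a_upper)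
      (use h0 in auto)
    then show ?thesis by (simp add: power2_eq_square mult_ac)
  qed
  have Gh: "4 * G j * h \<le> 8 * (1 + C) * (real T * h)"
  proof -
    have "4 * G j * h \<le> 4 * (2 * (1 + C) * real T) * h" by (intro mult_right_mono mult_left_mono G_bounds)
      (use h0 in auto)
    also have "\<dots> = 8 * (1 + C) * (real T * h)" by simp
    finally show ?thesis .
  qed
  have aGT: "\<bar>real (a j) * G j - real T * y (Part j T)\<bar> \<le> 4 * (1 + C) * h + h * \<Lambda> * (C * sqrt (sqrt h) + 4 *
    (1 + C))"
  proof -
    have yp: "0 \<le> y (Part j T)" "y (Part j T) \<le> h * \<Lambda>"
      using yT_lower[of j] lh h0 y_upper[of T j] by (auto simp: pT)
    have "real (a j) * G j - real T * y (Part j T) = (real (a j) - y (Part j T)) * G j + y (Part j T) *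
      (G j - real T)"
      by (simp add: algebra_simps)
    then have "\<bar>real (a j) * G j - real T * y (Part j T)\<bar> \<le> \<bar>real (a j) - y (Part j T)\<bar> * G j + y (Part j T)
      * \<bar>G j - real T\<bar>"
      using G_bounds(1)[of j] yp(1) by (simp add: abs_mult order_trans[OF abs_triangle_ineq])
    also have "\<dots> \<le> (2 * real T) * (2 * (1 + C) * real T) + (h * \<Lambda>) * (C * sqrt (sqrt h) + 4 * (1 + C))"
      by (intro add_mono mult_mono a_near G_bounds GT yp) (use h0 l in auto)
    also have "(2 * real T) * (2 * (1 + C) * real T) = 4 * (1 + C) * (real T)\<^sup>2" by (simp add: power2_eq_square)
    also have "\<dots> \<le> 4 * (1 + C) * h" by (intro mult_left_mono T_bounds) (use cC in auto)
    finally show ?thesis by simp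
  qed
  have nn: "0 \<le> real (a j) * G j / h" "0 \<le> 4 * G j * h" "0 \<le> real (a j) * (G j)\<^sup>2 / h" "0 \<le> real (a j) *
    (h * exp (- h))"
    using G_bounds(1)[of j] h0 by auto
  have "\<bar>?tail - real T * y (Part j T)\<bar> \<le> real (a j) * G j / h + 4 * G j * h + real (a j) * (G j)\<^sup>2 / h +
    real (a j) * (h * exp (- h))
     + \<bar>real (a j) * G j - real T * y (Part j T)\<bar>"
    using up lo nn by linarith
  also have "\<dots> \<le> 4 * (1 + C) * (h * \<Lambda>) + 8 * (1 + C) * (real T * h) + 8 * (1 + C)\<^sup>2 * (h * \<Lambda>) + 2 * h\<^sup>2 *
    \<Lambda> * exp (- h)
     + (4 * (1 + C) * h + h * \<Lambda> * (C * sqrt (sqrt h) + 4 * (1 + C)))"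
    by (intro add_mono aG Gh aG2 ah aGT)
  finally show ?thesis by (simp add: algebra_simps)
qed

text \<open>The coefficient of T h in the error of the mean. This is the one term of the full order
  h^(3/2) when T is of order sqrt h; it is made small by the choice of
  \<open>\<eta>\<close>.\<close>

definition K :: real where "K = 16 * (1 + C) + 2 * (ln ((1 + C) / c) + 1)"

lemma mean_error:
  "\<bar>bs.mean (a L) (a R) h - real_of_int (int (n - S))\<bar> \<le> \<bar>2 * mean_sum h (n + 1) - real n\<bar> + K * \<eta> * (h *
    sqrt h) + mean_slack c C h"
proof -
  have l: "1 \<le> \<Lambda>" by (rule Lam_pos)
  have N: "real_of_int (int (n - S)) = real n - real S" using sum_bound(1) by simp
  have "Sy = y Peak + ((\<Sum>t=1..T. y (Part L t)) + (\<Sum>t=1..T. y (Part R t)))" unfolding Sy_def by (rule sum_coords)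
  moreover have "0 \<le> y Peak" "y Peak \<le> h * \<Lambda>"
  proof -
    have "0 \<le> h * ln h / 2" using h16 by simp
    then show "0 \<le> y Peak" "y Peak \<le> h * \<Lambda>"
      using y_upper[of 0 L] y_lower[of 0 L] h0 by (auto simp: side_coord_def)
  qed
  ultimately have Sb: "\<bar>real S - (real T * y (Part L T) + real T * y (Part R T))\<bar> \<le> 6 * (real T)\<^sup>2 + h *
    \<Lambda> + 2 * (h * (real T * (ln ((1 + C) / c) + 1)))"
    using S_Sy side_sum[of L] side_sum[of R] by linarith
  let ?t = "8 * (1 + C) * (real T * h) + h * \<Lambda> * (8 * (1 + C)\<^sup>2 + 8 * (1 + C)) + 4 * (1 + C) * h + 2 * h\<^sup>2 *
    \<Lambda> * exp (- h) + h * \<Lambda> * C * sqrt (sqrt h)"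
  have "\<bar>bs.mean (a L) (a R) h - real_of_int (int (n - S))\<bar> \<le> \<bar>2 * mean_sum h (n + 1) - real n\<bar> + (6 *
    (real T)\<^sup>2 + h * \<Lambda> + 2 * (h * (real T * (ln ((1 + C) / c) + 1)))) + 2 * ?t"
    unfolding N bs_mean by (rule abs_combine[OF Sb tail_mean tail_mean])
  also have "\<dots> = \<bar>2 * mean_sum h (n + 1) - real n\<bar> + K * (real T * h) + (6 * (real T)\<^sup>2 + h * \<Lambda> + 2 * (h *
    \<Lambda> * (8 * (1 + C)\<^sup>2 + 8 * (1 + C)) + 4 * (1 + C) * h + 2 * h\<^sup>2 * \<Lambda> * exp (- h) + h * \<Lambda> * C * sqrt (sqrt h)))"
    by (simp add: K_def algebra_simps)
  also have "\<dots> \<le> \<bar>2 * mean_sum h (n + 1) - real n\<bar> + K * (\<eta> * sqrt h * h) + mean_slack c C h"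
  proof (intro add_mono order_refl)
    have "0 \<le> ln ((1 + C) / c)" using cC by (simp add: field_simps)
    then have "0 \<le> K" using cC by (simp add: K_def)
    then show "K * (real T * h) \<le> K * (\<eta> * sqrt h * h)" using Te h0
      by (intro mult_left_mono mult_right_mono) auto
    have "h * \<Lambda> * (16 * (1 + C)\<^sup>2) \<le> h * \<Lambda> * (24 * (1 + C)\<^sup>2)" using h0 l by (intro mult_left_mono) auto
    then show "6 * (real T)\<^sup>2 + h * \<Lambda> + 2 * (h * \<Lambda> * (8 * (1 + C)\<^sup>2 + 8 * (1 + C)) + 4 * (1 + C) * h + 2 *
      h\<^sup>2 * \<Lambda> * exp (- h) + h * \<Lambda> * C * sqrt (sqrt h)) \<le> mean_slack c C h"
      using T_bounds(3) unfolding mean_slack_def by (simp add: algebra_simps)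
  qed
  finally show ?thesis by (simp add: mult_ac)
qed

text \<open>Leaving out the factors from the cut on costs at most exp (G + G / h), which is exp
  (wgt) up to the rounding error. This produces the two end factors exp (- wgt) of the
  density.\<close>

lemma part_prod_a: "part_prod h (n + 1) * exp (- (wgt (u (Part j T)) + 6 * (1 + C) * \<eta>\<^sup>2)) \<le> part_prod h (a j)"
proof -
  have lh: "0 \<le> h * ln h / 2" using h16 by simp
  have a1: "1 \<le> a j" using a_lower[of j] lh by linarith
  have an: "a j \<le> n + 1" using sum_bound(2)[of j] by linarith
  let ?x = "exp (- (real (a j) / h)) * (1 + h)"
  have "?x = G j + G j / h" using h0 by (simp add: G_def algebra_simps)
  also have "\<dots> \<le> (wgt (u (Part j T)) + 4 * (1 + C) * \<eta>\<^sup>2) + 2 * (1 + C) * \<eta>\<^sup>2"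
  proof (rule add_mono)
    have "4 * (1 + C) * ((real T)\<^sup>2 / h) \<le> 4 * (1 + C) * \<eta>\<^sup>2" by (intro mult_left_mono T2h) (use cC in auto)
    then show "G j \<le> wgt (u (Part j T)) + 4 * (1 + C) * \<eta>\<^sup>2" using G_near[of j] by linarith
    have "real T * 1 \<le> real T * real T" by (intro mult_left_mono) (use T_bounds(5) in auto)
    then have "real T / h \<le> (real T)\<^sup>2 / h" using h0 by (intro divide_right_mono) (auto simp: power2_eq_square)
    then have Th: "real T / h \<le> \<eta>\<^sup>2" using T2h(1) by linarith
    have "G j / h \<le> (2 * (1 + C) * real T) / h" by (intro divide_right_mono G_bounds) (use h0 in auto)
    also have "\<dots> = 2 * (1 + C) * (real T / h)" by simp
    also have "\<dots> \<le> 2 * (1 + C) * \<eta>\<^sup>2" by (intro mult_left_mono Th) (use cC in auto)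
    finally show "G j / h \<le> 2 * (1 + C) * \<eta>\<^sup>2" .
  qed
  finally have x: "?x \<le> wgt (u (Part j T)) + 6 * (1 + C) * \<eta>\<^sup>2" by (simp add: algebra_simps)
  have "part_prod h (n + 1) * exp (- (wgt (u (Part j T)) + 6 * (1 + C) * \<eta>\<^sup>2)) \<le> (part_prod h (a j) *
    exp ?x) * exp (- ?x)"
    by (intro mult_mono part_prod_ratio_upper h0 a1 an) (use x part_prod_pos[of h "a j"] in auto)
  also have "\<dots> = part_prod h (a j)" by (simp add: mult.assoc exp_add[symmetric])
  finally show ?thesis .
qed

lemma chain_density_eq: "chain_density (\<lambda>_. T) u = 2 * (h ^ (2 * T + 1) * exp (- (Sy / h))) * (exp (- wgt (u
  (Part L T))) * exp (- wgt (u (Part R T))))"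
proof -
  have "(\<Prod>cc\<in>coords T. wgt (u cc)) = h ^ (2 * T + 1) * exp (- (Sy / h))"
  proof -
    have "(\<Prod>cc\<in>coords T. wgt (u cc)) = (\<Prod>cc\<in>coords T. h) * (\<Prod>cc\<in>coords T. exp (- (y cc / h)))"
      unfolding wgt_y by (rule prod.distrib)
    also have "(\<Prod>cc\<in>coords T. exp (- (y cc / h))) = exp (- (Sy / h))"
      by (simp add: exp_sum[OF finite_coords, symmetric] Sy_def sum_negf sum_divide_distrib)
    finally show ?thesis by (simp add: card_coords)
  qed
  moreover have "desc_chain (\<lambda>_. T) u" using g by (simp add: typical_def)
  ultimately show ?thesis by (simp add: chain_density_def coords_eq[symmetric] UNIV_side pT)
qed

text \<open>The density matches the count factor by factor: the weights of the prescribed parts give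
  the product of \<open>wgt\<close> values times \<open>h\<close> per coordinate, and the truncated
  products give the end factors. In the exponent, 6 comes from rounding the sum and 6 (1 + C) from
  each of the two products.\<close>

lemma card_lower:
  assumes e: "\<epsilon> \<le> 1" and llt: "1 - \<epsilon> \<le> bs.pr (a L) (a R) h (int (n - S)) * sqrt (2 * pi * bs.mom (a L) (a R)
    h 2)"
  shows "(1 - \<epsilon>) * exp (- ((6 + 12 * (1 + C)) * \<eta>\<^sup>2)) * ustar_asymp n * (chain_density (\<lambda>_. T) u / h ^ (2 *
    T + 1)) \<le>
     real (card {s \<in> ustar n. PK s = z Peak \<and> (\<forall>j. \<forall>t\<in>{1..T}. Y j t s = z (Part j t))})"
proof -
  let ?w = "\<lambda>j. wgt (u (Part j T))" and ?N = "n - S"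
  let ?pr = "bs.pr (a L) (a R) h (int ?N)"
  let ?mom = "bs.mom (a L) (a R) h 2"
  have h2: "2 \<le> h" using h16 by simp
  have V: "?mom \<le> total_var n"
    unfolding bs_mom total_var_def using moment_sum_mono[of "a L" "n + 1" h 2] moment_sum_mono[of "a R" "n +
      1" h 2] sum_bound(2)[of L] sum_bound(2)[of R] by simp
  have V0: "0 < total_var n" by (rule total_var_bounds(3)[OF h2])
  have "1 - \<epsilon> \<le> ?pr * sqrt (2 * pi * total_var n)"
  proof -
    have "?pr * sqrt (2 * pi * ?mom) \<le> ?pr * sqrt (2 * pi * total_var n)"
      by (intro mult_left_mono bs.pr_nonneg) (use V in simp)
    then show ?thesis using llt by simp
  qed
  then have pr: "(1 - \<epsilon>) / sqrt (2 * pi * total_var n) \<le> ?pr" using V0 by (simp add: pos_divide_le_eq)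
  have ex: "exp (real n / h) * (exp (- (Sy / h)) * exp (- (6 * \<eta>\<^sup>2))) \<le> exp (real ?N / h)"
  proof -
    have "real S / h \<le> (Sy + 6 * (real T)\<^sup>2) / h" using S_Sy h0 by (intro divide_right_mono) auto
    also have "\<dots> = Sy / h + 6 * ((real T)\<^sup>2 / h)" by (simp add: add_divide_distrib)
    also have "\<dots> \<le> Sy / h + 6 * \<eta>\<^sup>2" using T2h(1) by simp
    finally have "real n / h - (Sy / h + 6 * \<eta>\<^sup>2) \<le> real n / h - real S / h" by simp
    also have "\<dots> = real ?N / h" using sum_bound(1) by (simp add: diff_divide_distrib of_nat_diff)
    finally have "exp (real n / h - (Sy / h + 6 * \<eta>\<^sup>2)) \<le> exp (real ?N / h)" by simp
    then show ?thesis by (simp add: exp_add[symmetric] algebra_simps)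
  qed
  let ?b = "6 * (1 + C) * \<eta>\<^sup>2"
  have "(1 - \<epsilon>) * exp (- ((6 + 12 * (1 + C)) * \<eta>\<^sup>2)) * ustar_asymp n * (chain_density (\<lambda>_. T) u / h ^ (2 *
    T + 1)) =
     (1 - \<epsilon>) / sqrt (2 * pi * total_var n) * ((part_prod h (n + 1) * exp (- (?w L + ?b))) * (part_prod h (n
       + 1) * exp (- (?w R + ?b)))) * (exp (real n / h) * (exp (- (Sy / h)) * exp (- (6 * \<eta>\<^sup>2))))"
  proof -
    have "exp (- ((6 + 12 * (1 + C)) * \<eta>\<^sup>2)) = exp (- ?b) * exp (- ?b) * exp (- (6 * \<eta>\<^sup>2))"
      by (simp add: exp_add[symmetric] algebra_simps)
    moreover have "exp (- (?w j + ?b)) = exp (- ?w j) * exp (- ?b)" for j by (simp add: exp_add[symmetric])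
    moreover have "chain_density (\<lambda>_. T) u / h ^ (2 * T + 1) = 2 * exp (- (Sy / h)) * (exp (- ?w L) *
      exp (- ?w R))"
      unfolding chain_density_eq using h0 by simp
    ultimately show ?thesis unfolding ustar_asymp_def by (simp add: power2_eq_square)
  qed
  also have "\<dots> \<le> ?pr * (part_prod h (a L) * part_prod h (a R)) * exp (real ?N / h)"
    by (intro mult_mono pr part_prod_a ex mult_nonneg_nonneg bs.pr_nonneg) (use part_prod_pos[of h] e V0 in
      \<open>auto intro: less_imp_le\<close>)
  also have "\<dots> = real (pair_count (a L) (a R) ?N)" by (rule pair_count_eq_pr[symmetric])
  also have "\<dots> \<le> real (card {s \<in> ustar n. PK s = z Peak \<and> (\<forall>j. \<forall>t\<in>{1..T}. Y j t s = z (Part j t))})"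
  proof -
    have "pair_count (z (Part L T)) (z (Part R T)) (n - (\<Sum>cc\<in>coords T. z cc)) \<le>
       card {s \<in> ustar n. PK s = z Peak \<and> (\<forall>j. \<forall>t\<in>{1..T}. Y j t s = z (Part j t))}"
    proof (rule card_top_ge[OF T1 z_dec])
      show "1 \<le> z (Part j T)" for j
      proof -
        have "0 \<le> h * ln h / 2" using h16 by simp
        then show ?thesis using a_lower[of j] by linarith
      qed
      show "(\<Sum>cc\<in>coords T. z cc) \<le> n" using sum_bound(1) unfolding S_def by linarith
    qed
    then show ?thesis unfolding S_def by (simp only: of_nat_le_iff)
  qed
  finally show ?thesis .
qed

end

text \<open>One \<open>\<eta>\<close> has to work for all \<open>T\<close>, \<open>u\<close> and
  both shifts, so it is chosen from \<open>c\<close>, \<open>C\<close> and the tolerance of the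
  local limit theorem before \<open>n\<close>. The three parts of the error of the mean get a third
  of that tolerance each.\<close>

lemma pointwise_lower:
  assumes e: "0 < (\<epsilon>::real)" "\<epsilon> < 1" and cC: "0 < c" "c < 1" "0 < C"
  shows "\<exists>\<eta>>0. \<forall>\<^sub>F n in sequentially. \<forall>T u D. 1 \<le> T \<longrightarrow> real T \<le> \<eta> * sqrt (hscale n) \<longrightarrow> u \<in> typical c C T \<longrightarrow>
     D = -1 \<or> D = int T \<longrightarrow>
     (1 - \<epsilon>) * ustar_asymp n * (chain_density (\<lambda>_. T) u / hscale n ^ (2 * T + 1)) \<le>
       real (card {s \<in> ustar n. \<forall>cc\<in>coords T. int (case cc of Peak \<Rightarrow> PK s | Part j t \<Rightarrow> Y j t s) =
          \<lceil>hscale n * (u cc + ln (2 * hscale n))\<rceil> + D - int (level cc)})"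
proof -
  have e2: "0 < \<epsilon> / 2" using e by simp
  obtain \<delta> where d: "0 < \<delta>" and llt: "\<forall>\<^sub>F h in at_top. \<forall>a b N. h + 1 \<le> real a \<longrightarrow> h + 1 \<le> real b \<longrightarrow>
     \<bar>bs.mean a b h - real_of_int N\<bar> \<le> \<delta> * (h * sqrt h) \<longrightarrow>
     1 - \<epsilon> / 2 \<le> bs.pr a b h N * sqrt (2 * pi * bs.mom a b h 2)"
    using LLT_lower[OF e2] by blast
  define KK where "KK = 16 * (1 + C) + 2 * (ln ((1 + C) / c) + 1)"
  have "0 \<le> ln ((1 + C) / c)" using cC by (simp add: field_simps)
  then have KK0: "0 < KK" using cC unfolding KK_def by (intro add_pos_nonneg) auto
  define b where "b = 6 + 12 * (1 + C)"
  have b0: "0 < b" using cC by (simp add: b_def)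
  have "((\<lambda>x. exp (- (b * x\<^sup>2))) \<longlongrightarrow> exp (- (b * 0\<^sup>2))) (at_right 0)"
    by (intro tendsto_intros)
  then have "\<forall>\<^sub>F x in at_right 0. 1 - \<epsilon> / 2 < exp (- (b * x\<^sup>2))"
    by (rule order_tendstoD) (use e in simp)
  \<comment> \<open>The second bound keeps the prescribed parts above h ln h / 2, the third controls
    the order T h error of the mean; the bound on the exponential above absorbs the rounding
    factors.\<close>
  moreover have "\<forall>\<^sub>F x in at_right (0::real). 0 < x \<and> x < min 1 (min (1 / (3 * (1 + C))) (\<delta> / (3 * KK)))"
  proof -
    have "0 < min 1 (min (1 / (3 * (1 + C))) (\<delta> / (3 * KK)))" using cC d KK0 by simp
    then show ?thesis unfolding eventually_at_right_field by blast
  qed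
  ultimately have "\<forall>\<^sub>F x in at_right 0. 1 - \<epsilon> / 2 < exp (- (b * x\<^sup>2)) \<and> 0 < x \<and> x < min 1 (min (1 / (3 *
    (1 + C))) (\<delta> / (3 * KK)))"
    by eventually_elim auto
  then obtain \<eta> where et: "1 - \<epsilon> / 2 < exp (- (b * \<eta>\<^sup>2))" "0 < \<eta>" "\<eta> < min 1 (min (1 / (3 * (1 +
    C))) (\<delta> / (3 * KK)))"
    using eventually_happens trivial_limit_at_right_real by blast
  have eta': "\<eta> \<le> 1" "(1 + C) * \<eta> \<le> 1 / 3" "KK * \<eta> \<le> \<delta> / 3"
    using et(3) cC KK0 by (auto simp: field_simps)
  have m: "\<forall>\<^sub>F n in sequentially. \<bar>2 * mean_sum (hscale n) (n + 1) - real n\<bar> / (hscale n * sqrt (hscale n))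
    < \<delta> / 3"
    by (rule order_tendstoD[OF mean_total]) (use d in simp)
  have "\<forall>\<^sub>F h in at_top. mean_slack c C h / (h * sqrt h) < \<delta> / 3"
    by (rule order_tendstoD[OF mean_slack_tendsto[OF cC(1)]]) (use d in simp)
  note s = eventually_compose_filterlim[OF this hscale_filterlim]
  note l = eventually_compose_filterlim[OF llt hscale_filterlim]
  have "\<forall>\<^sub>F h in at_top. 16 \<le> h \<and> 6 * ln (h / c) \<le> sqrt h \<and> h + 1 \<le> h * ln h / 2"
  proof (intro eventually_conj eventually_ge_at_top)
    show "\<forall>\<^sub>F h in at_top. 6 * ln (h / c) \<le> sqrt h" using cC(1) by real_asymp
    show "\<forall>\<^sub>F h::real in at_top. h + 1 \<le> h * ln h / 2" by real_asymp
  qed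
  note f = eventually_compose_filterlim[OF this hscale_filterlim]
  show ?thesis
  proof (intro exI[of _ \<eta>] conjI et(2))
    show "\<forall>\<^sub>F n in sequentially. \<forall>T u D. 1 \<le> T \<longrightarrow> real T \<le> \<eta> * sqrt (hscale n) \<longrightarrow> u \<in> typical c C T \<longrightarrow>
     D = -1 \<or> D = int T \<longrightarrow>
     (1 - \<epsilon>) * ustar_asymp n * (chain_density (\<lambda>_. T) u / hscale n ^ (2 * T + 1)) \<le>
       real (card {s \<in> ustar n. \<forall>cc\<in>coords T. int (case cc of Peak \<Rightarrow> PK s | Part j t \<Rightarrow> Y j t s) =
          \<lceil>hscale n * (u cc + ln (2 * hscale n))\<rceil> + D - int (level cc)})"
      using m s l f
    proof eventually_elim
      case (elim n)
      show ?case
      proof (intro allI impI)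
        fix T :: nat and u :: "coord \<Rightarrow> real" and D :: int
        assume T: "1 \<le> T" "real T \<le> \<eta> * sqrt (hscale n)" and g: "u \<in> typical c C T" and D: "D = -1 \<or> D = int T"
        interpret top_parts n T \<eta> c C u D
          by unfold_locales (use T g D et eta' cC elim in auto)
        have hs: "0 < hscale n * sqrt (hscale n)" using h0 by simp
        have me: "\<bar>bs.mean (a L) (a R) (hscale n) - real_of_int (int (n - S))\<bar> \<le> \<delta> * (hscale n *
          sqrt (hscale n))"
        proof -
          have "\<bar>bs.mean (a L) (a R) (hscale n) - real_of_int (int (n - S))\<bar> \<le>
             \<bar>2 * mean_sum (hscale n) (n + 1) - real n\<bar> + KK * \<eta> * (hscale n * sqrt (hscale n)) +
               mean_slack c C (hscale n)"
            using mean_error unfolding KK_def top_parts.K_def[OF top_parts_axioms] by simp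
          also have "\<dots> \<le> \<delta> / 3 * (hscale n * sqrt (hscale n)) + \<delta> / 3 * (hscale n * sqrt (hscale n)) +
            \<delta> / 3 * (hscale n * sqrt (hscale n))"
          proof (intro add_mono mult_right_mono eta')
            show "\<bar>2 * mean_sum (hscale n) (n + 1) - real n\<bar> \<le> \<delta> / 3 * (hscale n * sqrt (hscale n))"
              using elim(1) hs by (simp only: pos_divide_less_eq less_imp_le)
            show "mean_slack c C (hscale n) \<le> \<delta> / 3 * (hscale n * sqrt (hscale n))"
              using elim(2) hs by (simp only: pos_divide_less_eq less_imp_le)
          qed (use hs in simp)
          finally show ?thesis by simp
        qed
        have al: "hscale n + 1 \<le> real (a j)" for j using a_lower[of j] elim(4) by linarith
        have llt': "1 - \<epsilon> / 2 \<le> bs.pr (a L) (a R) (hscale n) (int (n - S)) * sqrt (2 * pi * bs.mom (a L) (a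
          R) (hscale n) 2)"
          using elim(3) al me by blast
        have "0 \<le> ustar_asymp n" unfolding ustar_asymp_def by (intro divide_nonneg_nonneg) (use
          total_var_bounds(3)[of n] h16 in auto)
        moreover have "0 \<le> chain_density (\<lambda>_. T) u / hscale n ^ (2 * T + 1)" using chain_density_nonneg h0
          by simp
        ultimately have kd: "0 \<le> ustar_asymp n * (chain_density (\<lambda>_. T) u / hscale n ^ (2 * T + 1))"
          by (rule mult_nonneg_nonneg)
        have "1 - \<epsilon> \<le> (1 - \<epsilon> / 2) * (1 - \<epsilon> / 2)" by (simp add: algebra_simps)
        also have "\<dots> \<le> (1 - \<epsilon> / 2) * exp (- (b * \<eta>\<^sup>2))" by (rule mult_left_mono[OF less_imp_le[OF et(1)]])
          (use e in simp)
        finally have "(1 - \<epsilon>) * (ustar_asymp n * (chain_density (\<lambda>_. T) u / hscale n ^ (2 * T + 1))) \<le>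
          (1 - \<epsilon> / 2) * exp (- (b * \<eta>\<^sup>2)) * (ustar_asymp n * (chain_density (\<lambda>_. T) u / hscale n ^ (2 *
          T + 1)))"
          by (rule mult_right_mono[OF _ kd])
        also have "\<dots> = (1 - \<epsilon> / 2) * exp (- ((6 + 12 * (1 + C)) * \<eta>\<^sup>2)) * ustar_asymp n * (chain_density
          (\<lambda>_. T) u / hscale n ^ (2 * T + 1))"
          by (simp add: b_def)
        also have "\<dots> \<le> real (card {s \<in> ustar n. PK s = z Peak \<and> (\<forall>j. \<forall>t\<in>{1..T}. Y j t s = z (Part j t))})"
          by (rule card_lower[OF _ llt']) (use e in simp)
        also have "{s \<in> ustar n. PK s = z Peak \<and> (\<forall>j. \<forall>t\<in>{1..T}. Y j t s = z (Part j t))} =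
           {s \<in> ustar n. \<forall>cc\<in>coords T. int (case cc of Peak \<Rightarrow> PK s | Part j t \<Rightarrow> Y j t s) =
          \<lceil>hscale n * (u cc + ln (2 * hscale n))\<rceil> + D - int (level cc)}"
        proof -
          have zi: "int (z (side_coord j t)) = zz (side_coord j t)" if "t \<le> T" for j t using z_real[OF that,
            of j] by linarith
          have pk: "int (z Peak) = zz Peak" using zi[of 0 L] by (simp add: side_coord_def)
          have pj: "int (z (Part j t)) = zz (Part j t)" if "t \<in> {1..T}" for j t using zi[of t j] that
            by (simp add: side_coord_def)
          have c: "(\<forall>cc\<in>coords T. Q cc) \<longleftrightarrow> Q Peak \<and> (\<forall>j. \<forall>t\<in>{1..T}. Q (Part j t))" for Q
          proof -
            have "coords T = insert Peak (\<Union>j\<in>UNIV. Part j ` {1..T})" by (auto simp: coords_def UNIV_side)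
            then show ?thesis by auto
          qed
          have eqv: "\<lceil>hscale n * (u cc + ln (2 * hscale n))\<rceil> + D - int (level cc) = zz cc" for cc
            by (simp add: zz_def y_def)
          show ?thesis unfolding eqv c by (simp add: pk[symmetric] pj[symmetric])
        qed
        finally show "(1 - \<epsilon>) * ustar_asymp n * (chain_density (\<lambda>_. T) u / hscale n ^ (2 * T + 1)) \<le>
       real (card {s \<in> ustar n. \<forall>cc\<in>coords T. int (case cc of Peak \<Rightarrow> PK s | Part j t \<Rightarrow> Y j t s) =
          \<lceil>hscale n * (u cc + ln (2 * hscale n))\<rceil> + D - int (level cc)})" by (simp add: mult.assoc)
      qed
    qed
  qed
qed

section \<open>The joint limit law\<close>

definition part_value :: "useq \<Rightarrow> coord \<Rightarrow> nat" where
  "part_value s cc = (case cc of Peak \<Rightarrow> PK s | Part j t \<Rightarrow> Y j t s)"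

definition ceil_shift :: "nat \<Rightarrow> int \<Rightarrow> (coord \<Rightarrow> real) \<Rightarrow> coord \<Rightarrow> int" where
  "ceil_shift n D u cc = \<lceil>hscale n * (u cc + ln (2 * hscale n))\<rceil> + D - int (level cc)"

text \<open>The real points rounded to a given lattice point form a half-open box of side 1 / h in
  every coordinate; the shifts by \<open>D\<close> and the level only translate it.\<close>

lemma cell_box:
  assumes h: "0 < hscale n"
  shows "{u \<in> space (Pi\<^sub>M (coords T) (\<lambda>_. lborel)). \<forall>cc\<in>coords T. ceil_shift n D u cc = x cc} =
    (\<Pi>\<^sub>E cc\<in>coords T. {real_of_int (x cc - D + int (level cc) - 1) / hscale n - ln (2 * hscale n) <..
      real_of_int (x cc - D + int (level cc)) / hscale n - ln (2 * hscale n)})"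
proof -
  have eq: "ceil_shift n D u cc = x cc \<longleftrightarrow> u cc \<in> {real_of_int (x cc - D + int (level cc) - 1) / hscale n - ln
    (2 * hscale n) <.. real_of_int (x cc - D + int (level cc)) / hscale n - ln (2 * hscale n)}" for u cc
  proof -
    let ?m = "x cc - D + int (level cc)"
    have "ceil_shift n D u cc = x cc \<longleftrightarrow> \<lceil>hscale n * (u cc + ln (2 * hscale n))\<rceil> = ?m"
      unfolding ceil_shift_def by linarith
    also have "\<dots> \<longleftrightarrow> real_of_int ?m - 1 < hscale n * (u cc + ln (2 * hscale n)) \<and> hscale n * (u cc + ln (2 *
      hscale n)) \<le> real_of_int ?m"
      by (rule ceiling_eq_iff)
    also have "\<dots> \<longleftrightarrow> (real_of_int ?m - 1) / hscale n < u cc + ln (2 * hscale n) \<and> u cc + ln (2 * hscale n) \<le>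
      real_of_int ?m / hscale n"
      using h by (simp add: pos_divide_less_eq pos_le_divide_eq mult.commute)
    also have "\<dots> \<longleftrightarrow> u cc \<in> {real_of_int (?m - 1) / hscale n - ln (2 * hscale n) <.. real_of_int ?m / hscale n
      - ln (2 * hscale n)}"
      by auto
    finally show ?thesis .
  qed
  show ?thesis unfolding eq space_PiM by (auto simp: PiE_iff extensional_def)
qed

lemma cell_measure:
  fixes n T :: nat and D :: int and x :: "coord \<Rightarrow> int"
  assumes h: "0 < hscale n"
  defines "Q \<equiv> {u \<in> space (Pi\<^sub>M (coords T) (\<lambda>_. lborel)). \<forall>cc\<in>coords T. ceil_shift n D u cc = x cc}"
  shows "Q \<in> sets (Pi\<^sub>M (coords T) (\<lambda>_. lborel))"
    and "emeasure (Pi\<^sub>M (coords T) (\<lambda>_. lborel)) (Q) = ennreal (1 / hscale n ^ (2 * T + 1))"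
proof -
  let ?b = "\<lambda>cc. {real_of_int (x cc - D + int (level cc) - 1) / hscale n - ln (2 * hscale n) <.. real_of_int
    (x cc - D + int (level cc)) / hscale n - ln (2 * hscale n)}"
  have Q: "Q = (\<Pi>\<^sub>E cc\<in>coords T. ?b cc)" unfolding Q_def by (rule cell_box[OF h])
  show "Q \<in> sets (Pi\<^sub>M (coords T) (\<lambda>_. lborel))" unfolding Q by (intro sets_PiM_I_finite finite_coords) auto
  have "emeasure (Pi\<^sub>M (coords T) (\<lambda>_. lborel)) (Q) = (\<Prod>cc\<in>coords T. emeasure lborel (?b cc))"
    unfolding Q by (intro lborel_prod.emeasure_PiM finite_coords) auto
  also have "\<dots> = (\<Prod>cc\<in>coords T. ennreal (1 / hscale n))"
  proof (rule prod.cong[OF refl])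
    fix cc
    have "real_of_int (x cc - D + int (level cc) - 1) / hscale n \<le> real_of_int (x cc - D + int (level cc)) /
      hscale n"
      using h by (intro divide_right_mono) auto
    then show "emeasure lborel (?b cc) = ennreal (1 / hscale n)"
      by (subst emeasure_lborel_Ioc) (simp_all add: diff_divide_distrib[symmetric])
  qed
  also have "\<dots> = ennreal (1 / hscale n ^ (2 * T + 1))"
    using h by (subst prod_ennreal) (auto simp: card_coords power_one_over)
  finally show "emeasure (Pi\<^sub>M (coords T) (\<lambda>_. lborel)) (Q) = ennreal (1 / hscale n ^ (2 * T + 1))" .
qed

text \<open>The pointwise bound is integrated cell by cell. Since it holds at every real point of
  the part of a cell lying in \<open>B\<close>, it bounds the density there by a count divided by
  the cell volume, and no continuity estimate for the density is involved. Different lattice points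
  count disjoint sets of sequences. Positivity of the density forces every cell that meets
  \<open>B\<close> to carry a sequence.\<close>

lemma mass_transfer:
  assumes h: "0 < hscale n" and al: "0 < \<alpha>"
    and B: "B \<in> sets (limit_law T)" and Bg: "\<And>u. u \<in> B \<Longrightarrow> 0 < chain_density (\<lambda>_. T) u"
    and pw: "\<And>u. u \<in> B \<Longrightarrow> \<alpha> * (chain_density (\<lambda>_. T) u / hscale n ^ (2 * T + 1)) \<le> real (card {s \<in> ustar n.
      \<forall>cc\<in>coords T. int (part_value s cc) = ceil_shift n D u cc})"
    and Ev: "\<And>u s. u \<in> B \<Longrightarrow> s \<in> ustar n \<Longrightarrow> \<forall>cc\<in>coords T. int (part_value s cc) = ceil_shift n D u cc \<Longrightarrow> s \<in> Ev"
  shows "\<alpha> * measure (limit_law T) B \<le> real (card (ustar n \<inter> Ev))"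
proof -
  interpret N: prob_space "limit_law T" by (rule prob_space_limit_law)
  let ?M = "Pi\<^sub>M (coords T) (\<lambda>_. lborel) :: (coord \<Rightarrow> real) measure"
  let ?U = "ustar n \<inter> Ev"
  define fx where "fx s = restrict (\<lambda>cc. int (part_value s cc)) (coords T)" for s
  define Q where "Q x = {u \<in> space ?M. \<forall>cc\<in>coords T. ceil_shift n D u cc = x cc}" for x :: "coord \<Rightarrow> int"
  have Qm: "Q x \<in> sets ?M" "emeasure ?M (Q x) = ennreal (1 / hscale n ^ (2 * T + 1))" for x
    unfolding Q_def using cell_measure[OF h] by auto
  have fin: "finite ?U" using finite_ustar by auto
  have Bs: "B \<in> sets ?M" using B by simp
  have cover: "B \<subseteq> (\<Union>x\<in>fx ` ?U. Q x \<inter> B)"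
  proof
    fix u assume u: "u \<in> B"
    have "0 < \<alpha> * (chain_density (\<lambda>_. T) u / hscale n ^ (2 * T + 1))" using al Bg[OF u] h by simp
    then have "0 < card {s \<in> ustar n. \<forall>cc\<in>coords T. int (part_value s cc) = ceil_shift n D u cc}"
      using pw[OF u] by linarith
    then have "{s \<in> ustar n. \<forall>cc\<in>coords T. int (part_value s cc) = ceil_shift n D u cc} \<noteq> {}"
      by (metis card.empty less_irrefl)
    then obtain s where s: "s \<in> ustar n" "\<forall>cc\<in>coords T. int (part_value s cc) = ceil_shift n D u cc" by blast
    have "s \<in> Ev" by (rule Ev[OF u s])
    moreover have "u \<in> Q (fx s)" using sets.sets_into_space[OF Bs] u s by (auto simp: Q_def fx_def)
    ultimately show "u \<in> (\<Union>x\<in>fx ` ?U. Q x \<inter> B)" using s(1) u by blast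
  qed
  have each: "measure (limit_law T) (Q x \<inter> B) \<le> real (card {s \<in> ?U. fx s = x}) / \<alpha>" if x: "x \<in> fx ` ?U" for x
  proof -
    let ?c = "real (card {s \<in> ?U. fx s = x})"
    have bd: "chain_density (\<lambda>_. T) u \<le> ?c / \<alpha> * hscale n ^ (2 * T + 1)" if u: "u \<in> Q x \<inter> B" for u
    proof -
      have "{s \<in> ustar n. \<forall>cc\<in>coords T. int (part_value s cc) = ceil_shift n D u cc} \<subseteq> {s \<in> ?U. fx s = x}"
      proof
        fix s assume s: "s \<in> {s \<in> ustar n. \<forall>cc\<in>coords T. int (part_value s cc) = ceil_shift n D u cc}"
        then have "s \<in> Ev" using Ev[of u s] u by blast
        moreover have "fx s = x"
        proof -
          obtain s' where "x = fx s'" using x by blast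
          then have "x = restrict x (coords T)" by (simp add: fx_def)
          moreover have "fx s = restrict x (coords T)" using s u by (auto simp: fx_def Q_def restrict_def)
          ultimately show ?thesis by simp
        qed
        ultimately show "s \<in> {s \<in> ?U. fx s = x}" using s by blast
      qed
      then have "card {s \<in> ustar n. \<forall>cc\<in>coords T. int (part_value s cc) = ceil_shift n D u cc} \<le>
        card {s \<in> ?U. fx s = x}"
        by (rule card_mono[OF finite_subset[OF _ fin], rotated]) auto
      then have "\<alpha> * (chain_density (\<lambda>_. T) u / hscale n ^ (2 * T + 1)) \<le> ?c" using pw[of u] u by force
      then show ?thesis using al h by (simp add: field_simps)
    qed
    have "emeasure (limit_law T) (Q x \<inter> B) = (\<integral>\<^sup>+u. ennreal (chain_density (\<lambda>_. T) u) * indicator (Q x \<inter> B)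
      u \<partial>?M)"
      unfolding limit_law_def using Qm Bs by (subst emeasure_density) (auto simp: coords_eq)
    also have "\<dots> \<le> (\<integral>\<^sup>+u. ennreal (?c / \<alpha> * hscale n ^ (2 * T + 1)) * indicator (Q x) u \<partial>?M)"
      by (rule nn_integral_mono) (use bd in \<open>auto simp: indicator_def intro!: ennreal_leI\<close>)
    also have "\<dots> = ennreal (?c / \<alpha> * hscale n ^ (2 * T + 1)) * ennreal (1 / hscale n ^ (2 * T + 1))"
      using Qm by (simp add: nn_integral_cmult_indicator)
    also have "\<dots> = ennreal (?c / \<alpha>)" using h al by (simp add: ennreal_mult'[symmetric])
    finally show ?thesis using al by (simp add: N.emeasure_eq_measure)
  qed
  have "measure (limit_law T) B \<le> measure (limit_law T) (\<Union>x\<in>fx ` ?U. Q x \<inter> B)"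
    by (intro N.finite_measure_mono cover sets.finite_UN) (use fin Qm Bs in auto)
  also have "\<dots> \<le> (\<Sum>x\<in>fx ` ?U. measure (limit_law T) (Q x \<inter> B))"
    by (intro measure_UNION_le) (use fin Qm Bs in auto)
  also have "\<dots> \<le> (\<Sum>x\<in>fx ` ?U. real (card {s \<in> ?U. fx s = x}) / \<alpha>)"
    by (intro sum_mono each)
  also have "\<dots> = real (card ?U) / \<alpha>"
  proof -
    have "card ?U = (\<Sum>x\<in>fx ` ?U. card {s \<in> ?U. fx s = x})"
      using sum.image_gen[OF fin, of "\<lambda>_. 1::nat" fx] by simp
    then show ?thesis by (simp add: sum_divide_distrib[symmetric])
  qed
  finally show ?thesis using al by (simp add: field_simps)
qed

definition bound_of :: "real \<Rightarrow> (side \<Rightarrow> nat \<Rightarrow> real) \<Rightarrow> coord \<Rightarrow> real" where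
  "bound_of v0 v cc = (case cc of Peak \<Rightarrow> v0 | Part j t \<Rightarrow> v j t)"

lemma ball_coords: "(\<forall>cc\<in>coords T. Q cc) \<longleftrightarrow> Q Peak \<and> (\<forall>j\<in>{L, R}. \<forall>t\<in>{1..T}. Q (Part j t))"
  by (auto simp: coords_def)

lemma orthant_eq: "orthant T v0 v = {u \<in> space (Pi\<^sub>M (coords T) (\<lambda>_. lborel)). \<forall>cc\<in>coords T. u cc \<le>
  bound_of v0 v cc}"
  unfolding orthant_def ball_coords by (simp add: bound_of_def)

lemma orthant_sets: "orthant T v0 v \<in> sets (Pi\<^sub>M (coords T) (\<lambda>_. lborel))"
proof -
  have "orthant T v0 v = (\<Pi>\<^sub>E cc\<in>coords T. {..bound_of v0 v cc})"
    unfolding orthant_eq space_PiM by (auto simp: PiE_iff extensional_def)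
  then show ?thesis by (simp only:) (intro sets_PiM_I_finite finite_coords, auto)
qed

lemma set_integral_limit_law:
  assumes T: "1 \<le> T" and S: "S \<in> sets (Pi\<^sub>M (coords T) (\<lambda>_. lborel))"
  shows "set_lebesgue_integral (Pi\<^sub>M (coords T) (\<lambda>_. lborel)) S (F T) = measure (limit_law T) S"
proof -
  let ?M = "Pi\<^sub>M (coords T) (\<lambda>_. lborel) :: (coord \<Rightarrow> real) measure"
  have Fd: "F T = chain_density (\<lambda>_. T)" by (rule ext) (rule F_eq_chain_density[OF T])
  have m: "chain_density (\<lambda>_. T) \<in> borel_measurable ?M" by (simp add: coords_eq)
  have "set_lebesgue_integral ?M S (F T) = (\<integral>u. indicator S u * chain_density (\<lambda>_. T) u \<partial>?M)"
    by (simp add: set_lebesgue_integral_def Fd)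
  also have "\<dots> = enn2real (\<integral>\<^sup>+u. ennreal (indicator S u * chain_density (\<lambda>_. T) u) \<partial>?M)"
    by (rule integral_eq_nn_integral) (use m S chain_density_nonneg in auto)
  also have "(\<integral>\<^sup>+u. ennreal (indicator S u * chain_density (\<lambda>_. T) u) \<partial>?M) = (\<integral>\<^sup>+u. ennreal (chain_density
    (\<lambda>_. T) u) * indicator S u \<partial>?M)"
    by (rule nn_integral_cong) (simp add: indicator_def)
  also have "\<dots> = emeasure (limit_law T) S" unfolding limit_law_def using m S by (subst emeasure_density) auto
  finally show ?thesis by (simp add: measure_def)
qed

lemma scaled_hscale: "0 < hscale n \<Longrightarrow> scaled n x = x / hscale n - ln (2 * hscale n)"
  unfolding scaled_def hscale_def by (simp add: diff_divide_distrib mult.assoc)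

definition top_event :: "nat \<Rightarrow> nat \<Rightarrow> real \<Rightarrow> (side \<Rightarrow> nat \<Rightarrow> real) \<Rightarrow> useq set" where
  "top_event n T v0 v = {s. scaled n (real (PK s)) \<le> v0 \<and>
      (\<forall>j \<in> {L, R}. \<forall>t \<in> {1..T}. scaled n (real (Y j t s)) \<le> v j t)}"

lemma top_event_eq: "top_event n T v0 v = {s. \<forall>cc\<in>coords T. scaled n (real (part_value s cc)) \<le>
  bound_of v0 v cc}"
  unfolding top_event_def ball_coords by (simp add: bound_of_def part_value_def)

lemma prob_Pstar: "1 \<le> n \<Longrightarrow> measure_pmf.prob (Pstar n) E = real (card (ustar n \<inter> E)) / real (card (ustar n))"
  unfolding Pstar_def by (simp add: measure_pmf_of_set ustar_nonempty finite_ustar)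

lemma chain_density_typical: "u \<in> typical c C T \<Longrightarrow> 0 < chain_density (\<lambda>_. T) u"
  unfolding typical_def chain_density_def by (auto intro!: mult_pos_pos prod_pos wgt_pos)

lemma ustar_asymp_pos: "2 \<le> hscale n \<Longrightarrow> 0 < ustar_asymp n"
  unfolding ustar_asymp_def by (intro divide_pos_pos mult_pos_pos) (use total_var_bounds[of n]
    part_prod_pos[of "hscale n" "Suc n"] in auto)

text \<open>The subtracted \<open>\<epsilon>\<close> pays for atypical points. As the pointwise
  bound is uniform in \<open>u\<close>, both estimates hold for all \<open>T\<close>,
  \<open>v0\<close> and \<open>v\<close> at once, which allows thresholds that change with
  \<open>n\<close> arbitrarily.\<close>

lemma ustar_split_lower:
  assumes e: "0 < (\<epsilon>::real)" "\<epsilon> < 1"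
  shows "\<exists>\<eta>>0. \<forall>\<^sub>F n in sequentially. \<forall>T v0 v. 1 \<le> T \<longrightarrow> real T \<le> \<eta> * sqrt (hscale n) \<longrightarrow>
     (1 - \<epsilon>) * ustar_asymp n * (measure (limit_law T) (orthant T v0 v) - \<epsilon>) \<le> real (card (ustar n \<inter>
       top_event n T v0 v)) \<and>
     (1 - \<epsilon>) * ustar_asymp n * (1 - measure (limit_law T) (orthant T v0 v) - \<epsilon>) \<le> real (card (ustar n \<inter> -
       top_event n T v0 v))"
proof -
  obtain c C where cC: "0 < c" "c < 1" "0 < C" and gp: "\<And>T. 1 \<le> T \<Longrightarrow> 1 - \<epsilon> \<le> measure (limit_law T) (typical c
    C T)"
    using typical_prob[OF e(1)] by blast
  obtain \<eta> where eta: "0 < \<eta>" and pw: "\<forall>\<^sub>F n in sequentially. \<forall>T u D. 1 \<le> T \<longrightarrow> real T \<le> \<eta> * sqrt (hscale n) \<longrightarrow>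
    u \<in> typical c C T \<longrightarrow>
     D = -1 \<or> D = int T \<longrightarrow>
     (1 - \<epsilon>) * ustar_asymp n * (chain_density (\<lambda>_. T) u / hscale n ^ (2 * T + 1)) \<le>
       real (card {s \<in> ustar n. \<forall>cc\<in>coords T. int (case cc of Peak \<Rightarrow> PK s | Part j t \<Rightarrow> Y j t s) =
          \<lceil>hscale n * (u cc + ln (2 * hscale n))\<rceil> + D - int (level cc)})"
    using pointwise_lower[OF e cC] by blast
  have h2: "\<forall>\<^sub>F n in sequentially. 2 \<le> hscale n" using hscale_filterlim by (simp add: filterlim_at_top)
  show ?thesis
  proof (intro exI[of _ \<eta>] conjI eta)
    show "\<forall>\<^sub>F n in sequentially. \<forall>T v0 v. 1 \<le> T \<longrightarrow> real T \<le> \<eta> * sqrt (hscale n) \<longrightarrow>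
     (1 - \<epsilon>) * ustar_asymp n * (measure (limit_law T) (orthant T v0 v) - \<epsilon>) \<le> real (card (ustar n \<inter>
       top_event n T v0 v)) \<and>
     (1 - \<epsilon>) * ustar_asymp n * (1 - measure (limit_law T) (orthant T v0 v) - \<epsilon>) \<le> real (card (ustar n \<inter> -
       top_event n T v0 v))"
      using pw h2
    proof eventually_elim
      case (elim n)
      have h0: "0 < hscale n" using elim by simp
      have al: "0 < (1 - \<epsilon>) * ustar_asymp n" using e ustar_asymp_pos[OF elim(2)] by simp
      show ?case
      proof (intro allI impI)
        fix T v0 v assume T: "1 \<le> T" "real T \<le> \<eta> * sqrt (hscale n)"
        interpret N: prob_space "limit_law T" by (rule prob_space_limit_law)
        let ?O = "orthant T v0 v" and ?G = "typical c C T" and ?E = "top_event n T v0 v"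
        have Om: "?O \<in> sets (limit_law T)" using orthant_sets by simp
        have Gm: "?G \<in> sets (limit_law T)" by (rule typical_sets[OF T(1)])
        have pwD: "(1 - \<epsilon>) * ustar_asymp n * (chain_density (\<lambda>_. T) u / hscale n ^ (2 * T + 1)) \<le>
            real (card {s \<in> ustar n. \<forall>cc\<in>coords T. int (part_value s cc) = ceil_shift n D u cc})"
          if "u \<in> ?G" "D = -1 \<or> D = int T" for u D
          using elim(1) T that unfolding part_value_def ceil_shift_def by blast
        have inter: "measure (limit_law T) S - \<epsilon> \<le> measure (limit_law T) (S \<inter> ?G)"
          if "S \<in> sets (limit_law T)" for S
        proof -
          have "measure (limit_law T) S \<le> measure (limit_law T) ((S \<inter> ?G) \<union> (space (limit_law T) - ?G))"
          proof (rule N.finite_measure_mono)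
            show "S \<subseteq> (S \<inter> ?G) \<union> (space (limit_law T) - ?G)" using sets.sets_into_space[OF that] by blast
            show "(S \<inter> ?G) \<union> (space (limit_law T) - ?G) \<in> sets (limit_law T)" by (intro sets.Un sets.Int
              sets.compl_sets that Gm)
          qed
          also have "\<dots> \<le> measure (limit_law T) (S \<inter> ?G) + measure (limit_law T) (space (limit_law T) - ?G)"
            by (intro measure_Un_le sets.Int sets.compl_sets that Gm)
          also have "measure (limit_law T) (space (limit_law T) - ?G) \<le> \<epsilon>" using N.prob_compl[OF Gm] gp[OF
            T(1)] by simp
          finally show ?thesis by simp
        qed
        have sc: "scaled n (real (part_value s cc)) = (real_of_int (ceil_shift n D u cc)) / hscale n - ln (2
          * hscale n)"
          if "int (part_value s cc) = ceil_shift n D u cc" for s cc D u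
        proof -
          have "real (part_value s cc) = real_of_int (ceil_shift n D u cc)" using that
            by (metis of_int_of_nat_eq)
          then show ?thesis by (simp add: scaled_hscale[OF h0])
        qed
        have up: "scaled n (real (part_value s cc)) \<le> u cc" if "int (part_value s cc) = ceil_shift n (-1) u
          cc" for s cc u
        proof -
          have "real_of_int (ceil_shift n (-1) u cc) \<le> hscale n * (u cc + ln (2 * hscale n))"
            unfolding ceil_shift_def by linarith
          then show ?thesis unfolding sc[OF that] using h0 by (simp add: pos_divide_le_eq field_simps)
        qed
        have lo: "u cc \<le> scaled n (real (part_value s cc))" if "int (part_value s cc) = ceil_shift n (int T)
          u cc" "cc \<in> coords T" for s cc u
        proof -
          have "level cc \<le> T" using that(2) unfolding coords_cases by (auto simp: level_side_coord)
          then have "hscale n * (u cc + ln (2 * hscale n)) \<le> real_of_int (ceil_shift n (int T) u cc)"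
            unfolding ceil_shift_def by linarith
          then show ?thesis unfolding sc[OF that(1)] using h0 by (simp add: pos_le_divide_eq field_simps)
        qed
        have "(1 - \<epsilon>) * ustar_asymp n * (measure (limit_law T) ?O - \<epsilon>) \<le> (1 - \<epsilon>) * ustar_asymp n *
          measure (limit_law T) (?O \<inter> ?G)"
          by (intro mult_left_mono inter Om) (use al in simp)
        also have "\<dots> \<le> real (card (ustar n \<inter> ?E))"
        proof (rule mass_transfer[OF h0 al, of _ _ "-1"])
          show "?O \<inter> ?G \<in> sets (limit_law T)" using Om Gm by auto
          show "0 < chain_density (\<lambda>_. T) u" if "u \<in> ?O \<inter> ?G" for u using that chain_density_typical by blast
          show "(1 - \<epsilon>) * ustar_asymp n * (chain_density (\<lambda>_. T) u / hscale n ^ (2 * T + 1)) \<le> real (card {s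
            \<in> ustar n. \<forall>cc\<in>coords T. int (part_value s cc) = ceil_shift n (-1) u cc})"
            if "u \<in> ?O \<inter> ?G" for u using that pwD by blast
          fix u s assume u: "u \<in> ?O \<inter> ?G" and m: "\<forall>cc\<in>coords T. int (part_value s cc) = ceil_shift n (-1) u cc"
          show "s \<in> ?E" unfolding top_event_eq
          proof (intro CollectI ballI)
            fix cc assume cc: "cc \<in> coords T"
            have "u cc \<le> bound_of v0 v cc" using u cc unfolding orthant_eq by blast
            then show "scaled n (real (part_value s cc)) \<le> bound_of v0 v cc" using up[of s cc u] m cc by force
          qed
        qed
        finally have 1: "(1 - \<epsilon>) * ustar_asymp n * (measure (limit_law T) ?O - \<epsilon>) \<le> real (card (ustar n \<inter>
          ?E))" .
        let ?O' = "space (limit_law T) - ?O"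
        have O'm: "?O' \<in> sets (limit_law T)" by (intro sets.compl_sets Om)
        have "(1 - \<epsilon>) * ustar_asymp n * (1 - measure (limit_law T) ?O - \<epsilon>) \<le> (1 - \<epsilon>) * ustar_asymp n *
          measure (limit_law T) (?O' \<inter> ?G)"
          using inter[OF O'm] N.prob_compl[OF Om] al by (intro mult_left_mono) auto
        also have "\<dots> \<le> real (card (ustar n \<inter> - ?E))"
        proof (rule mass_transfer[OF h0 al, of _ _ "int T"])
          show "?O' \<inter> ?G \<in> sets (limit_law T)" by (intro sets.Int O'm Gm)
          show "0 < chain_density (\<lambda>_. T) u" if "u \<in> ?O' \<inter> ?G" for u using that chain_density_typical by blast
          show "(1 - \<epsilon>) * ustar_asymp n * (chain_density (\<lambda>_. T) u / hscale n ^ (2 * T + 1)) \<le> real (card {s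
            \<in> ustar n. \<forall>cc\<in>coords T. int (part_value s cc) = ceil_shift n (int T) u cc})"
            if "u \<in> ?O' \<inter> ?G" for u using that pwD by blast
          fix u s assume u: "u \<in> ?O' \<inter> ?G" and m: "\<forall>cc\<in>coords T. int (part_value s cc) = ceil_shift n (int
            T) u cc"
          obtain cc where cc: "cc \<in> coords T" "bound_of v0 v cc < u cc" using u
            unfolding orthant_eq space_limit_law by (auto simp: not_le)
          then have "bound_of v0 v cc < scaled n (real (part_value s cc))" using lo[of s cc u] m by force
          then show "s \<in> - ?E" unfolding top_event_eq using cc(1) by (auto simp: not_le)
        qed
        finally have 2: "(1 - \<epsilon>) * ustar_asymp n * (1 - measure (limit_law T) ?O - \<epsilon>) \<le> real (card (ustar n
          \<inter> - ?E))" .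
        from 1 2 show "(1 - \<epsilon>) * ustar_asymp n * (measure (limit_law T) ?O - \<epsilon>) \<le> real (card (ustar n \<inter> ?E)) \<and>
          (1 - \<epsilon>) * ustar_asymp n * (1 - measure (limit_law T) ?O - \<epsilon>) \<le> real (card (ustar n \<inter> - ?E))" ..
      qed
    qed
  qed
qed

lemma card_split: "real (card (ustar n)) = real (card (ustar n \<inter> E)) + real (card (ustar n \<inter> - E))"
proof -
  have "card ((ustar n \<inter> E) \<union> (ustar n \<inter> - E)) = card (ustar n \<inter> E) + card (ustar n \<inter> - E)"
    by (rule card_Un_disjoint) (auto simp: finite_ustar)
  moreover have "(ustar n \<inter> E) \<union> (ustar n \<inter> - E) = ustar n" by blast
  ultimately show ?thesis by simp
qed

lemma ratio_lower:
  assumes e: "0 < \<epsilon>" "\<epsilon> < 1" and k: "0 < k" and x: "(1 - \<epsilon>) * k * (p - \<epsilon>) \<le> x" and u: "0 < u" "u \<le> (1 + \<epsilon>) * k"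
    and x0: "0 \<le> x" and p1: "p \<le> 1"
  shows "p - 3 * \<epsilon> \<le> x / (u::real)"
proof (cases "p - 3 * \<epsilon> \<le> 0")
  case True
  then show ?thesis using x0 u by (smt (verit) divide_nonneg_pos)
next
  case False
  have "(p - 3 * \<epsilon>) * u \<le> (p - 3 * \<epsilon>) * ((1 + \<epsilon>) * k)" using False u by (intro mult_left_mono) auto
  also have "\<dots> \<le> (1 - \<epsilon>) * k * (p - \<epsilon>)"
  proof -
    have "(1 - \<epsilon>) * (p - \<epsilon>) - (p - 3 * \<epsilon>) * (1 + \<epsilon>) = 2 * \<epsilon> * (1 - p) + 4 * \<epsilon>\<^sup>2"
      by (simp add: power2_eq_square algebra_simps)
    moreover have "0 \<le> 2 * \<epsilon> * (1 - p) + 4 * \<epsilon>\<^sup>2" using e p1 by simp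
    ultimately have "(p - 3 * \<epsilon>) * (1 + \<epsilon>) \<le> (1 - \<epsilon>) * (p - \<epsilon>)" by linarith
    then have "((p - 3 * \<epsilon>) * (1 + \<epsilon>)) * k \<le> ((1 - \<epsilon>) * (p - \<epsilon>)) * k" using k by (intro mult_right_mono) auto
    then show ?thesis by (simp only: mult_ac)
  qed
  also have "\<dots> \<le> x" by (rule x)
  finally show ?thesis using u by (simp add: pos_le_divide_eq)
qed

text \<open>The lower bounds for an event and its complement add up to almost the upper bound for
  all sequences, so neither count can exceed its bound by much.\<close>

lemma joint_law:
  assumes e: "0 < (\<epsilon>::real)" "\<epsilon> < 1"
  shows "\<exists>\<eta>>0. \<forall>\<^sub>F n in sequentially. \<forall>T v0 v. 1 \<le> T \<longrightarrow> real T \<le> \<eta> * sqrt (hscale n) \<longrightarrow>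
     \<bar>measure_pmf.prob (Pstar n) (top_event n T v0 v) - measure (limit_law T) (orthant T v0 v)\<bar> \<le> 3 * \<epsilon>"
proof -
  obtain \<eta> where eta: "0 < \<eta>" and low: "\<forall>\<^sub>F n in sequentially. \<forall>T v0 v. 1 \<le> T \<longrightarrow> real T \<le> \<eta> * sqrt (hscale n) \<longrightarrow>
     (1 - \<epsilon>) * ustar_asymp n * (measure (limit_law T) (orthant T v0 v) - \<epsilon>) \<le> real (card (ustar n \<inter>
       top_event n T v0 v)) \<and>
     (1 - \<epsilon>) * ustar_asymp n * (1 - measure (limit_law T) (orthant T v0 v) - \<epsilon>) \<le> real (card (ustar n \<inter> -
       top_event n T v0 v))"
    using ustar_split_lower[OF e] by blast
  have h2: "\<forall>\<^sub>F n in sequentially. 2 \<le> hscale n" using hscale_filterlim by (simp add: filterlim_at_top)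
  show ?thesis
  proof (intro exI[of _ \<eta>] conjI eta)
    show "\<forall>\<^sub>F n in sequentially. \<forall>T v0 v. 1 \<le> T \<longrightarrow> real T \<le> \<eta> * sqrt (hscale n) \<longrightarrow>
     \<bar>measure_pmf.prob (Pstar n) (top_event n T v0 v) - measure (limit_law T) (orthant T v0 v)\<bar> \<le> 3 * \<epsilon>"
      using low card_ustar_upper[OF e(1)] h2 eventually_ge_at_top[of 1]
    proof eventually_elim
      case (elim n)
      have k: "0 < ustar_asymp n" by (rule ustar_asymp_pos[OF elim(3)])
      have u0: "0 < real (card (ustar n))" using ustar_nonempty[OF elim(4)] finite_ustar by (simp add:
        card_gt_0_iff)
      show ?case
      proof (intro allI impI)
        fix T v0 v assume T: "1 \<le> T" "real T \<le> \<eta> * sqrt (hscale n)"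
        interpret N: prob_space "limit_law T" by (rule prob_space_limit_law)
        let ?p = "measure (limit_law T) (orthant T v0 v)"
        let ?x = "real (card (ustar n \<inter> top_event n T v0 v))" and ?y = "real (card (ustar n \<inter> - top_event n
          T v0 v))" and ?u = "real (card (ustar n))"
        have "?p - 3 * \<epsilon> \<le> ?x / ?u"
          by (rule ratio_lower[OF e k _ u0 elim(2)]) (use elim(1) T in auto)
        moreover have "(1 - ?p) - 3 * \<epsilon> \<le> ?y / ?u"
          by (rule ratio_lower[OF e k _ u0 elim(2)]) (use elim(1) T in auto)
        moreover have "?x / ?u + ?y / ?u = 1" using card_split[of n "top_event n T v0 v"] u0 by (simp add:
          add_divide_distrib[symmetric])
        ultimately show "\<bar>measure_pmf.prob (Pstar n) (top_event n T v0 v) - ?p\<bar> \<le> 3 * \<epsilon>"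
          unfolding prob_Pstar[OF elim(4)] by linarith
      qed
    qed
  qed
qed

text \<open>Any event and its complement will do, here T = 1 with all thresholds 0: their lower
  bounds add up to 7/8 times 3/4, that is 21/32, of \<open>ustar_asymp n\<close>.\<close>

lemma card_ustar_lower: "\<forall>\<^sub>F n in sequentially. ustar_asymp n / 2 \<le> real (card (ustar n))"
proof -
  have e: "0 < (1/8::real)" "(1/8::real) < 1" by auto
  obtain \<eta> where eta: "0 < \<eta>" and low: "\<forall>\<^sub>F n in sequentially. \<forall>T v0 v. 1 \<le> T \<longrightarrow> real T \<le> \<eta> * sqrt (hscale n) \<longrightarrow>
     (1 - 1/8) * ustar_asymp n * (measure (limit_law T) (orthant T v0 v) - 1/8) \<le> real (card (ustar n \<inter>
       top_event n T v0 v)) \<and>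
     (1 - 1/8) * ustar_asymp n * (1 - measure (limit_law T) (orthant T v0 v) - 1/8) \<le> real (card (ustar n \<inter>
       - top_event n T v0 v))"
    using ustar_split_lower[OF e] by blast
  have h2: "\<forall>\<^sub>F n in sequentially. 2 \<le> hscale n" using hscale_filterlim by (simp add: filterlim_at_top)
  have "\<forall>\<^sub>F h in at_top. 1 \<le> \<eta> * sqrt h" using eta by real_asymp
  note s = eventually_compose_filterlim[OF this hscale_filterlim]
  show ?thesis using low h2 s
  proof eventually_elim
    case (elim n)
    let ?p = "measure (limit_law 1) (orthant 1 0 (\<lambda>_ _. 0))"
    have "(1 - 1/8) * ustar_asymp n * (?p - 1/8) \<le> real (card (ustar n \<inter> top_event n 1 0 (\<lambda>_ _. 0)))"
      "(1 - 1/8) * ustar_asymp n * (1 - ?p - 1/8) \<le> real (card (ustar n \<inter> - top_event n 1 0 (\<lambda>_ _. 0)))"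
      using elim(1,3) by (metis le_refl of_nat_1)+
    then have "(1 - 1/8) * ustar_asymp n * (?p - 1/8) + (1 - 1/8) * ustar_asymp n * (1 - ?p - 1/8) \<le>
      real (card (ustar n))"
      using card_split[of n "top_event n 1 0 (\<lambda>_ _. 0)"] by linarith
    moreover have "(1 - 1/8) * ustar_asymp n * (?p - 1/8) + (1 - 1/8) * ustar_asymp n * (1 - ?p - 1/8) =
      (21 / 32) * ustar_asymp n"
      by (simp add: algebra_simps)
    ultimately show ?case using ustar_asymp_pos[OF elim(2)] by linarith
  qed
qed

lemma Y_le_PK:
  assumes "s \<in> ustar n"
  shows "Y j t s \<le> PK s"
proof (cases "1 \<le> t \<and> t \<le> length (side_parts j s)")
  case True
  then have l: "t - 1 < length (side_parts j s)" by linarith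
  from True have "Y j t s = rev (sort (side_parts j s)) ! (t - 1)" by (simp add: Y_def)
  also have "\<dots> \<in> set (rev (sort (side_parts j s)))" by (rule nth_mem) (use l in simp)
  finally have "Y j t s \<in> set (side_parts j s)" by simp
  then show ?thesis using assms by (cases j) (auto simp: ustar_def strongly_unimodal_def sorted_wrt_append
    intro: less_imp_le)
qed (auto simp: Y_def)

text \<open>On a decreasing chain the peak is the largest coordinate, so with equal thresholds only
  its condition matters, and its marginal law is known.\<close>

lemma limit_law_peak: "measure (limit_law T) (orthant T v (\<lambda>_ _. v)) = exp (- exp (- v))"
proof -
  interpret N: prob_space "limit_law T" by (rule prob_space_limit_law)
  have pm: "(\<lambda>u. u Peak) \<in> borel_measurable (limit_law T)"
    using coord_measurable2[of Peak T] by (simp add: coords_def limit_law_def cong: measurable_cong_sets)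
  let ?S = "{u \<in> space (limit_law T). u Peak \<le> v}"
  have S: "?S \<in> sets (limit_law T)" using pm by measurable
  have "measure (limit_law T) (orthant T v (\<lambda>_ _. v)) = measure (limit_law T) ?S"
  proof (rule N.finite_measure_eq_AE)
    show "AE u in limit_law T. u \<in> orthant T v (\<lambda>_ _. v) \<longleftrightarrow> u \<in> ?S"
      using AE_chain
    proof eventually_elim
      case (elim u)
      have le: "u (Part j t) \<le> u Peak" if "t \<le> T" "1 \<le> t" for j t
      proof -
        have "t \<le> T \<Longrightarrow> u (side_coord j t) \<le> u Peak" for t
        proof (induction t)
          case (Suc t)
          have "u (side_coord j (Suc t)) \<le> u (side_coord j t)" using elim Suc.prems by (auto simp:
            desc_chain_def)
          then show ?case using Suc by simp
        qed (simp add: side_coord_def)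
        from this[OF that(1)] show ?thesis using that(2) by (simp add: side_coord_def)
      qed
      show ?case unfolding orthant_def space_limit_law by (auto intro: order_trans[OF le])
    qed
  qed (use S orthant_sets in auto)
  moreover have "emeasure (limit_law T) ?S = ennreal (exp (- exp (- v)))"
  proof -
    have "emeasure (limit_law T) ?S = chain_expect (\<lambda>_. T) (indicator ?S)" by (rule emeasure_limit_law) (use
      S in simp)
    also have "\<dots> = chain_expect (\<lambda>_. T) (\<lambda>u. indicator {..v} (u Peak))"
      unfolding chain_expect_def by (rule nn_integral_cong) (auto simp: indicator_def space_limit_law coords_eq)
    finally show ?thesis by (simp add: chain_expect_Peak_le)
  qed
  ultimately show ?thesis by (simp add: measure_def)
qed

lemma joint_limit_law:
  assumes T1: "\<And>n. 1 \<le> T n" and To: "(\<lambda>n. real (T n)) \<in> o(\<lambda>n. real n powr (1 / 4))"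
  shows "(\<lambda>n. measure_pmf.prob (Pstar n) (top_event n (T n) (v0 n) (v n)) - measure (limit_law (T n))
    (orthant (T n) (v0 n) (v n))) \<longlonglongrightarrow> 0"
proof (rule LIMSEQ_I)
  fix r :: real assume r: "0 < r"
  define \<epsilon> where "\<epsilon> = min (1/2) (r / 4)"
  have e: "0 < \<epsilon>" "\<epsilon> < 1" "3 * \<epsilon> < r" using r by (auto simp: \<epsilon>_def min_def)
  obtain \<eta> where eta: "0 < \<eta>" and law: "\<forall>\<^sub>F n in sequentially. \<forall>T v0 v. 1 \<le> T \<longrightarrow> real T \<le> \<eta> * sqrt (hscale n) \<longrightarrow>
     \<bar>measure_pmf.prob (Pstar n) (top_event n T v0 v) - measure (limit_law T) (orthant T v0 v)\<bar> \<le> 3 * \<epsilon>"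
    using joint_law[OF e(1,2)] by blast
  \<comment> \<open>Here \<open>sqrt (hscale n)\<close> equals \<open>sqrt A\<close> times n^(1/4),
    which turns the little-o condition into the bound required by \<open>joint_law\<close>.\<close>
  have "0 < \<eta> * sqrt A" using eta A_pos by simp
  from landau_o.smallD[OF To this]
  have "\<forall>\<^sub>F n in sequentially. real (T n) \<le> \<eta> * sqrt (hscale n)"
  proof eventually_elim
    case (elim n)
    have "real n powr (1 / 4) = sqrt (sqrt (real n))"
    proof (cases "n = 0")
      case False
      have "sqrt (sqrt (real n)) = (real n powr (1/2)) powr (1/2)" by (simp add: powr_half_sqrt)
      then show ?thesis by (simp add: powr_powr)
    qed simp
    then show ?case using elim by (simp add: hscale_def real_sqrt_mult)
  qed
  with law have "\<forall>\<^sub>F n in sequentially. norm (measure_pmf.prob (Pstar n) (top_event n (T n) (v0 n) (v n)) -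
    measure (limit_law (T n)) (orthant (T n) (v0 n) (v n)) - 0) < r"
  proof eventually_elim
    case (elim n)
    then have "\<bar>measure_pmf.prob (Pstar n) (top_event n (T n) (v0 n) (v n)) - measure (limit_law (T n))
      (orthant (T n) (v0 n) (v n))\<bar> \<le> 3 * \<epsilon>"
      using T1 by blast
    then show ?case using e(3) by simp
  qed
  then show "\<exists>no. \<forall>n\<ge>no. norm (measure_pmf.prob (Pstar n) (top_event n (T n) (v0 n) (v n)) - measure
    (limit_law (T n)) (orthant (T n) (v0 n) (v n)) - 0) < r"
    by (simp add: eventually_sequentially)
qed

lemma peak_limit_law: "(\<lambda>n. measure_pmf.prob (Pstar n) {s. scaled n (real (PK s)) \<le> v}) \<longlonglongrightarrow> exp (- exp (- v))"
proof -
  have "(\<lambda>n. real 1) \<in> o(\<lambda>n. real n powr (1 / 4))" by real_asymp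
  then have "(\<lambda>n. measure_pmf.prob (Pstar n) (top_event n 1 v (\<lambda>_ _. v)) - measure (limit_law 1) (orthant 1
    v (\<lambda>_ _. v))) \<longlonglongrightarrow> 0"
    by (intro joint_limit_law[of "\<lambda>_. 1" "\<lambda>_. v" "\<lambda>_ _ _. v"]) auto
  then have "(\<lambda>n. measure_pmf.prob (Pstar n) (top_event n 1 v (\<lambda>_ _. v))) \<longlonglongrightarrow> exp (- exp (- v))"
    unfolding limit_law_peak by (rule LIM_zero_cancel)
  moreover have "\<forall>\<^sub>F n in sequentially. measure_pmf.prob (Pstar n) (top_event n 1 v (\<lambda>_ _. v)) =
    measure_pmf.prob (Pstar n) {s. scaled n (real (PK s)) \<le> v}"
    using eventually_ge_at_top[of 1]
  proof eventually_elim
    case (elim n)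
    have h0: "0 < hscale n" using elim A_pos by (simp add: hscale_def)
    have "scaled n (real (Y j t s)) \<le> scaled n (real (PK s))" if "s \<in> ustar n" for j t s
      unfolding scaled_hscale[OF h0] using Y_le_PK[OF that, of j t] h0 by (simp add: divide_right_mono)
    then have "ustar n \<inter> top_event n 1 v (\<lambda>_ _. v) = ustar n \<inter> {s. scaled n (real (PK s)) \<le> v}"
      unfolding top_event_def by (auto intro: order_trans)
    then show ?case by (simp add: prob_Pstar[OF elim])
  qed
  ultimately show ?thesis by (rule Lim_transform_eventually)
qed

section \<open>The expected peak\<close>

definition low_peak :: "nat \<Rightarrow> nat" where "low_peak n = nat \<lceil>hscale n * ln (hscale n) / 2\<rceil>"

text \<open>Convergence in law does not control expectations, so a bound valid for every set of
  peaks is needed. The constant 8 is a bound 2 for the scaled point probability times the 4 left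
  after dividing by half of \<open>ustar_asymp n\<close>. The second summand disappears when no low
  peak is involved, so far upper tails carry no additive error.\<close>

lemma peak_mass:
  "\<forall>\<^sub>F n in sequentially. \<forall>W. measure_pmf.prob (Pstar n) {s. PK s \<in> W} \<le>
     8 * (\<Sum>m\<in>{1..n} \<inter> W \<inter> {low_peak n..}. exp (- (real m / hscale n)) * (part_prod (hscale n) m)\<^sup>2) /
       (part_prod (hscale n) (n + 1))\<^sup>2 +
     (if {1..<low_peak n} \<inter> W = {} then 0 else 2 * small_peak_mass (hscale n))"
proof -
  have "\<forall>\<^sub>F n in sequentially. 2 \<le> hscale n" using hscale_filterlim by (simp add: filterlim_at_top)
  with card_ustar_lower pr_upper_full[OF zero_less_one] low_peak_le_n eventually_ge_at_top[of 1] show ?thesis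
  proof eventually_elim
    case (elim n)
    show ?case
    proof
      fix W
      let ?h = "hscale n" and ?s = "sqrt (2 * pi * total_var n)" and ?M = "low_peak n" and ?P =
        "(part_prod (hscale n) (n + 1))\<^sup>2"
      let ?g = "\<lambda>m. exp (- (real m / ?h)) * (part_prod ?h m)\<^sup>2"
      have mlo: "0 < ?h * ln ?h / 2" using elim by simp
      have M: "1 \<le> ?M" "?M \<le> n + 1" "real ?M \<le> ?h * ln ?h / 2 + 1" "?h * ln ?h / 2 \<le> real ?M"
        using mlo elim(3) unfolding low_peak_def by linarith+
      have s0: "0 < ?s" using total_var_bounds(3)[OF elim(5)] by simp
      have P0: "0 < ?P" using part_prod_pos[of ?h "n + 1"] by simp
      have g0: "0 \<le> ?g m" for m by simp
      have ct: "real (pair_count m m (n - m)) = exp (real n / ?h) * (?g m * bs.pr m m ?h (int (n - m)))"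
        if "m \<le> n" for m
      proof -
        have "exp (real (n - m) / ?h) = exp (real n / ?h) * exp (- (real m / ?h))"
          using that by (simp add: exp_add[symmetric] of_nat_diff diff_divide_distrib)
        then show ?thesis unfolding pair_count_eq_pr[of m m "n - m" ?h] by (simp add: power2_eq_square)
      qed
      let ?T = "if {1..<?M} \<inter> W = {} then 0 else 2 * small_peak_mass ?h"
      have "(\<Sum>m\<in>{1..n} \<inter> W. ?g m * bs.pr m m ?h (int (n - m))) * ?s \<le>
         (\<Sum>m\<in>{1..n} \<inter> W. (if ?M \<le> m then 2 * ?g m else ?g m * ?s))"
        unfolding sum_distrib_right
      proof (rule sum_mono)
        fix m assume "m \<in> {1..n} \<inter> W"
        show "?g m * bs.pr m m ?h (int (n - m)) * ?s \<le> (if ?M \<le> m then 2 * ?g m else ?g m * ?s)"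
        proof (cases "?M \<le> m")
          case False
          have "?g m * bs.pr m m ?h (int (n - m)) * ?s \<le> ?g m * 1 * ?s"
            by (intro mult_right_mono mult_left_mono bs.pr_le_1 g0) (use s0 in auto)
          then show ?thesis using False by (simp only: mult_1_right if_False)
        next
          case True
          then have "?h * ln ?h / 2 \<le> real m" using M(4) by simp
          then have "bs.pr m m ?h (int (n - m)) * ?s \<le> 2" using elim(2) by force
          then have "?g m * (bs.pr m m ?h (int (n - m)) * ?s) \<le> ?g m * 2" by (rule mult_left_mono[OF _ g0])
          then show ?thesis using True by (simp add: mult.assoc mult.commute[of _ 2])
        qed
      qed
      also have "\<dots> = 2 * (\<Sum>m\<in>{1..n} \<inter> W \<inter> {?M..}. ?g m) + (\<Sum>m\<in>{1..n} \<inter> W \<inter> - {?M..}. ?g m) * ?s"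
        by (subst sum.If_cases) (auto simp: sum_distrib_left sum_distrib_right atLeast_def)
      also have "\<dots> \<le> 2 * (\<Sum>m\<in>{1..n} \<inter> W \<inter> {?M..}. ?g m) + ?P * ?T / 4"
      proof (rule add_left_mono)
        show "(\<Sum>m\<in>{1..n} \<inter> W \<inter> - {?M..}. ?g m) * ?s \<le> ?P * ?T / 4"
        proof (cases "{1..<?M} \<inter> W = {}")
          case True
          then have "{1..n} \<inter> W \<inter> - {?M..} = {}" by fastforce
          then show ?thesis using True by simp
        next
          case False
          have "(\<Sum>m\<in>{1..n} \<inter> W \<inter> - {?M..}. ?g m) \<le> (\<Sum>m=1..<?M. ?g m)"
            by (rule sum_mono2) auto
          also have "\<dots> \<le> (part_prod ?h ?M)\<^sup>2 / 2"
            using part_prod_telescope[of ?h ?M] by (simp add: sum_distrib_left[symmetric] mult.assoc)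
          finally have "(\<Sum>m\<in>{1..n} \<inter> W \<inter> - {?M..}. ?g m) * ?s \<le> (part_prod ?h ?M)\<^sup>2 / 2 * ?s"
            by (rule mult_right_mono) (use s0 in simp)
          moreover have "(part_prod ?h ?M)\<^sup>2 * ?s \<le> ?P * small_peak_mass ?h" by (rule part_prod_small) (use
            elim M in auto)
          moreover have "(part_prod ?h ?M)\<^sup>2 / 2 * ?s = (part_prod ?h ?M)\<^sup>2 * ?s / 2" by simp
          moreover have "?P * (2 * small_peak_mass ?h) / 4 = ?P * small_peak_mass ?h / 2" by simp
          ultimately have "(\<Sum>m\<in>{1..n} \<inter> W \<inter> - {?M..}. ?g m) * ?s \<le> ?P * (2 * small_peak_mass ?h) / 4"
            by linarith
          then show ?thesis unfolding if_not_P[OF False] .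
        qed
      qed
      finally have S: "(\<Sum>m\<in>{1..n} \<inter> W. ?g m * bs.pr m m ?h (int (n - m))) \<le> (2 * (\<Sum>m\<in>{1..n} \<inter> W \<inter> {?M..}. ?g
        m) + ?P * ?T / 4) / ?s"
        using s0 by (simp only: pos_le_divide_eq)
      have "real (card {s \<in> ustar n. PK s \<in> W}) \<le> real (\<Sum>m\<in>{1..n} \<inter> W. pair_count m m (n - m))"
        using card_peak_le[of n W] by (simp only: of_nat_le_iff)
      also have "\<dots> = exp (real n / ?h) * (\<Sum>m\<in>{1..n} \<inter> W. ?g m * bs.pr m m ?h (int (n - m)))"
        unfolding of_nat_sum sum_distrib_left by (intro sum.cong refl ct) simp
      also have "\<dots> \<le> exp (real n / ?h) * ((2 * (\<Sum>m\<in>{1..n} \<inter> W \<inter> {?M..}. ?g m) + ?P * ?T / 4) / ?s)"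
        by (intro mult_left_mono S) auto
      finally have c: "real (card {s \<in> ustar n. PK s \<in> W}) \<le> exp (real n / ?h) * ((2 * (\<Sum>m\<in>{1..n} \<inter> W \<inter>
        {?M..}. ?g m) + ?P * ?T / 4) / ?s)" .
      have k0: "0 < ustar_asymp n" by (rule ustar_asymp_pos[OF elim(5)])
      have "measure_pmf.prob (Pstar n) {s. PK s \<in> W} = real (card {s \<in> ustar n. PK s \<in> W}) / real (card
        (ustar n))"
        unfolding prob_Pstar[OF elim(4)] by (simp add: Int_def)
      also have "\<dots> \<le> exp (real n / ?h) * ((2 * (\<Sum>m\<in>{1..n} \<inter> W \<inter> {?M..}. ?g m) + ?P * ?T / 4) / ?s) /
        (ustar_asymp n / 2)"
      proof (intro frac_le c elim(1))
        show "0 \<le> exp (real n / ?h) * ((2 * (\<Sum>m\<in>{1..n} \<inter> W \<inter> {?M..}. ?g m) + ?P * ?T / 4) / ?s)"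
          by (rule order_trans[OF of_nat_0_le_iff c])
      qed (use k0 in simp)
      also have "\<dots> = (2 * (\<Sum>m\<in>{1..n} \<inter> W \<inter> {?M..}. ?g m) + ?P * ?T / 4) * (exp (real n / ?h) / ?s /
        (ustar_asymp n / 2))" by simp
      also have "exp (real n / ?h) / ?s / (ustar_asymp n / 2) = 4 / ?P"
        unfolding ustar_asymp_def using total_var_bounds(3)[OF elim(5)] P0 by (simp add: field_simps)
      also have "(2 * (\<Sum>m\<in>{1..n} \<inter> W \<inter> {?M..}. ?g m) + ?P * ?T / 4) * (4 / ?P) = 8 * (\<Sum>m\<in>{1..n} \<inter> W \<inter>
        {?M..}. ?g m) / ?P + ?T"
        using P0 by (simp add: add_divide_distrib distrib_right)
      finally show "measure_pmf.prob (Pstar n) {s. PK s \<in> W} \<le> 8 * (\<Sum>m\<in>{1..n} \<inter> W \<inter> {?M..}. ?g m) / ?P + ?T" .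
    qed
  qed
qed

text \<open>Above, the geometric sum of exp (- m / h) over m beyond h (v + ln (2 h)) is at most exp
  (- v). Below, the squared product at the cut is smaller than the full one by exp (1 - exp v / 4),
  at most 12 exp (- v). Exponential decay uniform in \<open>n\<close> is all that dominated
  convergence asks for.\<close>

lemma peak_tails:
  "\<forall>\<^sub>F n in sequentially. \<forall>v\<ge>0. measure_pmf.prob (Pstar n) {s. v < scaled n (real (PK s))} \<le> 50 * exp (- v) \<and>
     measure_pmf.prob (Pstar n) {s. scaled n (real (PK s)) \<le> - v} \<le> 50 * exp (- v)"
proof -
  have "((\<lambda>h. small_peak_mass h * (4 * h)) \<longlongrightarrow> 0) at_top" unfolding small_peak_mass_def by real_asymp
  then have "\<forall>\<^sub>F h in at_top. small_peak_mass h * (4 * h) < 1" by (rule order_tendstoD) simp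
  moreover have "\<forall>\<^sub>F h::real in at_top. h * ln h / 2 + 1 \<le> h * ln (2 * h)" by real_asymp
  moreover have "\<forall>\<^sub>F h::real in at_top. h * exp (- h) \<le> 1" by real_asymp
  moreover have "\<forall>\<^sub>F h::real in at_top. h * ln (2 * h) + 1 \<le> h\<^sup>2" by real_asymp
  ultimately have "\<forall>\<^sub>F h in at_top. small_peak_mass h * (4 * h) < 1 \<and> h * ln h / 2 + 1 \<le> h * ln (2 * h) \<and>
    h * exp (- h) \<le> 1 \<and> h * ln (2 * h) + 1 \<le> h\<^sup>2"
    by eventually_elim auto
  note ev = eventually_compose_filterlim[OF this hscale_filterlim]
  have "\<forall>\<^sub>F n in sequentially. 2 \<le> hscale n" using hscale_filterlim by (simp add: filterlim_at_top)
  with peak_mass ev show ?thesis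
  proof eventually_elim
    case (elim n)
    let ?h = "hscale n" and ?P = "(part_prod (hscale n) (n + 1))\<^sup>2"
    let ?l = "ln (2 * ?h)"
    let ?g = "\<lambda>m. exp (- (real m / ?h)) * (part_prod ?h m)\<^sup>2"
    have h0: "0 < ?h" using elim by simp
    have P0: "0 < ?P" using part_prod_pos[of ?h "n + 1"] by simp
    have sc: "scaled n (real m) = real m / ?h - ?l" for m by (rule scaled_hscale[OF h0])
    have el: "exp (- ?l) = 1 / (2 * ?h)" using h0 by (simp add: exp_minus inverse_eq_divide)
    have hl: "0 \<le> ?h * ln ?h / 2" using elim by simp
    have Mb: "real (low_peak n) \<le> ?h * ln ?h / 2 + 1" using hl unfolding low_peak_def by linarith
    show ?case
    proof (intro allI impI conjI)
      fix v :: real assume v: "0 \<le> v"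
      let ?W = "{m. v < scaled n (real m)}"
      have W: "m \<in> ?W \<longleftrightarrow> ?h * (v + ?l) < real m" for m
        unfolding mem_Collect_eq sc using h0 by (simp add: less_diff_eq pos_less_divide_eq mult.commute)
      define a where "a = nat \<lfloor>?h * (v + ?l)\<rfloor> + 1"
      have y0: "0 \<le> ?h * (v + ?l)" using v elim by (intro mult_nonneg_nonneg) auto
      have a: "?h * (v + ?l) < real a" unfolding a_def using y0 by linarith
      have aW: "a \<le> m" if "m \<in> ?W" for m
      proof -
        have "?h * (v + ?l) < real m" using that W by blast
        then show ?thesis unfolding a_def using y0 by linarith
      qed
      have emp: "{1..<low_peak n} \<inter> ?W = {}"
      proof -
        have "real m < ?h * (v + ?l)" if "m < low_peak n" for m
        proof -
          have "real m < real (low_peak n)" using that by simp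
          also have "\<dots> \<le> ?h * ?l" using Mb elim(2) by linarith
          also have "\<dots> \<le> ?h * (v + ?l)" using v h0 by simp
          finally show ?thesis .
        qed
        then show ?thesis unfolding disjoint_iff W by force
      qed
      have "(\<Sum>m\<in>{1..n} \<inter> ?W \<inter> {low_peak n..}. ?g m) \<le> (\<Sum>m=a..<n+1. ?g m)"
        by (rule sum_mono2) (use aW in auto)
      also have "\<dots> \<le> (\<Sum>m=a..<n+1. exp (- (real m / ?h)) * ?P)"
      proof (intro sum_mono mult_left_mono power_mono)
        fix m assume m: "m \<in> {a..<n+1}"
        have a1: "1 \<le> m" using m by (simp add: a_def)
        have "part_prod ?h m * exp (?h * (exp (- (real m / ?h)) - exp (- (real (n + 1) / ?h))) / 2) \<le>
          part_prod ?h (n + 1)"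
          by (rule part_prod_ratio_lower) (use h0 m a1 in auto)
        moreover have "1 \<le> exp (?h * (exp (- (real m / ?h)) - exp (- (real (n + 1) / ?h))) / 2)"
          using h0 m by (simp add: divide_right_mono)
        then have "part_prod ?h m * 1 \<le> part_prod ?h m * exp (?h * (exp (- (real m / ?h)) - exp (- (real (n
          + 1) / ?h))) / 2)"
          using part_prod_pos[of ?h m] by (intro mult_left_mono) auto
        ultimately show "part_prod ?h m \<le> part_prod ?h (n + 1)" by simp
      qed (use part_prod_pos less_imp_le in auto)
      also have "\<dots> \<le> (exp (- (real a / ?h)) * (1 + ?h)) * ?P"
        unfolding sum_distrib_right[symmetric] by (intro mult_right_mono geom_exp_bound h0) auto
      also have "\<dots> \<le> (exp (- v)) * ?P"
      proof (rule mult_right_mono)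
        have "v + ?l \<le> real a / ?h" using a h0 by (simp add: pos_le_divide_eq mult.commute)
        then have "exp (- (real a / ?h)) \<le> exp (- v + - ?l)" by simp
        also have "\<dots> = exp (- v) / (2 * ?h)" by (simp only: exp_add el) simp
        finally have "exp (- (real a / ?h)) * (1 + ?h) \<le> exp (- v) / (2 * ?h) * (2 * ?h)"
          by (intro mult_mono) (use elim in auto)
        then show "exp (- (real a / ?h)) * (1 + ?h) \<le> exp (- v)" using h0 by simp
      qed (use P0 in simp)
      finally have "8 * (\<Sum>m\<in>{1..n} \<inter> ?W \<inter> {low_peak n..}. ?g m) / ?P \<le> 8 * exp (- v)" using P0 by (simp add:
        pos_divide_le_eq)
      moreover have "measure_pmf.prob (Pstar n) {s. PK s \<in> ?W} \<le> 8 * (\<Sum>m\<in>{1..n} \<inter> ?W \<inter> {low_peak n..}. ?g m)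
        / ?P + 0"
        using elim(1)[rule_format, of ?W] unfolding if_P[OF emp] .
      ultimately have "measure_pmf.prob (Pstar n) {s. PK s \<in> ?W} \<le> 8 * exp (- v)" by linarith
      also have "\<dots> \<le> 50 * exp (- v)" by simp
      finally show "measure_pmf.prob (Pstar n) {s. v < scaled n (real (PK s))} \<le> 50 * exp (- v)" by simp
    next
      fix v :: real assume v: "0 \<le> v"
      let ?W = "{m. scaled n (real m) \<le> - v}"
      let ?y = "?h * (?l - v)"
      have W: "m \<in> ?W \<longleftrightarrow> real m \<le> ?y" for m
      proof -
        have "m \<in> ?W \<longleftrightarrow> real m / ?h \<le> ?l - v" unfolding mem_Collect_eq sc by linarith
        then show ?thesis using h0 by (simp add: pos_divide_le_eq mult.commute)
      qed
      show "measure_pmf.prob (Pstar n) {s. scaled n (real (PK s)) \<le> - v} \<le> 50 * exp (- v)"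
      \<comment> \<open>A peak is at least 1, so for \<open>?y\<close> below 1 the event is empty;
        otherwise v is below ln (2 h).\<close>
      proof (cases "1 \<le> ?y")
        case False
        then have "{1..n} \<inter> ?W = {}" "{1..<low_peak n} \<inter> ?W = {}" unfolding disjoint_iff W by force+
        then have "measure_pmf.prob (Pstar n) {s. PK s \<in> ?W} \<le> 0"
          using elim(1)[rule_format, of ?W] by simp
        then have "measure_pmf.prob (Pstar n) {s. scaled n (real (PK s)) \<le> - v} \<le> 0" by simp
        also have "0 \<le> 50 * exp (- v)" by simp
        finally show ?thesis .
      next
        case True
        define a where "a = nat \<lfloor>?y\<rfloor> + 1"
        have a: "?y < real a" "real a \<le> ?y + 1" "1 \<le> a" unfolding a_def using True by linarith+
        have "?y \<le> ?h * ?l" using v h0 by simp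
        then have "real a \<le> ?h\<^sup>2" using a(2) elim(2) by linarith
        then have an: "a \<le> n + 1" using hscale_sq_le[of n] by linarith
        have vl: "v \<le> ?l"
        proof (rule ccontr)
          assume "\<not> v \<le> ?l"
          then have "?y \<le> 0" using h0 by (simp add: mult_le_0_iff)
          then show False using True by simp
        qed
        have "(\<Sum>m\<in>{1..n} \<inter> ?W \<inter> {low_peak n..}. ?g m) \<le> (\<Sum>m=1..<a. ?g m)"
        proof (rule sum_mono2)
          show "{1..n} \<inter> ?W \<inter> {low_peak n..} \<subseteq> {1..<a}"
          proof
            fix m assume m: "m \<in> {1..n} \<inter> ?W \<inter> {low_peak n..}"
            then have "real m \<le> ?y" using W by blast
            then show "m \<in> {1..<a}" using m a(1) by auto
          qed
        qed auto
        also have "\<dots> \<le> (part_prod ?h a)\<^sup>2 / 2"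
          using part_prod_telescope[of ?h a] by (simp add: sum_distrib_left[symmetric] mult.assoc)
        finally have S: "(\<Sum>m\<in>{1..n} \<inter> ?W \<inter> {low_peak n..}. ?g m) \<le> (part_prod ?h a)\<^sup>2 / 2" .
        let ?E = "exp (?h * (exp (- (real a / ?h)) - exp (- (real (n + 1) / ?h))) / 2)"
        have "(part_prod ?h a * ?E)\<^sup>2 \<le> ?P"
          by (intro power_mono part_prod_ratio_lower h0 a an mult_nonneg_nonneg) (use part_prod_pos[of ?h a]
            in auto)
        moreover have "exp (exp v / 4 - 1) \<le> ?E\<^sup>2"
        proof -
          have "?h * exp (- (real a / ?h)) \<ge> exp v / 4"
          proof -
            have "real a / ?h \<le> (?y + 1) / ?h" using a h0 by (intro divide_right_mono) auto
            also have "\<dots> = ?l - v + 1 / ?h" using h0 by (simp add: add_divide_distrib)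
            finally have "exp (v + - ?l + - (1 / ?h)) \<le> exp (- (real a / ?h))" by simp
            moreover have "exp (v + - ?l + - (1 / ?h)) = exp v / (2 * ?h) * exp (- (1 / ?h))"
              by (simp only: exp_add el) simp
            moreover have "1 / 2 \<le> exp (- (1 / ?h))"
            proof -
              have "1 / ?h \<le> 1 / 2" using elim by simp
              then show ?thesis using exp_ge_add_one_self[of "- (1 / ?h)"] by linarith
            qed
            then have "exp v / (2 * ?h) * (1 / 2) \<le> exp v / (2 * ?h) * exp (- (1 / ?h))" using h0
              by (intro mult_left_mono) auto
            ultimately have "exp v / (2 * ?h) * (1 / 2) \<le> exp (- (real a / ?h))" by linarith
            then have "?h * (exp v / (2 * ?h) * (1 / 2)) \<le> ?h * exp (- (real a / ?h))" using h0
              by (intro mult_left_mono) auto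
            then show ?thesis using h0 by simp
          qed
          moreover have "?h * exp (- (real (n + 1) / ?h)) \<le> 1"
          proof -
            have "?h * ?h \<le> real (n + 1)" using hscale_sq_le[of n] by (simp add: power2_eq_square)
            then have "?h \<le> real (n + 1) / ?h" using h0 by (simp add: pos_le_divide_eq)
            then have "exp (- (real (n + 1) / ?h)) \<le> exp (- ?h)" by simp
            then have "?h * exp (- (real (n + 1) / ?h)) \<le> ?h * exp (- ?h)" using h0
              by (intro mult_left_mono) auto
            then show ?thesis using elim(2) by linarith
          qed
          ultimately have "exp v / 4 - 1 \<le> ?h * (exp (- (real a / ?h)) - exp (- (real (n + 1) / ?h)))"
            by (simp add: right_diff_distrib)
          then show ?thesis by (simp add: power2_eq_square exp_add[symmetric])
        qed
        then have "(part_prod ?h a)\<^sup>2 * exp (exp v / 4 - 1) \<le> (part_prod ?h a * ?E)\<^sup>2"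
          unfolding power_mult_distrib by (intro mult_left_mono) auto
        ultimately have "(part_prod ?h a)\<^sup>2 * exp (exp v / 4 - 1) \<le> ?P" by linarith
        then have "(part_prod ?h a)\<^sup>2 \<le> ?P * exp (- (exp v / 4 - 1))" by (simp add: exp_minus field_simps)
        also have "\<dots> \<le> ?P * (12 * exp (- v))"
        proof (rule mult_left_mono)
          have "exp (- (exp v / 4 - 1)) = exp 1 * exp (- (exp v / 4))" by (simp add: exp_add[symmetric])
          also have "\<dots> \<le> 3 * (1 / (exp v / 4))"
            by (intro mult_mono exp_neg_le_inverse) (use exp_le in auto)
          also have "\<dots> = 12 * exp (- v)" by (simp add: exp_minus field_simps)
          finally show "exp (- (exp v / 4 - 1)) \<le> 12 * exp (- v)" .
        qed simp
        finally have "8 * (\<Sum>m\<in>{1..n} \<inter> ?W \<inter> {low_peak n..}. ?g m) \<le> 4 * (?P * (12 * exp (- v)))" using S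
          by linarith
        also have "\<dots> = (48 * exp (- v)) * ?P" by simp
        finally have "8 * (\<Sum>m\<in>{1..n} \<inter> ?W \<inter> {low_peak n..}. ?g m) \<le> (48 * exp (- v)) * ?P" .
        then have S2: "8 * (\<Sum>m\<in>{1..n} \<inter> ?W \<inter> {low_peak n..}. ?g m) / ?P \<le> 48 * exp (- v)" using P0
          by (simp only: pos_divide_le_eq)
        \<comment> \<open>For v up to ln (2 h), exp (- v) is at least 1 / (2 h), which dominates the
          mass of the low peaks.\<close>
        have t: "2 * small_peak_mass ?h \<le> exp (- v)"
        proof -
          have "1 / (2 * ?h) \<le> exp (- v)" using vl unfolding el[symmetric] by simp
          moreover have "2 * small_peak_mass ?h \<le> 1 / (2 * ?h)" using elim(2) h0 by (simp add:
            pos_le_divide_eq mult_ac)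
          ultimately show ?thesis by linarith
        qed
        have "measure_pmf.prob (Pstar n) {s. PK s \<in> ?W} \<le> 8 * (\<Sum>m\<in>{1..n} \<inter> ?W \<inter> {low_peak n..}. ?g m) / ?P +
          (if {1..<low_peak n} \<inter> ?W = {} then 0 else 2 * small_peak_mass ?h)"
          using elim(1) by blast
        also have "\<dots> \<le> 48 * exp (- v) + exp (- v)"
          by (intro add_mono S2) (use t in auto)
        also have "\<dots> \<le> 50 * exp (- v)" by simp
        finally show ?thesis by simp
      qed
    qed
  qed
qed

section \<open>The Euler-Mascheroni constant as a mean\<close>

lemma layer_cake: "has_bochner_integral lborel (\<lambda>v. indicator {0..<r} v - indicator {0..- r} v) (r::real)"
proof (cases "0 \<le> r")
  case True
  have "has_bochner_integral lborel (indicator {0..<r} :: real \<Rightarrow> real) (measure lborel {0..<r})"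
    by (rule has_bochner_integral_real_indicator) (use True in auto)
  moreover have "has_bochner_integral lborel (indicator {0..-r} :: real \<Rightarrow> real) (measure lborel {0..-r})"
    by (rule has_bochner_integral_real_indicator) (use True in \<open>auto simp: emeasure_lborel_Icc_eq\<close>)
  moreover have "measure lborel {0..-r} = 0" using True by (simp add: measure_def emeasure_lborel_Icc_eq)
  ultimately show ?thesis using has_bochner_integral_diff True by fastforce
next
  case False
  have "has_bochner_integral lborel (indicator {0..<r} :: real \<Rightarrow> real) (measure lborel {0..<r})"
    by (rule has_bochner_integral_real_indicator) (use False in auto)
  moreover have "measure lborel {0..<r} = 0" using False by simp
  moreover have "has_bochner_integral lborel (indicator {0..-r} :: real \<Rightarrow> real) (measure lborel {0..-r})"
    by (rule has_bochner_integral_real_indicator) (use False in \<open>auto simp: emeasure_lborel_Icc_eq\<close>)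
  moreover have "measure lborel {0..-r} = - r" using False by simp
  ultimately show ?thesis using has_bochner_integral_diff False by fastforce
qed

text \<open>For the Gumbel law, the probability of exceeding v minus the probability of being at
  most -v. By the layer cake formula its integral is the mean of that law.\<close>

definition gumbel_tails :: "real \<Rightarrow> real" where
  "gumbel_tails v = indicator {0..} v * ((1 - exp (- exp (- v))) - exp (- exp v))"

lemma integrable_exp_indicator: "integrable lborel (\<lambda>v::real. c * (exp (- v) * indicator {0..} v))"
proof -
  have "(\<integral>\<^sup>+x. ennreal (exp (- x)) * indicator {0..} x \<partial>lborel) = ennreal (0 - (- exp (- 0)))"
  proof (rule nn_integral_FTC_atLeast)
    show "((\<lambda>x::real. - exp (- x)) has_real_derivative exp (- x)) (at x)" for x by (auto intro!:
      derivative_eq_intros)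
    show "((\<lambda>x::real. - exp (- x)) \<longlongrightarrow> 0) at_top" by real_asymp
  qed auto
  moreover have "(\<integral>\<^sup>+x. ennreal (exp (- x)) * indicator {0..} x \<partial>lborel) = (\<integral>\<^sup>+x. ennreal (exp (- x) *
    indicator {0..} (x::real)) \<partial>lborel)"
    by (intro nn_integral_cong) (simp add: indicator_def)
  ultimately have "has_bochner_integral lborel (\<lambda>x. exp (- x) * indicator {0..} x) (0 - (- exp (- 0)) :: real)"
    by (intro has_bochner_integral_nn_integral) auto
  then show ?thesis by (auto simp: has_bochner_integral_iff)
qed

text \<open>The same difference of tails for the maximum of N unit exponentials minus ln N. The
  lower tail stops at ln N because the maximum is nonnegative.\<close>

definition max_exp_tails :: "nat \<Rightarrow> real \<Rightarrow> real" where
  "max_exp_tails N v = (1 - (1 - exp (- v) / real N) ^ N) * indicator {0..} v - (1 - exp v / real N) ^ N *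
    indicator {0..ln (real N)} v"

text \<open>The maximum of \<open>N\<close> independent standard exponential variables has mean \<open>harm N\<close>.\<close>

lemma max_exp_tails_integral:
  assumes N: "1 \<le> N"
  shows "has_bochner_integral lborel (max_exp_tails N) (harm N - ln (real N))"
proof -
  have N0: "0 < real N" using N by simp
  have geo: "(\<Sum>j=1..N. x ^ (j - 1)) * (1 - x) = 1 - x ^ N" for x :: real
  proof -
    have "(\<Sum>j=1..N. x ^ (j - 1)) = (\<Sum>j<N. x ^ j)"
      by (rule sum.reindex_bij_witness[of _ Suc "\<lambda>j. j - 1"]) auto
    then show ?thesis using one_diff_power_eq[of x N] by (simp add: mult.commute)
  qed
  \<comment> \<open>A partial sum of the series of - ln (1 - x). Its derivative is a geometric sum,
    so along x = 1 - exp (- v) / N and x = 1 - exp v / N it is an antiderivative of the two tails,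
    up to the summand v in the second case. At x = 1 its value is \<open>harm N\<close>.\<close>
  let ?S = "\<lambda>x::real. \<Sum>j=1..N. x ^ j / real j"
  have dS: "((\<lambda>v. ?S (g v)) has_real_derivative (\<Sum>j=1..N. g v ^ (j - 1)) * g') (at v)"
    if "(g has_real_derivative g') (at v)" for g :: "real \<Rightarrow> real" and g' v
  proof -
    have "((\<lambda>v. ?S (g v)) has_real_derivative (\<Sum>j=1..N. g v ^ (j - 1) * g')) (at v)"
    proof (rule DERIV_sum)
      fix j assume "j \<in> {1..N}"
      then have "((\<lambda>v. g v ^ j / real j) has_real_derivative (real j * (g' * g v ^ (j - Suc 0))) / real j)
        (at v)"
        by (intro DERIV_cdivide DERIV_power that)
      then show "((\<lambda>v. g v ^ j / real j) has_real_derivative g v ^ (j - 1) * g') (at v)"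
        using \<open>j \<in> {1..N}\<close> by (simp add: mult.commute)
    qed
    then show ?thesis by (simp only: sum_distrib_right)
  qed
  have z01: "0 \<le> 1 - exp (- v) / real N" "1 - exp (- v) / real N \<le> 1" if "0 \<le> v" for v
  proof -
    have "exp (- v) \<le> 1" using that by simp
    also have "\<dots> \<le> real N" using N by simp
    finally show "0 \<le> 1 - exp (- v) / real N" using N0 by simp
  qed simp
  have 1: "has_bochner_integral lborel (\<lambda>v. (1 - (1 - exp (- v) / real N) ^ N) * indicator {0..} v) (harm N
    - ?S (1 - 1 / real N))"
  proof -
    have e: "(\<integral>\<^sup>+v. ennreal (1 - (1 - exp (- v) / real N) ^ N) * indicator {0..} v \<partial>lborel) = ennreal (harm
      N - ?S (1 - exp (- 0) / real N))"
    proof (rule nn_integral_FTC_atLeast[where F = "\<lambda>v. ?S (1 - exp (- v) / real N)"])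
      fix v
      have "((\<lambda>v. 1 - exp (- v) / real N) has_real_derivative exp (- v) / real N) (at v)"
        using N0 by (auto intro!: derivative_eq_intros)
      from dS[OF this] show "((\<lambda>v. ?S (1 - exp (- v) / real N)) has_real_derivative 1 - (1 - exp (- v) /
        real N) ^ N) (at v)"
        using geo[of "1 - exp (- v) / real N"] by simp
      show "0 \<le> 1 - (1 - exp (- v) / real N) ^ N" if "0 \<le> v" using z01[OF that] by (simp add: power_le_one)
      have ex0: "((\<lambda>v::real. exp (- v)) \<longlongrightarrow> 0) at_top" by real_asymp
      have "((\<lambda>v::real. 1 - exp (- v) / real N) \<longlongrightarrow> 1 - 0 / real N) at_top"
        by (intro tendsto_intros ex0) (use N in auto)
      then have "((\<lambda>v. ?S (1 - exp (- v) / real N)) \<longlongrightarrow> ?S (1 - 0 / real N)) at_top"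
        by (intro tendsto_sum tendsto_divide tendsto_power tendsto_const) auto
      moreover have "?S (1 - 0 / real N) = harm N" by (simp add: harm_def inverse_eq_divide)
      ultimately show "((\<lambda>v. ?S (1 - exp (- v) / real N)) \<longlongrightarrow> harm N) at_top" by simp
    qed auto
    show ?thesis
    proof (rule has_bochner_integral_nn_integral)
      show "(\<integral>\<^sup>+v. ennreal ((1 - (1 - exp (- v) / real N) ^ N) * indicator {0..} v) \<partial>lborel) = ennreal (harm
        N - ?S (1 - 1 / real N))"
        using e by (simp add: ennreal_mult'' ennreal_indicator)
      show "0 \<le> harm N - ?S (1 - 1 / real N)"
        unfolding harm_def sum_subtractf[symmetric] using N0
        by (intro sum_nonneg) (auto simp: inverse_eq_divide diff_divide_distrib[symmetric] intro!:
          divide_nonneg_nonneg power_le_one)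
      show "AE v in lborel. 0 \<le> (1 - (1 - exp (- v) / real N) ^ N) * indicator {0..} v"
        using z01 by (auto simp: indicator_def power_le_one)
    qed auto
  qed
  have 2: "has_bochner_integral lborel (\<lambda>v. (1 - exp v / real N) ^ N * indicator {0..ln (real N)} v)
     ((ln (real N) + ?S (1 - exp (ln (real N)) / real N)) - (0 + ?S (1 - exp 0 / real N)))"
  proof (rule has_bochner_integral_FTC_Icc_real)
    show "0 \<le> ln (real N)" using N by simp
    fix v
    have "((\<lambda>v. 1 - exp v / real N) has_real_derivative - (exp v / real N)) (at v)"
      using N0 by (auto intro!: derivative_eq_intros)
    from DERIV_add[OF DERIV_ident dS[OF this]]
    show "((\<lambda>v. v + ?S (1 - exp v / real N)) has_real_derivative (1 - exp v / real N) ^ N) (at v)"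
      using geo[of "1 - exp v / real N"] by simp
    show "isCont (\<lambda>v. (1 - exp v / real N) ^ N) v" using N0 by (auto intro!: continuous_intros)
  qed
  have "?S (1 - exp (ln (real N)) / real N) = 0" using N0 by (simp add: zero_power)
  then have "(harm N - ?S (1 - 1 / real N)) - ((ln (real N) + ?S (1 - exp (ln (real N)) / real N)) - (0 +
    ?S (1 - exp 0 / real N))) = harm N - ln (real N)"
    by simp
  with has_bochner_integral_diff[OF 1 2] show ?thesis by (simp add: max_exp_tails_def[abs_def])
qed

lemma gumbel_tails_measurable[measurable]: "gumbel_tails \<in> borel_measurable borel"
  unfolding gumbel_tails_def[abs_def] by measurable

text \<open>As N grows the centred maximum tends to the Gumbel law and its mean
  \<open>harm N - ln N\<close> to the constant. Domination is elementary: Bernoulli's inequality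
  bounds the upper tail by exp (- v), and exp (- exp v) is at most exp (- v) for the lower
  one.\<close>

lemma gumbel_tails_integral: "integral\<^sup>L lborel gumbel_tails = euler_mascheroni"
proof -
  have "(\<lambda>N. integral\<^sup>L lborel (max_exp_tails (N + 1))) \<longlonglongrightarrow> integral\<^sup>L lborel gumbel_tails"
  proof (rule integral_dominated_convergence[where w = "\<lambda>v. 2 * (exp (- v) * indicator {0..} v)"])
    show "AE v in lborel. (\<lambda>N. max_exp_tails (N + 1) v) \<longlonglongrightarrow> gumbel_tails v"
    proof (rule AE_I2)
      fix v :: real
      have "(\<lambda>N. max_exp_tails N v) \<longlonglongrightarrow> gumbel_tails v"
      proof (cases "0 \<le> v")
        case False
        then show ?thesis by (simp add: max_exp_tails_def gumbel_tails_def)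
      next
        case True
        have 1: "(\<lambda>N. (1 - exp (- v) / real N) ^ N) \<longlonglongrightarrow> exp (- exp (- v))"
          using tendsto_exp_limit_sequentially[of "- exp (- v)"] by simp
        have 2: "(\<lambda>N. (1 - exp v / real N) ^ N) \<longlonglongrightarrow> exp (- exp v)"
          using tendsto_exp_limit_sequentially[of "- exp v"] by simp
        have ln: "\<forall>\<^sub>F N in sequentially. v \<le> ln (real N)"
        proof -
          have "filterlim (\<lambda>N::nat. ln (real N)) at_top sequentially" by real_asymp
          then show ?thesis by (simp add: filterlim_at_top)
        qed
        have "(\<lambda>N. (1 - (1 - exp (- v) / real N) ^ N) - (1 - exp v / real N) ^ N) \<longlonglongrightarrow> gumbel_tails v"
          unfolding gumbel_tails_def using True by (auto intro!: tendsto_intros 1 2)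
        then show ?thesis
          by (rule Lim_transform_eventually) (use ln in eventually_elim, use True in
            \<open>simp add: max_exp_tails_def\<close>)
      qed
      then show "(\<lambda>N. max_exp_tails (N + 1) v) \<longlonglongrightarrow> gumbel_tails v" by (rule LIMSEQ_ignore_initial_segment)
    qed
    show "AE v in lborel. norm (max_exp_tails (N + 1) v) \<le> 2 * (exp (- v) * indicator {0..} v)" for N
    proof (rule AE_I2)
      fix v :: real
      let ?N = "N + 1"
      show "norm (max_exp_tails ?N v) \<le> 2 * (exp (- v) * indicator {0..} v)"
      proof (cases "0 \<le> v")
        case False
        then show ?thesis by (simp add: max_exp_tails_def)
      next
        case True
        have N0: "0 < real ?N" by simp
        have ev: "exp (- v) \<le> 1" using True by simp
        have a: "exp (- v) / real ?N \<le> 1" unfolding divide_le_eq_1_pos[OF N0] using ev by linarith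
        have "1 + real ?N * (- (exp (- v) / real ?N)) \<le> (1 + - (exp (- v) / real ?N)) ^ ?N"
          by (rule Bernoulli_inequality) (use a in simp)
        moreover have "real ?N * (- (exp (- v) / real ?N)) = - exp (- v)" using N0 by simp
        ultimately have 1: "1 - (1 - exp (- v) / real ?N) ^ ?N \<le> exp (- v)" by simp
        have "(1 - exp (- v) / real ?N) ^ ?N \<le> 1" by (rule power_le_one) (use a in auto)
        then have nn1: "0 \<le> 1 - (1 - exp (- v) / real ?N) ^ ?N" by linarith
        have 2: "0 \<le> (1 - exp v / real ?N) ^ ?N \<and> (1 - exp v / real ?N) ^ ?N \<le> exp (- v)" if "v \<le> ln (real ?N)"
        proof -
          have "exp v \<le> exp (ln (real ?N))" using that by (simp only: exp_le_cancel_iff)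
          then have w0: "0 \<le> 1 - exp v / real ?N" using N0 by simp
          have "1 - exp v / real ?N \<le> exp (- (exp v / real ?N))" using exp_ge_add_one_self[of "- (exp v /
            real ?N)"] by simp
          then have "(1 - exp v / real ?N) ^ ?N \<le> exp (- (exp v / real ?N)) ^ ?N" using w0 by (rule power_mono)
          also have "\<dots> = exp (real ?N * (- (exp v / real ?N)))" by (rule exp_of_nat_mult[symmetric])
          also have "real ?N * (- (exp v / real ?N)) = - exp v" using N0 by simp
          also have "exp (- exp v) \<le> exp (- v)"
          proof -
            have "v \<le> exp v" using exp_ge_add_one_self[of v] by linarith
            then show ?thesis by simp
          qed
          finally show ?thesis using w0 by simp
        qed
        show ?thesis
        proof (cases "v \<le> ln (real ?N)")
          case True
          then show ?thesis using 1 nn1 2[OF True] \<open>0 \<le> v\<close> by (simp add: max_exp_tails_def) linarith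
        next
          case False
          then show ?thesis using 1 nn1 \<open>0 \<le> v\<close> exp_ge_zero[of "- v"] by (simp add: max_exp_tails_def)
        qed
      qed
    qed
    show "integrable lborel (\<lambda>v::real. 2 * (exp (- v) * indicator {0..} v))" by (rule integrable_exp_indicator)
  qed (auto simp: max_exp_tails_def[abs_def])
  moreover have "integral\<^sup>L lborel (max_exp_tails (N + 1)) = harm (N + 1) - ln (real (N + 1))" for N
    using max_exp_tails_integral[of "N + 1"] by (simp add: has_bochner_integral_iff)
  moreover have "(\<lambda>N. harm (N + 1) - ln (real (N + 1))) \<longlonglongrightarrow> euler_mascheroni"
    by (rule LIMSEQ_ignore_initial_segment[OF euler_mascheroni_LIMSEQ])
  ultimately show ?thesis using LIMSEQ_unique by simp
qed

text \<open>The layer cake formula writes the expectation as an integral of tail probabilities;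
  these converge by the limit law for the peak and are dominated by
  \<open>peak_tails\<close>.\<close>

lemma scaled_expectation: "(\<lambda>n. measure_pmf.expectation (Pstar n) (\<lambda>s. scaled n (real (PK s)))) \<longlonglongrightarrow>
  euler_mascheroni"
proof -
  define g where "g n v = indicator {0..} v * (measure_pmf.prob (Pstar n) {s. v < scaled n (real (PK s))} -
    measure_pmf.prob (Pstar n) {s. scaled n (real (PK s)) \<le> - v})" for n and v :: real
  have gi: "has_bochner_integral lborel (g n) (measure_pmf.expectation (Pstar n) (\<lambda>s. scaled n (real (PK
    s))))" if n: "1 \<le> n" for n
  proof -
    let ?U = "ustar n" and ?X = "\<lambda>s. scaled n (real (PK s))"
    have si: "(\<Sum>s\<in>?U. indicator S s) = real (card (?U \<inter> S))" for S
      by (simp add: indicator_def finite_ustar Int_def)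
    have "measure_pmf.expectation (Pstar n) ?X = (\<Sum>s\<in>?U. ?X s / real (card ?U))"
      unfolding Pstar_def by (subst integral_pmf_of_set) (auto simp: ustar_nonempty[OF n] finite_ustar
        sum_divide_distrib)
    moreover have "has_bochner_integral lborel (\<lambda>v. \<Sum>s\<in>?U. (indicator {0..<?X s} v - indicator {0..- ?X s}
      v) / real (card ?U)) (\<Sum>s\<in>?U. ?X s / real (card ?U))"
      by (intro has_bochner_integral_sum has_bochner_integral_divide_zero layer_cake)
    moreover have "(\<lambda>v. \<Sum>s\<in>?U. (indicator {0..<?X s} v - indicator {0..- ?X s} v) / real (card ?U)) = g n"
    proof
      fix v :: real
      have "(\<Sum>s\<in>?U. (indicator {0..<?X s} v - indicator {0..- ?X s} v) / real (card ?U)) =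
         (\<Sum>s\<in>?U. indicator {0..} v * (indicator {s. v < ?X s} s - indicator {s. ?X s \<le> - v} s)) / real (card
           ?U)"
        unfolding sum_divide_distrib by (intro sum.cong refl) (auto simp: indicator_def)
      also have "\<dots> = indicator {0..} v * ((\<Sum>s\<in>?U. indicator {s. v < ?X s} s) - (\<Sum>s\<in>?U. indicator {s. ?X s \<le>
        - v} s)) / real (card ?U)"
        by (simp add: sum_distrib_left sum_subtractf right_diff_distrib)
      also have "\<dots> = g n v"
        unfolding g_def prob_Pstar[OF n] si by (simp only: diff_divide_distrib times_divide_eq_right
          right_diff_distrib)
      finally show "(\<Sum>s\<in>?U. (indicator {0..<?X s} v - indicator {0..- ?X s} v) / real (card ?U)) = g n v" .
    qed
    ultimately show ?thesis by simp
  qed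
  obtain n0 where n0: "\<And>n v. n0 \<le> n \<Longrightarrow> 0 \<le> v \<Longrightarrow> measure_pmf.prob (Pstar n) {s. v < scaled n (real (PK s))} \<le>
    50 * exp (- v) \<and>
     measure_pmf.prob (Pstar n) {s. scaled n (real (PK s)) \<le> - v} \<le> 50 * exp (- v)"
    using peak_tails unfolding eventually_sequentially by blast
  \<comment> \<open>The shift removes the initial \<open>n\<close> for which the tail bounds may
    fail, and n = 0, so that domination holds for every member of the sequence.\<close>
  let ?k = "n0 + 1"
  have "(\<lambda>n. integral\<^sup>L lborel (g (n + ?k))) \<longlonglongrightarrow> integral\<^sup>L lborel gumbel_tails"
  proof (rule integral_dominated_convergence[where w = "\<lambda>v. 100 * (exp (- v) * indicator {0..} v)"])
    show "g (n + ?k) \<in> borel_measurable lborel" for n using gi[of "n + ?k"] by (auto simp: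
      has_bochner_integral_iff)
    show "AE v in lborel. (\<lambda>n. g (n + ?k) v) \<longlonglongrightarrow> gumbel_tails v"
    proof (rule AE_I2)
      fix v :: real
      have c: "measure_pmf.prob (Pstar n) {s. v < scaled n (real (PK s))} = 1 - measure_pmf.prob (Pstar n)
        {s. scaled n (real (PK s)) \<le> v}" for n
      proof -
        have "{s. v < scaled n (real (PK s))} = space (measure_pmf (Pstar n)) - {s. scaled n (real (PK s)) \<le>
          v}" by auto
        then show ?thesis by (simp only: measure_pmf.prob_compl[of "{s. scaled n (real (PK s)) \<le>
          v}"] sets_measure_pmf UNIV_I)
      qed
      have "(\<lambda>n. g n v) \<longlonglongrightarrow> gumbel_tails v"
        unfolding g_def gumbel_tails_def c using peak_limit_law[of v] peak_limit_law[of "- v"]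
          by (intro tendsto_intros) auto
      then show "(\<lambda>n. g (n + ?k) v) \<longlonglongrightarrow> gumbel_tails v" by (rule LIMSEQ_ignore_initial_segment)
    qed
    show "AE v in lborel. norm (g (n + ?k) v) \<le> 100 * (exp (- v) * indicator {0..} v)" for n
    proof (rule AE_I2)
      fix v :: real
      show "norm (g (n + ?k) v) \<le> 100 * (exp (- v) * indicator {0..} v)"
      proof (cases "0 \<le> v")
        case True
        have "\<bar>x - y\<bar> \<le> 100 * e" if "0 \<le> x" "0 \<le> y" "x \<le> 50 * e \<and> y \<le> 50 * e" for x y e :: real using that
          by linarith
        from this[OF measure_nonneg measure_nonneg n0[of "n + ?k" v]] True show ?thesis by (simp add: g_def)
      qed (simp add: g_def)
    qed
    show "integrable lborel (\<lambda>v::real. 100 * (exp (- v) * indicator {0..} v))"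
      by (rule integrable_exp_indicator)
  qed auto
  moreover have "integral\<^sup>L lborel (g (n + ?k)) = measure_pmf.expectation (Pstar (n + ?k)) (\<lambda>s. scaled (n +
    ?k) (real (PK s)))" for n
    using gi[of "n + ?k"] by (simp add: has_bochner_integral_iff)
  ultimately have "(\<lambda>n. measure_pmf.expectation (Pstar (n + ?k)) (\<lambda>s. scaled (n + ?k) (real (PK s)))) \<longlonglongrightarrow>
    euler_mascheroni"
    by (simp add: gumbel_tails_integral)
  then show ?thesis by (rule LIMSEQ_offset)
qed

text \<open>The relative error is obtained by solving for it, which is possible because the
  Euler-Mascheroni constant is not 0.\<close>

lemma peak_expectation: "\<exists>\<epsilon> :: nat \<Rightarrow> real. \<epsilon> \<longlonglongrightarrow> 0 \<and>
      (\<forall>n \<ge> 1. measure_pmf.expectation (Pstar n) (\<lambda>s. real (PK s)) =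
         A * sqrt (real n) * ln (2 * A * sqrt (real n))
         + A * euler_mascheroni * sqrt (real n) * (1 + \<epsilon> n))"
proof -
  define X where "X n = measure_pmf.expectation (Pstar n) (\<lambda>s. scaled n (real (PK s)))" for n
  define \<epsilon> where "\<epsilon> n = X n / euler_mascheroni - 1" for n
  have g: "(euler_mascheroni :: real) \<noteq> 0" using euler_mascheroni_pos by simp
  have "(\<lambda>n. X n / euler_mascheroni - 1) \<longlonglongrightarrow> euler_mascheroni / euler_mascheroni - 1"
    unfolding X_def by (intro tendsto_intros scaled_expectation g)
  then have "\<epsilon> \<longlonglongrightarrow> 0" using g by (simp add: \<epsilon>_def[abs_def])
  moreover have "measure_pmf.expectation (Pstar n) (\<lambda>s. real (PK s)) =
         A * sqrt (real n) * ln (2 * A * sqrt (real n)) + A * euler_mascheroni * sqrt (real n) * (1 + \<epsilon> n)"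
           if n: "1 \<le> n" for n
  proof -
    have h0: "0 < hscale n" using n A_pos by (simp add: hscale_def)
    have fin: "finite (set_pmf (Pstar n))" unfolding Pstar_def by (simp add: ustar_nonempty[OF n] finite_ustar)
    have "real (PK s) = hscale n * ln (2 * hscale n) + hscale n * scaled n (real (PK s))" for s
      using h0 by (simp add: scaled_hscale[OF h0] right_diff_distrib)
    then have "measure_pmf.expectation (Pstar n) (\<lambda>s. real (PK s)) = measure_pmf.expectation (Pstar n) (\<lambda>s.
      hscale n * ln (2 * hscale n) + hscale n * scaled n (real (PK s)))"
      by simp
    also have "\<dots> = hscale n * ln (2 * hscale n) + hscale n * X n"
      unfolding X_def by (subst Bochner_Integration.integral_add) (auto intro: integrable_measure_pmf_finite
        fin)
    also have "X n = euler_mascheroni * (1 + \<epsilon> n)" using g by (simp add: \<epsilon>_def)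
    finally show ?thesis by (simp add: hscale_def mult_ac)
  qed
  ultimately show ?thesis by blast
qed

theorem theorem1p10:
  "(\<forall>v::real.
      (\<lambda>n. measure_pmf.prob (Pstar n) {s. scaled n (real (PK s)) \<le> v})
        \<longlonglongrightarrow> exp (- exp (- v))) \<and>
   (\<exists>\<epsilon> :: nat \<Rightarrow> real. \<epsilon> \<longlonglongrightarrow> 0 \<and>
      (\<forall>n \<ge> 1. measure_pmf.expectation (Pstar n) (\<lambda>s. real (PK s)) =
         A * sqrt (real n) * ln (2 * A * sqrt (real n))
         + A * euler_mascheroni * sqrt (real n) * (1 + \<epsilon> n))) \<and>
   (\<forall>(T :: nat \<Rightarrow> nat) (v0 :: nat \<Rightarrow> real) (v :: nat \<Rightarrow> side \<Rightarrow> nat \<Rightarrow> real).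
      (\<forall>n. 1 \<le> T n) \<longrightarrow>
      (\<lambda>n. real (T n)) \<in> o(\<lambda>n. real n powr (1 / 4)) \<longrightarrow>
      (\<lambda>n. measure_pmf.prob (Pstar n)
              {s. scaled n (real (PK s)) \<le> v0 n \<and>
                  (\<forall>j \<in> {L, R}. \<forall>t \<in> {1..T n}. scaled n (real (Y j t s)) \<le> v n j t)}
            - set_lebesgue_integral (Pi\<^sub>M (coords (T n)) (\<lambda>_. lborel))
                (orthant (T n) (v0 n) (v n)) (F (T n)))
        \<longlonglongrightarrow> 0)"
proof (intro conjI allI impI)
  fix T :: "nat \<Rightarrow> nat" and v0 :: "nat \<Rightarrow> real" and v :: "nat \<Rightarrow> side \<Rightarrow> nat \<Rightarrow> real"
  assume T1: "\<forall>n. 1 \<le> T n" and To: "(\<lambda>n. real (T n)) \<in> o(\<lambda>n. real n powr (1 / 4))"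
  show "(\<lambda>n. measure_pmf.prob (Pstar n)
              {s. scaled n (real (PK s)) \<le> v0 n \<and>
                  (\<forall>j \<in> {L, R}. \<forall>t \<in> {1..T n}. scaled n (real (Y j t s)) \<le> v n j t)}
            - set_lebesgue_integral (Pi\<^sub>M (coords (T n)) (\<lambda>_. lborel))
                (orthant (T n) (v0 n) (v n)) (F (T n))) \<longlonglongrightarrow> 0"
    using joint_limit_law[of T, OF T1[rule_format] To]
    unfolding top_event_def set_integral_limit_law[OF T1[rule_format] orthant_sets] .
qed (rule peak_limit_law peak_expectation)+

end
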